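(* There exist parameters $c\in\mathbb{C}$ such that the quadratic polynomial $P_c(z)=z^2+c$ is a Feigenbaum map and its Julia set $J(P_c)$ has Hausdorff dimension $\operatorname{HD}(J(P_c))<2$.
   Context: A quadratic-like map is a holomorphic proper map $f:U\to V$ of degree $2$ between topological disks $U\Subset V\subset\mathbb{C}$ (critical point normalized to $0$); its filled Julia set $K(f)$ is the set of points whose forward orbits stay in $U$, and $J(f)=\partial K(f)$. Quadratic-like maps with connected Julia set are considered as germs (maps agreeing on a neighborhood of a common Julia set are identified), and $\operatorname{mod}(f)=\sup\operatorname{mod}(V\setminus\overline U)$ over all representatives. A quadratic-like map with connected Julia set is renormalizable if there are $p>1$ and topological disks $U'\Subset V'$ containing $0$ such that $f^p:U'\to V'$ is quadratic-like with connected Julia set $J'$ and the sets $f^k(J')$, $0\le k<p$, are pairwise disjoint except possibly touching at their non-separating ($\beta$-)fixed points; the renormalization $Rf$ is such a map with minimal $p$, considered up to affine conjugacy, and its combinatorial type is the little copy of the Mandelbrot set determined by it. A Feigenbaum map is a quadratic-like map that is infinitely renormalizable ($R^nf$ defined for all $n$), of bounded type (the renormalization periods are bounded), and has a priori bounds ($\inf_n\operatorname{mod}(R^nf)>0$). A quadratic polynomial is called Feigenbaum if a quadratic-like restriction of it is. *)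

theory Defs
  imports "HOL-Complex_Analysis.Complex_Analysis"
begin

definition topological_disk :: "complex set \<Rightarrow> bool" where
  "topological_disk D \<longleftrightarrow> open D \<and> D \<noteq> {} \<and> connected D \<and> simply_connected D \<and> bounded D"

definition ql_map :: "(complex \<Rightarrow> complex) \<Rightarrow> complex set \<Rightarrow> complex set \<Rightarrow> bool" where
  "ql_map f U V \<longleftrightarrow>
     topological_disk U \<and> topological_disk V \<and> compact (closure U) \<and> closure U \<subseteq> V \<and>
     f holomorphic_on U \<and> f ` U = V \<and>
     (\<forall>C. compact C \<and> C \<subseteq> V \<longrightarrow> compact {z\<in>U. f z \<in> C}) \<and>
     (\<forall>w\<in>V. finite {z\<in>U. f z = w} \<and> (\<Sum>z\<in>{z\<in>U. f z = w}. zorder (\<lambda>x. f x - w) z) = 2) \<and>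
     0 \<in> U \<and> deriv f 0 = 0"

definition filled_julia :: "(complex \<Rightarrow> complex) \<Rightarrow> complex set \<Rightarrow> complex set" where
  "filled_julia f U = {z. \<forall>n. (f ^^ n) z \<in> U}"

definition julia :: "(complex \<Rightarrow> complex) \<Rightarrow> complex set \<Rightarrow> complex set" where
  "julia f U = frontier (filled_julia f U)"

text \<open>Two representatives (domains) of the same germ of the map f.\<close>
definition rep_eq :: "(complex \<Rightarrow> complex) \<Rightarrow> complex set \<Rightarrow> complex set \<Rightarrow> complex set \<Rightarrow> complex set \<Rightarrow> bool" where
  "rep_eq f U V U0 V0 \<longleftrightarrow> ql_map f U V \<and> ql_map f U0 V0 \<and> julia f U = julia f U0"

definition is_renorm :: "(complex \<Rightarrow> complex) \<Rightarrow> complex set \<Rightarrow> complex set \<Rightarrow> nat \<Rightarrow> complex set \<Rightarrow> complex set \<Rightarrow> bool" where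
  "is_renorm f U V p U' V' \<longleftrightarrow>
     p > 1 \<and> 0 \<in> U' \<and> (\<forall>z\<in>U'. \<forall>k<p. (f ^^ k) z \<in> U) \<and>
     ql_map (f ^^ p) U' V' \<and> connected (julia (f ^^ p) U') \<and>
     (let J' = julia (f ^^ p) U';
          NS = {z\<in>J'. (f ^^ p) z = z \<and> connected (J' - {z})}
      in \<forall>i<p. \<forall>j<p. i \<noteq> j \<longrightarrow>
           (f ^^ i) ` J' \<inter> (f ^^ j) ` J' \<subseteq> (f ^^ i) ` NS \<inter> (f ^^ j) ` NS)"

definition renorm_by :: "(complex \<Rightarrow> complex) \<Rightarrow> complex set \<Rightarrow> complex set \<Rightarrow> nat \<Rightarrow> complex set \<Rightarrow> complex set \<Rightarrow> bool" where
  "renorm_by f U V p U' V' \<longleftrightarrow> (\<exists>U0 V0. rep_eq f U V U0 V0 \<and> is_renorm f U0 V0 p U' V')"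

definition annulus_mod :: "complex set \<Rightarrow> ereal" where
  "annulus_mod A = Sup {ereal (ln R / (2 * pi)) | R. R > 1 \<and>
      (\<exists>h. h holomorphic_on A \<and> bij_betw h A {z. 1 < cmod z \<and> cmod z < R})}"

definition ql_mod :: "(complex \<Rightarrow> complex) \<Rightarrow> complex set \<Rightarrow> complex set \<Rightarrow> ereal" where
  "ql_mod f U V = Sup {annulus_mod (V0 - closure U0) | U0 V0. rep_eq f U V U0 V0}"

text \<open>The restriction F : U -> V is a Feigenbaum quadratic-like map: R^n F is represented by
  F^(q n) : Us n -> Vs n with q n = p 0 * ... * p (n-1), p n the minimal renormalization period.\<close>
definition feigenbaum_restriction :: "(complex \<Rightarrow> complex) \<Rightarrow> complex set \<Rightarrow> complex set \<Rightarrow> bool" where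
  "feigenbaum_restriction F U V \<longleftrightarrow>
     ql_map F U V \<and> connected (julia F U) \<and>
     (\<exists>p :: nat \<Rightarrow> nat. \<exists>Us Vs.
        Us 0 = U \<and> Vs 0 = V \<and>
        (\<forall>n. let g = F ^^ (\<Prod>i<n. p i) in
              p n = (LEAST m. \<exists>U' V'. renorm_by g (Us n) (Vs n) m U' V') \<and>
              renorm_by g (Us n) (Vs n) (p n) (Us (Suc n)) (Vs (Suc n))) \<and>
        (\<exists>B. \<forall>n. p n \<le> B) \<and>
        (\<exists>\<epsilon>>0. \<forall>n. ql_mod (F ^^ (\<Prod>i<n. p i)) (Us n) (Vs n) \<ge> ereal \<epsilon>))"

definition quad_poly :: "complex \<Rightarrow> complex \<Rightarrow> complex" where
  "quad_poly c z = z ^ 2 + c"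

definition feigenbaum_poly :: "complex \<Rightarrow> bool" where
  "feigenbaum_poly c \<longleftrightarrow> (\<exists>U V. feigenbaum_restriction (quad_poly c) U V)"

definition poly_julia :: "complex \<Rightarrow> complex set" where
  "poly_julia c = frontier {z. bounded (range (\<lambda>n. (quad_poly c ^^ n) z))}"

definition hd_term :: "real \<Rightarrow> complex set \<Rightarrow> ennreal" where
  "hd_term s X = (if X = {} then 0 else if s = 0 then 1 else ennreal (diameter X powr s))"

definition hausdorff_content :: "real \<Rightarrow> real \<Rightarrow> complex set \<Rightarrow> ennreal" where
  "hausdorff_content s \<delta> A =
     (INF C \<in> {C :: nat \<Rightarrow> complex set. A \<subseteq> (\<Union>i. C i) \<and> (\<forall>i. bounded (C i) \<and> diameter (C i) \<le> \<delta>)}.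
        (\<Sum>i. hd_term s (C i)))"

definition hausdorff_measure :: "real \<Rightarrow> complex set \<Rightarrow> ennreal" where
  "hausdorff_measure s A = (SUP \<delta> \<in> {0<..}. hausdorff_content s \<delta> A)"

definition hausdorff_dim :: "complex set \<Rightarrow> real" where
  "hausdorff_dim A = Inf {s. s \<ge> 0 \<and> hausdorff_measure s A = 0}"

end

theory Submission
  imports Defs "HOL-Computational_Algebra.Primes"
begin

text \<open>The parameter is taken close to \<^term>\<open>-2\<close>, infinitely renormalizable with a constant huge prime
  period \<^term>\<open>m\<close>, every renormalization following the combinatorics in which the critical orbit spends
  the times 2, ..., m - 1 near the fixed point 2. After rescaling by \<^term>\<open>lam\<close>, the inverse of
  the multiplier along this orbit, the renormalization of a map \<^term>\<open>\<lambda>z. \<psi> (z^2)\<close> with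
  \<^term>\<open>\<psi>\<close> close to a translation is of the same form, with \<^term>\<open>\<psi>\<close> even closer to a translation.
  So for a holomorphic family of such maps the renormalizable parameters form a disc on which the
  renormalizations are again such a family, and a nested intersection gives the parameter. The fundamental
  annuli of all renormalizations are comparable to a round annulus, which gives the a priori bounds.

  For the dimension, consider the Poincare series with exponent 7/4. Away from the critical
  point the maps expand with margin, and each passage near the critical point at level \<^term>\<open>n\<close> rescales
  to level \<^term>\<open>n + 1\<close>; since \<^term>\<open>lam\<close> is tiny, the losses are compensated by the gain at the
  small scales, and an explicit supersolution of the transfer operator bounds the sums over first
  entries into the discs of radius comparable to the product of the first \<^term>\<open>k\<close> factors
  \<^term>\<open>lam\<close>. Hence the filled Julia set has zero Hausdorff measure in a dimension below 2.\<close>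


section \<open>Maps close to quadratic polynomials\<close>

text \<open>Two features of the definitions shape the proof. A modulus is defined through a
  conformal map onto a round annulus, so it is not enough to find a round annulus inside: every
  fundamental annulus has to be uniformized, through its universal cover. And the period is a
  minimum over all quadratic-like restrictions, with arbitrary domains. Primality of
  \<open>m\<close> answers this: a competing period \<open>k < m\<close> divides no power of
  \<open>m\<close>, whereas the critical point returns close to itself at the times
  \<open>m ^ l\<close>. The neighbourhood of -2 is chosen for the identity
  \<open>(z^2 - 2)^2 - 4 = z^2 (z^2 - 4)\<close>. For \<open>z^2 - 2\<close> the weight
  \<open>1 / |z^2 - 4|\<close>, transferred with exponent 7/4 over both preimages, is multiplied by
  \<open>2 |z|^(1/4) / 2^(7/4)\<close>, which is below 4/5 as long as \<open>|z| < 3\<close>. The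
  identity survives perturbation because the critical value stays within a multiple of
  \<open>|lam|\<close> of the second preimage of the fixed point near 2. In the covering argument
  each level costs a factor 52 in the supersolution and gains at least the factor
  \<open>|lam|\<close> in the diameters, so the entries into very deep levels have small total
  size.\<close>

definition qm :: "(complex \<Rightarrow> complex) \<Rightarrow> complex \<Rightarrow> complex" where
  "qm \<psi> z = \<psi> (z\<^sup>2)"

definition near_quad :: "(complex \<Rightarrow> complex) \<Rightarrow> complex \<Rightarrow> bool" where
  "near_quad \<psi> t \<longleftrightarrow> \<psi> holomorphic_on UNIV \<and> norm (t + 2) \<le> 7/20 \<and>
     (\<forall>w. norm w < 25 \<longrightarrow> norm (\<psi> w - (w + t)) \<le> 1/100)"

lemma deriv_norm_bound:
  assumes "f holomorphic_on ball z R" "0 < r" "r < R" "\<And>x. x \<in> ball z R \<Longrightarrow> norm (f x) \<le> B"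
  shows "norm (deriv f z) \<le> B / r"
proof -
  have "norm ((deriv ^^ 1) f z) \<le> fact 1 * B / r ^ 1"
  proof (rule Cauchy_inequality)
    show "f holomorphic_on ball z r" using assms by (meson holomorphic_on_subset subset_ball less_imp_le)
    show "continuous_on (cball z r) f"
      using assms by (intro holomorphic_on_imp_continuous_on holomorphic_on_subset[OF assms(1)]) auto
    show "\<And>x. norm (z - x) = r \<Longrightarrow> norm (f x) \<le> B"
      using assms by (simp add: dist_norm)
  qed (use assms in auto)
  thus ?thesis by simp
qed

lemma hol_funpow:
  assumes "f holomorphic_on UNIV" shows "(f ^^ n) holomorphic_on UNIV"
proof (induction n)
  case 0 show ?case by (simp add: id_def)
next
  case (Suc n)
  thus ?case using holomorphic_on_compose[OF Suc holomorphic_on_subset[OF assms]] by (simp add: o_def)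
qed

lemma hol_UNIV_diff: "f holomorphic_on UNIV \<Longrightarrow> f field_differentiable (at z)"
  by (simp add: holomorphic_on_def)

lemma deriv_funpow:
  assumes "f holomorphic_on UNIV"
  shows "deriv (f ^^ n) z = (\<Prod>j<n. deriv f ((f ^^ j) z))"
proof (induction n)
  case 0 show ?case by (simp add: id_def)
next
  case (Suc n)
  have "deriv (f \<circ> (f ^^ n)) z = deriv f ((f ^^ n) z) * deriv (f ^^ n) z"
    by (rule deriv_chain) (auto intro!: hol_UNIV_diff assms hol_funpow)
  moreover have "f ^^ Suc n = f \<circ> (f ^^ n)" by simp
  ultimately show ?case unfolding prod.lessThan_Suc by (simp only: Suc.IH mult.commute)
qed

section \<open>Elementary estimates for one map close to \<open>z^2 + t\<close>\<close>

locale nq =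
  fixes \<psi> :: "complex \<Rightarrow> complex" and t :: complex
  assumes near: "near_quad \<psi> t"
begin

abbreviation f where "f \<equiv> qm \<psi>"

lemma hol: "\<psi> holomorphic_on A" and t2: "norm (t + 2) \<le> 7/20"
  and close: "norm w < 25 \<Longrightarrow> norm (\<psi> w - (w + t)) \<le> 1/100"
  using near holomorphic_on_subset by (auto simp: near_quad_def)

lemma norm_t: "norm t \<le> 47/20"
  using t2 norm_triangle_ineq4[of "t+2" 2] by simp

lemma deriv_close: "norm w \<le> 16 \<Longrightarrow> norm (deriv \<psi> w - 1) \<le> 1/500"
proof -
  assume w: "norm w \<le> 16"
  let ?h = "\<lambda>w. \<psi> w - (w + t)"
  \<comment> \<open>Radius 9 fits because \<open>16 + 9 = 25\<close> is the radius of the disc of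
    closeness.\<close>
  have "norm (deriv ?h w) \<le> (1/100) / 8"
  proof (rule deriv_norm_bound)
    show "?h holomorphic_on ball w 9" by (intro holomorphic_intros hol)
    show "norm (?h x) \<le> 1/100" if "x \<in> ball w 9" for x
      using that w norm_triangle_ineq4[of w "w-x"] by (intro close) (auto simp: dist_norm)
  qed auto
  moreover have "deriv ?h w = deriv \<psi> w - 1"
  proof -
    have "(\<psi> has_field_derivative deriv \<psi> w) (at w)"
      using hol[of UNIV] by (simp add: holomorphic_derivI)
    hence "(?h has_field_derivative deriv \<psi> w - (1 + 0)) (at w)"
      by (intro derivative_intros) auto
    thus ?thesis by (simp add: DERIV_imp_deriv)
  qed
  ultimately show ?thesis by simp
qed

text \<open>The error \<open>\<psi> w - w\<close> has a small derivative on a convex disc, which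
  makes \<open>\<psi>\<close> nearly an isometry there. Both Lipschitz bounds, injectivity, and with
  them all statements about fibres of \<open>f\<close>, come from this.\<close>

lemma lip_close:
  assumes "norm w \<le> 16" "norm w' \<le> 16"
  shows "norm ((\<psi> w - \<psi> w') - (w - w')) \<le> (1/500) * norm (w - w')"
proof -
  let ?h = "\<lambda>w. \<psi> w - w"
  have "norm (?h w - ?h w') \<le> (1/500) * norm (w - w')"
  proof (rule field_differentiable_bound[where S="cball 0 16"])
    fix z :: complex assume "z \<in> cball 0 16"
    thus "norm (deriv \<psi> z - 1) \<le> 1/500" by (intro deriv_close) auto
    have "(\<psi> has_field_derivative deriv \<psi> z) (at z within cball 0 16)"
      using hol[of UNIV] by (simp add: holomorphic_derivI has_field_derivative_at_within)
    thus "(?h has_field_derivative deriv \<psi> z - 1) (at z within cball 0 16)"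
      by (intro derivative_intros) auto
  qed (use assms in auto)
  thus ?thesis by (simp add: algebra_simps)
qed

lemma lip_upper: "norm w \<le> 16 \<Longrightarrow> norm w' \<le> 16 \<Longrightarrow> norm (\<psi> w - \<psi> w') \<le> (501/500) * norm (w - w')"
  and lip_lower: "norm w \<le> 16 \<Longrightarrow> norm w' \<le> 16 \<Longrightarrow> norm (\<psi> w - \<psi> w') \<ge> (499/500) * norm (w - w')"
  using lip_close[of w w'] norm_triangle_ineq2[of "\<psi> w - \<psi> w'" "w - w'"]
    norm_triangle_ineq2[of "w - w'" "\<psi> w - \<psi> w'"] by (simp_all add: norm_minus_commute)

lemma psi_inj: "norm w \<le> 16 \<Longrightarrow> norm w' \<le> 16 \<Longrightarrow> \<psi> w = \<psi> w' \<Longrightarrow> w = w'"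
  using lip_lower[of w w'] by simp

lemma f_hol: "f holomorphic_on A"
proof -
  have "(\<psi> \<circ> (\<lambda>z. z\<^sup>2)) holomorphic_on A"
    by (intro holomorphic_on_compose holomorphic_intros hol)
  moreover have "\<psi> \<circ> (\<lambda>z. z\<^sup>2) = f" by (auto simp: fun_eq_iff qm_def)
  ultimately show ?thesis by simp
qed

lemma f_deriv: "deriv f z = 2 * z * deriv \<psi> (z\<^sup>2)"
proof -
  have "deriv (\<psi> \<circ> (\<lambda>z. z\<^sup>2)) z = deriv \<psi> (z\<^sup>2) * deriv (\<lambda>z. z\<^sup>2) z"
    by (rule deriv_chain) (auto intro!: derivative_intros hol_UNIV_diff hol simp: field_differentiable_power)
  moreover have "\<psi> \<circ> (\<lambda>z. z\<^sup>2) = f" by (auto simp: fun_eq_iff qm_def)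
  moreover have "deriv (\<lambda>z::complex. z\<^sup>2) z = 2 * z"
    by (rule DERIV_imp_deriv) (auto intro!: derivative_eq_intros)
  ultimately show ?thesis by simp
qed

lemma f_even: "f (- z) = f z" by (simp add: qm_def)

lemma f_close: "norm z < 5 \<Longrightarrow> norm (f z - (z\<^sup>2 + t)) \<le> 1/100"
  unfolding qm_def
proof (rule close)
  assume "norm z < 5"
  hence "norm z * norm z < 5 * 5" by (intro mult_strict_mono) auto
  thus "norm (z\<^sup>2) < 25" by (simp add: norm_mult power2_eq_square)
qed

lemma f_upper: "norm z < 5 \<Longrightarrow> norm (f z) \<le> (norm z)\<^sup>2 + 59/25"
  and f_lower: "norm z < 5 \<Longrightarrow> norm (f z) \<ge> (norm z)\<^sup>2 - 59/25"
proof -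
  assume z: "norm z < 5"
  have c: "norm (f z - (z\<^sup>2 + t)) \<le> 1/100" by (rule f_close[OF z])
  have "norm (f z) \<le> norm (f z - (z\<^sup>2 + t)) + norm (z\<^sup>2 + t)" by norm
  also have "norm (z\<^sup>2 + t) \<le> norm (z\<^sup>2) + norm t" by norm
  finally show "norm (f z) \<le> (norm z)\<^sup>2 + 59/25" using c norm_t by (simp add: norm_power)
  have "norm (z\<^sup>2) \<le> norm (f z - (z\<^sup>2 + t)) + norm (f z) + norm t" by norm
  thus "norm (f z) \<ge> (norm z)\<^sup>2 - 59/25" using c norm_t by (simp add: norm_power)
qed

lemma norm_sq16: "norm (z::complex) \<le> 4 \<Longrightarrow> norm (z\<^sup>2) \<le> 16"
  using mult_mono[of "norm z" 4 "norm z" 4] by (simp add: norm_mult power2_eq_square)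

lemma f_deriv_lower: "norm z \<le> 4 \<Longrightarrow> norm (deriv f z) \<ge> (499/250) * norm z"
  and f_deriv_upper: "norm z \<le> 4 \<Longrightarrow> norm (deriv f z) \<le> (501/250) * norm z"
proof -
  assume z: "norm z \<le> 4"
  have "norm (deriv \<psi> (z\<^sup>2) - 1) \<le> 1/500" by (rule deriv_close[OF norm_sq16[OF z]])
  hence "norm (deriv \<psi> (z\<^sup>2)) \<ge> 499/500" "norm (deriv \<psi> (z\<^sup>2)) \<le> 501/500"
    using norm_triangle_ineq2[of 1 "deriv \<psi> (z\<^sup>2)"] norm_triangle_ineq2[of "deriv \<psi> (z\<^sup>2)" 1]
    by (simp_all add: norm_minus_commute)
  hence "2 * norm z * norm (deriv \<psi> (z\<^sup>2)) \<ge> 2 * norm z * (499/500)"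
     "2 * norm z * norm (deriv \<psi> (z\<^sup>2)) \<le> 2 * norm z * (501/500)"
    by (intro mult_left_mono; simp)+
  thus "norm (deriv f z) \<ge> (499/250) * norm z" "norm (deriv f z) \<le> (501/250) * norm z"
    by (simp_all add: f_deriv norm_mult)
qed

lemma f_deriv_0: "deriv f 0 = 0" by (simp add: f_deriv)

lemma f_eq_iff: "norm z \<le> 4 \<Longrightarrow> norm z' \<le> 4 \<Longrightarrow> f z = f z' \<longleftrightarrow> z' = z \<or> z' = - z"
  using psi_inj[of "z\<^sup>2" "z'\<^sup>2"] norm_sq16[of z] norm_sq16[of z'] by (auto simp: qm_def power2_eq_iff)

text \<open>The square contributes exactly \<open>(x - a)^2\<close>. Only the perturbation needs
  Taylor, and its second derivative is at most 1/100 by Cauchy on circles of radius 3/2, which stay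
  inside \<open>|z| < 5\<close>.\<close>

lemma f_taylor:
  assumes "norm a \<le> 3" "norm x \<le> 3"
  shows "norm (f x - f a - deriv f a * (x - a)) \<le> (101/100) * (norm (x - a))\<^sup>2"
proof -
  let ?k = "\<lambda>z. f z - (z\<^sup>2 + t)"
  have khol: "?k holomorphic_on A" for A by (intro holomorphic_intros f_hol)
  have d1: "deriv ?k z = deriv f z - 2 * z" for z
  proof -
    have "(f has_field_derivative deriv f z) (at z)"
      using f_hol[of UNIV] by (simp add: holomorphic_derivI)
    hence "(?k has_field_derivative deriv f z - (2 * z + 0)) (at z)"
      by (auto intro!: derivative_eq_intros)
    thus ?thesis by (simp add: DERIV_imp_deriv)
  qed
  let ?g = "\<lambda>i. (deriv ^^ i) ?k"
  have "norm (?g 0 x - (\<Sum>i\<le>1. ?g i a * (x - a) ^ i / fact i)) \<le> (1/100) * norm (x - a) ^ Suc 1 / fact 1"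
  proof (rule complex_Taylor[where S = "cball 0 3"])
    fix i :: nat and z :: complex assume z: "z \<in> cball 0 3"
    have "(deriv ^^ i) ?k holomorphic_on UNIV" by (intro holomorphic_higher_deriv khol) auto
    thus "((deriv ^^ i) ?k has_field_derivative (deriv ^^ Suc i) ?k z) (at z within cball 0 3)"
      by (simp add: holomorphic_derivI has_field_derivative_at_within)
  next
    fix z :: complex assume z: "z \<in> cball 0 3"
    have "norm ((deriv ^^ 2) ?k z) \<le> fact 2 * (1/100) / (3/2) ^ 2"
    proof (rule Cauchy_inequality)
      show "?k holomorphic_on ball z (3/2)" "continuous_on (cball z (3/2)) ?k"
        using khol holomorphic_on_imp_continuous_on by blast+
      fix y assume "norm (z - y) = 3/2"
      hence "norm y < 5" using z norm_triangle_ineq4[of z "z - y"] by simp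
      thus "norm (?k y) \<le> 1/100" by (rule f_close)
    qed auto
    thus "norm ((deriv ^^ Suc 1) ?k z) \<le> 1/100"
      by (simp add: numeral_2_eq_2 power2_eq_square)
  qed (use assms in auto)
  hence "norm (?k x - ?k a - deriv ?k a * (x - a)) \<le> (1/100) * (norm (x-a))\<^sup>2"
    by (simp add: algebra_simps numeral_2_eq_2)
  moreover have "f x - f a - deriv f a * (x - a) = (?k x - ?k a - deriv ?k a * (x - a)) + (x - a)\<^sup>2"
    by (simp only: d1) (simp add: algebra_simps power2_eq_square)
  ultimately have "norm (f x - f a - deriv f a * (x - a)) \<le> (1/100) * (norm (x-a))\<^sup>2 + norm ((x - a)\<^sup>2)"
    using norm_triangle_ineq[of "?k x - ?k a - deriv ?k a * (x - a)" "(x - a)\<^sup>2"] by (simp only:)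
  thus ?thesis by (simp add: norm_power)
qed

end

section \<open>One renormalization step: the critical orbit over a period\<close>

locale step = nq +
  fixes m :: nat and lam :: complex
  assumes m: "2 < m"
    and orb: "2 \<le> j \<Longrightarrow> j < m \<Longrightarrow> norm ((qm \<psi> ^^ j) 0 - 2) < 4/5"
    and lam0: "lam \<noteq> 0" and lam_small: "norm lam \<le> (1/10^4)^36"
    and lam_eq: "lam * deriv (\<lambda>w. (qm \<psi> ^^ (m-1)) (\<psi> w)) 0 = 1"
    and am: "norm ((qm \<psi> ^^ m) 0) \<le> 3 * norm lam"
begin

abbreviation a where "a j \<equiv> (f ^^ j) 0"
abbreviation G where "G j \<equiv> norm (deriv f (a j))"
text \<open>The factor by which an error made at time \<open>j\<close> is magnified up to time
  \<open>m\<close>, to first order.\<close>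

definition p where "p j = (\<Prod>i=j..<m. G i)"

lemma lam_tiny: "norm lam \<le> 1/10^100"
  using lam_small by (rule order_trans) (simp add: power_one_over flip: power_mult)

lemma lam_tiny8: "norm lam \<le> 1/10^8"
  using lam_tiny by (rule order_trans) simp

lemma lam_pos: "norm lam > 0" using lam0 by simp

lemma a1: "a 1 = \<psi> 0" unfolding One_nat_def funpow.simps o_apply qm_def by simp

lemma a1_bd: "norm (a 1 + 2) \<le> 9/25"
proof -
  have "norm (\<psi> 0 - t) \<le> 1/100" using close[of 0] by simp
  moreover have "a 1 + 2 = (\<psi> 0 - t) + (t + 2)" by (simp add: qm_def)
  ultimately show ?thesis using t2 norm_triangle_ineq[of "\<psi> 0 - t" "t + 2"] by simp
qed

lemma a_bd: assumes "1 \<le> j" "j < m" shows "6/5 \<le> norm (a j)" "norm (a j) \<le> 14/5"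
proof -
  have "6/5 \<le> norm (a j) \<and> norm (a j) \<le> 14/5"
  proof (cases "j = 1")
    case True
    thus ?thesis using a1_bd norm_triangle_ineq4[of "a 1 + 2" 2] norm_triangle_ineq3[of "-2" "a 1 + 2"]
        norm_triangle_ineq4[of "a 1 + 2" "a 1"]
      by auto
  next
    case False
    hence "norm (a j - 2) < 4/5" using assms by (intro orb) auto
    thus ?thesis using norm_triangle_ineq[of "a j - 2" 2] norm_triangle_ineq4[of "a j - 2" "a j"] by auto
  qed
  thus "6/5 \<le> norm (a j)" "norm (a j) \<le> 14/5" by auto
qed

lemma G_lower: assumes "1 \<le> j" "j < m" shows "G j \<ge> 239/100"
  using f_deriv_lower[of "a j"] a_bd[OF assms] by auto

lemma G_upper: assumes "1 \<le> j" "j < m" shows "G j \<le> 6"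
  using f_deriv_upper[of "a j"] a_bd[OF assms] by auto

lemma p_step: "j < m \<Longrightarrow> p j = G j * p (Suc j)"
  unfolding p_def by (rule prod.atLeast_Suc_lessThan)

lemma p_m: "p m = 1" by (simp add: p_def)

lemma p_lower: assumes "1 \<le> j" "j \<le> m" shows "p j \<ge> 2 ^ (m - j)"
proof -
  have "(\<Prod>i=j..<m. (2::real)) \<le> (\<Prod>i=j..<m. G i)"
  proof (intro prod_mono conjI)
    fix i assume "i \<in> {j..<m}"
    hence "G i \<ge> 239/100" using assms by (intro G_lower) auto
    thus "2 \<le> G i" by simp
  qed auto
  thus ?thesis by (simp add: p_def)
qed

lemma p_upper: assumes "1 \<le> j" shows "p j \<le> 6 ^ (m - j)"
proof -
  have "(\<Prod>i=j..<m. G i) \<le> (\<Prod>i=j..<m. (6::real))"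
  proof (intro prod_mono conjI)
    fix i assume "i \<in> {j..<m}"
    thus "G i \<le> 6" using assms by (intro G_upper) auto
  qed auto
  thus ?thesis by (simp add: p_def)
qed

lemma psi0: "norm (deriv \<psi> 0) \<ge> 499/500" "norm (deriv \<psi> 0) \<le> 501/500"
  using deriv_close[of 0] norm_triangle_ineq2[of 1 "deriv \<psi> 0"] norm_triangle_ineq2[of "deriv \<psi> 0" 1]
  by (simp_all add: norm_minus_commute)

lemma deriv_Psi: "deriv (\<lambda>w. (f ^^ k) (\<psi> w)) w = deriv (f ^^ k) (\<psi> w) * deriv \<psi> w"
proof -
  have "deriv ((f ^^ k) \<circ> \<psi>) w = deriv (f ^^ k) (\<psi> w) * deriv \<psi> w"
    by (rule deriv_chain) (auto intro!: hol_UNIV_diff hol hol_funpow f_hol)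
  thus ?thesis by (simp add: o_def)
qed

lemma p1_lam: "norm lam * (p 1 * norm (deriv \<psi> 0)) = 1"
proof -
  have e: "(f ^^ j) (\<psi> 0) = a (Suc j)" for j
    by (simp add: funpow_swap1 qm_def)
  have "deriv (f ^^ (m-1)) (\<psi> 0) = (\<Prod>j<m-1. deriv f (a (Suc j)))"
    by (simp only: deriv_funpow[OF f_hol] e)
  hence "norm (deriv (f ^^ (m-1)) (\<psi> 0)) = (\<Prod>j<m-1. G (Suc j))"
    by (simp only: prod_norm)
  also have "\<dots> = (\<Prod>j=1..<m. G j)"
    using prod.shift_bounds_Suc_ivl[of G 0 "m-1"] m by (simp add: lessThan_atLeast0)
  finally have "norm (deriv (f ^^ (m-1)) (\<psi> 0)) = p 1" by (simp add: p_def)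
  moreover have "norm (lam * deriv (\<lambda>w. (f ^^ (m-1)) (\<psi> w)) 0) = 1"
    by (simp only: lam_eq norm_one)
  ultimately show ?thesis by (simp only: deriv_Psi norm_mult)
qed

lemma lam_lower: "norm lam \<ge> 1 / 6 ^ m"
proof -
  have "p 1 * norm (deriv \<psi> 0) \<le> 6 ^ (m-1) * 6"
    using p_upper[of 1] psi0 p_lower[of 1] m by (intro mult_mono) auto
  also have "\<dots> = 6 ^ m" using m by (metis One_nat_def Suc_pred le_less_trans mult.commute power_Suc zero_le less_trans zero_less_numeral)
  finally have "norm lam * 6 ^ m \<ge> 1" using p1_lam lam_pos
    by (metis mult_le_cancel_left_pos)
  thus ?thesis by (simp add: divide_simps)
qed

text \<open>Weighting the error at time \<open>j\<close> by \<open>p j\<close> makes the linear part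
  of each step neutral, so only the quadratic remainders accumulate. They are summable because
  \<open>p j >= 2^(m-j)\<close> makes the unweighted error decay geometrically away from time
  \<open>m\<close>. This yields the distortion control over a whole period by hand.\<close>

lemma deviation_aux:
  assumes x: "norm (x - a 1) * p 1 \<le> 1/20" and "1 \<le> j" "j \<le> m"
  shows "norm ((f ^^ (j-1)) x - a j) * p j \<le> (1/20) * (1 + (1/2)^(m-j))"
  using assms(2,3)
proof (induction j rule: dec_induct)
  case base
  have "(1/20::real) * 1 \<le> (1/20) * (1 + (1/2)^(m-1))" by (intro mult_left_mono) auto
  moreover have "(f ^^ (1-1)) x = x" by simp
  ultimately show ?case using x by (simp only:)
next
  case (step j)
  define u where "u = (f ^^ (j-1)) x"
  define d where "d = norm (u - a j)"
  define y :: real where "y = (1/2)^(m-j)"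
  have y: "0 < y" "y \<le> 1" unfolding y_def by (auto intro: power_le_one)
  have y2: "(1/2)^(m - Suc j) = 2 * y"
  proof -
    have "m - j = Suc (m - Suc j)" using step by simp
    thus ?thesis by (simp add: y_def)
  qed
  have IH: "d * p j \<le> (1/20) * (1 + y)" using step by (simp add: d_def y_def u_def)
  have pl: "p j \<ge> 2^(m-j)" using step by (intro p_lower) auto
  have d: "d \<le> y / 10"
  proof -
    have "d * 2^(m-j) \<le> d * p j" using pl by (intro mult_left_mono) (auto simp: d_def)
    also have "\<dots> \<le> 1/10" using IH y by simp
    finally have "d * 2^(m-j) * y \<le> 1/10 * y" using y by (intro mult_right_mono) auto
    moreover have "2^(m-j) * y = 1" by (simp add: y_def power_one_over)
    ultimately show ?thesis by (simp add: mult.assoc)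
  qed
  have d0: "d \<ge> 0" by (simp add: d_def)
  have aj: "norm (a j) \<le> 14/5" using a_bd step by auto
  have Gj: "G j \<ge> 239/100" using G_lower step by auto
  have u3: "norm u \<le> 3"
    using norm_triangle_ineq[of "u - a j" "a j"] d aj y by (simp add: d_def)
  have "norm (f u - f (a j)) \<le> norm (f u - f (a j) - deriv f (a j) * (u - a j)) + norm (deriv f (a j) * (u - a j))"
    by norm
  also have "\<dots> \<le> (101/100) * d\<^sup>2 + G j * d"
    using f_taylor[of "a j" u] aj u3 by (simp add: d_def norm_mult)
  also have "\<dots> \<le> G j * d * (1 + d / 2)"
  proof -
    have "(101/100) * d\<^sup>2 \<le> (G j / 2) * d\<^sup>2" using Gj by (intro mult_right_mono) auto
    thus ?thesis by (simp add: algebra_simps power2_eq_square)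
  qed
  finally have A: "norm (f u - f (a j)) \<le> G j * d * (1 + d/2)" .
  have fu: "(f ^^ j) x = f u"
  proof -
    have "j = Suc (j - 1)" using step by simp
    thus ?thesis unfolding u_def by (metis funpow.simps(2) o_apply)
  qed
  have "norm ((f ^^ j) x - a (Suc j)) * p (Suc j) \<le> G j * d * (1 + d/2) * p (Suc j)"
    using A p_lower[of "Suc j"] step by (intro mult_right_mono) (auto simp: fu intro: order_trans[of 0 "2^(m - Suc j)"])
  also have "\<dots> = (d * p j) * (1 + d/2)" using p_step[of j] step by simp
  also have "\<dots> \<le> (1/20) * (1 + y) * (1 + y/20)"
  proof (rule mult_mono)
    show "d * p j \<le> 1/20 * (1 + y)" by (rule IH)
  qed (use d d0 y in auto)
  also have "\<dots> \<le> (1/20) * (1 + 2 * y)"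
  proof -
    have "y * y \<le> y" using y by (simp add: mult_left_le)
    thus ?thesis using y by (simp add: algebra_simps)
  qed
  finally show ?case by (simp add: y2)
qed

lemma deviation:
  assumes x: "norm (x - a 1) * p 1 \<le> 1/20" and j: "1 \<le> j" "j \<le> m"
  shows "norm ((f ^^ (j-1)) x - a j) \<le> 1/10"
proof -
  have "norm ((f ^^ (j-1)) x - a j) * 1 \<le> norm ((f ^^ (j-1)) x - a j) * p j"
    using p_lower[OF j] by (intro mult_left_mono) (auto intro: order_trans[of 1 "2^(m-j)"])
  also have "\<dots> \<le> (1/20) * (1 + (1/2)^(m-j))" by (rule deviation_aux[OF assms])
  also have "\<dots> \<le> 1/10" using power_le_one[of "1/2::real" "m-j"] by simp
  finally show ?thesis by simp
qed

text \<open>By \<open>p1_lam\<close> the factor \<open>p 1\<close> is comparable to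
  \<open>1 / |lam|\<close>. Using 21 in place of 20 pays for the losses 501/500 and 499/500 in the
  derivative of \<open>\<psi>\<close>.\<close>

lemma near_v: assumes "norm w \<le> norm lam / 21" shows "norm (\<psi> w - a 1) * p 1 \<le> 1/20"
proof -
  have "norm w \<le> 16" using assms lam_tiny by simp
  hence "norm (\<psi> w - \<psi> 0) \<le> (501/500) * norm w" using lip_upper[of w 0] by simp
  hence "norm (\<psi> w - a 1) * p 1 \<le> ((501/500) * (norm lam / 21)) * p 1"
    using assms p_lower[of 1] m a1 by (intro mult_right_mono) (auto intro: order_trans[of 0 "2^(m-1)"])
  moreover have "norm lam * p 1 \<le> 500/499"
  proof -
    have "norm lam * p 1 * (499/500) \<le> norm lam * p 1 * norm (deriv \<psi> 0)"
      using psi0 p_lower[of 1] m by (intro mult_left_mono) (auto intro!: mult_nonneg_nonneg intro: order_trans[of 0 "2^(m-1)"])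
    thus ?thesis using p1_lam by (simp add: mult.assoc)
  qed
  ultimately show ?thesis by (simp add: algebra_simps)
qed

lemma funpow_psi: "1 \<le> j \<Longrightarrow> (f ^^ j) x = (f ^^ (j-1)) (\<psi> (x\<^sup>2))"
  by (metis One_nat_def Suc_pred funpow_simps_right(2) less_eq_Suc_le o_apply qm_def)

text \<open>Shadowing of the critical orbit over a whole period. Its main consequence,
  \<open>inner_bd\<close>, is that no intermediate image comes near 0; this later gives the
  disjointness of the little Julia sets and localizes the weight pushed forward along the
  orbit.\<close>

lemma inner:
  assumes "(norm x)\<^sup>2 \<le> norm lam / 21" "1 \<le> j" "j \<le> m"
  shows "norm ((f ^^ j) x - a j) \<le> 1/10"
  unfolding funpow_psi[OF assms(2), of x]
  by (rule deviation[OF near_v assms(2,3)]) (use assms(1) in \<open>simp add: norm_power\<close>)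

lemma inner_bd:
  assumes "(norm x)\<^sup>2 \<le> norm lam / 21" "1 \<le> j" "j < m"
  shows "11/10 \<le> norm ((f ^^ j) x)" "norm ((f ^^ j) x) \<le> 29/10"
  using inner[of x j] a_bd[of j] assms norm_triangle_ineq[of "(f ^^ j) x - a j" "a j"]
     norm_triangle_ineq4[of "(f ^^ j) x - a j" "(f ^^ j) x"] by auto

lemma inner_bd':
  assumes "(norm x)\<^sup>2 \<le> norm lam / 21" "1 \<le> j" "j \<le> m"
  shows "norm ((f ^^ j) x) \<le> 29/10"
proof (cases "j = m")
  case True
  thus ?thesis using inner[of x m] assms am lam_tiny norm_triangle_ineq[of "(f ^^ m) x - a m" "a m"] by simp
qed (use inner_bd assms in auto)

text \<open>The return map \<open>f^m (lam z) / lam\<close>, written as a function of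
  \<open>w = z^2\<close> so that the critical point disappears from the formula. The condition
  \<open>lam_eq\<close> is exactly what makes its derivative at 0 equal to 1.\<close>

definition nxt where "nxt w = (f ^^ (m-1)) (\<psi> (lam\<^sup>2 * w)) / lam"

lemma nxt_hol: "nxt holomorphic_on A"
proof -
  have "((f ^^ (m-1)) \<circ> (\<psi> \<circ> (\<lambda>w. lam\<^sup>2 * w))) holomorphic_on A"
    by (intro holomorphic_on_compose holomorphic_intros hol holomorphic_on_subset[OF hol_funpow[OF f_hol]]) auto
  thus ?thesis unfolding nxt_def[abs_def] by (intro holomorphic_intros lam0) (auto simp: o_def)
qed

lemma nxt_0: "nxt 0 = a m / lam"
  using funpow_psi[of m 0] m by (simp add: nxt_def)

lemma nxt_deriv_0: "deriv nxt 0 = 1"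
proof -
  let ?P = "\<lambda>w. (f ^^ (m-1)) (\<psi> w)"
  have "?P holomorphic_on UNIV"
    using holomorphic_on_compose[OF hol holomorphic_on_subset[OF hol_funpow[OF f_hol]]] by (simp add: o_def)
  hence "(?P has_field_derivative deriv ?P 0) (at (lam\<^sup>2 * 0))"
    by (simp add: holomorphic_derivI)
  hence "((\<lambda>w. ?P (lam\<^sup>2 * w)) has_field_derivative deriv ?P 0 * lam\<^sup>2) (at 0)"
    by (rule DERIV_chain2) (auto intro!: derivative_eq_intros)
  hence "(nxt has_field_derivative deriv ?P 0 * lam\<^sup>2 / lam) (at 0)"
    unfolding nxt_def[abs_def] by (intro DERIV_cdivide)
  moreover have "deriv ?P 0 * lam\<^sup>2 / lam = 1"
    using lam_eq lam0 by (simp add: power2_eq_square mult.commute)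
  ultimately show ?thesis by (simp add: DERIV_imp_deriv)
qed

text \<open>Shadowing bounds \<open>nxt w - nxt 0\<close> by a multiple of \<open>1 / |lam|\<close>
  on the disc of radius \<open>R = 1 / (21 |lam|)\<close>, so Cauchy on half of that disc gives a
  second derivative of order \<open>|lam|\<close>. With derivative 1 at 0 the map is then nearly a
  translation on a disc far larger than \<open>|w| < 25\<close>.\<close>

lemma nxt_taylor:
  assumes w: "norm w \<le> 1 / (42 * norm lam)"
  shows "norm (nxt w - (nxt 0 + w)) \<le> 600 * norm lam * (norm w)\<^sup>2"
    and "norm (deriv nxt w - 1) \<le> 600 * norm lam * norm w"
proof -
  let ?h = "\<lambda>w. nxt w - (nxt 0 + w)"
  define R where "R = 1 / (21 * norm lam)"
  have R0: "R > 0" using lam_pos by (simp add: R_def)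
  have hh: "?h holomorphic_on A" for A by (intro holomorphic_intros nxt_hol)
  have bd: "norm (?h u) \<le> (31/10) * R" if u: "norm u \<le> R" for u
  proof -
    have "norm (lam\<^sup>2 * u) = norm lam * (norm lam * norm u)" by (simp add: norm_mult norm_power power2_eq_square)
    also have "\<dots> \<le> norm lam * (norm lam * R)" using u by (intro mult_left_mono) auto
    also have "\<dots> = norm lam / 21" using lam_pos by (simp add: R_def)
    finally have "norm ((f ^^ (m-1)) (\<psi> (lam\<^sup>2*u)) - a m) \<le> 1/10"
      by (intro deviation near_v) (use m in auto)
    hence "norm ((f ^^ (m-1)) (\<psi> (lam\<^sup>2*u)) - a m) / norm lam \<le> (1/10) / norm lam"
      using lam_pos by (intro divide_right_mono) auto
    moreover have "nxt u - nxt 0 = ((f ^^ (m-1)) (\<psi> (lam\<^sup>2*u)) - a m) / lam"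
      unfolding nxt_0 by (simp add: nxt_def diff_divide_distrib)
    ultimately have "norm (nxt u - nxt 0) \<le> (1/10) / norm lam" by (simp add: norm_divide)
    also have "\<dots> = (21/10) * R" by (simp add: R_def)
    finally have "norm (nxt u - nxt 0) \<le> (21/10) * R" .
    moreover have "?h u = (nxt u - nxt 0) - u" by simp
    ultimately show ?thesis using norm_triangle_ineq4[of "nxt u - nxt 0" u] u by (simp only:)
  qed
  have D1: "(?h has_field_derivative deriv nxt u - 1) (at u)" for u
    using holomorphic_derivI[OF nxt_hol[of UNIV], of u] by (auto intro!: derivative_eq_intros)
  have D: "deriv ?h u = deriv nxt u - 1" for u
    using D1 by (simp add: DERIV_imp_deriv)
  have h2: "norm ((deriv ^^ 2) ?h u) \<le> 600 * norm lam" if u: "norm u \<le> R/2" for u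
  proof -
    have "norm ((deriv ^^ 2) ?h u) \<le> fact 2 * ((31/10) * R) / (R/2)^2"
    proof (rule Cauchy_inequality)
      show "?h holomorphic_on ball u (R/2)" "continuous_on (cball u (R/2)) ?h"
        using hh holomorphic_on_imp_continuous_on by blast+
      fix y assume "norm (u - y) = R/2"
      thus "norm (?h y) \<le> (31/10) * R" using u norm_triangle_ineq4[of u "u - y"] by (intro bd) simp
    qed (use R0 in auto)
    also have "\<dots> = (124/5) / R" using R0 by (simp add: power2_eq_square)
    also have "\<dots> = (124/5*21) * norm lam" by (simp add: R_def)
    also have "\<dots> \<le> 600 * norm lam" by simp
    finally show ?thesis .
  qed
  let ?C = "cball 0 (R/2) :: complex set"
  have wC: "w \<in> ?C" using w by (simp add: R_def)
  have zC: "0 \<in> ?C" using R0 by simp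
  have Dk: "((deriv ^^ i) ?h has_field_derivative (deriv ^^ Suc i) ?h u) (at u within ?C)" for i u
  proof -
    have "(deriv ^^ i) ?h holomorphic_on UNIV" by (intro holomorphic_higher_deriv hh) auto
    thus ?thesis by (simp add: holomorphic_derivI has_field_derivative_at_within)
  qed
  let ?g = "\<lambda>i. (deriv ^^ i) ?h"
  have "norm (?g 0 w - (\<Sum>i\<le>1. ?g i 0 * (w - 0) ^ i / fact i)) \<le> (600 * norm lam) * norm (w - 0) ^ Suc 1 / fact 1"
  proof (rule complex_Taylor[where S = "?C"])
    show "norm (?g (Suc 1) u) \<le> 600 * norm lam" if "u \<in> ?C" for u
      using h2[of u] that by (simp add: numeral_2_eq_2)
  qed (use wC zC Dk in auto)
  thus "norm (?h w) \<le> 600 * norm lam * (norm w)\<^sup>2"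
    by (simp add: D nxt_deriv_0 numeral_2_eq_2)
  have "norm (deriv ?h w - deriv ?h 0) \<le> (600 * norm lam) * norm (w - 0)"
  proof (rule field_differentiable_bound[where S = ?C])
    show "(deriv ?h has_field_derivative (deriv ^^ 2) ?h u) (at u within ?C)" for u
      using Dk[of 1 u] by (simp add: numeral_2_eq_2)
  qed (use wC zC h2 in auto)
  thus "norm (deriv nxt w - 1) \<le> 600 * norm lam * norm w"
    by (simp only: D nxt_deriv_0) simp
qed

lemma nxt_qm: "(f ^^ m) (lam * z) / lam = qm nxt z"
  using funpow_psi[of m "lam * z"] m by (simp add: nxt_def qm_def power_mult_distrib)

text \<open>A hundred times better than \<open>near_quad\<close> demands. The surplus pays for the
  Cauchy estimate with respect to the parameter in \<open>lip_t\<close>.\<close>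

lemma nxt_near: "norm w < 25 \<Longrightarrow> norm (nxt w - (nxt 0 + w)) \<le> 1/10000"
proof -
  assume w: "norm w < 25"
  have "(1/10^4::real)^36 \<le> (1/10^4)^3" by (rule power_decreasing) auto
  hence l: "norm lam * 1000000000000 \<le> 1" using lam_small by (simp add: power3_eq_cube)
  have "norm w * (42 * norm lam) \<le> 25 * (42 * norm lam)" using w by (intro mult_right_mono) auto
  hence "norm w * (42 * norm lam) \<le> 1" using l lam_pos by linarith
  hence "norm w \<le> 1 / (42 * norm lam)" using lam_pos by (simp add: field_simps)
  hence "norm (nxt w - (nxt 0 + w)) \<le> 600 * norm lam * (norm w)\<^sup>2" by (rule nxt_taylor)
  also have "\<dots> \<le> 600 * norm lam * 25\<^sup>2" using w by (intro mult_left_mono power_mono) auto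
  also have "\<dots> \<le> 1/10000" using l lam_pos by (simp add: power2_eq_square)
  finally show ?thesis .
qed

section \<open>The fixed point near 2 and the position of the critical value\<close>

lemma beta_ex: "\<exists>\<beta>. norm (\<beta> - 2) \<le> 1/5 \<and> f \<beta> = \<beta>"
proof -
  \<comment> \<open>A simplified Newton step: 3 is the derivative of \<open>x^2 - 2 - x\<close> at
    2, so the terms linear in \<open>x - 2\<close> cancel and a small disc is mapped into
    itself.\<close>
  let ?H = "\<lambda>x. x - (f x - x) / 3"
  have *: "?H x \<in> cball 2 (1/5)" if x: "x \<in> cball 2 (1/5)" for x
  proof -
    have nx: "norm (x - 2) \<le> 1/5" using x by (simp add: dist_norm norm_minus_commute)
    have "norm x < 5" using nx norm_triangle_ineq[of "x-2" 2] by simp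
    hence c: "norm (f x - (x\<^sup>2 + t)) \<le> 1/100" by (rule f_close)
    have "?H x - 2 = - ((f x - (x\<^sup>2 + t)) + (t + 2) + (x-2)\<^sup>2) / 3"
      by (simp add: field_simps power2_eq_square)
    hence "norm (?H x - 2) = norm ((f x - (x\<^sup>2 + t)) + (t + 2) + (x-2)\<^sup>2) / 3"
      by (simp only: norm_divide norm_minus_cancel) simp
    also have "norm ((f x - (x\<^sup>2 + t)) + (t + 2) + (x-2)\<^sup>2) \<le> 1/100 + 7/20 + (1/5)\<^sup>2"
    proof -
      have "norm ((x-2)\<^sup>2) \<le> (1/5)\<^sup>2" unfolding norm_power using nx by (intro power_mono) auto
      thus ?thesis using c t2 norm_triangle_ineq[of "(f x - (x\<^sup>2 + t)) + (t + 2)" "(x-2)\<^sup>2"]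
          norm_triangle_ineq[of "f x - (x\<^sup>2 + t)" "t + 2"] by linarith
    qed
    finally show ?thesis by (simp add: dist_norm norm_minus_commute power2_eq_square)
  qed
  have "continuous_on (cball 2 (1/5)) ?H"
    by (intro continuous_intros holomorphic_on_imp_continuous_on f_hol) auto
  then obtain x where "x \<in> cball 2 (1/5)" "?H x = x"
    using brouwer_ball[of "1/5" 2 ?H] * by (auto simp: Pi_def)
  thus ?thesis by (intro exI[of _ x]) (auto simp: dist_norm norm_minus_commute)
qed

definition beta where "beta = (SOME \<beta>. norm (\<beta> - 2) \<le> 1/5 \<and> f \<beta> = \<beta>)"

lemma beta: "norm (beta - 2) \<le> 1/5" "f beta = beta"
  using someI_ex[OF beta_ex] by (auto simp: beta_def)

lemma beta_norm: "norm beta \<le> 11/5" "norm beta \<ge> 9/5"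
  using beta norm_triangle_ineq[of "beta-2" 2] norm_triangle_ineq4[of "beta-2" "beta"] by auto

text \<open>The second inequality compares the derivative at \<open>a j\<close> with the true rate
  of escape from \<open>beta\<close>: they differ by a factor \<open>1 + (7/20) d\<close>, where
  7/20 comes from \<open>(101/100) / (29/10)\<close>. By the first inequality the distances
  \<open>d\<close> decrease geometrically backwards in time, so the product of these factors stays
  bounded.\<close>

lemma delta_step:
  assumes j: "2 \<le> j" "j < m"
  shows "29/10 * norm (a j - beta) \<le> norm (a (Suc j) - beta)"
    and "G j * norm (a j - beta) \<le> norm (a (Suc j) - beta) * (1 + (7/20) * norm (a j - beta))"
proof -
  define d where "d = norm (a j - beta)"
  define d' where "d' = norm (a (Suc j) - beta)"
  have aj: "norm (a j) \<le> 14/5" "norm (a j - 2) < 4/5" using a_bd[of j] orb[of j] j by auto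
  have sum3: "norm (a j + beta) \<ge> 3"
    using norm_triangle_ineq4[of "(a j - 2) + (beta - 2)" "a j + beta"]
      norm_triangle_ineq[of "a j - 2" "beta - 2"] aj beta by simp
  have d': "d' = norm (\<psi> ((a j)\<^sup>2) - \<psi> (beta\<^sup>2))"
    using beta(2) by (simp add: d'_def qm_def)
  have "(499/500) * norm ((a j)\<^sup>2 - beta\<^sup>2) \<le> d'"
    unfolding d' using aj beta_norm by (intro lip_lower norm_sq16) auto
  also have "norm ((a j)\<^sup>2 - beta\<^sup>2) = d * norm (a j + beta)"
    unfolding d_def by (simp add: power2_eq_square flip: norm_mult) (simp add: algebra_simps)
  finally have "(499/500) * (d * norm (a j + beta)) \<le> d'" .
  moreover have "d * 3 \<le> d * norm (a j + beta)" using sum3 by (intro mult_left_mono) (auto simp: d_def)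
  moreover have "d \<ge> 0" by (simp add: d_def)
  ultimately have 1: "29/10 * d \<le> d'" by linarith
  thus "29/10 * norm (a j - beta) \<le> norm (a (Suc j) - beta)" by (simp add: d_def d'_def)
  have "norm (f beta - f (a j) - deriv f (a j) * (beta - a j)) \<le> (101/100) * d\<^sup>2"
    using f_taylor[of "a j" beta] aj beta_norm by (simp add: d_def norm_minus_commute)
  moreover have "norm (deriv f (a j) * (beta - a j)) = G j * d" by (simp add: norm_mult d_def norm_minus_commute)
  moreover have "norm (f beta - f (a j)) = d'" using beta(2) by (simp add: d'_def norm_minus_commute)
  ultimately have "G j * d \<le> d' + (101/100) * d\<^sup>2"
    using norm_triangle_ineq4[of "f beta - f (a j)" "f beta - f (a j) - deriv f (a j) * (beta - a j)"]
    by simp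
  also have "(101/100) * d\<^sup>2 \<le> d' * ((7/20) * d)"
  proof -
    have "(29/10) * (d * d) \<le> d' * d" using mult_right_mono[OF 1, of d] by (simp add: d_def mult.assoc)
    moreover have "d * d \<ge> 0" by simp
    ultimately have "(101/100) * (d * d) \<le> (7/20) * (d' * d)" by linarith
    thus ?thesis by (simp add: power2_eq_square)
  qed
  finally show "G j * norm (a j - beta) \<le> norm (a (Suc j) - beta) * (1 + (7/20) * norm (a j - beta))"
    by (simp add: d_def d'_def algebra_simps)
qed

text \<open>Induction backwards from time \<open>m\<close>, when the orbit is near 0. The subtracted
  term \<open>(3/4) (1/2)^i\<close> is a reserve spent on the factors \<open>1 + (7/20) d\<close>;
  at \<open>i = 0\<close> it leaves exactly the 5/2 that bounds the distance from \<open>a m\<close>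
  to \<open>beta\<close>.\<close>

lemma delta_bd: 
  assumes "i \<le> m - 2"
  shows "(i > 0 \<longrightarrow> norm (a (m-i) - beta) \<le> (8/5) * (1/2)^i) \<and>
     norm (a (m-i) - beta) * p (m-i) \<le> 10 * (1 - (3/4) * (1/2)^i)"
  using assms
proof (induction i)
  case 0
  have "norm (a m - beta) \<le> 5/2"
    using norm_triangle_ineq4[of "a m" beta] am lam_tiny beta_norm by simp
  thus ?case by (simp add: p_m)
next
  case (Suc i)
  define j where "j = m - Suc i"
  have j: "2 \<le> j" "j < m" "Suc j = m - i" using Suc m by (auto simp: j_def)
  define d where "d = norm (a j - beta)"
  define d' where "d' = norm (a (Suc j) - beta)"
  define x :: real where "x = (1/2)^Suc i"
  have x: "0 < x" "x \<le> 1/2" and x2: "(1/2)^i = 2 * x" by (auto simp: x_def power_le_one)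
  note ds = delta_step[OF j(1,2), folded d_def d'_def]
  have d0: "d \<ge> 0" by (simp add: d_def)
  have dx: "d \<le> (8/5) * x"
  proof (cases "i = 0")
    case True
    have "d' \<le> 23/10" using j True norm_triangle_ineq4[of "a m" beta] am lam_tiny beta_norm
      by (simp add: d'_def)
    thus ?thesis using ds True by (simp add: x_def)
  next
    case False
    hence "d' \<le> (8/5) * (2 * x)" using Suc j x2 by (simp add: d'_def)
    thus ?thesis using ds d0 by simp
  qed
  have IH: "d' * p (Suc j) \<le> 10 * (1 - (3/4) * (2 * x))" using Suc j x2 by (simp add: d'_def)
  have pp: "p (Suc j) \<ge> 0" by (simp add: p_def prod_nonneg)
  have "d * p j = G j * d * p (Suc j)" using p_step j by simp
  also have "\<dots> \<le> (d' * (1 + (7/20) * d)) * p (Suc j)" using ds pp by (intro mult_right_mono)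
  also have "\<dots> = (d' * p (Suc j)) * (1 + (7/20) * d)" by simp
  also have "\<dots> \<le> (10 * (1 - (3/4) * (2 * x))) * (1 + (7/20) * d)" using IH d0 by (intro mult_right_mono) auto
  also have "\<dots> \<le> (10 * (1 - (3/4) * (2 * x))) * (1 + (14/25) * x)"
    using x dx by (intro mult_left_mono) auto
  also have "\<dots> \<le> 10 * (1 - (3/4) * x)" using x by (simp add: algebra_simps)
  finally show ?case using dx unfolding d_def j_def x_def by simp
qed

text \<open>Since \<open>- beta\<close> is the other preimage of \<open>beta\<close>, the long stay
  near \<open>beta\<close> forces the critical value to be close to \<open>- beta\<close>, at a
  distance of order \<open>|lam|\<close>. Hence \<open>f x + beta\<close> is close to
  \<open>x^2\<close>, which is what \<open>bg_transfer\<close> needs.\<close>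

lemma beta_v: "norm (a 1 + beta) \<le> 15 * norm lam"
proof -
  have d2: "norm (a 2 - beta) * p 2 \<le> 10"
  proof -
    have "norm (a (m-(m-2)) - beta) * p (m-(m-2)) \<le> 10 * (1 - (3/4) * (1/2)^(m-2))"
      using delta_bd[of "m-2"] by blast
    also have "\<dots> \<le> 10" by simp
    finally show ?thesis using m by simp
  qed
  have G1: "G 1 \<le> 5"
    using f_deriv_upper[of "a 1"] a1_bd norm_triangle_ineq4[of "a 1 + 2" 2] by simp
  have p1: "p 1 = G 1 * p 2" using p_step[of 1] m by (simp add: numeral_2_eq_2)
  have p2: "p 2 > 0" using p_lower[of 2] m by (auto intro: less_le_trans[of 0 "2^(m-2)"])
  have p2l: "1 \<le> p 2 * ((51/10) * norm lam)"
  proof -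
    have "1 = norm lam * (G 1 * p 2 * norm (deriv \<psi> 0))" using p1_lam p1 by simp
    also have "\<dots> \<le> norm lam * (5 * p 2 * (501/500))"
      using G1 psi0 p2 by (intro mult_left_mono mult_mono) auto
    also have "\<dots> \<le> p 2 * ((51/10) * norm lam)" using p2 lam_pos by simp
    finally show ?thesis .
  qed
  have "norm (a 2 - beta) * 1 \<le> norm (a 2 - beta) * (p 2 * ((51/10) * norm lam))"
    using p2l by (intro mult_left_mono) auto
  also have "\<dots> = (norm (a 2 - beta) * p 2) * ((51/10) * norm lam)" by simp
  also have "\<dots> \<le> 10 * ((51/10) * norm lam)" using d2 by (intro mult_right_mono) auto
  finally have A: "norm (a 2 - beta) \<le> 51 * norm lam" by simp
  have e: "norm (a 2 - beta) = norm (\<psi> ((a 1)\<^sup>2) - \<psi> (beta\<^sup>2))"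
    using beta(2) by (simp add: qm_def numeral_2_eq_2)
  have "(499/500) * norm ((a 1)\<^sup>2 - beta\<^sup>2) \<le> norm (a 2 - beta)"
    unfolding e using a_bd[of 1] m beta_norm by (intro lip_lower norm_sq16) auto
  also have "norm ((a 1)\<^sup>2 - beta\<^sup>2) = norm (a 1 + beta) * norm (a 1 - beta)"
    by (simp add: power2_eq_square flip: norm_mult) (simp add: algebra_simps)
  finally have B: "(499/500) * (norm (a 1 + beta) * norm (a 1 - beta)) \<le> norm (a 2 - beta)" .
  have "norm (a 1 - beta) \<ge> 172/50"
    using norm_triangle_ineq4[of "(a 1 + 2) - (beta - 2)" "a 1 - beta"]
      norm_triangle_ineq4[of "a 1 + 2" "beta - 2"] a1_bd beta by simp
  hence "norm (a 1 + beta) * (172/50) \<le> norm (a 1 + beta) * norm (a 1 - beta)"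
    by (intro mult_left_mono) auto
  thus ?thesis using A B norm_ge_zero[of lam] by linarith
qed

end

section \<open>Moduli of annuli\<close>

lemma disc_automorphism_form:
  fixes \<tau> \<sigma> :: "complex \<Rightarrow> complex"
  assumes "\<tau> holomorphic_on ball 0 1" "\<sigma> holomorphic_on ball 0 1"
    and t: "\<And>z. norm z < 1 \<Longrightarrow> norm (\<tau> z) < 1 \<and> \<sigma> (\<tau> z) = z"
    and s: "\<And>z. norm z < 1 \<Longrightarrow> norm (\<sigma> z) < 1 \<and> \<tau> (\<sigma> z) = z"
  obtains \<alpha> b where "norm \<alpha> = 1" "norm b < 1"
    "\<And>z. norm z < 1 \<Longrightarrow> 1 + cnj b * \<alpha> * z \<noteq> 0 \<and> \<tau> z = (\<alpha> * z + b) / (1 + cnj b * \<alpha> * z)"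
proof -
  define b where "b = \<tau> 0"
  have b: "norm b < 1" using t[of 0] by (simp add: b_def)
  \<comment> \<open>After this normalization 0 is fixed, and the Schwarz lemma for the map and for
    its inverse leaves only rotations.\<close>
  define M where "M = Moebius_function 0 b"
  define Mi where "Mi = Moebius_function 0 (-b)"
  have M1: "norm (M z) < 1" "norm (Mi z) < 1" if "norm z < 1" for z
    using that b Moebius_function_norm_lt_1[of b z 0] Moebius_function_norm_lt_1[of "-b" z 0]
    by (auto simp: M_def Mi_def)
  have MM: "Mi (M z) = z" "M (Mi z) = z" if "norm z < 1" for z
    unfolding M_def Mi_def using that b by (auto intro!: Moebius_function_compose)
  have holM: "M holomorphic_on ball 0 1" "Mi holomorphic_on ball 0 1"
    unfolding M_def Mi_def using b by (auto intro!: Moebius_function_holomorphic)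
  define F where "F = M \<circ> \<tau>"
  define K where "K = \<sigma> \<circ> Mi"
  have holF: "F holomorphic_on ball 0 1" unfolding F_def
    by (rule holomorphic_on_compose_gen[OF assms(1) holM(1)]) (use t in auto)
  have holK: "K holomorphic_on ball 0 1" unfolding K_def
    by (rule holomorphic_on_compose_gen[OF holM(2) assms(2)]) (use M1 in auto)
  have F0: "F 0 = 0" by (simp add: F_def M_def b_def Moebius_function_eq_zero)
  have K0: "K 0 = 0"
  proof -
    have "Mi 0 = b" by (simp add: Mi_def Moebius_function_def)
    thus ?thesis using t[of 0] by (simp add: K_def b_def)
  qed
  have F1: "norm (F z) < 1" and K1: "norm (K z) < 1" and KF: "K (F z) = z" if "norm z < 1" for z
    using that t s M1 MM by (auto simp: F_def K_def)
  have le: "norm (F z) \<le> norm z" if "norm z < 1" for z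
    by (rule Schwarz_Lemma(1)[OF holF F0 F1 that])
  have ge: "norm z \<le> norm (F z)" if "norm z < 1" for z
    using Schwarz_Lemma(1)[OF holK K0 K1 F1[OF that]] KF[OF that] by simp
  have "norm (F (1/2)) = norm (1/2::complex)" using le[of "1/2"] ge[of "1/2"] by simp
  hence "\<exists>z. norm z < 1 \<and> z \<noteq> 0 \<and> norm (F z) = norm z"
    by (intro exI[of _ "1/2"]) (simp add: norm_divide)
  then obtain \<alpha> where \<alpha>: "\<And>z. norm z < 1 \<Longrightarrow> F z = \<alpha> * z" "norm \<alpha> = 1"
    using Schwarz_Lemma(3)[of F 0] holF F0 F1 by (metis norm_zero zero_less_one)
  show ?thesis
  proof (rule that[OF \<alpha>(2) b])
    fix z :: complex assume z: "norm z < 1"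
    have "\<tau> z = Mi (F z)" using MM t[OF z] by (simp add: F_def)
    also have "\<dots> = (\<alpha> * z + b) / (1 + cnj b * \<alpha> * z)"
      by (simp add: Mi_def Moebius_function_def \<alpha>(1)[OF z] mult.assoc)
    finally have e: "\<tau> z = (\<alpha> * z + b) / (1 + cnj b * \<alpha> * z)" .
    have "norm (cnj b * \<alpha> * z) < 1"
    proof -
      have "norm b * norm z < 1 * 1" using b z by (intro mult_strict_mono') auto
      thus ?thesis by (simp add: norm_mult \<alpha>(2))
    qed
    hence "1 + cnj b * \<alpha> * z \<noteq> 0" by (metis add_eq_0_iff norm_minus_cancel norm_one less_irrefl)
    with e show "1 + cnj b * \<alpha> * z \<noteq> 0 \<and> \<tau> z = (\<alpha> * z + b) / (1 + cnj b * \<alpha> * z)" by simp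
  qed
qed

lemma real_pos_multiplier:
  assumes "\<And>h. Im h > 0 \<Longrightarrow> Im (\<kappa> * h) > 0"
  shows "Im \<kappa> = 0" "Re \<kappa> > 0"
proof -
  have k: "x * Im \<kappa> + Re \<kappa> > 0" for x :: real
    using assms[of "Complex x 1"] by (simp add: algebra_simps)
  show "Re \<kappa> > 0" using k[of 0] by simp
  show "Im \<kappa> = 0"
  proof (rule ccontr)
    assume n: "Im \<kappa> \<noteq> 0"
    have "(- (Re \<kappa>) / Im \<kappa>) * Im \<kappa> + Re \<kappa> > 0" by (rule k)
    thus False using n by simp
  qed
qed


text \<open>The fixed points are the roots \<open>z1\<close>, \<open>z2\<close> of a quadratic
  equation. Their moduli have product 1 and neither root is in the disc, so both are on the circle.
  Sending distinct roots to 0 and infinity gives a dilation of a half-plane; sending a double root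
  to infinity gives a translation.\<close>

lemma disc_automorphism_cases:
  fixes \<tau> \<sigma> :: "complex \<Rightarrow> complex"
  assumes "\<tau> holomorphic_on ball 0 1" "\<sigma> holomorphic_on ball 0 1"
    and t: "\<And>z. norm z < 1 \<Longrightarrow> norm (\<tau> z) < 1 \<and> \<sigma> (\<tau> z) = z"
    and s: "\<And>z. norm z < 1 \<Longrightarrow> norm (\<sigma> z) < 1 \<and> \<tau> (\<sigma> z) = z"
    and nofix: "\<And>z. norm z < 1 \<Longrightarrow> \<tau> z \<noteq> z"
  obtains
    (hyp) N Ni \<kappa> where "N holomorphic_on ball 0 1" "Ni holomorphic_on {h. Im h > 0}"
      "\<And>z. norm z < 1 \<Longrightarrow> Im (N z) > 0 \<and> Ni (N z) = z"
      "\<And>h. Im h > 0 \<Longrightarrow> norm (Ni h) < 1 \<and> N (Ni h) = h"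
      "\<kappa> > 0" "\<kappa> \<noteq> 1" "\<And>z. norm z < 1 \<Longrightarrow> N (\<tau> z) = of_real \<kappa> * N z"
  | (par) N Ni c where "N holomorphic_on ball 0 1" "Ni holomorphic_on {h. Re h > 0}"
      "\<And>z. norm z < 1 \<Longrightarrow> Re (N z) > 0 \<and> Ni (N z) = z"
      "\<And>h. Re h > 0 \<Longrightarrow> norm (Ni h) < 1 \<and> N (Ni h) = h"
      "Re c = 0" "\<And>z. norm z < 1 \<Longrightarrow> N (\<tau> z) = N z + c"
proof -
  obtain \<alpha> b where \<alpha>: "norm \<alpha> = 1" and b: "norm b < 1"
    and \<tau>: "\<And>z. norm z < 1 \<Longrightarrow> 1 + cnj b * \<alpha> * z \<noteq> 0 \<and> \<tau> z = (\<alpha> * z + b) / (1 + cnj b * \<alpha> * z)"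
    using disc_automorphism_form[OF assms(1-4)] by metis
  have b0: "b \<noteq> 0"
  proof
    assume "b = 0"
    hence "\<tau> 0 = 0" using \<tau>[of 0] by simp
    thus False using nofix[of 0] by simp
  qed
  have \<alpha>0: "\<alpha> \<noteq> 0" using \<alpha> by auto
  define A where "A = cnj b * \<alpha>"
  have A0: "A \<noteq> 0" using b0 \<alpha>0 by (simp add: A_def)
  define D where "D = csqrt ((1-\<alpha>)\<^sup>2 + 4 * A * b)"
  have D2: "D\<^sup>2 = (1-\<alpha>)\<^sup>2 + 4 * A * b" by (simp add: D_def)
  define z1 where "z1 = (-(1-\<alpha>) + D) / (2*A)"
  define z2 where "z2 = (-(1-\<alpha>) - D) / (2*A)"
  have sum: "A * (z1 + z2) = -(1-\<alpha>)" using A0 by (simp add: z1_def z2_def field_simps)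
  have prd: "A * z1 * z2 = - b"
  proof -
    have "4 * A * (A * z1 * z2) = (2*A*z1) * (2*A*z2)" by simp
    also have "\<dots> = (-(1-\<alpha>) + D) * (-(1-\<alpha>) - D)" using A0 by (simp add: z1_def z2_def)
    also have "\<dots> = (1-\<alpha>)\<^sup>2 - D\<^sup>2" by (simp add: power2_eq_square algebra_simps)
    also have "\<dots> = 4 * A * (- b)" by (simp add: D2)
    finally show ?thesis using A0 by (metis mult_cancel_left mult_eq_0_iff zero_neq_numeral)
  qed
  have r1: "A * z1\<^sup>2 + (1-\<alpha>) * z1 - b = 0" and r2: "A * z2\<^sup>2 + (1-\<alpha>) * z2 - b = 0"
    using sum prd by (simp_all add: power2_eq_square) algebra+
  have big: "norm z \<ge> 1" if r: "A * z\<^sup>2 + (1-\<alpha>) * z - b = 0" for z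
  proof (rule ccontr)
    assume "\<not> norm z \<ge> 1"
    hence z: "norm z < 1" by simp
    have "\<alpha> * z + b = z * (1 + A * z)" using r by algebra
    hence "\<alpha> * z + b = z * (1 + cnj b * \<alpha> * z)" by (simp add: A_def)
    hence "\<tau> z = z" using \<tau>[OF z] by (simp add: divide_simps)
    thus False using nofix[OF z] by simp
  qed
  have nn: "norm z1 * norm z2 = 1"
  proof -
    have "norm A * (norm z1 * norm z2) = norm A"
      using arg_cong[OF prd, of norm] by (simp add: norm_mult A_def \<alpha>)
    thus ?thesis using A0 by simp
  qed
  have n1: "norm z1 = 1" and n2: "norm z2 = 1"
  proof -
    have "norm z1 \<ge> 1" "norm z2 \<ge> 1" using big r1 r2 by auto
    moreover have "norm z1 * 1 \<le> norm z1 * norm z2" "1 * norm z2 \<le> norm z1 * norm z2"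
      using calculation mult_left_mono[of 1 "norm z2" "norm z1"] mult_right_mono[of 1 "norm z1" "norm z2"]
      by auto
    ultimately show "norm z1 = 1" "norm z2 = 1" using nn by auto
  qed
  have ub: "1 - z * cnj b \<noteq> 0" if "norm z = 1" for z
  proof
    assume "1 - z * cnj b = 0"
    hence "norm (z * cnj b) = 1" by (metis eq_iff_diff_eq_0 norm_one)
    thus False using that b by (simp add: norm_mult)
  qed
  have tz: "\<tau> z - w = \<alpha> * (1 - w * cnj b) * (z - w) / (1 + A * z)"
    if z: "norm z < 1" and w: "A * w\<^sup>2 + (1-\<alpha>) * w - b = 0" for z w
  proof -
    have d: "1 + A * z \<noteq> 0" "\<tau> z = (\<alpha> * z + b) / (1 + A * z)" using \<tau>[OF z] by (auto simp: A_def)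
    have "(\<alpha> * z + b) - w * (1 + A * z) = (\<alpha> - w * A) * (z - w)" using w by algebra
    moreover have "\<alpha> - w * A = \<alpha> * (1 - w * cnj b)" by (simp add: A_def algebra_simps)
    ultimately have "(\<alpha> * z + b) - w * (1 + A * z) = \<alpha> * (1 - w * cnj b) * (z - w)" by simp
    thus ?thesis using d by (simp add: field_simps)
  qed
  have tau1: "norm (\<tau> z) < 1" if "norm z < 1" for z using t that by blast
  show ?thesis
  proof (cases "z1 = z2")
    case False
    define q where "q = csqrt (z1 * z2)"
    have q2: "q * q = z1 * z2" by (simp add: q_def flip: power2_eq_square)
    have nq: "norm q = 1"
    proof -
      have "norm q * norm q = 1" using arg_cong[OF q2, of norm] n1 n2 by (simp add: norm_mult)
      thus ?thesis by (simp add: power2_eq_1_iff flip: power2_eq_square) (use norm_ge_zero[of q] in linarith)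
    qed
    have c1: "z1 * cnj z1 = 1" and c2: "z2 * cnj z2 = 1" and cq: "q * cnj q = 1"
      using n1 n2 nq by (simp_all flip: complex_norm_square)
    \<comment> \<open>The unimodular factor \<open>u\<close> turns the image of the unit circle into
      the real axis, and the sign \<open>e\<close> selects the upper half-plane as the image of the
      disc.\<close>
    define u0 where "u0 = q * cnj z1"
    have im0: "Im u0 \<noteq> 0"
    proof
      assume "Im u0 = 0"
      hence "u0 = cnj u0" by (simp add: complex_eq_iff)
      hence "q * cnj z1 = cnj q * z1" by (simp add: u0_def)
      hence "q * q = z1 * z1" using c1 cq by algebra
      hence "z1 * z2 = z1 * z1" using q2 by simp
      thus False using False n1 by auto
    qed
    define e :: complex where "e = (if Im u0 < 0 then 1 else -1)"
    define u where "u = e * u0"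
    have imu: "Im u < 0" using im0 by (auto simp: u_def e_def)
    have e2: "cnj e = e" "e * e = 1" by (auto simp: e_def)
    have "u * z1 = e * q * (z1 * cnj z1)" by (simp add: u_def u0_def)
    hence uz1: "u * z1 = e * q" using c1 by simp
    have uz2: "u * cnj z2 = cnj (e * q)"
    proof -
      have "q * cnj z1 * cnj z2 = cnj q"
      proof -
        have "cnj q * cnj q = cnj z1 * cnj z2" using arg_cong[OF q2, of cnj] by simp
        thus ?thesis using cq by algebra
      qed
      thus ?thesis by (simp add: u_def u0_def e2 mult.assoc)
    qed
    have uz12: "u * z1 * cnj z2 = cnj u"
    proof -
      have "q * cnj z2 = cnj q * z1" using q2 c2 cq by algebra
      thus ?thesis by (simp only: uz1) (simp add: u_def u0_def e2 mult.assoc)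
    qed
    have u0': "u \<noteq> 0" using imu by auto
    define N where "N = (\<lambda>z. u * (z - z1) / (z - z2))"
    have ImN: "Im (N z) = - Im u * (1 - (norm z)\<^sup>2) / (norm (z - z2))\<^sup>2" if "z \<noteq> z2" for z
    proof -
      have "N z = u * (z - z1) * cnj (z - z2) / (norm (z - z2))\<^sup>2"
        using that by (simp add: N_def complex_div_cnj[of _ "z - z2"])
      moreover have "u * (z - z1) * cnj (z - z2) =
          (u * of_real ((norm z)\<^sup>2) + cnj u) - (cnj (e * q) * z + (e * q) * cnj z)"
        unfolding complex_norm_square using uz1 uz2 uz12 by (simp add: algebra_simps)
      moreover have "Im (cnj (e * q) * z + (e * q) * cnj z) = 0" by (simp add: algebra_simps)
      ultimately have "Im (N z) = Im (u * of_real ((norm z)\<^sup>2) + cnj u) / (norm (z - z2))\<^sup>2"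
        by (metis (no_types, lifting) Im_divide_of_real diff_zero minus_complex.simps(2))
      thus ?thesis by (simp add: algebra_simps)
    qed
    define Ni where "Ni = (\<lambda>h. (u * z1 - h * z2) / (u - h))"
    have hu: "u - h \<noteq> 0" if "Im h > 0" for h using imu that by auto
    have zne: "z \<noteq> z2" if "norm z < 1" for z using that n2 by auto
    have Npos: "Im (N z) > 0" if "norm z < 1" for z
    proof -
      have "(norm z)\<^sup>2 < 1" using that by (simp add: power_less_one_iff abs_square_less_1)
      thus ?thesis using ImN[OF zne[OF that]] imu zne[OF that] by (simp add: divide_neg_pos mult_neg_pos)
    qed
    have NiN: "Ni (N z) = z" if "norm z < 1" for z
    proof -
      have d: "z - z2 \<noteq> 0" using zne[OF that] by simp
      have "u - N z = u * (z1 - z2) / (z - z2)" using d by (simp add: N_def field_simps)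
      moreover have "u * z1 - N z * z2 = u * (z1 - z2) * z / (z - z2)"
        using d by (simp add: N_def field_simps)
      ultimately show ?thesis using d False u0' by (simp add: Ni_def)
    qed
    have NNi: "N (Ni h) = h" and Ninorm: "norm (Ni h) < 1" if h: "Im h > 0" for h
    proof -
      have d: "u - h \<noteq> 0" by (rule hu[OF h])
      have 1: "Ni h - z1 = h * (z1 - z2) / (u - h)" "Ni h - z2 = u * (z1 - z2) / (u - h)"
        using d by (simp_all add: Ni_def field_simps)
      show NN: "N (Ni h) = h" unfolding N_def 1 using d False u0' by simp
      have ne: "Ni h \<noteq> z2" using 1(2) d False u0' by auto
      have "- Im u * (1 - (norm (Ni h))\<^sup>2) / (norm (Ni h - z2))\<^sup>2 > 0"
        using ImN[OF ne] h NN by simp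
      moreover have "- Im u * (1 - (norm (Ni h))\<^sup>2) / (norm (Ni h - z2))\<^sup>2 \<le> 0" if "1 - (norm (Ni h))\<^sup>2 \<le> 0"
        using that imu ne by (intro divide_nonpos_pos mult_nonneg_nonpos) auto
      ultimately have "1 - (norm (Ni h))\<^sup>2 > 0" by fastforce
      thus "norm (Ni h) < 1" by (simp add: abs_square_less_1)
    qed
    define \<kappa> where "\<kappa> = (1 - z1 * cnj b) / (1 - z2 * cnj b)"
    have Nt: "N (\<tau> z) = \<kappa> * N z" if z: "norm z < 1" for z
    proof -
      have d: "1 + A * z \<noteq> 0" using \<tau>[OF z] by (simp add: A_def)
      have "N (\<tau> z) = u * (\<alpha> * (1 - z1 * cnj b) * (z - z1) / (1 + A * z)) / (\<alpha> * (1 - z2 * cnj b) * (z - z2) / (1 + A * z))"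
        unfolding N_def by (simp only: tz[OF z r1] tz[OF z r2])
      also have "\<dots> = \<kappa> * N z" using d \<alpha>0 ub[OF n2] zne[OF z] by (simp add: \<kappa>_def N_def)
      finally show ?thesis .
    qed
    have "Im (\<kappa> * h) > 0" if h: "Im h > 0" for h
      using Nt[OF Ninorm[OF h]] Npos[OF tau1[OF Ninorm[OF h]]] NNi[OF h] by simp
    note K = real_pos_multiplier[OF this]
    have \<kappa>r: "\<kappa> = of_real (Re \<kappa>)" using K by (simp add: complex_eq_iff)
    have "Re \<kappa> \<noteq> 1"
    proof
      assume "Re \<kappa> = 1"
      hence "N (\<tau> 0) = N 0" using Nt[of 0] \<kappa>r by simp
      hence "\<tau> 0 = 0" using NiN[of 0] NiN[of "\<tau> 0"] tau1[of 0] by simp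
      thus False using nofix[of 0] by simp
    qed
    moreover have "N holomorphic_on ball 0 1" unfolding N_def
      using zne by (intro holomorphic_intros) auto
    moreover have "Ni holomorphic_on {h. Im h > 0}" unfolding Ni_def
      using hu by (intro holomorphic_intros) auto
    ultimately show ?thesis
      using hyp[of N Ni "Re \<kappa>"] K Npos NiN NNi Ninorm Nt \<kappa>r by metis
  next
    case True
    define \<zeta> where "\<zeta> = z1"
    have nz: "norm \<zeta> = 1" using n1 by (simp add: \<zeta>_def)
    have z0: "\<zeta> \<noteq> 0" using nz by auto
    have cz: "\<zeta> * cnj \<zeta> = 1" using nz by (simp flip: complex_norm_square)
    have s2: "2 * A * \<zeta> = -(1-\<alpha>)" using sum True by (simp add: \<zeta>_def algebra_simps)
    define N where "N = (\<lambda>z. - \<zeta> / (z - \<zeta>) - 1/2)"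
    have zne: "z - \<zeta> \<noteq> 0" if "norm z < 1" for z using that nz by auto
    have ReN: "Re (N z) = (1 - (norm z)\<^sup>2) / (2 * (norm (z - \<zeta>))\<^sup>2)" if d: "z - \<zeta> \<noteq> 0" for z
    proof -
      have "N z = - (\<zeta> + z) / (2 * (z - \<zeta>))" using d by (simp add: N_def field_simps)
      also have "\<dots> = - (\<zeta> + z) * cnj (z - \<zeta>) / (2 * of_real ((norm (z - \<zeta>))\<^sup>2))"
        using d unfolding complex_norm_square by simp
      finally have "N z = - (\<zeta> + z) * cnj (z - \<zeta>) / of_real (2 * (norm (z - \<zeta>))\<^sup>2)" by simp
      moreover have "- (\<zeta> + z) * cnj (z - \<zeta>) = 1 - of_real ((norm z)\<^sup>2) - (\<zeta> * cnj z - z * cnj \<zeta>)"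
        unfolding complex_norm_square using cz by (simp add: algebra_simps)
      moreover have "Re (\<zeta> * cnj z - z * cnj \<zeta>) = 0" by (simp add: algebra_simps)
      ultimately show ?thesis by (simp only: Re_divide_of_real minus_complex.simps one_complex.simps Re_complex_of_real) simp
    qed
    define Ni where "Ni = (\<lambda>h. \<zeta> - \<zeta> / (h + 1/2))"
    have hu: "h + 1/2 \<noteq> 0" if "Re h > 0" for h :: complex
    proof
      assume "h + 1/2 = 0"
      hence "Re (h + 1/2) = 0" by simp
      thus False using that by simp
    qed
    have Npos: "Re (N z) > 0" if "norm z < 1" for z
    proof -
      have "(norm z)\<^sup>2 < 1" using that by (simp add: abs_square_less_1)
      thus ?thesis using ReN[OF zne[OF that]] zne[OF that] by (simp add: divide_pos_pos)
    qed
    have NiN: "Ni (N z) = z" if "norm z < 1" for z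
      using zne[OF that] z0 by (simp add: Ni_def N_def field_simps)
    have NNi: "N (Ni h) = h" and Ninorm: "norm (Ni h) < 1" if h: "Re h > 0" for h
    proof -
      have d: "h + 1/2 \<noteq> 0" by (rule hu[OF h])
      have 1: "Ni h - \<zeta> = - \<zeta> / (h + 1/2)" by (simp add: Ni_def)
      have ne: "Ni h - \<zeta> \<noteq> 0" unfolding 1 using d z0 by simp
      show NN: "N (Ni h) = h" unfolding N_def 1 using d z0 by simp
      have "(1 - (norm (Ni h))\<^sup>2) / (2 * (norm (Ni h - \<zeta>))\<^sup>2) > 0" using ReN[OF ne] h NN by simp
      hence "1 - (norm (Ni h))\<^sup>2 > 0" using ne by (simp add: zero_less_divide_iff)
      thus "norm (Ni h) < 1" by (simp add: abs_square_less_1)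
    qed
    define c where "c = - \<zeta> * cnj b / (1 - \<zeta> * cnj b)"
    have Nt: "N (\<tau> z) = N z + c" if z: "norm z < 1" for z
    proof -
      have d: "1 + A * z \<noteq> 0" using \<tau>[OF z] by (simp add: A_def)
      have d2: "z - \<zeta> \<noteq> 0" "1 - \<zeta> * cnj b \<noteq> 0" using zne[OF z] ub[OF nz] by auto
      have "\<tau> z - \<zeta> = \<alpha> * (1 - \<zeta> * cnj b) * (z - \<zeta>) / (1 + A * z)"
        using tz[OF z r1] by (simp add: \<zeta>_def)
      hence "N (\<tau> z) = - \<zeta> * (1 + A * z) / (\<alpha> * (1 - \<zeta> * cnj b) * (z - \<zeta>)) - 1/2"
        by (simp add: N_def)
      moreover have "1 + A * z = \<alpha> * (1 - \<zeta> * cnj b) + A * (z - \<zeta>)"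
        using s2 by (simp add: A_def algebra_simps)
      ultimately have "N (\<tau> z) = - \<zeta> * (\<alpha> * (1 - \<zeta> * cnj b) + A * (z - \<zeta>)) / (\<alpha> * (1 - \<zeta> * cnj b) * (z - \<zeta>)) - 1/2"
        by simp
      also have "\<dots> = (- \<zeta> / (z - \<zeta>) - 1/2) + (- \<zeta> * A / (\<alpha> * (1 - \<zeta> * cnj b)))"
      proof -
        have "- \<zeta> * (P + A * d) / (P * d) - 1/2 = (- \<zeta> / d - 1/2) + (- \<zeta> * A / P)"
          if "P \<noteq> 0" "d \<noteq> 0" for P d :: complex using that by (simp add: field_simps)
        thus ?thesis using d2 \<alpha>0 by simp
      qed
      also have "\<dots> = N z + c" using \<alpha>0 by (simp add: N_def c_def A_def)
      finally show ?thesis .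
    qed
    have sig1: "norm (\<sigma> z) < 1" "\<tau> (\<sigma> z) = z" if "norm z < 1" for z using s that by auto
    \<comment> \<open>Translation by \<open>c\<close> and, through the inverse
      \<open>\<sigma>\<close>, translation by \<open>- c\<close> both preserve the
      half-plane.\<close>
    have "Re c = 0"
    proof (rule ccontr)
      assume cc: "Re c \<noteq> 0"
      define h where "h = (of_real (\<bar>Re c\<bar> / 2) :: complex)"
      have h: "Re h > 0" using cc by (simp add: h_def)
      have 1: "Re (h + c) > 0" using Nt[OF Ninorm[OF h]] Npos[OF tau1[OF Ninorm[OF h]]] NNi[OF h] by simp
      have "N (\<sigma> (Ni h)) + c = h"
        using Nt[OF sig1(1)[OF Ninorm[OF h]]] sig1(2)[OF Ninorm[OF h]] NNi[OF h] by simp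
      moreover have "Re (N (\<sigma> (Ni h))) > 0" by (rule Npos[OF sig1(1)[OF Ninorm[OF h]]])
      ultimately have "Re (h - c) > 0" by (metis add_diff_cancel_right')
      thus False using 1 by (simp add: h_def)
    qed
    moreover have "N holomorphic_on ball 0 1" unfolding N_def
      using zne by (intro holomorphic_intros) auto
    moreover have "Ni holomorphic_on {h. Re h > 0}" unfolding Ni_def
      using hu by (intro holomorphic_intros) auto
    ultimately show ?thesis
      using par[of N Ni c] Npos NiN NNi Ninorm Nt by metis
  qed
qed

section \<open>A lower bound for the modulus of a nearly round annulus\<close>

lemma deriv_bound_exp:
  assumes "E holomorphic_on ball w \<rho>" "\<rho> > 0" "norm c = 1"
    and "\<And>x. x \<in> ball w \<rho> \<Longrightarrow> Re (c * E x) \<in> {lo<..<hi}"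
  shows "norm (deriv E w) \<le> 2 * exp (hi - lo) / \<rho>"
proof -
  \<comment> \<open>Exponentiating turns a bound on one real coordinate into a bound on a modulus,
    to which Cauchy applies; a crude form of the hyperbolic metric of a strip.\<close>
  let ?e = "\<lambda>x. exp (c * E x)"
  have "norm (deriv ?e w) \<le> exp hi / (\<rho>/2)"
  proof (rule deriv_norm_bound)
    show "?e holomorphic_on ball w \<rho>" by (intro holomorphic_intros assms)
    show "norm (?e x) \<le> exp hi" if "x \<in> ball w \<rho>" for x using assms(4)[OF that] by simp
  qed (use assms in auto)
  moreover have "deriv ?e w = exp (c * E w) * (c * deriv E w)"
  proof (rule DERIV_imp_deriv)
    have "(E has_field_derivative deriv E w) (at w)"
      using assms by (intro holomorphic_derivI[of _ "ball w \<rho>"]) auto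
    thus "(?e has_field_derivative exp (c * E w) * (c * deriv E w)) (at w)"
      by (auto intro!: derivative_eq_intros)
  qed
  ultimately have "exp (Re (c * E w)) * norm (deriv E w) \<le> exp hi / (\<rho>/2)"
    using assms(3) by (simp add: norm_mult)
  moreover have "exp lo * norm (deriv E w) \<le> exp (Re (c * E w)) * norm (deriv E w)"
    using assms(2) assms(4)[of w] by (intro mult_right_mono) auto
  ultimately have "exp lo * norm (deriv E w) \<le> exp hi / (\<rho>/2)" by linarith
  thus ?thesis using assms(2) by (simp add: exp_diff field_simps)
qed

text \<open>The logarithmic preimage \<open>S\<close> of the annulus is contractible because
  \<open>C\<close> is star-shaped about 0, and the deck map \<open>w + 2 pi i\<close> becomes an
  automorphism of the disc without fixed points. It turns out to be hyperbolic; its translation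
  length \<open>l\<close> gives a round annulus of modulus \<open>pi / |l|\<close>, and the part of
  the annulus between the radii \<open>r1\<close> and \<open>R\<close> bounds \<open>l\<close> from
  above.\<close>

lemma annulus_mod_ge:
  fixes C :: "complex set"
  assumes r: "0 < r0" "r0 \<le> r1" "r1 < R" and C: "closed C" "ball 0 r0 \<subseteq> C" "C \<subseteq> ball 0 r1"
    and star: "\<And>z s. z \<notin> C \<Longrightarrow> s \<ge> 1 \<Longrightarrow> of_real s * z \<notin> C"
  shows "annulus_mod (ball 0 R - C) \<ge> ereal (ln (R / r1) / (8 * exp pi))"
proof -
  define S where "S = {w. exp w \<in> ball 0 R - C}"
  define x0 where "x0 = (ln r1 + ln R) / 2"
  define \<rho> where "\<rho> = (ln R - ln r1) / 2"
  have rp: "r1 > 0" "R > 0" "ln r1 < ln R" using r by auto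
  have x0: "ln r1 < x0" "x0 < ln R" using rp by (auto simp: x0_def)
  have \<rho>: "\<rho> > 0" using rp by (simp add: \<rho>_def)
  have S_iff: "w \<in> S \<longleftrightarrow> Re w < ln R \<and> exp w \<notin> C" for w
  proof -
    have "exp (Re w) < R \<longleftrightarrow> Re w < ln R" using rp exp_less_cancel_iff[of "Re w" "ln R"] by simp
    thus ?thesis by (simp add: S_def)
  qed
  have inS: "w \<in> S" if "ln r1 \<le> Re w" "Re w < ln R" for w
  proof -
    have "norm (exp w) \<ge> r1" using that(1) rp exp_le_cancel_iff[of "ln r1" "Re w"] by simp
    thus ?thesis using that C(3) by (auto simp: S_iff)
  qed
  have right: "u \<in> S" if "w \<in> S" "Im u = Im w" "Re w \<le> Re u" "Re u < ln R" for w u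
  proof -
    have "exp u = of_real (exp (Re u - Re w)) * exp w"
      using that(2) by (simp add: exp_eq_polar[of u] exp_eq_polar[of w] exp_diff)
    thus ?thesis using star[of "exp w" "exp (Re u - Re w)"] that by (simp add: S_iff)
  qed
  have ReS: "Re w > ln r0 - 1" if "w \<in> S" for w
  proof (rule ccontr)
    assume "\<not> ?thesis"
    hence "exp (Re w) < exp (ln r0)" by simp
    hence "exp (Re w) < r0" using r by simp
    thus False using that C(2) by (auto simp: S_iff subset_iff)
  qed
  have openS: "open S"
  proof -
    have "S = exp -` (ball 0 R - C)" by (auto simp: S_def)
    thus ?thesis using C(1) by (auto intro!: open_vimage open_Diff continuous_intros)
  qed
  \<comment> \<open>Contract horizontally onto the line \<open>Re w = x0\<close>, then along this
    line to a point.\<close>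
  define pr where "pr = (\<lambda>w. Complex x0 (Im w))"
  have prS: "pr w \<in> S" for w using x0 by (intro inS) (auto simp: pr_def)
  have "contractible S"
  proof -
    have pc: "continuous_on S pr"
      unfolding pr_def Complex_eq by (intro continuous_intros)
    have 1: "homotopic_with_canon (\<lambda>x. True) S S id pr"
    proof (rule homotopic_with_linear)
      fix w assume w: "w \<in> S"
      show "closed_segment (id w) (pr w) \<subseteq> S"
      proof
        fix u assume "u \<in> closed_segment (id w) (pr w)"
        then obtain s where s: "0 \<le> s" "s \<le> 1" "u = (1 - s) *\<^sub>R w + s *\<^sub>R pr w"
          by (auto simp: closed_segment_def)
        have im: "Im u = Im w" unfolding s(3) by (simp add: pr_def algebra_simps)
        have re: "Re u = Re w + s * (x0 - Re w)" unfolding s(3) by (simp add: pr_def algebra_simps)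
        have wR: "Re w < ln R" using w by (simp add: S_iff)
        show "u \<in> S"
        proof (cases "Re w \<le> x0")
          case True
          hence "0 \<le> s * (x0 - Re w)" "s * (x0 - Re w) \<le> x0 - Re w"
            using s by (auto simp: mult_left_le_one_le)
          thus ?thesis using right[OF w im] re x0 by simp
        next
          case False
          hence "s * (Re w - x0) \<ge> 0" "s * (Re w - x0) \<le> Re w - x0"
            using s by (auto simp: mult_left_le_one_le)
          hence "Re u \<ge> x0" "Re u \<le> Re w" using re by (auto simp: algebra_simps)
          thus ?thesis using x0 wR by (intro inS) auto
        qed
      qed
    qed (use pc in \<open>auto simp: id_def\<close>)
    have 2: "homotopic_with_canon (\<lambda>x. True) S S pr (\<lambda>w. pr 0)"
    proof (rule homotopic_with_linear)
      fix w assume "w \<in> S"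
      show "closed_segment (pr w) (pr 0) \<subseteq> S"
      proof
        fix u assume "u \<in> closed_segment (pr w) (pr 0)"
        then obtain s where s: "u = (1 - s) *\<^sub>R pr w + s *\<^sub>R pr 0"
          by (auto simp: closed_segment_def)
        have "Re u = x0" unfolding s by (simp add: pr_def algebra_simps)
        thus "u \<in> S" using x0 by (intro inS) auto
      qed
    qed (use pc in auto)
    from homotopic_with_trans[OF 1 2] show ?thesis
      unfolding contractible_def by blast
  qed
  hence sc: "simply_connected S" by (rule contractible_imp_simply_connected)
  have Sne: "S \<noteq> {}" using prS by blast
  have SU: "S \<noteq> UNIV"
  proof
    assume "S = UNIV"
    hence "of_real (ln R) \<in> S" by simp
    thus False by (simp add: S_iff)
  qed
  obtain f g where fg: "f holomorphic_on S" "g holomorphic_on ball 0 1"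
     and f: "\<And>z. z \<in> S \<Longrightarrow> f z \<in> ball 0 1 \<and> g (f z) = z"
     and g: "\<And>z. z \<in> ball 0 1 \<Longrightarrow> g z \<in> S \<and> f (g z) = z"
    using simply_connected_eq_biholomorphic_to_disc[OF openS] sc Sne SU by metis
  let ?T = "2 * of_real pi * \<i> :: complex"
  have eT: "exp (w + ?T) = exp w" "exp (w - ?T) = exp w" for w
    by (auto simp: exp_add exp_diff exp_two_pi_i)
  have TS: "w + ?T \<in> S" "w - ?T \<in> S" if "w \<in> S" for w using that by (auto simp: S_def eT)
  define \<tau> where "\<tau> = (\<lambda>z. f (g z + ?T))"
  define \<sigma> where "\<sigma> = (\<lambda>z. f (g z - ?T))"
  have t: "norm (\<tau> z) < 1 \<and> \<sigma> (\<tau> z) = z" if "norm z < 1" for z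
  proof -
    have 1: "g z \<in> S" "f (g z) = z" using g[of z] that by auto
    have 2: "f (g z + ?T) \<in> ball 0 1" "g (f (g z + ?T)) = g z + ?T" using f[OF TS(1)[OF 1(1)]] by auto
    show ?thesis using 1 2 by (simp add: \<tau>_def \<sigma>_def)
  qed
  have s: "norm (\<sigma> z) < 1 \<and> \<tau> (\<sigma> z) = z" if "norm z < 1" for z
  proof -
    have 1: "g z \<in> S" "f (g z) = z" using g[of z] that by auto
    have 2: "f (g z - ?T) \<in> ball 0 1" "g (f (g z - ?T)) = g z - ?T" using f[OF TS(2)[OF 1(1)]] by auto
    show ?thesis using 1 2 by (simp add: \<tau>_def \<sigma>_def)
  qed
  have holt: "\<tau> holomorphic_on ball 0 1" "\<sigma> holomorphic_on ball 0 1"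
    unfolding \<tau>_def \<sigma>_def
    by (rule holomorphic_on_compose_gen[OF _ fg(1), unfolded o_def]; use fg g TS in \<open>auto intro!: holomorphic_intros\<close>)+
  have nofix: "\<tau> z \<noteq> z" if "norm z < 1" for z
  proof
    assume "\<tau> z = z"
    moreover have "g (\<tau> z) = g z + ?T" using f[OF TS(1)] g[of z] that by (simp add: \<tau>_def)
    ultimately show False by simp
  qed
  show ?thesis
    using holt t s nofix
  proof (rule disc_automorphism_cases)
    fix N Ni :: "complex \<Rightarrow> complex" and c :: complex
    assume N: "N holomorphic_on ball 0 1" "Ni holomorphic_on {h. Re h > 0}"
      "\<And>z. norm z < 1 \<Longrightarrow> Re (N z) > 0 \<and> Ni (N z) = z"
      "\<And>h. Re h > 0 \<Longrightarrow> norm (Ni h) < 1 \<and> N (Ni h) = h"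
      "Re c = 0" "\<And>z. norm z < 1 \<Longrightarrow> N (\<tau> z) = N z + c"
    \<comment> \<open>The parabolic case is impossible. Real parts on \<open>S\<close> are bounded
      on both sides, because \<open>C\<close> contains \<open>ball 0 r0\<close>, so the derivative
      of \<open>E\<close> decays like \<open>1 / Re h\<close>; yet translation by the fixed
      \<open>c\<close> must move \<open>E\<close> by \<open>2 pi i\<close> however far out.\<close>
    define E where "E = (\<lambda>h. g (Ni h))"
    have hE: "E holomorphic_on {h. Re h > 0}" unfolding E_def
      by (rule holomorphic_on_compose_gen[OF N(2) fg(2), unfolded o_def]) (use N(4) in auto)
    have ES: "E h \<in> S" if "Re h > 0" for h using g N(4)[OF that] by (auto simp: E_def)
    have Et: "E (h + c) = E h + ?T" if h: "Re h > 0" for h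
    proof -
      have n: "norm (Ni h) < 1" "N (Ni h) = h" using N(4)[OF h] by auto
      have "N (\<tau> (Ni h)) = h + c" using N(6)[OF n(1)] n(2) by simp
      hence "Ni (h + c) = \<tau> (Ni h)" using N(3)[of "\<tau> (Ni h)"] t[OF n(1)] by metis
      moreover have "g (\<tau> (Ni h)) = g (Ni h) + ?T"
        using f[OF TS(1)] g[of "Ni h"] n by (simp add: \<tau>_def)
      ultimately show ?thesis by (simp add: E_def)
    qed
    define K where "K = 2 * exp (ln R - (ln r0 - 1))"
    have dE: "norm (deriv E h) \<le> K / Re h" if h: "Re h > 0" for h
      unfolding K_def
    proof (rule deriv_bound_exp[where c=1])
      have sub: "ball h (Re h) \<subseteq> {h. Re h > 0}"
      proof
        fix y assume "y \<in> ball h (Re h)"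
        hence "norm (h - y) < Re h" by (simp add: dist_norm)
        thus "y \<in> {h. Re h > 0}" using complex_Re_le_cmod[of "h - y"] by simp
      qed
      show "E holomorphic_on ball h (Re h)" using hE sub by (rule holomorphic_on_subset)
      show "Re (1 * E x) \<in> {ln r0 - 1<..<ln R}" if "x \<in> ball h (Re h)" for x
        using ES[of x] sub that ReS[of "E x"] by (auto simp: S_iff)
    qed (use h in auto)
    define X where "X = K * norm c + 1"
    have Kp: "K > 0" by (simp add: K_def)
    hence X: "X > 0" "X > K * norm c" by (auto simp: X_def add_nonneg_pos)
    let ?L = "closed_segment (of_real X) (of_real X + c)"
    have ReL: "Re h = X" if "h \<in> ?L" for h
      using that N(5) by (auto simp: closed_segment_def algebra_simps)
    have "norm (E (of_real X + c) - E (of_real X)) \<le> (K / X) * norm ((of_real X + c) - of_real X)"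
    proof (rule field_differentiable_bound[where S = ?L])
      fix h assume h: "h \<in> ?L"
      have "(E has_field_derivative deriv E h) (at h)"
        by (rule holomorphic_derivI[OF hE]) (use ReL[OF h] X in \<open>auto simp: open_halfspace_Re_gt\<close>)
      thus "(E has_field_derivative deriv E h) (at h within ?L)" by (rule has_field_derivative_at_within)
      show "norm (deriv E h) \<le> K / X" using dE[of h] ReL[OF h] X by simp
    qed auto
    hence "2 * pi \<le> (K / X) * norm c" using Et[of "of_real X"] X by (simp add: norm_mult)
    moreover have "(K / X) * norm c < 1" using X by (simp add: field_simps)
    ultimately show ?thesis using pi_gt3 by simp
  next
    fix N Ni :: "complex \<Rightarrow> complex" and \<kappa> :: real
    assume N: "N holomorphic_on ball 0 1" "Ni holomorphic_on {h. Im h > 0}"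
      "\<And>z. norm z < 1 \<Longrightarrow> Im (N z) > 0 \<and> Ni (N z) = z"
      "\<And>h. Im h > 0 \<Longrightarrow> norm (Ni h) < 1 \<and> N (Ni h) = h"
      "\<kappa> > 0" "\<kappa> \<noteq> 1" "\<And>z. norm z < 1 \<Longrightarrow> N (\<tau> z) = of_real \<kappa> * N z"
    \<comment> \<open>Hyperbolic case: in the coordinate \<open>F\<close>, which maps
      \<open>S\<close> onto the strip \<open>0 < Im q < pi\<close>, the deck map is translation by
      the real number \<open>l\<close>.\<close>
    define l where "l = ln \<kappa>"
    have l0: "l \<noteq> 0" using N(5,6) by (simp add: l_def)
    define F where "F = (\<lambda>w. Ln (N (f w)))"
    have Nf: "Im (N (f w)) > 0" if "w \<in> S" for w using f[OF that] N(3) by auto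
    have holF: "F holomorphic_on S" unfolding F_def
    proof (rule holomorphic_on_Ln')
      show "(\<lambda>w. N (f w)) holomorphic_on S"
        by (rule holomorphic_on_compose_gen[OF fg(1) N(1), unfolded o_def]) (use f in auto)
      fix w assume "w \<in> S"
      thus "N (f w) \<notin> \<real>\<^sub>\<le>\<^sub>0" using Nf[of w] by (auto simp: complex_nonpos_Reals_iff)
    qed
    have ImF: "0 < Im (F w)" "Im (F w) < pi" if "w \<in> S" for w
    proof -
      have "N (f w) \<noteq> 0" using Nf[OF that] by force
      thus "0 < Im (F w)" "Im (F w) < pi"
        using Nf[OF that] Im_Ln_pos_lt[of "N (f w)"] by (auto simp: F_def)
    qed
    have FT: "F (w + ?T) = F w + of_real l" if w: "w \<in> S" for w
    proof -
      have "f (w + ?T) = \<tau> (f w)" using f[OF w] by (simp add: \<tau>_def)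
      hence "N (f (w + ?T)) = of_real \<kappa> * N (f w)" using N(7) f[OF w] by simp
      moreover have "N (f w) \<noteq> 0" using Nf[OF w] by auto
      ultimately show ?thesis using N(5)
        by (simp add: F_def l_def Ln_times_of_real Ln_of_real)
    qed
    have FTn: "F (w + of_nat n * ?T) = F w + of_nat n * of_real l \<and> w + of_nat n * ?T \<in> S" if w: "w \<in> S" for w n
    proof (induction n)
      case (Suc n)
      have e: "w + of_nat (Suc n) * ?T = (w + of_nat n * ?T) + ?T" by (simp add: algebra_simps)
      have m: "w + of_nat n * ?T \<in> S" using Suc by blast
      show ?case unfolding e using FT[OF m] TS(1)[OF m] Suc by (simp add: distrib_right)
    qed (use w in simp)
    have FTi: "F (w + of_int n * ?T) = F w + of_int n * of_real l \<and> w + of_int n * ?T \<in> S" if w: "w \<in> S" for w n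
    proof (cases "n \<ge> 0")
      case True thus ?thesis using FTn[OF w, of "nat n"] by simp
    next
      case False
      define k where "k = nat (-n)"
      have nk: "of_int n = - (of_nat k :: complex)" using False by (simp add: k_def)
      define w' where "w' = w + of_int n * ?T"
      have "exp w' = exp w" unfolding exp_eq w'_def by (intro exI[of _ n]) (simp add: algebra_simps)
      hence "w' \<in> S" using w by (simp only: S_def mem_Collect_eq)
      from FTn[OF this, of k] show ?thesis using \<open>w' \<in> S\<close> by (simp add: w'_def nk algebra_simps)
    qed
    have Finj: "w = w'" if "w \<in> S" "w' \<in> S" "F w = F w'" for w w'
    proof -
      have "N (f w) \<noteq> 0" "N (f w') \<noteq> 0" using Nf that by force+
      hence "N (f w) = N (f w')" using that(3) by (metis F_def exp_Ln)
      thus ?thesis using N(3) f that by (metis mem_ball_0)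
    qed
    have Fsurj: "\<exists>w\<in>S. F w = q" if q: "0 < Im q" "Im q < pi" for q
    proof -
      have "Im (exp q) > 0" using q by (simp add: Im_exp sin_gt_zero)
      hence n: "norm (Ni (exp q)) < 1" "N (Ni (exp q)) = exp q" using N(4) by auto
      have "g (Ni (exp q)) \<in> S" "f (g (Ni (exp q))) = Ni (exp q)" using g n by auto
      moreover have "Ln (exp q) = q" using q by (simp add: Ln_exp)
      ultimately show ?thesis using n by (intro bexI[of _ "g (Ni (exp q))"]) (auto simp: F_def)
    qed
    \<comment> \<open>Integrate the derivative of \<open>F\<close> over one period of the line
      \<open>Re w = x0\<close>, around each point of which a disc of radius \<open>\<rho>\<close>
      fits into \<open>S\<close>.\<close>
    have lb: "\<bar>l\<bar> \<le> 2 * pi * (2 * exp pi / \<rho>)"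
    proof -
      let ?L = "closed_segment (of_real x0) (of_real x0 + ?T)"
      have ReL: "Re w = x0" if "w \<in> ?L" for w
        using that by (auto simp: closed_segment_def algebra_simps)
      have bS: "ball w \<rho> \<subseteq> S" if "w \<in> ?L" for w
      proof
        fix y assume "y \<in> ball w \<rho>"
        hence "norm (w - y) < \<rho>" by (simp add: dist_norm)
        hence "\<bar>Re w - Re y\<bar> < \<rho>" using abs_Re_le_cmod[of "w - y"] by simp
        thus "y \<in> S" using ReL[OF that] by (intro inS) (auto simp: x0_def \<rho>_def abs_less_iff field_simps)
      qed
      have "norm (F (of_real x0 + ?T) - F (of_real x0)) \<le> (2 * exp (pi - 0) / \<rho>) * norm ((of_real x0 + ?T) - of_real x0)"
      proof (rule field_differentiable_bound[where S = ?L])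
        fix w assume w: "w \<in> ?L"
        have wS: "w \<in> S" using bS[OF w] \<rho> by auto
        have "(F has_field_derivative deriv F w) (at w)"
          by (rule holomorphic_derivI[OF holF openS wS])
        thus "(F has_field_derivative deriv F w) (at w within ?L)" by (rule has_field_derivative_at_within)
        show "norm (deriv F w) \<le> 2 * exp (pi - 0) / \<rho>"
        proof (rule deriv_bound_exp[where c="-\<i>"])
          show "F holomorphic_on ball w \<rho>" using holF bS[OF w] by (rule holomorphic_on_subset)
          show "Re (- \<i> * F x) \<in> {0<..<pi}" if "x \<in> ball w \<rho>" for x
            using ImF[of x] bS[OF w] that by auto
        qed (use \<rho> in auto)
      qed auto
      moreover have "of_real x0 \<in> S" using x0 by (intro inS) auto
      ultimately show ?thesis using FT[of "of_real x0"] by (simp add: norm_mult mult.commute)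
    qed
    \<comment> \<open>With this scale one period of the strip becomes a full turn of the
      exponential, so \<open>H\<close> descends to the annulus.\<close>
    define k where "k = 2 * pi / \<bar>l\<bar>"
    have k0: "k > 0" using l0 by (simp add: k_def)
    define H where "H = (\<lambda>w. exp (- \<i> * of_real k * F w))"
    have HTi: "H (w + of_int n * ?T) = H w" if w: "w \<in> S" for w n
    proof -
      have "- \<i> * of_real k * (F w + of_int n * of_real l) =
           - \<i> * of_real k * F w + of_int (2 * (if l > 0 then - n else n)) * of_real pi * \<i>"
        using l0 by (cases "l > 0") (auto simp: k_def field_simps)
      moreover have "F (w + of_int n * ?T) = F w + of_int n * of_real l" using FTi[OF w] by blast
      ultimately show ?thesis unfolding H_def exp_eq by (intro exI) simp
    qed
    have HE: "H w = H w'" if wS: "w \<in> S" and ww: "exp w = exp w'" for w w'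
    proof -
      obtain n :: int where "w' = w + of_int n * ?T"
        using ww exp_eq[of w' w] by (auto simp: algebra_simps)
      thus ?thesis using HTi[OF wS] by simp
    qed
    let ?A = "ball 0 R - C"
    define Rr where "Rr = exp (k * pi)"
    have Rr: "Rr > 1" using k0 by (simp add: Rr_def)
    define h where "h = (\<lambda>z. H (Ln z))"
    have "0 \<in> C" using C(2) r(1) by (meson centre_in_ball subsetD)
    hence A0: "z \<noteq> 0" if "z \<in> ?A" for z using that by auto
    have LnS: "Ln z \<in> S" if "z \<in> ?A" for z using that A0 by (simp add: S_def)
    have hH: "h (exp w) = H w" if "w \<in> S" for w
    proof -
      have "exp w \<in> ?A" using that by (simp add: S_def)
      hence "Ln (exp w) \<in> S" by (rule LnS)
      thus ?thesis unfolding h_def by (rule HE) simp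
    qed
    have holH: "H holomorphic_on S" unfolding H_def by (intro holomorphic_intros holF)
    \<comment> \<open>\<open>Ln\<close> jumps along the negative axis. There
      \<open>Ln (- z) + pi i\<close> is another logarithm, and \<open>H\<close> does not see the
      difference.\<close>
    have hol: "h holomorphic_on ?A"
    proof -
      let ?A1 = "?A - \<real>\<^sub>\<le>\<^sub>0" and ?A2 = "?A \<inter> uminus -` (- \<real>\<^sub>\<le>\<^sub>0)"
      have oA: "open ?A" using C(1) by auto
      have o1: "open ?A1" by (rule open_Diff[OF oA closed_nonpos_Reals_complex])
      have o2: "open ?A2" by (rule open_Int[OF oA open_vimage]) (auto intro!: continuous_intros simp: closed_nonpos_Reals_complex)
      have h1: "h holomorphic_on ?A1" unfolding h_def
        by (rule holomorphic_on_compose_gen[OF _ holH, unfolded o_def])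
           (use LnS in \<open>auto intro!: holomorphic_intros\<close>)
      have h2: "h holomorphic_on ?A2"
      proof (rule holomorphic_transform)
        let ?m = "\<lambda>z. Ln (- z) + of_real pi * \<i>"
        have em: "exp (?m z) = z" if "z \<in> ?A2" for z
          using that A0[of z] by (simp add: exp_add)
        have mS: "?m z \<in> S" if "z \<in> ?A2" for z using em[OF that] that by (simp only: S_def mem_Collect_eq) simp
        show "(\<lambda>z. H (?m z)) holomorphic_on ?A2"
          by (rule holomorphic_on_compose_gen[OF _ holH, unfolded o_def])
             (use mS in \<open>auto intro!: holomorphic_intros\<close>)
        fix z assume z: "z \<in> ?A2"
        show "H (?m z) = h z" using hH[OF mS[OF z]] em[OF z] by simp
      qed
      have "?A \<subseteq> ?A1 \<union> ?A2"
        using A0 by (auto simp: complex_nonpos_Reals_iff complex_eq_iff)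
      hence "?A = ?A1 \<union> ?A2" by auto
      thus ?thesis using holomorphic_on_Un[OF h1 h2 o1 o2] by simp
    qed
    have nH: "norm (H w) = exp (k * Im (F w))" for w by (simp add: H_def)
    have bij: "bij_betw h ?A {z. 1 < norm z \<and> norm z < Rr}"
      unfolding bij_betw_def
    proof
      show "inj_on h ?A"
      proof (rule inj_onI)
        fix z z' assume z: "z \<in> ?A" "z' \<in> ?A" and "h z = h z'"
        hence e: "H (Ln z) = H (Ln z')" by (simp add: h_def)
        then obtain n :: int where n: "- \<i> * of_real k * F (Ln z) = - \<i> * of_real k * F (Ln z') + of_int (2 * n) * (of_real pi * \<i>)"
          unfolding H_def exp_eq by auto
        have "- \<i> * of_real k * (F (Ln z) - F (Ln z') + of_int n * of_real \<bar>l\<bar>) = 0"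
        proof -
          have "of_real k * of_real \<bar>l\<bar> = (2 * of_real pi :: complex)"
            unfolding of_real_mult[symmetric] using l0 by (simp add: k_def)
          thus ?thesis using n by (simp add: algebra_simps)
        qed
        moreover have "- \<i> * of_real k \<noteq> 0" using k0 by simp
        ultimately have "F (Ln z) - F (Ln z') + of_int n * of_real \<bar>l\<bar> = 0" by (metis mult_eq_0_iff)
        hence "F (Ln z) = F (Ln z') - of_int n * of_real \<bar>l\<bar>" by algebra
        also have "\<dots> = F (Ln z') + of_int (if l > 0 then -n else n) * of_real l"
          by (cases "l > 0") auto
        also have "\<dots> = F (Ln z' + of_int (if l > 0 then -n else n) * ?T)"
          using FTi[OF LnS[OF z(2)]] by simp
        finally have "Ln z = Ln z' + of_int (if l > 0 then -n else n) * ?T"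
          using Finj LnS z FTi by blast
        hence "exp (Ln z) = exp (Ln z' + of_int (if l > 0 then -n else n) * ?T)" by simp
        also have "\<dots> = exp (Ln z')" unfolding exp_eq by (auto simp: algebra_simps)
        finally show "z = z'" using A0 z by simp
      qed
      show "h ` ?A = {z. 1 < norm z \<and> norm z < Rr}"
      proof (intro equalityI subsetI)
        fix y assume "y \<in> h ` ?A"
        then obtain z where z: "z \<in> ?A" "y = H (Ln z)" by (auto simp: h_def)
        show "y \<in> {z. 1 < norm z \<and> norm z < Rr}"
          using ImF[OF LnS[OF z(1)]] k0 by (simp add: z(2) nH Rr_def)
      next
        fix y :: complex assume y: "y \<in> {z. 1 < norm z \<and> norm z < Rr}"
        hence y0: "y \<noteq> 0" by auto
        define q where "q = \<i> * Ln y / of_real k"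
        have "Im q = ln (norm y) / k" using y0 by (simp add: q_def)
        moreover have "0 < ln (norm y)" using y by (intro ln_gt_zero) auto
        moreover have "ln (norm y) < ln Rr" using y y0 Rr by simp
        moreover have "ln Rr = k * pi" by (simp add: Rr_def)
        ultimately have "0 < Im q" "Im q < pi" using k0 by (simp_all add: divide_less_eq mult.commute)
        then obtain w where w: "w \<in> S" "F w = q" using Fsurj by blast
        have "H w = exp (Ln y)" unfolding H_def w(2) q_def using k0 by simp
        hence "h (exp w) = y" using hH[OF w(1)] y0 by simp
        moreover have "exp w \<in> ?A" using w by (simp add: S_def)
        ultimately show "y \<in> h ` ?A" by blast
      qed
    qed
    have "ereal (ln Rr / (2 * pi)) \<le> annulus_mod ?A"
      unfolding annulus_mod_def by (rule Sup_upper) (use Rr hol bij in blast)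
    moreover have "ln (R / r1) / (8 * exp pi) \<le> ln Rr / (2 * pi)"
    proof -
      have "ln Rr / (2 * pi) = pi / \<bar>l\<bar>" by (simp add: Rr_def k_def)
      moreover have "ln (R/r1) = 2 * \<rho>" using rp by (simp add: \<rho>_def ln_div)
      moreover have "2 * \<rho> / (8 * exp pi) \<le> pi / \<bar>l\<bar>"
      proof -
        have "\<bar>l\<bar> * \<rho> \<le> 2 * pi * (2 * exp pi / \<rho>) * \<rho>" using lb \<rho> by (intro mult_right_mono) auto
        also have "\<dots> = 4 * pi * exp pi" using \<rho> by simp
        finally show ?thesis using l0 by (simp add: field_simps)
      qed
      ultimately show ?thesis by simp
    qed
    ultimately show ?thesis by (metis ereal_less_eq(3) order_trans)
  qed
qed

text \<open>Reduces the exponent 7/4 to integer powers: a bound on a fourth root \<open>q\<close>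
  turns the numerical work into rational arithmetic.\<close>

lemma powr_neg_bound:
  assumes "q > 0" "q ^ 4 \<le> (d::real)"
  shows "d powr (-7/4) \<le> 1 / q ^ 7"
proof -
  have "d powr (-7/4) \<le> (q ^ 4) powr (-7/4)"
    using assms by (intro powr_mono2') auto
  also have "(q ^ 4) powr (-7/4) = (q powr 4) powr (-7/4)"
    using powr_realpow[of q 4] assms(1) by simp
  also have "\<dots> = q powr (-7)" by (simp add: powr_powr)
  also have "\<dots> = 1 / q powr 7" by (rule powr_minus_divide)
  also have "q powr 7 = q ^ 7" using powr_realpow[of q 7] assms(1) by simp
  finally show ?thesis .
qed

lemma sum_le_card_two:
  fixes g :: "complex \<Rightarrow> real"
  assumes "A \<subseteq> {x, - x}" "\<And>z. z \<in> A \<Longrightarrow> g z \<le> b" "b \<ge> 0"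
  shows "sum g A \<le> 2 * b"
proof -
  have "card A \<le> card {x, - x}" using assms(1) by (intro card_mono) auto
  also have "\<dots> \<le> 2" by (simp add: card_insert_if)
  finally have c: "card A \<le> 2" .
  have "sum g A \<le> of_nat (card A) * b" using assms(2) by (intro sum_bounded_above)
  also have "\<dots> \<le> 2 * b" using c assms(3) by (intro mult_right_mono) auto
  finally show ?thesis .
qed

section \<open>A weight contracted by the transfer operator\<close>

context step begin

text \<open>The root of order 36 makes every scale an integer power of \<open>nu\<close>. With
  \<open>rr = nu^20\<close>, the square \<open>rr^2 = |lam| nu^4\<close> is small enough for
  shadowing, \<open>|lam| = rr nu^16\<close> is small against \<open>rr\<close>, and
  \<open>rr^(7/4) = nu^35\<close> still dominates \<open>|lam| = nu^36\<close>.\<close>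

definition nu where "nu = root 36 (norm lam)"
definition rr where "rr = nu ^ 20"
text \<open>The singular weight \<open>1 / |x^2 - beta^2|\<close> imitates
  \<open>1 / |z^2 - 4|\<close> for the map \<open>z^2 - 2\<close>. The cut-off
  \<open>nu^35 = rr^(7/4)\<close> matches, up to a constant, the size of \<open>|f'|^(7/4)\<close>
  at \<open>|x| = rr\<close>, where the approximation of \<open>f x + beta\<close> by
  \<open>x^2\<close> is given up.\<close>

definition bg where "bg x = 1 / max (norm (x\<^sup>2 - beta\<^sup>2)) (nu ^ 35)"
abbreviation f1 where "f1 \<equiv> qm nxt"

lemma nu: "nu ^ 36 = norm lam" "0 < nu" "nu \<le> 1/10^4"
proof -
  show "nu ^ 36 = norm lam" "0 < nu" using lam_pos by (simp_all add: nu_def)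
  have "nu \<le> root 36 ((1/10^4)^36)" unfolding nu_def using lam_small by (intro real_root_le_mono) auto
  also have "\<dots> = 1/10^4" by (rule real_root_power_cancel) auto
  finally show "nu \<le> 1/10^4" .
qed

lemma nu_pow: "k > 0 \<Longrightarrow> nu ^ k \<le> 1/10^4"
  using nu power_decreasing[of 1 k nu] by simp

lemma nu_pow_pos: "nu ^ k > 0" using nu by simp

lemma rr: "0 < rr" "rr \<le> 1/10^4" using nu_pow[of 20] nu_pow_pos[of 20] by (auto simp: rr_def)

lemma rr_lam: "norm lam = rr * nu ^ 16" "rr\<^sup>2 = norm lam * nu ^ 4"
  by (simp_all only: rr_def nu(1)[symmetric]) (simp_all flip: power_add power_mult)

lemma lam_rr: "norm lam * 10^4 \<le> rr"
proof -
  have "rr * nu ^ 16 \<le> rr * (1/10^4)" using nu_pow[of 16] rr by (intro mult_left_mono) auto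
  thus ?thesis unfolding rr_lam(1) by simp
qed

lemma small_inner: "norm x \<le> rr \<Longrightarrow> (norm x)\<^sup>2 \<le> norm lam / 21"
proof -
  assume "norm x \<le> rr"
  hence "(norm x)\<^sup>2 \<le> rr\<^sup>2" by (intro power_mono) auto
  also have "\<dots> \<le> norm lam * (1/21)" unfolding rr_lam(2) using nu_pow[of 4]
    by (intro mult_left_mono) auto
  finally show ?thesis by simp
qed

lemma scaled_sq:
  assumes "norm (lam * \<zeta>) \<le> rr"
  shows "norm lam * norm (\<zeta>\<^sup>2) \<le> nu ^ 4" "norm (\<zeta>\<^sup>2) \<le> 1 / (42 * norm lam)"
proof -
  have "(norm lam * norm \<zeta>)\<^sup>2 \<le> rr\<^sup>2" using assms by (intro power_mono) (auto simp: norm_mult)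
  hence "norm lam * (norm lam * (norm \<zeta>)\<^sup>2) \<le> norm lam * nu ^ 4"
    unfolding rr_lam(2) by (simp add: power_mult_distrib power2_eq_square mult_ac)
  thus 1: "norm lam * norm (\<zeta>\<^sup>2) \<le> nu ^ 4" using lam_pos by (simp add: norm_power)
  have "norm lam * norm (\<zeta>\<^sup>2) \<le> 1/42" using 1 nu_pow[of 4] by simp
  thus "norm (\<zeta>\<^sup>2) \<le> 1 / (42 * norm lam)" using lam_pos by (simp add: field_simps)
qed

lemma nxt0: "norm (nxt 0) \<le> 3"
  using am lam_pos by (simp add: nxt_0 norm_divide field_simps)

lemma f1_close:
  assumes "norm (lam * \<zeta>) \<le> rr"
  shows "norm (f1 \<zeta> - (nxt 0 + \<zeta>\<^sup>2)) \<le> (1/100) * (norm \<zeta>)\<^sup>2"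
proof -
  have "norm (nxt (\<zeta>\<^sup>2) - (nxt 0 + \<zeta>\<^sup>2)) \<le> 600 * norm lam * (norm (\<zeta>\<^sup>2))\<^sup>2"
    by (rule nxt_taylor[OF scaled_sq(2)[OF assms]])
  also have "\<dots> = 600 * (norm lam * norm (\<zeta>\<^sup>2)) * norm (\<zeta>\<^sup>2)" by (simp add: power2_eq_square)
  also have "\<dots> \<le> 600 * nu ^ 4 * norm (\<zeta>\<^sup>2)" using scaled_sq(1)[OF assms] by (intro mult_right_mono) auto
  also have "\<dots> \<le> (1/100) * norm (\<zeta>\<^sup>2)"
  proof (intro mult_right_mono)
    have "nu ^ 4 \<le> (1/10^4)^4" using nu by (intro power_mono) auto
    thus "600 * nu ^ 4 \<le> 1/100" by (simp add: power_divide)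
  qed auto
  finally show ?thesis by (simp add: qm_def norm_power)
qed

lemma nxt_deriv_close:
  assumes "norm lam * norm w \<le> nu ^ 4" shows "norm (deriv nxt w - 1) \<le> 1/100"
proof -
  have "norm lam * norm w \<le> 1/42" using assms nu_pow[of 4] by simp
  hence "norm w \<le> 1 / (42 * norm lam)" using lam_pos by (simp add: field_simps)
  hence "norm (deriv nxt w - 1) \<le> 600 * norm lam * norm w" by (rule nxt_taylor)
  also have "\<dots> \<le> 600 * nu ^ 4" using assms by simp
  also have "\<dots> \<le> 1/100"
  proof -
    have "nu ^ 4 \<le> (1/10^4)^4" using nu by (intro power_mono) auto
    thus "600 * nu ^ 4 \<le> 1/100" by (simp add: power_divide)
  qed
  finally show ?thesis .
qed

lemma f1_deriv: "deriv f1 \<zeta> = 2 * \<zeta> * deriv nxt (\<zeta>\<^sup>2)"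
proof -
  have "(nxt has_field_derivative deriv nxt (\<zeta>\<^sup>2)) (at (\<zeta>\<^sup>2))"
    by (rule holomorphic_derivI[OF nxt_hol[of UNIV]]) auto
  hence "((\<lambda>z. nxt (z\<^sup>2)) has_field_derivative deriv nxt (\<zeta>\<^sup>2) * (2 * \<zeta>)) (at \<zeta>)"
    by (rule DERIV_chain2) (auto intro!: derivative_eq_intros)
  thus ?thesis unfolding qm_def[abs_def] by (simp add: DERIV_imp_deriv)
qed

lemma f1_deriv_lower:
  assumes "norm (lam * \<zeta>) \<le> rr" shows "norm (deriv f1 \<zeta>) \<ge> (19/10) * norm \<zeta>"
proof -
  have "norm (deriv nxt (\<zeta>\<^sup>2) - 1) \<le> 1/100" by (rule nxt_deriv_close[OF scaled_sq(1)[OF assms]])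
  hence "norm (deriv nxt (\<zeta>\<^sup>2)) \<ge> 99/100"
    using norm_triangle_ineq2[of 1 "deriv nxt (\<zeta>\<^sup>2)"] by (simp add: norm_minus_commute)
  hence "2 * norm \<zeta> * norm (deriv nxt (\<zeta>\<^sup>2)) \<ge> 2 * norm \<zeta> * (99/100)" by (intro mult_left_mono) auto
  moreover have "(19/10) * norm \<zeta> \<le> 2 * norm \<zeta> * (99/100)" by simp
  ultimately have "(19/10) * norm \<zeta> \<le> 2 * norm \<zeta> * norm (deriv nxt (\<zeta>\<^sup>2))" by linarith
  thus ?thesis by (simp add: f1_deriv norm_mult)
qed

lemma nxt_inj:
  assumes "norm lam * norm w \<le> nu ^ 4" "norm lam * norm w' \<le> nu ^ 4" "nxt w = nxt w'"
  shows "w = w'"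
proof -
  let ?h = "\<lambda>w. nxt w - w" and ?S = "cball 0 (nu ^ 4 / norm lam) :: complex set"
  have in_S: "z \<in> ?S \<longleftrightarrow> norm lam * norm z \<le> nu ^ 4" for z :: complex
    using lam_pos by (simp add: field_simps)
  have "norm (?h w - ?h w') \<le> (1/100) * norm (w - w')"
  proof (rule field_differentiable_bound[where S = ?S])
    fix z assume z: "z \<in> ?S"
    thus "norm (deriv nxt z - 1) \<le> 1/100" by (intro nxt_deriv_close) (simp only: in_S)
    have "(nxt has_field_derivative deriv nxt z) (at z within ?S)"
      by (rule has_field_derivative_at_within[OF holomorphic_derivI[OF nxt_hol[of UNIV]]]) auto
    thus "(?h has_field_derivative deriv nxt z - 1) (at z within ?S)"
      by (intro derivative_intros) auto
  qed (use assms in_S in auto)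
  hence "norm (w - w') \<le> (1/100) * norm (w - w')" using assms(3) by (simp add: norm_minus_commute)
  thus ?thesis by simp
qed

lemma f1_inj:
  assumes "norm (lam * \<zeta>) \<le> rr" "norm (lam * \<zeta>') \<le> rr" "f1 \<zeta> = f1 \<zeta>'"
  shows "\<zeta>' \<in> {\<zeta>, - \<zeta>}"
proof -
  have "\<zeta>\<^sup>2 = \<zeta>'\<^sup>2"
    using nxt_inj[OF scaled_sq(1)[OF assms(1)] scaled_sq(1)[OF assms(2)]] assms(3) by (simp add: qm_def)
  thus ?thesis by (auto simp: power2_eq_iff)
qed

lemma fm_scaled: "(f ^^ m) (lam * \<zeta>) = lam * f1 \<zeta>"
  using nxt_qm[of \<zeta>] lam0 by (simp add: field_simps)

lemma fm_x: "(f ^^ m) x = lam * f1 (x / lam)"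
  using fm_scaled[of "x / lam"] lam0 by simp

lemma fm_deriv: "deriv (f ^^ m) x = deriv f1 (x / lam)"
proof -
  have D: "(f1 has_field_derivative deriv f1 (x / lam)) (at (x / lam))"
  proof (rule holomorphic_derivI)
    show "f1 holomorphic_on UNIV" unfolding qm_def[abs_def]
      by (rule holomorphic_on_compose_gen[OF _ nxt_hol[of UNIV], unfolded o_def]) (auto intro!: holomorphic_intros)
  qed auto
  have "((\<lambda>x. f1 (x / lam)) has_field_derivative deriv f1 (x / lam) * (1 / lam)) (at x)"
    by (rule DERIV_chain2[where f = f1 and g = "\<lambda>x. x / lam", OF D]) (auto intro!: derivative_eq_intros simp: lam0)
  hence "((\<lambda>x. lam * f1 (x / lam)) has_field_derivative lam * (deriv f1 (x / lam) * (1 / lam))) (at x)"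
    by (rule DERIV_cmult)
  moreover have "(\<lambda>x. lam * f1 (x / lam)) = (f ^^ m)" using fm_x by auto
  ultimately show ?thesis using lam0 by (simp add: DERIV_imp_deriv)
qed

text \<open>Apply the remaining \<open>m - i\<close> iterates: injectivity up to sign of the full
  return map is inherited by all earlier times.\<close>

lemma fi_inj:
  assumes "norm x \<le> rr" "norm x' \<le> rr" "(f ^^ i) x = (f ^^ i) x'" "i \<le> m"
  shows "x' \<in> {x, - x}"
proof -
  have "(f ^^ m) x = (f ^^ m) x'"
  proof -
    have "(f ^^ (m - i + i)) x = (f ^^ (m - i + i)) x'" unfolding funpow_add o_apply assms(3) ..
    thus ?thesis using assms(4) by simp
  qed
  hence "f1 (x / lam) = f1 (x' / lam)" using lam0 by (simp add: fm_x)
  hence "x' / lam \<in> {x / lam, - (x / lam)}"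
    using assms lam0 by (intro f1_inj) auto
  thus ?thesis using lam0 by (auto simp: field_simps)
qed

lemma fibre_two:
  assumes "A \<subseteq> {x. norm x < 3 \<and> f x = y}" obtains x where "A \<subseteq> {x, - x}"
proof (cases "A = {}")
  case False
  then obtain x where x: "x \<in> A" by auto
  have "z \<in> {x, - x}" if "z \<in> A" for z
  proof -
    have "norm x < 3" "f x = y" "norm z < 3" "f z = y" using x that assms by auto
    thus ?thesis using f_eq_iff[of x z] by auto
  qed
  thus ?thesis using that by blast
qed (use that in auto)

lemma inner_fibre_two:
  assumes "A \<subseteq> {x. norm x < rr \<and> (f ^^ i) x = y}" "i \<le> m" obtains x where "A \<subseteq> {x, - x}"
proof (cases "A = {}")
  case False
  then obtain x where x: "x \<in> A" by auto
  have "z \<in> {x, - x}" if "z \<in> A" for z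
  proof -
    have "norm x < rr" "(f ^^ i) x = y" "norm z < rr" "(f ^^ i) z = y" using x that assms by auto
    thus ?thesis using assms(2) by (intro fi_inj[of x z i]) auto
  qed
  thus ?thesis using that by blast
qed (use that in auto)

lemma bg_pos: "bg x > 0" using nu_pow_pos[of 35] by (simp add: bg_def less_max_iff_disj)

lemma bg_le: "bg x \<le> 1 / nu ^ 35"
  unfolding bg_def using nu_pow_pos[of 35] by (intro divide_left_mono) (auto simp: less_max_iff_disj)

lemma bg_le': "d > 0 \<Longrightarrow> norm (x\<^sup>2 - beta\<^sup>2) \<ge> d \<Longrightarrow> bg x \<le> 1 / d"
  unfolding bg_def using nu_pow_pos[of 35] by (intro divide_left_mono) (auto simp: less_max_iff_disj intro!: mult_pos_pos)

lemma beta_sq: "norm (beta\<^sup>2) \<ge> 81/25" "norm (beta\<^sup>2) \<le> 121/25"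
  using power_mono[OF beta_norm(2), of 2] power_mono[OF beta_norm(1), of 2]
  by (simp_all only: norm_power) (simp_all add: power2_eq_square)

lemma bg_ge: assumes "norm y < 3" shows "bg y \<ge> 1/14"
proof -
  have "(norm y)\<^sup>2 \<le> 3\<^sup>2" using assms by (intro power_mono) auto
  hence "norm (y\<^sup>2 - beta\<^sup>2) \<le> 14" using norm_triangle_ineq4[of "y\<^sup>2" "beta\<^sup>2"] beta_sq by (simp add: norm_power)
  moreover have "nu ^ 35 \<le> 14" using nu_pow[of 35] by simp
  ultimately have "max (norm (y\<^sup>2 - beta\<^sup>2)) (nu ^ 35) \<le> 14" by simp
  thus ?thesis unfolding bg_def using nu_pow_pos[of 35]
    by (intro divide_left_mono) (auto simp: less_max_iff_disj intro!: mult_pos_pos)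
qed

lemma bg_small: assumes "norm y < rr" shows "bg y \<le> 5/16"
proof -
  have "(norm y)\<^sup>2 \<le> rr\<^sup>2" using assms by (intro power_mono) auto
  also have "\<dots> \<le> 1/100" using power_mono[OF rr(2), of 2] rr(1) by (simp add: power_one_over)
  finally have "norm (y\<^sup>2 - beta\<^sup>2) \<ge> 16/5"
    using norm_triangle_ineq3[of "y\<^sup>2" "beta\<^sup>2"] beta_sq by (auto simp: norm_power)
  from bg_le'[OF _ this] show ?thesis by simp
qed

text \<open>Factor \<open>(f x)^2 - beta^2\<close>. One factor is close to
  \<open>x^2 - beta^2\<close> and the other, by \<open>beta_v\<close>, to \<open>x^2\<close>; so the
  quotient is about \<open>|x|^2 / (2 |x|)^(7/4)\<close>. For \<open>|x| < 3\<close> this is less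
  than \<open>3^(1/4) / 2^(7/4)\<close>, about 0.391, which leaves little room below 2/5. Two
  preimages together then lose a definite amount.\<close>

lemma bg_transfer:
  assumes x: "rr \<le> norm x" "norm x < 3"
  shows "norm (deriv f x) powr (-7/4) * bg x \<le> (2/5) * bg (f x)"
proof -
  define q where "q = root 4 (norm x)"
  have x0: "norm x > 0" using x rr by linarith
  have q4: "q ^ 4 = norm x" and q0: "q > 0" using x0 by (simp_all add: q_def)
  define W where "W = norm (deriv f x) powr (-7/4)"
  have fd: "norm (deriv f x) \<ge> (499/250) * norm x" using x by (intro f_deriv_lower) auto
  \<comment> \<open>\<open>k\<close> is slightly below the fourth root of 499/250. In the same way
    132/100 below is slightly above the fourth root of 3.\<close>
  define k :: real where "k = 1188/1000"
  have k: "k > 0" "k ^ 4 \<le> 499/250" "1 / k ^ 7 \<le> 29943/100000" by (simp_all add: k_def power_divide)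
  have W1: "W \<le> 1 / (k * q) ^ 7" unfolding W_def
  proof (rule powr_neg_bound)
    have "(k * q) ^ 4 = k ^ 4 * norm x" by (simp only: power_mult_distrib q4)
    also have "\<dots> \<le> (499/250) * norm x" using k by (intro mult_right_mono) auto
    finally show "(k * q) ^ 4 \<le> norm (deriv f x)" using fd by linarith
  qed (use q0 k in simp)
  have W: "W * q ^ 7 \<le> 29943/100000"
  proof -
    have "W * q ^ 7 \<le> 1 / (k * q) ^ 7 * q ^ 7" using W1 q0 by (intro mult_right_mono) auto
    also have "\<dots> = 1 / k ^ 7" using q0 by (simp only: power_mult_distrib) simp
    finally show ?thesis using k by linarith
  qed
  have q3: "q \<le> 132/100"
  proof (rule ccontr)
    assume "\<not> ?thesis"
    hence "(132/100) ^ 4 \<le> q ^ 4" by (intro power_mono) auto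
    thus False using q4 x by (simp add: power_divide)
  qed
  have W0: "W \<ge> 0" by (simp add: W_def)
  let ?dx = "norm (x\<^sup>2 - beta\<^sup>2)" and ?dy = "norm ((f x)\<^sup>2 - beta\<^sup>2)"
  have A: "W * ?dy \<le> (2/5) * ?dx"
  proof -
    have dy: "?dy = norm (f x - beta) * norm (f x + beta)"
      by (simp add: power2_eq_square flip: norm_mult) (simp add: algebra_simps)
    have n16: "norm (x\<^sup>2) \<le> 16" "norm (beta\<^sup>2) \<le> 16" using x beta_norm by (auto intro!: norm_sq16)
    have 1: "norm (f x - beta) \<le> (501/500) * ?dx"
      using lip_upper[OF n16] beta(2) by (simp add: qm_def)
    have "norm (f x - a 1) \<le> (501/500) * norm (x\<^sup>2)"
      using lip_upper[OF n16(1), of 0] by (simp add: a1 qm_def)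
    hence 2: "norm (f x + beta) \<le> 15 * nu ^ 36 + (501/500) * (q ^ 8)"
    proof -
      have "norm (x\<^sup>2) = q ^ 8" by (simp add: norm_power q4[symmetric] flip: power_mult)
      moreover have "norm (a 1 + beta) \<le> 15 * nu ^ 36" using beta_v nu(1) by simp
      moreover have "norm (f x + beta) \<le> norm (f x - a 1) + norm (a 1 + beta)" by norm
      ultimately show ?thesis using \<open>norm (f x - a 1) \<le> (501/500) * norm (x\<^sup>2)\<close> by linarith
    qed
    have 3: "15 * nu ^ 36 \<le> (15/10000) * q ^ 7"
    proof -
      have "rr \<le> q ^ 4" using q4 x by simp
      hence "(nu ^ 5) ^ 4 \<le> q ^ 4" by (simp add: rr_def flip: power_mult)
      hence "nu ^ 5 \<le> q" using q0 nu_pow_pos[of 5] power_mono_iff[of "nu ^ 5" q 4] by simp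
      hence "(nu ^ 5) ^ 7 \<le> q ^ 7" using nu by (intro power_mono) auto
      hence "nu ^ 35 \<le> q ^ 7" by (simp flip: power_mult)
      hence "nu * nu ^ 35 \<le> (1/10^4) * q ^ 7" using nu by (intro mult_mono) auto
      thus ?thesis using power_add[of nu 1 35] by simp
    qed
    have 4: "norm (f x + beta) \<le> q ^ 7 * (13242/10000)"
    proof -
      have "q * q ^ 7 \<le> (132/100) * q ^ 7" using q3 q0 by (intro mult_right_mono) auto
      hence "q ^ 8 \<le> (132/100) * q ^ 7" using power_add[of q 1 7] by simp
      moreover have "q ^ 7 > 0" using q0 by simp
      ultimately show ?thesis using 2 3 by linarith
    qed
    have "W * ?dy \<le> W * (((501/500) * ?dx) * (q ^ 7 * (13242/10000)))"
      unfolding dy using 1 4 W0 by (intro mult_left_mono mult_mono) auto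
    also have "\<dots> = (W * q ^ 7) * ((501/500) * (13242/10000) * ?dx)" by simp
    also have "\<dots> \<le> (29943/100000) * ((501/500) * (13242/10000) * ?dx)"
      using W by (intro mult_right_mono) auto
    also have "\<dots> \<le> (2/5) * ?dx" by simp
    finally show ?thesis .
  qed
  \<comment> \<open>The truncated part: for \<open>|x| >= 11/10\<close> the expansion alone gives
    the factor 2/5; elsewhere \<open>|x^2 - beta^2| >= 2\<close>, and \<open>nu^35 <= q^7\<close>
    since \<open>|x| >= rr\<close>.\<close>
  have B: "W * nu ^ 35 \<le> (2/5) * max ?dx (nu ^ 35)"
  proof (cases "norm x \<ge> 11/10")
    case True
    have "W \<le> 1 / (121/100) ^ 7" unfolding W_def
      by (rule powr_neg_bound) (use True fd in \<open>auto simp: power_divide\<close>)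
    also have "\<dots> \<le> 2/5" by (simp add: power_divide)
    finally have "W * nu ^ 35 \<le> (2/5) * nu ^ 35" using nu_pow_pos[of 35] by (intro mult_right_mono) auto
    thus ?thesis by (simp add: max_def)
  next
    case False
    hence "(norm x)\<^sup>2 \<le> (11/10)\<^sup>2" by (intro power_mono) auto
    hence "norm (x\<^sup>2) \<le> 121/100" by (simp add: norm_power power_divide)
    hence dx: "?dx \<ge> 2" using norm_triangle_ineq3[of "x\<^sup>2" "beta\<^sup>2"] beta_sq(1) by linarith
    have "nu ^ 35 \<le> q ^ 7"
    proof -
      have "rr \<le> q ^ 4" using q4 x by simp
      hence "(nu ^ 5) ^ 4 \<le> q ^ 4" by (simp add: rr_def flip: power_mult)
      hence "nu ^ 5 \<le> q" using q0 nu_pow_pos[of 5] power_mono_iff[of "nu ^ 5" q 4] by simp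
      hence "(nu ^ 5) ^ 7 \<le> q ^ 7" using nu by (intro power_mono) auto
      thus ?thesis by (simp flip: power_mult)
    qed
    hence "W * nu ^ 35 \<le> W * q ^ 7" using W0 by (intro mult_left_mono)
    also have "\<dots> \<le> (2/5) * ?dx" using W dx by simp
    finally show ?thesis by (simp add: max_def)
  qed
  define MX where "MX = max ?dx (nu ^ 35)"
  define MY where "MY = max ?dy (nu ^ 35)"
  have pos: "MX > 0" "MY > 0" using nu_pow_pos[of 35] by (auto simp: MX_def MY_def less_max_iff_disj)
  have "W * MY \<le> (2/5) * MX"
  proof (cases "?dy \<ge> nu ^ 35")
    case True
    have "(2/5) * ?dx \<le> (2/5) * MX" by (simp add: MX_def)
    thus ?thesis using A True by (simp add: MY_def)
  next
    case False
    thus ?thesis using B by (simp add: MY_def MX_def max_def)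
  qed
  hence "W * (1 / MX) \<le> (2/5) * (1 / MY)" using pos by (simp add: field_simps)
  thus ?thesis by (simp add: W_def bg_def MX_def MY_def)
qed

end

section \<open>Towers of renormalizations and a supersolution\<close>

lemma deriv_funpow_add:
  assumes "f holomorphic_on UNIV"
  shows "deriv (f ^^ (i + j)) z = deriv (f ^^ i) ((f ^^ j) z) * deriv (f ^^ j) z"
  unfolding funpow_add by (rule deriv_chain) (auto intro!: hol_UNIV_diff hol_funpow assms)

context step begin

lemma f1_deriv_upper:
  assumes "norm (lam * \<zeta>) \<le> rr" shows "norm (deriv f1 \<zeta>) \<le> (21/10) * norm \<zeta>"
proof -
  have "norm (deriv nxt (\<zeta>\<^sup>2) - 1) \<le> 1/100" by (rule nxt_deriv_close[OF scaled_sq(1)[OF assms]])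
  hence "norm (deriv nxt (\<zeta>\<^sup>2)) \<le> 101/100"
    using norm_triangle_ineq2[of "deriv nxt (\<zeta>\<^sup>2)" 1] by simp
  hence "2 * norm \<zeta> * norm (deriv nxt (\<zeta>\<^sup>2)) \<le> 2 * norm \<zeta> * (101/100)" by (intro mult_left_mono) auto
  also have "\<dots> \<le> (21/10) * norm \<zeta>" by simp
  finally show ?thesis by (simp add: f1_deriv norm_mult)
qed

lemma inner_factor: "norm x \<le> rr \<Longrightarrow> 1 \<le> j \<Longrightarrow> j < m \<Longrightarrow> norm (deriv f ((f ^^ j) x)) \<ge> 2"
  using inner_bd[OF small_inner, of x j] f_deriv_lower[of "(f ^^ j) x"] by force

text \<open>The factors still missing at time \<open>i\<close> are all at least 1, so the derivative
  of \<open>f^i\<close> is dominated by that of the full return map, which is known from the next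
  level.\<close>

lemma fi_deriv_upper:
  assumes x: "norm x \<le> rr" and i: "1 \<le> i" "i \<le> m"
  shows "norm (deriv (f ^^ i) x) \<le> (21/10) * (norm x / norm lam)"
proof -
  have "norm (deriv (f ^^ (m - i)) ((f ^^ i) x)) = (\<Prod>j<m-i. norm (deriv f ((f ^^ j) ((f ^^ i) x))))"
    unfolding deriv_funpow[OF f_hol] by (simp add: prod_norm)
  also have "\<dots> \<ge> (\<Prod>j<m-i. 1)"
  proof (rule prod_mono)
    fix j assume "j \<in> {..<m-i}"
    hence "norm (deriv f ((f ^^ (j + i)) x)) \<ge> 2" using i by (intro inner_factor[OF x]) auto
    thus "0 \<le> (1::real) \<and> 1 \<le> norm (deriv f ((f ^^ j) ((f ^^ i) x)))" by (simp add: funpow_add)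
  qed
  finally have 1: "norm (deriv (f ^^ (m - i)) ((f ^^ i) x)) \<ge> 1" by simp
  have "norm (deriv (f ^^ i) x) \<le> norm (deriv (f ^^ (m - i)) ((f ^^ i) x)) * norm (deriv (f ^^ i) x)"
    using mult_right_mono[OF 1, of "norm (deriv (f ^^ i) x)"] by simp
  also have "\<dots> = norm (deriv (f ^^ m) x)"
    using deriv_funpow_add[OF f_hol, of "m - i" i x] i by (simp add: norm_mult)
  also have "\<dots> \<le> (21/10) * norm (x / lam)"
    unfolding fm_deriv using x lam0 by (intro f1_deriv_upper) simp
  finally show ?thesis by (simp add: norm_divide)
qed

lemma fi_deriv_lower:
  assumes x: "norm x \<le> rr" and i: "1 \<le> i" "i \<le> m"
  shows "norm (deriv (f ^^ i) x) \<ge> norm x"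
proof -
  obtain k where k: "i = Suc k" using i by (cases i) auto
  have "norm (deriv (f ^^ i) x) = norm (deriv f x) * (\<Prod>j<k. norm (deriv f ((f ^^ Suc j) x)))"
    unfolding deriv_funpow[OF f_hol] k prod.lessThan_Suc_shift by (simp add: norm_mult prod_norm)
  also have "\<dots> \<ge> norm x * 1"
  proof (rule mult_mono)
    have "norm x \<le> 4" using x rr by simp
    hence "(499/250) * norm x \<le> norm (deriv f x)" by (rule f_deriv_lower)
    thus "norm x \<le> norm (deriv f x)" using norm_ge_zero[of x] by linarith
    have "(\<Prod>j<k. (1::real)) \<le> (\<Prod>j<k. norm (deriv f ((f ^^ Suc j) x)))"
    proof (rule prod_mono)
      fix j assume "j \<in> {..<k}"
      hence "norm (deriv f ((f ^^ Suc j) x)) \<ge> 2" using i k by (intro inner_factor[OF x]) auto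
      thus "0 \<le> (1::real) \<and> 1 \<le> norm (deriv f ((f ^^ Suc j) x))" by simp
    qed
    thus "1 \<le> (\<Prod>j<k. norm (deriv f ((f ^^ Suc j) x)))" by simp
  qed auto
  finally show ?thesis by simp
qed

lemma fi_lip:
  assumes R: "R \<le> rr" and x: "norm x \<le> R" "norm u \<le> R" and i: "1 \<le> i" "i \<le> m"
  shows "norm ((f ^^ i) x - (f ^^ i) u) \<le> (21/10) * (R / norm lam) * norm (x - u)"
proof (rule field_differentiable_bound[where S = "cball 0 R"])
  fix z :: complex assume z: "z \<in> cball 0 R"
  show "((f ^^ i) has_field_derivative deriv (f ^^ i) z) (at z within cball 0 R)"
    by (rule has_field_derivative_at_within[OF holomorphic_derivI[OF hol_funpow[OF f_hol]]]) auto
  have "norm (deriv (f ^^ i) z) \<le> (21/10) * (norm z / norm lam)" using z R i by (intro fi_deriv_upper) auto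
  also have "\<dots> \<le> (21/10) * (R / norm lam)" using z lam_pos by (intro mult_left_mono divide_right_mono) auto
  finally show "norm (deriv (f ^^ i) z) \<le> (21/10) * (R / norm lam)" .
qed (use x in auto)

end

locale tower =
  fixes m :: nat and \<psi> :: "nat \<Rightarrow> complex \<Rightarrow> complex" and t lam :: "nat \<Rightarrow> complex"
  assumes step: "step (\<psi> n) (t n) m (lam n)"
    and nxt_eq: "\<psi> (Suc n) w = (qm (\<psi> n) ^^ (m-1)) (\<psi> n ((lam n)\<^sup>2 * w)) / lam n"
begin

sublocale L: step "\<psi> n" "t n" m "lam n" for n by (rule step)

abbreviation F where "F n \<equiv> qm (\<psi> n)"

lemma nxt_psi: "L.nxt n = \<psi> (Suc n)"
  by (rule ext) (simp add: L.nxt_def nxt_eq)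

lemma f1_F: "qm (L.nxt n) = F (Suc n)" by (simp add: nxt_psi)

definition Lam where "Lam n K = (\<Prod>i=n..<n+K. lam i)"

lemma Lam_0: "Lam n 0 = 1" by (simp add: Lam_def)
lemma Lam_Suc: "Lam n (Suc K) = lam n * Lam (Suc n) K"
  by (simp add: Lam_def prod.atLeast_Suc_lessThan)
lemma Lam_nz: "Lam n K \<noteq> 0" using L.lam0 by (simp add: Lam_def)

lemma lam_le: "norm (lam n) \<le> 1/10^8" by (rule L.lam_tiny8)

lemma Lam_le: "norm (Lam n K) \<le> (1/10^8)^K"
proof (induction K arbitrary: n)
  case (Suc K)
  have "norm (Lam n (Suc K)) \<le> (1/10^8) * (1/10^8)^K"
    unfolding Lam_Suc norm_mult using Suc lam_le by (intro mult_mono) auto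
  thus ?case by simp
qed (simp add: Lam_0)

lemma Lam_le_1: "norm (Lam n K) \<le> 1"
  using Lam_le[of n K] power_le_one[of "1/10^8::real" K] by simp

text \<open>13/5 exceeds the bound 47/20 valid for all critical orbits, and
  \<open>(13/5)^2 - 59/25 > 3\<close>, so the circle of this radius is thrown beyond the rescaled
  radius 3 by the return map. \<open>Q_gap\<close> rests on the first fact and
  \<open>barrier\<close> on the second.\<close>

definition dl where "dl K n = (13/5) * norm (Lam n K)"

lemma dl_Suc: "dl (Suc K) n = norm (lam n) * dl K (Suc n)"
  by (simp add: dl_def Lam_Suc norm_mult)
lemma dl_pos: "dl K n > 0" by (simp add: dl_def Lam_nz)
text \<open>52 is chosen so that the gain 1/200 at the next level, multiplied by 52, covers
  \<open>1/200 + (4/5) (5/16)\<close>, the amount to be absorbed in the inner disc. In the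
  surrounding ring 100 exceeds the bound 64 of \<open>push_m_mid\<close> with room for the same
  amount.\<close>

definition hat where "hat g n y = (if norm y < 3 * norm (lam n) then 52 * g (y / lam n) else (100::real))"
definition Z where "Z K n i y = {x. norm x < L.rr n \<and> dl K n \<le> norm x \<and> (F n ^^ i) x = y}"
definition W where "W n i x = norm (deriv (F n ^^ i) x) powr (-7/4)"
text \<open>Weight that inner points deliver to \<open>y\<close> after \<open>i\<close> steps. One
  more transfer only turns \<open>i\<close> into \<open>i + 1\<close> (\<open>push_step\<close>), so
  the passage through a whole period is followed without estimating the single steps.\<close>

definition push where "push g K n i y = (\<Sum>x\<in>Z K n i y. W n i x * hat g n x)"
definition Fib where "Fib K n y = {x. norm x < 3 \<and> dl K n \<le> norm x \<and> F n x = y}"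

text \<open>\<open>K\<close> is the number of levels kept: preimages inside the disc of radius
  \<open>dl K n\<close> are left out, which makes the recursion finite. The useful bounds,
  \<open>rho_ring\<close> and \<open>rho_away\<close>, do not deteriorate as \<open>K\<close>
  grows.\<close>

primrec rho :: "nat \<Rightarrow> nat \<Rightarrow> complex \<Rightarrow> real" where
  "rho 0 n y = L.bg n y"
| "rho (Suc K) n y = (if norm y < L.rr n then hat (rho K (Suc n)) n y else L.bg n y)
      + (\<Sum>i=1..<m. push (rho K (Suc n)) (Suc K) n i y)"

lemma Fib_two: obtains x where "Fib K n y \<subseteq> {x, - x}"
  by (rule L.fibre_two[of "Fib K n y" n y]) (auto simp: Fib_def)
lemma Z_two: assumes "i \<le> m" obtains x where "Z K n i y \<subseteq> {x, - x}"
  by (rule L.inner_fibre_two[of "Z K n i y" n i y]) (use assms in \<open>auto simp: Z_def\<close>)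
lemma finite_Fib: "finite (Fib K n y)" using Fib_two by (metis finite.emptyI finite_insert finite_subset)
lemma finite_Z: "i \<le> m \<Longrightarrow> finite (Z K n i y)" using Z_two by (metis finite.emptyI finite_insert finite_subset)

lemma W_nonneg: "W n i x \<ge> 0" by (simp add: W_def)

definition wt where "wt n x = norm (deriv (F n) x) powr (-7/4)"

lemma W_Suc: "W n (Suc i) x = wt n ((F n ^^ i) x) * W n i x"
  unfolding W_def wt_def deriv_funpow[OF L.f_hol] by (simp add: norm_mult powr_mult mult.commute)

lemma wt_nonneg: "wt n x \<ge> 0" by (simp add: wt_def)

lemma W_1: "W n 1 x = wt n x"
  unfolding W_def wt_def deriv_funpow[OF L.f_hol] by simp

lemma hat_nonneg: "(\<And>y. g y \<ge> 0) \<Longrightarrow> hat g n y \<ge> 0" by (simp add: hat_def)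
lemma push_nonneg: "(\<And>y. g y \<ge> 0) \<Longrightarrow> push g K n i y \<ge> 0"
  unfolding push_def by (intro sum_nonneg mult_nonneg_nonneg W_nonneg hat_nonneg)

lemma rho_nonneg: "rho K n y \<ge> 0"
proof (induction K arbitrary: n y)
  case 0 show ?case using L.bg_pos[of n y] by simp
next
  case (Suc K)
  thus ?case using L.bg_pos[of n y] hat_nonneg[of "rho K (Suc n)" n y]
    by (auto intro!: add_nonneg_nonneg sum_nonneg push_nonneg)
qed

lemma push_step:
  assumes g: "\<And>y. g y \<ge> 0" and i: "i < m"
  shows "(\<Sum>x\<in>Fib K n y. wt n x * push g K n i x) \<le> push g K n (Suc i) y"
proof -
  let ?h = "\<lambda>u. W n (Suc i) u * hat g n u"
  have "(\<Sum>x\<in>Fib K n y. wt n x * push g K n i x) = (\<Sum>x\<in>Fib K n y. \<Sum>u\<in>Z K n i x. ?h u)"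
    unfolding push_def sum_distrib_left
    by (intro sum.cong refl) (auto simp: W_Suc Z_def)
  also have "\<dots> = sum ?h (\<Union>x\<in>Fib K n y. Z K n i x)"
    using i finite_Fib finite_Z[of i] by (intro sum.UNION_disjoint[symmetric]) (auto simp: Z_def)
  also have "\<dots> \<le> sum ?h (Z K n (Suc i) y)"
    using i by (intro sum_mono2 finite_Z mult_nonneg_nonneg W_nonneg hat_nonneg g) (auto simp: Z_def Fib_def)
  finally show ?thesis by (simp add: push_def)
qed

lemma F_Suc: "(F n ^^ m) x = lam n * F (Suc n) (x / lam n)"
  using L.fm_x[of n x] by (simp add: f1_F)
lemma F_Suc_deriv: "deriv (F n ^^ m) x = deriv (F (Suc n)) (x / lam n)"
  using L.fm_deriv[of n x] by (simp add: f1_F)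

lemma lam_pos: "norm (lam n) > 0" by (rule L.lam_pos)

lemma Z_m:
  assumes x: "x \<in> Z K n m y"
  shows "y / lam n = F (Suc n) (x / lam n)" "W n m x = wt (Suc n) (x / lam n)" "norm x < L.rr n" "dl K n \<le> norm x"
    "norm (lam n * (x / lam n)) \<le> L.rr n"
proof -
  have "y = lam n * F (Suc n) (x / lam n)" using x F_Suc[of n x] by (simp add: Z_def)
  thus "y / lam n = F (Suc n) (x / lam n)" using L.lam0[of n] by simp
qed (use x L.lam0[of n] in \<open>auto simp: Z_def W_def wt_def F_Suc_deriv\<close>)

lemma W_bound: "q > 0 \<Longrightarrow> q ^ 4 \<le> norm (deriv (F n) x) \<Longrightarrow> wt n x \<le> 1 / q ^ 7"
  unfolding wt_def by (rule powr_neg_bound)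

text \<open>A point leaving the disc of radius 3 cannot be close to \<open>beta\<close> or
  \<open>- beta\<close>, since both are mapped to \<open>beta\<close>.\<close>

lemma outer_bg:
  assumes "norm \<zeta> < 3" "norm (F n \<zeta>) \<ge> 3"
  shows "L.bg n \<zeta> \<le> 13/10" "norm \<zeta> \<ge> 4/5"
proof -
  have "norm (F n \<zeta>) \<le> (norm \<zeta>)\<^sup>2 + 59/25" using assms by (intro L.f_upper) auto
  hence "(4/5)\<^sup>2 \<le> (norm \<zeta>)\<^sup>2" using assms by (simp add: power2_eq_square)
  thus "norm \<zeta> \<ge> 4/5" by (rule power2_le_imp_le) simp
  have n16: "norm (\<zeta>\<^sup>2) \<le> 16" "norm ((L.beta n)\<^sup>2) \<le> 16"
    using assms L.beta_norm(1)[of n] by (auto intro!: L.norm_sq16)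
  have "norm (F n \<zeta> - L.beta n) \<le> (501/500) * norm (\<zeta>\<^sup>2 - (L.beta n)\<^sup>2)"
  proof -
    have "norm (\<psi> n (\<zeta>\<^sup>2) - \<psi> n ((L.beta n)\<^sup>2)) \<le> (501/500) * norm (\<zeta>\<^sup>2 - (L.beta n)\<^sup>2)"
      by (rule L.lip_upper[OF n16])
    thus ?thesis using L.beta(2)[of n] by (simp add: qm_def)
  qed
  moreover have "norm (F n \<zeta> - L.beta n) \<ge> 4/5"
    using norm_triangle_ineq2[of "F n \<zeta>" "L.beta n"] L.beta_norm(1)[of n] assms by linarith
  ultimately have "norm (\<zeta>\<^sup>2 - (L.beta n)\<^sup>2) \<ge> 10/13" by linarith
  from L.bg_le'[OF _ this] show "L.bg n \<zeta> \<le> 13/10" by simp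
qed

text \<open>Images of inner points stay below 29/10 during a whole period, so a point about to
  escape receives no pushed weight.\<close>

lemma rho_outer:
  assumes "norm \<zeta> < 3" "norm (F n \<zeta>) \<ge> 3"
  shows "rho K n \<zeta> = L.bg n \<zeta>"
proof (cases K)
  case (Suc K')
  have "\<not> norm \<zeta> < L.rr n" using outer_bg(2)[OF assms] L.rr(2)[of n] by auto
  moreover have "push g (Suc K') n i \<zeta> = 0" if i: "i \<in> {1..<m}" for g i
  proof -
    have "Z (Suc K') n i \<zeta> = {}"
    proof -
      have False if "x \<in> Z (Suc K') n i \<zeta>" for x
      proof -
        have x: "norm x < L.rr n" "(F n ^^ i) x = \<zeta>" using that by (auto simp: Z_def)
        have "norm ((F n ^^ Suc i) x) \<le> 29/10"
          using i x by (intro L.inner_bd' L.small_inner) auto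
        thus False using x assms by simp
      qed
      thus ?thesis by blast
    qed
    thus ?thesis by (simp add: push_def)
  qed
  ultimately show ?thesis using Suc by simp
qed simp

lemma push_zero_small:
  assumes "i \<in> {1..<m}" "norm y < 11/10" shows "push g K n i y = 0"
proof -
  have "Z K n i y = {}"
  proof -
    have False if "x \<in> Z K n i y" for x
    proof -
      have x: "norm x < L.rr n" "(F n ^^ i) x = y" using that by (auto simp: Z_def)
      have "norm ((F n ^^ i) x) \<ge> 11/10"
        using assms x by (intro L.inner_bd L.small_inner) auto
      thus False using x assms by simp
    qed
    thus ?thesis by blast
  qed
  thus ?thesis by (simp add: push_def)
qed

lemma bg_sum:
  "(\<Sum>x\<in>{x\<in>Fib K n y. L.rr n \<le> norm x}. wt n x * L.bg n x) \<le> (4/5) * L.bg n y"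
proof -
  obtain x where x: "Fib K n y \<subseteq> {x, - x}" by (rule Fib_two)
  have "(\<Sum>x\<in>{x\<in>Fib K n y. L.rr n \<le> norm x}. wt n x * L.bg n x) \<le> 2 * ((2/5) * L.bg n y)"
  proof (rule sum_le_card_two[of _ x])
    fix z assume "z \<in> {x\<in>Fib K n y. L.rr n \<le> norm x}"
    thus "wt n z * L.bg n z \<le> (2/5) * L.bg n y"
      using L.bg_transfer[of n z] by (auto simp: Fib_def wt_def)
  qed (use x L.bg_pos[of n y] in auto)
  thus ?thesis by simp
qed

lemma Z0_image:
  assumes x: "norm x < 3 * norm (lam n)"
  shows "norm (x / lam n) < 3"
  using x lam_pos[of n] by (simp add: norm_divide field_simps)

lemma lam_rr3: "3 * norm (lam n) < L.rr n" "12 * norm (lam n) < L.rr n"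
proof -
  have "norm (lam n) * 10000 \<le> L.rr n" using L.lam_rr[of n] by simp
  thus "3 * norm (lam n) < L.rr n" "12 * norm (lam n) < L.rr n" using lam_pos[of n] by linarith+
qed

text \<open>To land beyond \<open>rr\<close> the rescaled preimage must have modulus at least
  \<open>10^4\<close>, where a single factor is already at most \<open>10^(-7)\<close>.\<close>

lemma push_m_far:
  assumes y: "L.rr n \<le> norm y"
  shows "push g K n m y \<le> 1/200"
proof -
  obtain x0 where x0: "Z K n m y \<subseteq> {x0, - x0}" using Z_two[of m K n y] by blast
  have "push g K n m y \<le> 2 * (100 / 10^7)" unfolding push_def
  proof (rule sum_le_card_two[OF x0])
    fix x assume x: "x \<in> Z K n m y"
    define \<zeta> where "\<zeta> = x / lam n"
    note zm = Z_m[OF x, folded \<zeta>_def]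
    have ylam: "norm y = norm (lam n) * norm (F (Suc n) \<zeta>)"
      using zm(1) L.lam0[of n] by (metis norm_mult nonzero_mult_div_cancel_left times_divide_eq_right)
    have big: "norm (F (Suc n) \<zeta>) \<ge> 10^16"
    proof -
      have "norm (lam n) * 10^16 \<le> L.rr n"
      proof -
        have "L.nu n ^ 16 \<le> (1/10^4)^16" using L.nu[of n] by (intro power_mono) auto
        also have "\<dots> \<le> 1/10^16" by (simp add: power_divide)
        finally have "L.rr n * L.nu n ^ 16 \<le> L.rr n * (1/10^16)" using L.rr(1)[of n] by (intro mult_left_mono) auto
        thus ?thesis unfolding L.rr_lam(1)[of n] by simp
      qed
      hence "norm (lam n) * 10^16 \<le> norm (lam n) * norm (F (Suc n) \<zeta>)" using y ylam by linarith
      thus ?thesis using lam_pos[of n] by simp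
    qed
    have cl: "norm (F (Suc n) \<zeta> - (L.nxt n 0 + \<zeta>\<^sup>2)) \<le> (1/100) * (norm \<zeta>)\<^sup>2"
      using L.f1_close[of n \<zeta>] zm(5) by (simp add: f1_F)
    have "norm (F (Suc n) \<zeta>) \<le> (1/100) * (norm \<zeta>)\<^sup>2 + 3 + (norm \<zeta>)\<^sup>2"
      using cl L.nxt0[of n] norm_triangle_ineq[of "F (Suc n) \<zeta> - (L.nxt n 0 + \<zeta>\<^sup>2)" "L.nxt n 0 + \<zeta>\<^sup>2"]
        norm_triangle_ineq[of "L.nxt n 0" "\<zeta>\<^sup>2"] by (simp add: norm_power)
    hence "(10^4)\<^sup>2 \<le> (norm \<zeta>)\<^sup>2" using big by (simp add: power2_eq_square)
    hence zb: "norm \<zeta> \<ge> 10^4" by (rule power2_le_imp_le) simp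
    have dv: "norm (deriv (F (Suc n)) \<zeta>) \<ge> (19/10) * norm \<zeta>"
      using L.f1_deriv_lower[of n \<zeta>] zm(5) by (simp add: f1_F)
    have "wt (Suc n) \<zeta> \<le> 1 / 10 ^ 7"
    proof (rule W_bound)
      have "(19/10) * norm \<zeta> \<ge> 1 * norm \<zeta>" by (intro mult_right_mono) auto
      thus "10 ^ 4 \<le> norm (deriv (F (Suc n)) \<zeta>)" using zb dv by linarith
    qed auto
    moreover have "hat g n x = 100"
    proof -
      have "\<not> norm x < 3 * norm (lam n)"
      proof
        assume "norm x < 3 * norm (lam n)"
        hence "norm \<zeta> < 3" unfolding \<zeta>_def by (rule Z0_image)
        thus False using zb by simp
      qed
      thus ?thesis by (simp add: hat_def)
    qed
    ultimately show "W n m x * hat g n x \<le> 100 / 10^7" using zm(2) by simp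
  qed auto
  thus ?thesis by simp
qed

text \<open>The rescaled preimage either lies in the disc of radius 3 and is about to leave it,
  where \<open>g\<close> is at most 13/10, or lies outside, where the derivative is large. Either
  way the contribution is at most 32.\<close>

lemma push_m_mid:
  assumes y: "3 * norm (lam n) \<le> norm y"
    and g: "\<And>\<zeta>. norm \<zeta> < 3 \<Longrightarrow> norm (F (Suc n) \<zeta>) \<ge> 3 \<Longrightarrow> g \<zeta> \<le> 13/10"
  shows "push g K n m y \<le> 64"
proof -
  obtain x0 where x0: "Z K n m y \<subseteq> {x0, - x0}" using Z_two[of m K n y] by blast
  have "push g K n m y \<le> 2 * 32" unfolding push_def
  proof (rule sum_le_card_two[OF x0])
    fix x assume x: "x \<in> Z K n m y"
    define \<zeta> where "\<zeta> = x / lam n"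
    note zm = Z_m[OF x, folded \<zeta>_def]
    have F3: "norm (F (Suc n) \<zeta>) \<ge> 3"
      using y zm(1) lam_pos[of n] by (simp add: norm_divide flip: zm(1)) (simp add: field_simps)
    show "W n m x * hat g n x \<le> 32"
    proof (cases "norm x < 3 * norm (lam n)")
      case True
      have z3: "norm \<zeta> < 3" unfolding \<zeta>_def by (rule Z0_image[OF True])
      have "wt (Suc n) \<zeta> \<le> 1 / (112/100) ^ 7"
      proof (rule W_bound)
        have "norm (deriv (F (Suc n)) \<zeta>) \<ge> (499/250) * norm \<zeta>" using z3 by (intro L.f_deriv_lower) auto
        thus "(112/100) ^ 4 \<le> norm (deriv (F (Suc n)) \<zeta>)" using outer_bg(2)[OF z3 F3] by (simp add: power_divide)
      qed auto
      also have "\<dots> \<le> 46/100" by (simp add: power_divide)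
      finally have w46: "wt (Suc n) \<zeta> \<le> 46/100" .
      have "W n m x * hat g n x = wt (Suc n) \<zeta> * (52 * g \<zeta>)" using True zm(2) by (simp add: hat_def \<zeta>_def)
      also have "\<dots> \<le> wt (Suc n) \<zeta> * (52 * (13/10))"
        using g[OF z3 F3] wt_nonneg by (intro mult_left_mono) auto
      also have "\<dots> \<le> (46/100) * (52 * (13/10))" using w46 by (intro mult_right_mono) auto
      finally have "W n m x * hat g n x \<le> (46/100) * (52 * (13/10))" .
      thus ?thesis by simp
    next
      case False
      hence z3: "norm \<zeta> \<ge> 3" using lam_pos[of n] by (simp add: \<zeta>_def norm_divide field_simps)
      have dv: "norm (deriv (F (Suc n)) \<zeta>) \<ge> (19/10) * norm \<zeta>"
        using L.f1_deriv_lower[of n \<zeta>] zm(5) by (simp add: f1_F)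
      have "wt (Suc n) \<zeta> \<le> 1 / (15/10) ^ 7"
        by (rule W_bound) (use dv z3 in \<open>auto simp: power_divide\<close>)
      also have "\<dots> \<le> 32/100" by (simp add: power_divide)
      finally show ?thesis using False zm(2) by (simp add: hat_def)
    qed
  qed auto
  thus ?thesis by simp
qed

text \<open>Self-similarity: division by \<open>lam n\<close> identifies the \<open>m\<close>-step
  preimages in the inner disc with the one-step preimages at the next level. None is lost, because a
  rescaled preimage outside radius 3 would have its image outside radius 3 as well.\<close>

lemma push_m_near:
  assumes y: "norm y < 3 * norm (lam n)"
  shows "push g (Suc K) n m y = 52 * (\<Sum>\<zeta>\<in>Fib K (Suc n) (y / lam n). wt (Suc n) \<zeta> * g \<zeta>)"
proof -
  have l0: "lam n \<noteq> 0" by (rule L.lam0)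
  have inj: "inj_on (\<lambda>\<zeta>. lam n * \<zeta>) A" for A using l0 by (auto intro: inj_onI)
  have ynorm: "norm (y / lam n) < 3" by (rule Z0_image[OF y])
  have eq: "Z (Suc K) n m y = (\<lambda>\<zeta>. lam n * \<zeta>) ` Fib K (Suc n) (y / lam n)"
  proof (intro equalityI subsetI)
    fix x assume x: "x \<in> Z (Suc K) n m y"
    define \<zeta> where "\<zeta> = x / lam n"
    note zm = Z_m[OF x, folded \<zeta>_def]
    have "norm \<zeta> < 3"
    proof (rule ccontr)
      assume "\<not> norm \<zeta> < 3"
      hence "3\<^sup>2 \<le> (norm \<zeta>)\<^sup>2" by (intro power_mono) auto
      moreover have cl: "norm (F (Suc n) \<zeta> - (L.nxt n 0 + \<zeta>\<^sup>2)) \<le> (1/100) * (norm \<zeta>)\<^sup>2"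
        using L.f1_close[of n \<zeta>] zm(5) by (simp add: f1_F)
      moreover have "(norm \<zeta>)\<^sup>2 \<le> norm (F (Suc n) \<zeta> - (L.nxt n 0 + \<zeta>\<^sup>2)) + norm (F (Suc n) \<zeta>) + norm (L.nxt n 0)"
        using norm_triangle_ineq4[of "F (Suc n) \<zeta> - L.nxt n 0" "F (Suc n) \<zeta> - (L.nxt n 0 + \<zeta>\<^sup>2)"]
          norm_triangle_ineq4[of "F (Suc n) \<zeta>" "L.nxt n 0"] by (simp add: norm_power)
      ultimately have "(99/100) * 9 \<le> norm (F (Suc n) \<zeta>) + norm (L.nxt n 0)" by simp
      moreover have "norm (F (Suc n) \<zeta>) < 3" using ynorm zm(1) by simp
      ultimately show False using L.nxt0[of n] by simp
    qed
    moreover have "dl K (Suc n) \<le> norm \<zeta>"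
      using zm(4) lam_pos[of n] by (simp add: \<zeta>_def dl_Suc norm_divide field_simps)
    ultimately have "\<zeta> \<in> Fib K (Suc n) (y / lam n)" using zm(1) by (simp add: Fib_def)
    moreover have "x = lam n * \<zeta>" using l0 by (simp add: \<zeta>_def)
    ultimately show "x \<in> (\<lambda>\<zeta>. lam n * \<zeta>) ` Fib K (Suc n) (y / lam n)" by blast
  next
    fix x assume "x \<in> (\<lambda>\<zeta>. lam n * \<zeta>) ` Fib K (Suc n) (y / lam n)"
    then obtain \<zeta> where z: "x = lam n * \<zeta>" "norm \<zeta> < 3" "dl K (Suc n) \<le> norm \<zeta>" "F (Suc n) \<zeta> = y / lam n"
      by (auto simp: Fib_def)
    have "norm x < 3 * norm (lam n)" using z lam_pos[of n] by (simp add: norm_mult)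
    hence "norm x < L.rr n" using lam_rr3[of n] by linarith
    moreover have "dl (Suc K) n \<le> norm x" using z by (simp add: dl_Suc norm_mult mult_left_mono)
    moreover have "(F n ^^ m) x = y" using z l0 by (simp add: F_Suc)
    ultimately show "x \<in> Z (Suc K) n m y" by (simp add: Z_def)
  qed
  have "push g (Suc K) n m y = (\<Sum>\<zeta>\<in>Fib K (Suc n) (y / lam n). W n m (lam n * \<zeta>) * hat g n (lam n * \<zeta>))"
    unfolding push_def eq by (subst sum.reindex[OF inj]) simp
  also have "\<dots> = (\<Sum>\<zeta>\<in>Fib K (Suc n) (y / lam n). 52 * (wt (Suc n) \<zeta> * g \<zeta>))"
  proof (rule sum.cong[OF refl])
    fix \<zeta> assume "\<zeta> \<in> Fib K (Suc n) (y / lam n)"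
    hence "norm \<zeta> < 3" by (simp add: Fib_def)
    hence "hat g n (lam n * \<zeta>) = 52 * g \<zeta>" using l0 lam_pos[of n] by (simp add: hat_def norm_mult)
    moreover have "W n m (lam n * \<zeta>) = wt (Suc n) \<zeta>" using l0 by (simp add: W_def wt_def F_Suc_deriv)
    ultimately show "W n m (lam n * \<zeta>) * hat g n (lam n * \<zeta>) = 52 * (wt (Suc n) \<zeta> * g \<zeta>)" by simp
  qed
  finally show ?thesis by (simp add: sum_distrib_left)
qed

text \<open>One transfer turns the base weight into at most \<open>(4/5) bg\<close> plus the first
  pushed term, and shifts the other pushed terms by one. What remains is
  \<open>1/200 + (4/5) bg + P m <= base\<close>. Outside the innermost disc this is numerical;
  inside it is the same inequality at the next level, multiplied by 52.\<close>

lemma rho_super: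
  assumes "norm y < 3"
  shows "1/200 + (\<Sum>x\<in>Fib K n y. wt n x * rho K n x) \<le> rho K n y"
  using assms
proof (induction K arbitrary: n y)
  case 0
  have "{x\<in>Fib 0 n y. L.rr n \<le> norm x} = Fib 0 n y"
    using L.rr(2)[of n] by (auto simp: Fib_def dl_def Lam_0)
  hence "(\<Sum>x\<in>Fib 0 n y. wt n x * L.bg n x) \<le> (4/5) * L.bg n y" using bg_sum[where K=0 and n=n and y=y] by simp
  moreover have "L.bg n y \<ge> 1/14" by (rule L.bg_ge[OF 0])
  ultimately show ?case by simp
next
  case (Suc K)
  define g where "g = rho K (Suc n)"
  have g0: "g y \<ge> 0" for y by (simp add: g_def rho_nonneg)
  define base where "base = (\<lambda>y. if norm y < L.rr n then hat g n y else L.bg n y)"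
  define P where "P = (\<lambda>i y. push g (Suc K) n i y)"
  have rho: "rho (Suc K) n y = base y + (\<Sum>i=1..<m. P i y)" for y
    by (simp add: base_def g_def P_def)
  let ?Fib = "Fib (Suc K) n y"
  have m2: "2 < m" by (rule L.m)
  have rr3: "L.rr n < 3" using L.rr(2)[of n] by simp
  have S1: "(\<Sum>x\<in>?Fib. wt n x * base x) =
     (\<Sum>x\<in>{x\<in>?Fib. L.rr n \<le> norm x}. wt n x * L.bg n x) + P 1 y"
  proof -
    have "(\<Sum>x\<in>?Fib. wt n x * base x) = (\<Sum>x\<in>{x\<in>?Fib. L.rr n \<le> norm x}. wt n x * base x)
        + (\<Sum>x\<in>{x\<in>?Fib. \<not> L.rr n \<le> norm x}. wt n x * base x)"
      by (subst sum.union_disjoint[symmetric]) (auto simp: finite_Fib intro!: sum.cong)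
    moreover have "(\<Sum>x\<in>{x\<in>?Fib. L.rr n \<le> norm x}. wt n x * base x) = (\<Sum>x\<in>{x\<in>?Fib. L.rr n \<le> norm x}. wt n x * L.bg n x)"
      by (intro sum.cong) (auto simp: base_def)
    moreover have "(\<Sum>x\<in>{x\<in>?Fib. \<not> L.rr n \<le> norm x}. wt n x * base x) = P 1 y"
      unfolding P_def push_def using rr3 by (intro sum.cong) (auto simp: base_def Fib_def Z_def W_1[unfolded One_nat_def])
    ultimately show ?thesis by simp
  qed
  have "(\<Sum>x\<in>?Fib. wt n x * rho (Suc K) n x) = (\<Sum>x\<in>?Fib. wt n x * base x) + (\<Sum>i=1..<m. \<Sum>x\<in>?Fib. wt n x * P i x)"
  proof -
    have "(\<Sum>x\<in>?Fib. W1 x * (base x + (\<Sum>i=1..<m. P i x))) = (\<Sum>x\<in>?Fib. W1 x * base x) + (\<Sum>i=1..<m. \<Sum>x\<in>?Fib. W1 x * P i x)"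
      for W1 :: "complex \<Rightarrow> real"
      unfolding distrib_left sum.distrib sum_distrib_left by (subst (2) sum.swap) (rule refl)
    thus ?thesis by (simp only: rho)
  qed
  also have "(\<Sum>i=1..<m. \<Sum>x\<in>?Fib. wt n x * P i x) \<le> (\<Sum>i=1..<m. P (Suc i) y)"
    unfolding P_def by (intro sum_mono push_step g0) auto
  also have "(\<Sum>i=1..<m. P (Suc i) y) = (\<Sum>i=2..<Suc m. P i y)"
    using sum.shift_bounds_Suc_ivl[of "\<lambda>i. P i y" 1 m] by (simp add: numeral_2_eq_2)
  also have "\<dots> = (\<Sum>i=2..<m. P i y) + P m y" using m2 by (simp add: sum.atLeastLessThan_Suc)
  finally have "(\<Sum>x\<in>?Fib. wt n x * rho (Suc K) n x)
      \<le> (\<Sum>x\<in>?Fib. wt n x * base x) + ((\<Sum>i=2..<m. P i y) + P m y)" by simp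
  moreover have "(\<Sum>i=1..<m. P i y) = P 1 y + (\<Sum>i=2..<m. P i y)"
    using m2 by (simp add: sum.atLeast_Suc_lessThan numeral_2_eq_2)
  ultimately have main: "(\<Sum>x\<in>?Fib. wt n x * rho (Suc K) n x)
      \<le> (4/5) * L.bg n y + P m y + (\<Sum>i=1..<m. P i y)"
    using S1 bg_sum[where K="Suc K" and n=n and y=y] by simp
  have "1/200 + (4/5) * L.bg n y + P m y \<le> base y"
  proof (cases "norm y < L.rr n")
    case False
    hence "P m y \<le> 1/200" unfolding P_def by (intro push_m_far) auto
    moreover have "L.bg n y \<ge> 1/14" by (rule L.bg_ge[OF Suc.prems])
    ultimately show ?thesis using False by (simp add: base_def)
  next
    case True
    have b: "(4/5) * L.bg n y \<le> 1/4" using L.bg_small[OF True] by simp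
    show ?thesis
    proof (cases "norm y < 3 * norm (lam n)")
      case near: True
      have "1/200 + (\<Sum>\<zeta>\<in>Fib K (Suc n) (y / lam n). wt (Suc n) \<zeta> * g \<zeta>) \<le> g (y / lam n)"
        unfolding g_def by (rule Suc.IH[OF Z0_image[OF near]])
      hence "52/200 + P m y \<le> 52 * g (y / lam n)"
        unfolding P_def push_m_near[OF near] by simp
      thus ?thesis using b True near by (simp add: base_def hat_def)
    next
      case far: False
      have "P m y \<le> 64" unfolding P_def
        by (rule push_m_mid) (use far rho_outer outer_bg in \<open>auto simp: g_def\<close>)
      thus ?thesis using b True far by (simp add: base_def hat_def)
    qed
  qed
  thus ?case using main rho[of y] by linarith
qed

text \<open>Rescaled to level \<open>n + k\<close>, the points of this ring escape at once and stay
  away from both zeros of \<open>y^2 - beta^2\<close>, so the weight there is at most 1. Each level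
  passed on the way multiplies it by 52, whatever the cut-off.\<close>

lemma rho_ring:
  assumes "(14/5) * norm (Lam n k) \<le> norm y" "norm y < 3 * norm (Lam n k)"
  shows "rho (k + K) n y \<le> 52 ^ k"
  using assms
proof (induction k arbitrary: n y)
  case 0
  hence y: "14/5 \<le> norm y" "norm y < 3" by (auto simp: Lam_0)
  have "(14/5)\<^sup>2 \<le> (norm y)\<^sup>2" using y by (intro power_mono) auto
  moreover have "norm (F n y) \<ge> (norm y)\<^sup>2 - 59/25" using y by (intro L.f_lower) auto
  ultimately have F: "norm (F n y) \<ge> 21/4" by (simp add: power2_eq_square)
  have n16: "norm (y\<^sup>2) \<le> 16" "norm ((L.beta n)\<^sup>2) \<le> 16"
    using y L.beta_norm(1)[of n] by (auto intro!: L.norm_sq16)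
  have "norm (F n y - L.beta n) \<le> (501/500) * norm (y\<^sup>2 - (L.beta n)\<^sup>2)"
  proof -
    have "norm (\<psi> n (y\<^sup>2) - \<psi> n ((L.beta n)\<^sup>2)) \<le> (501/500) * norm (y\<^sup>2 - (L.beta n)\<^sup>2)"
      by (rule L.lip_upper[OF n16])
    thus ?thesis using L.beta(2)[of n] by (simp add: qm_def)
  qed
  moreover have "norm (F n y - L.beta n) \<ge> 3"
    using norm_triangle_ineq2[of "F n y" "L.beta n"] L.beta_norm(1)[of n] F by linarith
  ultimately have "norm (y\<^sup>2 - (L.beta n)\<^sup>2) \<ge> 1" by linarith
  from L.bg_le'[OF _ this] have "L.bg n y \<le> 1" by simp
  thus ?case using rho_outer[of y n] y F by simp
next
  case (Suc k)
  let ?l = "norm (lam n)"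
  have l: "?l > 0" by (rule lam_pos)
  have "norm y < 3 * (?l * norm (Lam (Suc n) k))" using Suc.prems by (simp add: Lam_Suc norm_mult)
  also have "\<dots> \<le> 3 * (?l * 1)" using Lam_le_1 l by (intro mult_left_mono) auto
  finally have y3: "norm y < 3 * ?l" by simp
  hence yr: "norm y < L.rr n" using lam_rr3[of n] by linarith
  have yd: "norm (y / lam n) = norm y / ?l" by (simp add: norm_divide)
  have "rho (k + K) (Suc n) (y / lam n) \<le> 52 ^ k"
  proof (rule Suc.IH)
    show "(14/5) * norm (Lam (Suc n) k) \<le> norm (y / lam n)" "norm (y / lam n) < 3 * norm (Lam (Suc n) k)"
      unfolding yd using Suc.prems l by (simp_all add: Lam_Suc norm_mult field_simps)
  qed
  moreover have "(\<Sum>i=1..<m. push (rho (k+K) (Suc n)) (Suc (k+K)) n i y) = 0"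
    using yr L.rr(2)[of n] by (intro sum.neutral ballI push_zero_small) auto
  ultimately show ?case using y3 yr by (simp add: hat_def)
qed


section \<open>The critical orbit and bounds for the weight away from it\<close>

lemma F_Suc_pow: "(F n ^^ (m * i)) (lam n * z) = lam n * (F (Suc n) ^^ i) z"
proof (induction i)
  case (Suc i)
  have "(F n ^^ (m * Suc i)) (lam n * z) = (F n ^^ m) ((F n ^^ (m * i)) (lam n * z))"
    by (simp add: funpow_add)
  also have "\<dots> = lam n * F (Suc n) ((F (Suc n) ^^ i) z)"
    unfolding Suc F_Suc using L.lam0[of n] by simp
  finally show ?case by simp
qed simp

text \<open>Write the time as \<open>r + m q\<close>. The first \<open>m q\<close> steps are
  \<open>q\<close> steps at the next level, with \<open>q\<close> smaller, and the last
  \<open>r\<close> steps shadow the critical orbit.\<close>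

lemma crit_orbit_bd: "norm ((F n ^^ i) 0) \<le> 29/10"
proof (induction i arbitrary: n rule: less_induct)
  case (less i)
  have m2: "2 < m" by (rule L.m)
  define q r where "q = i div m" and "r = i mod m"
  have i: "i = r + m * q" by (simp add: q_def r_def)
  have "(F n ^^ (m * q)) 0 = lam n * (F (Suc n) ^^ q) 0" using F_Suc_pow[where n=n and i=q and z=0] by simp
  hence e: "(F n ^^ i) 0 = (F n ^^ r) (lam n * (F (Suc n) ^^ q) 0)" unfolding i funpow_add by simp
  have q29: "norm ((F (Suc n) ^^ q) 0) \<le> 29/10"
  proof (cases "q = 0")
    case False
    hence "q < i" unfolding i using m2 by (metis One_nat_def Suc_lessD bot_nat_0.not_eq_extremum less_le_trans le_add2 n_less_m_mult_n numeral_2_eq_2)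
    thus ?thesis by (rule less)
  qed simp
  have u: "norm (lam n * (F (Suc n) ^^ q) 0) \<le> 3 * norm (lam n)"
    using q29 mult_left_mono[OF q29, of "norm (lam n)"] lam_pos[of n] by (simp add: norm_mult)
  show ?case
  proof (cases "r = 0")
    case True
    thus ?thesis using e u lam_le[of n] by simp
  next
    case False
    have "r < m" using m2 by (simp add: r_def)
    thus ?thesis unfolding e using False u lam_rr3[of n]
      by (intro L.inner_bd'[OF L.small_inner]) auto
  qed
qed

text \<open>Division by the tiny \<open>lam n\<close> more than compensates the Lipschitz constant
  of \<open>F^i\<close> on the inner disc, so the distance to the critical orbit at least doubles
  with every descent by one level.\<close>

lemma away_scale:
  assumes d: "\<And>i. i \<ge> 1 \<Longrightarrow> d \<le> norm (y - (F n ^^ i) 0)" and "d \<ge> 0" and i: "i < m"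
    and x: "norm x \<le> 3 * norm (lam n)" "(F n ^^ i) x = y" and l: "l \<ge> 1"
  shows "2 * d \<le> norm (x / lam n - (F (Suc n) ^^ l) 0)"
proof -
  define p where "p = (F (Suc n) ^^ l) 0"
  have lp: "lam n * p = (F n ^^ (m * l)) 0" using F_Suc_pow[where n=n and i=l and z=0] by (simp add: p_def)
  have p3: "norm (lam n * p) \<le> 3 * norm (lam n)"
    using mult_left_mono[OF crit_orbit_bd[where n="Suc n" and i=l], of "norm (lam n)"] lam_pos[of n]
    by (simp add: norm_mult p_def)
  have "i + m * l \<ge> 1" using l L.m by (simp add: Suc_le_eq)
  hence "d \<le> norm (y - (F n ^^ (i + m * l)) 0)" by (rule d)
  also have "(F n ^^ (i + m * l)) 0 = (F n ^^ i) (lam n * p)" by (simp add: funpow_add lp)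
  finally have D: "d \<le> norm ((F n ^^ i) x - (F n ^^ i) (lam n * p))" by (simp add: x(2))
  have "d \<le> 10 * norm (x - lam n * p)"
  proof (cases "i = 0")
    case True thus ?thesis using D by (simp add: order_trans)
  next
    case False
    have "norm ((F n ^^ i) x - (F n ^^ i) (lam n * p)) \<le> (21/10) * ((3 * norm (lam n)) / norm (lam n)) * norm (x - lam n * p)"
      using False i lam_rr3[of n] x p3 by (intro L.fi_lip) auto
    also have "\<dots> \<le> 10 * norm (x - lam n * p)" using lam_pos[of n] by simp
    finally show ?thesis using D by linarith
  qed
  moreover have "norm (x - lam n * p) = norm (lam n) * norm (x / lam n - p)"
  proof -
    have "x - lam n * p = lam n * (x / lam n - p)" using L.lam0[of n] by (simp add: right_diff_distrib)
    thus ?thesis by (simp only: norm_mult)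
  qed
  moreover have "norm (lam n) * norm (x / lam n - p) \<le> (1/20) * norm (x / lam n - p)"
    using lam_le[of n] by (intro mult_right_mono) auto
  ultimately show ?thesis unfolding p_def by linarith
qed

text \<open>Induction over dyadic distances: a descent by one level doubles the distance to the
  critical orbit, and no point of the disc has distance 6 from it. So only boundedly many levels
  contribute, and the bound is uniform in \<open>n\<close> and \<open>K\<close>.\<close>

lemma rho_away:
  "\<exists>M\<ge>0. \<forall>n K y. norm y < 3 \<longrightarrow> (\<forall>i\<ge>1. 6 / 2 ^ j \<le> norm (y - (F n ^^ i) 0)) \<longrightarrow> rho K n y \<le> M"
proof (induction j)
  case 0
  have False if "norm y < 3" "\<forall>i\<ge>1. 6 / 2 ^ 0 \<le> norm (y - (F n ^^ i) 0)" for y n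
  proof -
    have "6 \<le> norm (y - (F n ^^ 1) 0)" using that(2) by auto
    also have "\<dots> \<le> norm y + norm ((F n ^^ 1) 0)" by (rule norm_triangle_ineq4)
    also have "\<dots> < 6" using that(1) crit_orbit_bd[where n=n and i=1] by linarith
    finally show False by simp
  qed
  thus ?case by blast
next
  case (Suc j)
  then obtain M where M0: "M \<ge> 0" and M: "\<And>n K y. norm y < 3 \<Longrightarrow> (\<And>i. i \<ge> 1 \<Longrightarrow> 6 / 2 ^ j \<le> norm (y - (F n ^^ i) 0)) \<Longrightarrow> rho K n y \<le> M"
    by blast
  define d :: real where "d = 6 / 2 ^ Suc j"
  have d0: "d > 0" and d2: "2 * d = 6 / 2 ^ j" by (auto simp: d_def)
  \<comment> \<open>An inner point with \<open>|x| < \<epsilon>\<close> would arrive within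
    \<open>d\<close> of the critical orbit; by \<open>lam_lower\<close> the power \<open>6^m\<close>
    controls \<open>1 / |lam|\<close>.\<close>
  define \<epsilon> where "\<epsilon> = d / (3 * 6 ^ m)"
  have e0: "\<epsilon> > 0" using d0 by (simp add: \<epsilon>_def)
  define V where "V = \<epsilon> powr (-7/4)"
  define H where "H = 100 + 52 * M"
  define M' where "M' = H + 6 ^ m + real m * (2 * (V * H))"
  have H0: "H \<ge> 0" "V \<ge> 0" using M0 by (auto simp: H_def V_def)
  have "rho K n y \<le> M'" if y: "norm y < 3" and A: "\<forall>i\<ge>1. 6 / 2 ^ Suc j \<le> norm (y - (F n ^^ i) 0)" for K n y
  proof -
    have A': "\<And>i. i \<ge> 1 \<Longrightarrow> d \<le> norm (y - (F n ^^ i) 0)" using A by (simp add: d_def)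
    have bg: "L.bg n y \<le> 6 ^ m"
    proof -
      have "L.nu n ^ 36 \<le> L.nu n ^ 35" using L.nu[of n] by (intro power_decreasing) auto
      hence "1 / 6 ^ m \<le> L.nu n ^ 35" using L.lam_lower[of n] L.nu(1)[of n] by simp
      hence "1 / L.nu n ^ 35 \<le> 6 ^ m" using L.nu_pow_pos[where n=n and k=35] by (simp add: field_simps)
      thus ?thesis using L.bg_le[of n y] by linarith
    qed
    show ?thesis
    proof (cases K)
      case 0
      have "0 \<le> real m * (2 * (V * H))" using H0 by simp
      moreover have "rho K n y = L.bg n y" using 0 by simp
      ultimately show ?thesis unfolding M'_def using bg H0(1) by linarith
    next
      case (Suc K')
      let ?g = "rho K' (Suc n)"
      have hat: "hat ?g n x \<le> H" if x: "(F n ^^ i) x = y" "i < m" for x i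
      proof (cases "norm x < 3 * norm (lam n)")
        case True
        have "rho K' (Suc n) (x / lam n) \<le> M"
        proof (rule M[OF Z0_image[OF True]])
          fix l :: nat assume "l \<ge> 1"
          hence "2 * d \<le> norm (x / lam n - (F (Suc n) ^^ l) 0)"
            using A' d0 x True by (intro away_scale[of d y n i]) auto
          thus "6 / 2 ^ j \<le> norm (x / lam n - (F (Suc n) ^^ l) 0)" by (simp add: d2)
        qed
        thus ?thesis using True by (simp add: hat_def H_def)
      qed (use M0 in \<open>simp add: hat_def H_def\<close>)
      have "(if norm y < L.rr n then hat ?g n y else L.bg n y) \<le> H + 6 ^ m"
        using bg hat[of 0 y] H0 L.m L.bg_pos[of n y] by auto
      moreover have "(\<Sum>i=1..<m. push ?g (Suc K') n i y) \<le> real m * (2 * (V * H))"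
      proof -
        have "push ?g (Suc K') n i y \<le> 2 * (V * H)" if i: "i \<in> {1..<m}" for i
        proof -
          obtain x0 where x0: "Z (Suc K') n i y \<subseteq> {x0, - x0}" using Z_two[of i "Suc K'" n y] i by auto
          show ?thesis unfolding push_def
          proof (rule sum_le_card_two[OF x0])
            fix x assume "x \<in> Z (Suc K') n i y"
            hence x: "norm x < L.rr n" "(F n ^^ i) x = y" by (auto simp: Z_def)
            have "d \<le> norm ((F n ^^ i) x - (F n ^^ i) 0)" using A'[of i] i x by simp
            also have "\<dots> \<le> (21/10) * (L.rr n / norm (lam n)) * norm (x - 0)"
              using i x L.rr(1)[of n] by (intro L.fi_lip) auto
            also have "\<dots> \<le> (3 * 6 ^ m) * norm x"
            proof -
              have "L.rr n / norm (lam n) \<le> 1 / norm (lam n)"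
                using L.rr(2)[of n] lam_pos[of n] by (intro divide_right_mono) auto
              also have "\<dots> \<le> 6 ^ m" using L.lam_lower[of n] lam_pos[of n] by (simp add: field_simps)
              finally have "(21/10) * (L.rr n / norm (lam n)) \<le> 3 * 6 ^ m"
                using zero_le_power[of "6::real" m] by linarith
              from mult_right_mono[OF this norm_ge_zero[of x]] show ?thesis by (simp only: diff_zero)
            qed
            finally have "\<epsilon> \<le> norm x" by (simp add: \<epsilon>_def field_simps)
            moreover have "norm x \<le> norm (deriv (F n ^^ i) x)"
              using i x by (intro L.fi_deriv_lower) auto
            ultimately have "W n i x \<le> V" unfolding W_def V_def using e0 by (intro powr_mono2') auto
            thus "W n i x * hat ?g n x \<le> V * H"
              using hat[OF x(2)] i H0 W_nonneg by (intro mult_mono) (auto intro: hat_nonneg rho_nonneg)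
          qed (use H0 in auto)
        qed
        hence "(\<Sum>i=1..<m. push ?g (Suc K') n i y) \<le> (\<Sum>i=1..<m. 2 * (V * H))" by (intro sum_mono)
        also have "\<dots> = real (m - 1) * (2 * (V * H))" by simp
        also have "\<dots> \<le> real m * (2 * (V * H))" using H0 by (intro mult_right_mono) auto
        finally show ?thesis .
      qed
      ultimately show ?thesis using Suc by (simp add: M'_def)
    qed
  qed
  moreover have "M' \<ge> 0" using H0 by (simp add: M'_def)
  ultimately show ?case by blast
qed

section \<open>The truncated Poincare series\<close>

definition A where "A K j y = {x. (F 0 ^^ j) x = y \<and> (\<forall>i<j. norm ((F 0 ^^ i) x) < 3 \<and> dl K 0 \<le> norm ((F 0 ^^ i) x))}"

lemma A_Suc: "A K (Suc j) y = (\<Union>u\<in>Fib K 0 y. A K j u)"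
  by (auto simp: A_def Fib_def less_Suc_eq)

lemma finite_A: "finite (A K j y)"
proof (induction j arbitrary: y)
  case 0
  have "A K 0 y \<subseteq> {y}" by (auto simp: A_def)
  thus ?case by (rule finite_subset) simp
next
  case (Suc j) thus ?case unfolding A_Suc using finite_Fib by blast
qed

text \<open>The supersolution inequality iterated: the term 1 for \<open>j = 0\<close> is paid by
  200 times the gain 1/200, the rest by induction at the preimages.\<close>

lemma poincare:
  assumes "norm y < 3"
  shows "(\<Sum>j<N. \<Sum>x\<in>A K j y. W 0 j x) \<le> 200 * rho K 0 y"
  using assms
proof (induction N arbitrary: y)
  case 0 thus ?case using rho_nonneg by simp
next
  case (Suc N)
  have "A K 0 y = {y}" by (auto simp: A_def)
  hence "(\<Sum>x\<in>A K 0 y. W 0 0 x) = 1" by (simp add: W_def id_def)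
  moreover have "(\<Sum>j<N. \<Sum>x\<in>A K (Suc j) y. W 0 (Suc j) x) = (\<Sum>u\<in>Fib K 0 y. wt 0 u * (\<Sum>j<N. \<Sum>x\<in>A K j u. W 0 j x))"
  proof -
    have "(\<Sum>x\<in>A K (Suc j) y. W 0 (Suc j) x) = (\<Sum>u\<in>Fib K 0 y. wt 0 u * (\<Sum>x\<in>A K j u. W 0 j x))" for j
    proof -
      have "(\<Sum>x\<in>A K (Suc j) y. W 0 (Suc j) x) = (\<Sum>u\<in>Fib K 0 y. \<Sum>x\<in>A K j u. W 0 (Suc j) x)"
        unfolding A_Suc using finite_Fib finite_A by (intro sum.UNION_disjoint) (auto simp: A_def)
      also have "\<dots> = (\<Sum>u\<in>Fib K 0 y. wt 0 u * (\<Sum>x\<in>A K j u. W 0 j x))"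
        unfolding sum_distrib_left by (intro sum.cong refl) (auto simp: W_Suc A_def)
      finally show ?thesis .
    qed
    thus ?thesis by (simp add: sum_distrib_left sum.swap[of _ "{..<N}"])
  qed
  moreover have "(\<Sum>u\<in>Fib K 0 y. wt 0 u * (\<Sum>j<N. \<Sum>x\<in>A K j u. W 0 j x)) \<le> (\<Sum>u\<in>Fib K 0 y. wt 0 u * (200 * rho K 0 u))"
    using Suc.IH by (intro sum_mono mult_left_mono wt_nonneg) (auto simp: Fib_def)
  moreover have "(\<Sum>u\<in>Fib K 0 y. wt 0 u * (200 * rho K 0 u)) = 200 * (\<Sum>u\<in>Fib K 0 y. wt 0 u * rho K 0 u)"
    by (simp add: sum_distrib_left mult_ac)
  ultimately show ?case using rho_super[OF Suc.prems, where K=K and n=0]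
    by (simp add: sum.lessThan_Suc_shift del: sum.lessThan_Suc)
qed

end

section \<open>Coverings and Hausdorff measure\<close>

text \<open>A separation \<open>A\<close>, \<open>B\<close> with 0 in \<open>A\<close> can be made
  symmetric by shrinking \<open>A\<close> to \<open>C\<close> and enlarging \<open>B\<close> to
  \<open>E\<close>. Symmetric disjoint sets have disjoint squares, so \<open>Y\<close> would be
  separated.\<close>

lemma sq_preimage_connected:
  fixes Y :: "complex set"
  assumes Y: "compact Y" "connected Y" "0 \<in> Y"
  shows "connected {z. z\<^sup>2 \<in> Y}"
proof -
  let ?S = "{z. z\<^sup>2 \<in> Y}"
  have clS: "closed ?S"
  proof -
    have "closed ((\<lambda>z. z\<^sup>2) -` Y)" using Y by (intro closed_vimage continuous_intros compact_imp_closed)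
    thus ?thesis by (simp add: vimage_def)
  qed
  have bS: "bounded ?S"
  proof -
    obtain B where B: "\<And>y. y \<in> Y \<Longrightarrow> norm y \<le> B" using compact_imp_bounded[OF Y(1)] by (auto simp: bounded_iff)
    have "norm z \<le> 1 + B" if "z \<in> ?S" for z
    proof -
      have zz: "norm z * norm z \<le> B" using B[of "z\<^sup>2"] that by (simp add: norm_mult power2_eq_square)
      show ?thesis
      proof (cases "norm z \<le> 1")
        case True
        have "0 \<le> norm z * norm z" by simp
        thus ?thesis using zz True by linarith
      next
        case False
        hence "norm z * 1 \<le> norm z * norm z" by (intro mult_left_mono) auto
        thus ?thesis using zz by simp
      qed
    qed
    thus ?thesis by (auto simp: bounded_iff)
  qed
  have False if AB: "closed A" "closed B" "B \<noteq> {}" "A \<union> B = ?S" "A \<inter> B = {}" "0 \<in> A" for A B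
  proof -
    define C where "C = A \<inter> uminus ` A"
    define E where "E = B \<union> uminus ` B"
    have m: "z \<in> uminus ` X \<longleftrightarrow> - z \<in> X" for z :: complex and X by (metis image_iff minus_minus)
    have nS: "- z \<in> ?S \<longleftrightarrow> z \<in> ?S" for z by simp
    have cA: "closed (uminus ` A)" "closed (uminus ` B)" using AB closed_negations by blast+
    have cC: "compact C" "compact E"
    proof -
      have "C \<subseteq> ?S" "E \<subseteq> ?S" using AB(4) nS m unfolding C_def E_def by blast+
      thus "compact C" "compact E" using bS AB cA
        by (auto simp: compact_eq_bounded_closed C_def E_def intro: bounded_subset)
    qed
    have un: "C \<union> E = ?S"
    proof (intro equalityI subsetI)
      fix z assume "z \<in> ?S"
      hence "z \<in> A \<union> B" "- z \<in> A \<union> B" using AB(4) nS by blast+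
      thus "z \<in> C \<union> E" by (auto simp: C_def E_def m)
    next
      fix z assume "z \<in> C \<union> E"
      thus "z \<in> ?S" using AB(4) nS m unfolding C_def E_def by blast
    qed
    have dis: "C \<inter> E = {}" using AB(5) by (auto simp: C_def E_def m)
    let ?q = "\<lambda>z::complex. z\<^sup>2"
    have "?q ` C \<union> ?q ` E = Y"
    proof -
      have "?q ` ?S = Y"
      proof (intro equalityI subsetI)
        fix y assume "y \<in> Y"
        thus "y \<in> ?q ` ?S" by (intro image_eqI[of _ _ "csqrt y"]) auto
      qed auto
      thus ?thesis using un by (metis image_Un)
    qed
    moreover have "?q ` C \<inter> ?q ` E = {}"
    proof -
      have False if "z \<in> C" "u \<in> E" "z\<^sup>2 = u\<^sup>2" for z u
      proof -
        have "u = z \<or> u = - z" using that(3) by (auto simp: power2_eq_iff)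
        moreover have "- z \<in> C" using that(1) by (auto simp: C_def m)
        ultimately have "u \<in> C" using that(1) by auto
        thus False using dis that(2) by blast
      qed
      thus ?thesis by blast
    qed
    moreover have "closed (?q ` C)" "closed (?q ` E)"
      using cC by (auto intro!: compact_imp_closed compact_continuous_image continuous_intros)
    moreover have "?q ` C \<noteq> {}" "?q ` E \<noteq> {}" using AB by (auto simp: C_def E_def m)
    ultimately show False
      using Y(2) connected_closed_set[OF compact_imp_closed[OF Y(1)]] by blast
  qed
  moreover have "0 \<in> ?S" using Y by simp
  ultimately show ?thesis unfolding connected_closed_set[OF clS] by (metis UnE Un_commute Int_commute)
qed

text \<open>Bounding the Taylor coefficients of all the functions at once replaces a distortion theorem.\<close>

lemma sum_norm_interior_bound:
  fixes h :: "'i \<Rightarrow> complex \<Rightarrow> complex"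
  assumes I: "finite I" and h: "\<And>i. i \<in> I \<Longrightarrow> h i holomorphic_on ball y R" and r: "0 < r" "r < R"
    and M: "\<And>w. norm (w - y) = r \<Longrightarrow> (\<Sum>i\<in>I. norm (h i w)) \<le> M"
    and \<theta>: "0 \<le> \<theta>" "\<theta> < 1" and w: "\<And>i. i \<in> I \<Longrightarrow> norm (w i - y) \<le> \<theta> * r"
  shows "(\<Sum>i\<in>I. norm (h i (w i))) \<le> M / (1 - \<theta>)"
proof -
  define a where "a = (\<lambda>i k. (deriv ^^ k) (h i) y / fact k)"
  have M0: "M \<ge> 0"
  proof -
    have "norm ((y + of_real r) - y) = r" using r by simp
    from M[OF this] show ?thesis by (meson order_trans sum_nonneg norm_ge_zero)
  qed
  have coeff: "(\<Sum>i\<in>I. norm (a i k)) \<le> M / r ^ k" for k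
  proof -
    \<comment> \<open>These factors of modulus at most 1 align the coefficients of order
      \<open>k\<close>, so the sum of their moduli becomes a single Taylor coefficient of
      \<open>H\<close>, to which Cauchy applies.\<close>
    define e where "e = (\<lambda>i. cnj (sgn (a i k)))"
    have ne: "norm (e i) \<le> 1" for i by (simp add: e_def norm_sgn)
    have ea: "e i * a i k = of_real (norm (a i k))" for i
    proof (cases "a i k = 0")
      case False
      have "cnj (a i k) * a i k = of_real (norm (a i k)) * of_real (norm (a i k))"
        using complex_norm_square[of "a i k"] by (simp add: power2_eq_square mult.commute)
      thus ?thesis using False by (simp add: e_def sgn_eq)
    qed (simp add: e_def)
    define H where "H = (\<lambda>w. \<Sum>i\<in>I. e i * h i w)"
    have hd: "(deriv ^^ k) (\<lambda>w. \<Sum>i\<in>J. e i * h i w) y = (\<Sum>i\<in>J. e i * (deriv ^^ k) (h i) y)" if "J \<subseteq> I" for J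
      using finite_subset[OF that I] that
    proof (induction J rule: finite_induct)
      case (insert j J)
      have "(deriv ^^ k) (\<lambda>w. e j * h j w + (\<Sum>i\<in>J. e i * h i w)) y =
         (deriv ^^ k) (\<lambda>w. e j * h j w) y + (deriv ^^ k) (\<lambda>w. \<Sum>i\<in>J. e i * h i w) y"
        using insert h r by (intro higher_deriv_add[where S="ball y R"] holomorphic_intros) auto
      also have "(deriv ^^ k) (\<lambda>w. e j * h j w) y = e j * (deriv ^^ k) (h j) y"
        using insert h r by (intro higher_deriv_cmult[where A="ball y R"]) auto
      finally show ?case using insert by simp
    qed simp
    have hH: "H holomorphic_on ball y R" unfolding H_def using h by (intro holomorphic_intros)
    have "norm ((deriv ^^ k) H y) \<le> fact k * M / r ^ k"
    proof (rule Cauchy_inequality)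
      show "H holomorphic_on ball y r" using hH r by (meson holomorphic_on_subset subset_ball less_imp_le)
      show "continuous_on (cball y r) H"
        by (rule holomorphic_on_imp_continuous_on[OF holomorphic_on_subset[OF hH]]) (use r in auto)
      fix x assume "norm (y - x) = r"
      hence "(\<Sum>i\<in>I. norm (h i x)) \<le> M" by (intro M) (simp add: norm_minus_commute)
      moreover have "norm (H x) \<le> (\<Sum>i\<in>I. norm (h i x))" unfolding H_def
      proof (rule order_trans[OF norm_sum sum_mono])
        fix i assume "i \<in> I"
        show "norm (e i * h i x) \<le> norm (h i x)" using mult_right_mono[OF ne[of i], of "norm (h i x)"] by (simp add: norm_mult)
      qed
      ultimately show "norm (H x) \<le> M" by simp
    qed (use r in auto)
    moreover have "(deriv ^^ k) H y = fact k * of_real (\<Sum>i\<in>I. norm (a i k))"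
    proof -
      have "(deriv ^^ k) H y = (\<Sum>i\<in>I. fact k * (e i * a i k))"
        unfolding H_def hd[OF subset_refl] by (intro sum.cong) (auto simp: a_def)
      thus ?thesis by (simp only: ea) (simp add: sum_distrib_left)
    qed
    moreover have "norm (fact k * of_real S :: complex) = fact k * S" if "S \<ge> 0" for S :: real
      using that by (simp add: norm_mult)
    ultimately have "fact k * (\<Sum>i\<in>I. norm (a i k)) \<le> fact k * M / r ^ k"
      by (simp only: sum_nonneg norm_ge_zero)
    hence "fact k * (\<Sum>i\<in>I. norm (a i k)) \<le> fact k * (M / r ^ k)" by simp
    thus ?thesis by (rule mult_left_le_imp_le) simp
  qed
  have part: "(\<Sum>i\<in>I. norm (\<Sum>k<N. a i k * (w i - y) ^ k)) \<le> M / (1 - \<theta>)" for N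
  proof -
    have "(\<Sum>i\<in>I. norm (\<Sum>k<N. a i k * (w i - y) ^ k)) \<le> (\<Sum>i\<in>I. \<Sum>k<N. norm (a i k) * (\<theta> * r) ^ k)"
    proof (intro sum_mono order_trans[OF norm_sum])
      fix i k assume "i \<in> I"
      thus "norm (a i k * (w i - y) ^ k) \<le> norm (a i k) * (\<theta> * r) ^ k"
        using w by (simp add: norm_mult norm_power mult_left_mono power_mono)
    qed
    also have "\<dots> = (\<Sum>k<N. (\<Sum>i\<in>I. norm (a i k)) * (\<theta> * r) ^ k)"
      by (subst sum.swap) (simp add: sum_distrib_right)
    also have "\<dots> \<le> (\<Sum>k<N. M * \<theta> ^ k)"
    proof (rule sum_mono)
      fix k
      have "(\<Sum>i\<in>I. norm (a i k)) * (\<theta> * r) ^ k \<le> M / r ^ k * (\<theta> * r) ^ k"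
        using coeff \<theta> r by (intro mult_right_mono) auto
      also have "\<dots> = M * \<theta> ^ k" using r by (simp add: power_mult_distrib)
      finally show "(\<Sum>i\<in>I. norm (a i k)) * (\<theta> * r) ^ k \<le> M * \<theta> ^ k" .
    qed
    also have "\<dots> = M * (\<Sum>k<N. \<theta> ^ k)" by (simp add: sum_distrib_left)
    also have "(\<Sum>k<N. \<theta> ^ k) \<le> 1 / (1 - \<theta>)"
      using sum_le_suminf[OF summable_geometric, of \<theta> "{..<N}"] suminf_geometric[of \<theta>] \<theta> by auto
    finally show ?thesis using M0 by (simp add: mult_left_mono)
  qed
  have "(\<lambda>N. \<Sum>i\<in>I. norm (\<Sum>k<N. a i k * (w i - y) ^ k)) \<longlonglongrightarrow> (\<Sum>i\<in>I. norm (h i (w i)))"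
  proof (intro tendsto_sum tendsto_norm)
    fix i assume i: "i \<in> I"
    have "\<theta> * r \<le> 1 * r" using \<theta> r by (intro mult_right_mono) auto
    hence "norm (w i - y) < R" using w[OF i] r by linarith
    hence "w i \<in> ball y R" by (simp add: dist_norm norm_minus_commute)
    from holomorphic_power_series[OF h[OF i] this]
    show "(\<lambda>N. \<Sum>k<N. a i k * (w i - y) ^ k) \<longlonglongrightarrow> h i (w i)" by (simp add: a_def sums_def)
  qed
  thus ?thesis by (rule LIMSEQ_le_const2) (use part in auto)
qed

text \<open>\<open>g\<close> is locally injective at the common value, since a right inverse
  excludes a vanishing derivative. So the branches agree near \<open>y\<close>, and the identity
  theorem does the rest.\<close>

lemma inverse_branch_unique:
  assumes g: "g holomorphic_on UNIV" and D: "open D" "connected D" "y \<in> D"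
    and \<phi>: "\<phi> holomorphic_on D" "\<And>w. w \<in> D \<Longrightarrow> g (\<phi> w) = w"
    and \<eta>: "\<eta> holomorphic_on D" "\<And>w. w \<in> D \<Longrightarrow> g (\<eta> w) = w"
    and y: "\<phi> y = \<eta> y" and w: "w \<in> D"
  shows "\<phi> w = \<eta> w"
proof -
  have chain: "deriv g (\<phi> u) * deriv \<phi> u = 1" if u: "u \<in> D" for u
  proof -
    have "deriv (g \<circ> \<phi>) u = deriv g (\<phi> u) * deriv \<phi> u"
      using u D \<phi> g by (intro deriv_chain) (auto simp: hol_UNIV_diff holomorphic_on_imp_differentiable_at)
    moreover have "deriv (g \<circ> \<phi>) u = deriv (\<lambda>w. w) u"
      by (rule deriv_cong_ev) (use u D \<phi> in \<open>auto simp: eventually_nhds intro!: exI[of _ D]\<close>)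
    ultimately show ?thesis by simp
  qed
  have "deriv g (\<phi> y) \<noteq> 0" using chain[OF D(3)] by auto
  then obtain \<rho> where \<rho>: "\<rho> > 0" "inj_on g (ball (\<phi> y) \<rho>)"
    using has_complex_derivative_locally_injective[OF g, of "\<phi> y"] by auto
  have c: "continuous_on D \<phi>" "continuous_on D \<eta>" using \<phi> \<eta> holomorphic_on_imp_continuous_on by auto
  define S where "S = D \<inter> \<phi> -` ball (\<phi> y) \<rho> \<inter> (D \<inter> \<eta> -` ball (\<phi> y) \<rho>)"
  have oS: "open S" unfolding S_def by (rule open_Int[OF continuous_open_preimage[OF c(1) D(1) open_ball] continuous_open_preimage[OF c(2) D(1) open_ball]])
  have yS: "y \<in> S" using D y \<rho> by (auto simp: S_def)
  show ?thesis
  proof (rule analytic_continuation_open[of S D \<phi> \<eta>])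
    show "\<And>z. z \<in> S \<Longrightarrow> \<phi> z = \<eta> z"
      using \<rho>(2) \<phi>(2) \<eta>(2) unfolding S_def inj_on_def by (metis IntD1 IntD2 vimage_eq)
  qed (use oS yS D \<phi> \<eta> w in \<open>auto simp: S_def\<close>)
qed

definition cc :: "real \<Rightarrow> real \<Rightarrow> complex set \<Rightarrow> bool" where
  "cc s \<epsilon> A \<longleftrightarrow> (\<exists>C :: nat \<Rightarrow> complex set. A \<subseteq> (\<Union>i. C i) \<and> (\<forall>i. bounded (C i)) \<and>
      (\<forall>N. (\<Sum>i<N. diameter (C i) powr s) \<le> \<epsilon>))"

lemma cc_countable:
  fixes X :: "'i \<Rightarrow> complex set"
  assumes I: "countable I" and A: "A \<subseteq> (\<Union>i\<in>I. X i)" and b: "\<And>i. i \<in> I \<Longrightarrow> bounded (X i)"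
    and fin: "\<And>J. finite J \<Longrightarrow> J \<subseteq> I \<Longrightarrow> (\<Sum>i\<in>J. diameter (X i) powr s) \<le> \<epsilon>"
  shows "cc s \<epsilon> A"
proof -
  define e where "e = to_nat_on I"
  have inj: "inj_on e I" using I by (simp add: e_def inj_on_to_nat_on)
  define C where "C = (\<lambda>j. if j \<in> e ` I then X (inv_into I e j) else {})"
  have Ce: "C (e i) = X i" if "i \<in> I" for i using that inj by (auto simp: C_def)
  show ?thesis unfolding cc_def
  proof (intro exI[of _ C] conjI allI)
    show "A \<subseteq> (\<Union>i. C i)" using A Ce by blast
    show "bounded (C j)" for j using b by (auto simp: C_def inv_into_into)
    fix N
    let ?J = "{i \<in> I. e i < N}"
    have fJ: "finite ?J"
      by (rule finite_imageD[of e]) (use inj in \<open>auto intro: inj_on_subset finite_subset[of _ "{..<N}"]\<close>)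
    have "(\<Sum>j<N. diameter (C j) powr s) = (\<Sum>j\<in>e ` ?J. diameter (C j) powr s)"
      by (intro sum.mono_neutral_right) (auto simp: C_def)
    also have "\<dots> = (\<Sum>i\<in>?J. diameter (X i) powr s)"
      by (subst sum.reindex) (use inj Ce in \<open>auto intro: inj_on_subset\<close>)
    also have "\<dots> \<le> \<epsilon>" by (rule fin[OF fJ]) auto
    finally show "(\<Sum>j<N. diameter (C j) powr s) \<le> \<epsilon>" .
  qed
qed

lemma cc_Un:
  assumes "cc s \<epsilon> A" "cc s \<delta> B" shows "cc s (\<epsilon> + \<delta>) (A \<union> B)"
proof -
  obtain C :: "nat \<Rightarrow> complex set" where C: "A \<subseteq> (\<Union>i. C i)" "\<And>i. bounded (C i)" "\<And>N. (\<Sum>i<N. diameter (C i) powr s) \<le> \<epsilon>"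
    using assms(1) unfolding cc_def by blast
  obtain D :: "nat \<Rightarrow> complex set" where D: "B \<subseteq> (\<Union>i. D i)" "\<And>i. bounded (D i)" "\<And>N. (\<Sum>i<N. diameter (D i) powr s) \<le> \<delta>"
    using assms(2) unfolding cc_def by blast
  define X where "X = (\<lambda>p :: bool \<times> nat. if fst p then C (snd p) else D (snd p))"
  show ?thesis
  proof (rule cc_countable[where I = UNIV and X = X])
    show "A \<union> B \<subseteq> (\<Union>i\<in>UNIV. X i)"
    proof
      fix z assume "z \<in> A \<union> B"
      then consider i where "z \<in> C i" | i where "z \<in> D i" using C(1) D(1) by blast
      thus "z \<in> (\<Union>i\<in>UNIV. X i)"
        by cases (force simp: X_def intro: UN_I[of "(True, _)"] UN_I[of "(False, _)"])+
    qed
    show "bounded (X i)" for i using C(2) D(2) by (auto simp: X_def)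
    fix J :: "(bool \<times> nat) set" assume "finite J"
    then obtain N where N: "\<And>p. p \<in> J \<Longrightarrow> snd p < N"
      using finite_nat_bounded[of "snd ` J"] by auto
    have "(\<Sum>i\<in>J. diameter (X i) powr s) \<le> (\<Sum>i\<in>UNIV \<times> {..<N}. diameter (X i) powr s)"
      using N by (intro sum_mono2) auto
    also have "\<dots> = (\<Sum>b\<in>UNIV. \<Sum>i<N. diameter (X (b, i)) powr s)" by (simp add: sum.cartesian_product)
    also have "\<dots> = (\<Sum>i<N. diameter (D i) powr s) + (\<Sum>i<N. diameter (C i) powr s)"
      by (simp add: X_def UNIV_bool)
    also have "\<dots> \<le> \<epsilon> + \<delta>" using C(3)[of N] D(3)[of N] by simp
    finally show "(\<Sum>i\<in>J. diameter (X i) powr s) \<le> \<epsilon> + \<delta>" .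
  qed auto
qed

lemma cc_mono: "cc s \<epsilon> A \<Longrightarrow> B \<subseteq> A \<Longrightarrow> \<epsilon> \<le> \<delta> \<Longrightarrow> cc s \<delta> B"
  unfolding cc_def by (meson order_trans)

lemma hausdorff_measure_null:
  assumes s: "s > 0" and A: "\<And>\<epsilon>. \<epsilon> > 0 \<Longrightarrow> cc s \<epsilon> A"
  shows "hausdorff_measure s A = 0"
proof -
  have "hausdorff_content s \<delta> A = 0" if \<delta>: "\<delta> > 0" for \<delta>
  proof -
    have le: "hausdorff_content s \<delta> A \<le> ennreal \<epsilon>" if e: "\<epsilon> > 0" for \<epsilon>
    proof -
      \<comment> \<open>Capping the sum by \<open>\<delta> powr s\<close> forces each single
        diameter below \<open>\<delta>\<close>, so the cover is automatically fine.\<close>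
      define \<epsilon>' where "\<epsilon>' = min \<epsilon> (\<delta> powr s)"
      have "\<epsilon>' > 0" using e \<delta> by (simp add: \<epsilon>'_def)
      then obtain C :: "nat \<Rightarrow> complex set" where C: "A \<subseteq> (\<Union>i. C i)" "\<And>i. bounded (C i)" "\<And>N. (\<Sum>i<N. diameter (C i) powr s) \<le> \<epsilon>'"
        using A[of \<epsilon>'] unfolding cc_def by blast
      have one: "diameter (C i) powr s \<le> \<epsilon>'" for i
      proof -
        have "diameter (C i) powr s \<le> (\<Sum>i<Suc i. diameter (C i) powr s)"
          by (simp add: sum_nonneg)
        thus ?thesis using C(3)[of "Suc i"] by simp
      qed
      have "diameter (C i) \<le> \<delta>" for i
      proof (rule ccontr)
        assume "\<not> diameter (C i) \<le> \<delta>"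
        hence "\<delta> powr s < diameter (C i) powr s" using \<delta> s by (intro powr_less_mono2) auto
        thus False using one[of i] by (simp add: \<epsilon>'_def)
      qed
      hence "hausdorff_content s \<delta> A \<le> (\<Sum>i. hd_term s (C i))"
        unfolding hausdorff_content_def using C(1,2) by (intro INF_lower) auto
      also have "\<dots> \<le> (\<Sum>i. ennreal (diameter (C i) powr s))"
        using s by (intro suminf_le summableI) (auto simp: hd_term_def)
      also have "\<dots> \<le> ennreal \<epsilon>'"
      proof (rule suminf_le_const[OF summableI])
        fix N
        have "(\<Sum>i<N. ennreal (diameter (C i) powr s)) = ennreal (\<Sum>i<N. diameter (C i) powr s)"
          by (rule sum_ennreal) simp
        also have "\<dots> \<le> ennreal \<epsilon>'" using C(3) by (rule ennreal_leI)
        finally show "(\<Sum>i<N. ennreal (diameter (C i) powr s)) \<le> ennreal \<epsilon>'" .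
      qed
      also have "\<dots> \<le> ennreal \<epsilon>" by (rule ennreal_leI) (simp add: \<epsilon>'_def)
      finally show ?thesis .
    qed
    have "hausdorff_content s \<delta> A \<le> 0"
    proof (rule ennreal_le_epsilon)
      fix e :: real assume "e > 0"
      thus "hausdorff_content s \<delta> A \<le> 0 + ennreal e" using le by simp
    qed
    thus ?thesis by simp
  qed
  thus ?thesis unfolding hausdorff_measure_def by (auto intro!: antisym SUP_least)
qed

text \<open>Discs with radii equal to the diameters have total area at most \<open>pi\<close> times
  the sum of the \<open>diameter powr s\<close>, because the exponent is at most 2 and the diameters
  at most 1. Applied to the filled Julia set, this identifies it with its boundary.\<close>

lemma cc_empty_interior:
  assumes A: "\<And>\<epsilon>. \<epsilon> > 0 \<Longrightarrow> cc s \<epsilon> A" and s: "0 < s" "s \<le> 2"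
  shows "interior A = {}"
proof (rule ccontr)
  assume "interior A \<noteq> {}"
  then obtain z r where z: "r > 0" "ball z r \<subseteq> A" by (metis equals0I mem_interior)
  have pos: "measure lebesgue (ball z r) > 0"
    using z by (simp add: content_ball_pos)
  define \<epsilon> where "\<epsilon> = min 1 (measure lebesgue (ball z r) / (2 * pi))"
  have e: "\<epsilon> > 0" "\<epsilon> \<le> 1" using pos by (auto simp: \<epsilon>_def)
  have "\<epsilon> * pi \<le> measure lebesgue (ball z r) / (2 * pi) * pi" by (intro mult_right_mono) (auto simp: \<epsilon>_def)
  moreover have "measure lebesgue (ball z r) / (2 * pi) * pi = measure lebesgue (ball z r) / 2" by simp
  ultimately have e3: "\<epsilon> * pi < measure lebesgue (ball z r)" using pos by linarith
  obtain C :: "nat \<Rightarrow> complex set" where C: "A \<subseteq> (\<Union>i. C i)" "\<And>i. bounded (C i)" "\<And>N. (\<Sum>i<N. diameter (C i) powr s) \<le> \<epsilon>"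
    using A[OF e(1)] unfolding cc_def by blast
  have one: "diameter (C i) powr s \<le> \<epsilon>" for i
  proof -
    have "diameter (C i) powr s \<le> (\<Sum>i<Suc i. diameter (C i) powr s)" by (simp add: sum_nonneg)
    thus ?thesis using C(3)[of "Suc i"] by simp
  qed
  define c where "c = (\<lambda>i. if C i = {} then 0 else SOME x. x \<in> C i)"
  define B where "B = (\<lambda>i. cball (c i) (diameter (C i)))"
  have CB: "C i \<subseteq> B i" for i
  proof
    fix x assume x: "x \<in> C i"
    hence "c i \<in> C i" by (auto simp: c_def intro: someI)
    thus "x \<in> B i" using diameter_bounded_bound[OF C(2)[of i] _ x] by (simp add: B_def)
  qed
  have d0: "diameter (C i) \<ge> 0" for i by (rule diameter_ge_0[OF C(2)])
  have mB: "emeasure lebesgue (B i) \<le> ennreal (pi * diameter (C i) powr s)" for i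
  proof -
    have d1: "diameter (C i) \<le> 1"
    proof (rule ccontr)
      assume "\<not> diameter (C i) \<le> 1"
      hence "1 powr s < diameter (C i) powr s" using s by (intro powr_less_mono2) auto
      thus False using one[of i] e by simp
    qed
    have "measure lebesgue (B i) = pi * (diameter (C i))\<^sup>2"
      unfolding B_def using content_cball[OF d0[of i], of "c i"] by (simp add: unit_ball_vol_2)
    also have "(diameter (C i))\<^sup>2 \<le> diameter (C i) powr s"
    proof (cases "diameter (C i) = 0")
      case False
      hence "diameter (C i) > 0" using d0[of i] by simp
      hence "diameter (C i) powr 2 \<le> diameter (C i) powr s" using d1 s by (intro powr_mono') auto
      thus ?thesis using d0[of i] by (simp add: powr_numeral)
    qed simp
    finally have "measure lebesgue (B i) \<le> pi * diameter (C i) powr s" by simp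
    moreover have "emeasure lebesgue (B i) = ennreal (measure lebesgue (B i))"
      unfolding B_def using emeasure_bounded_finite[OF bounded_cball, of "c i" "diameter (C i)"]
      by (intro emeasure_eq_ennreal_measure) auto
    ultimately show ?thesis by (simp add: ennreal_leI)
  qed
  have "ball z r \<subseteq> (\<Union>i. B i)" using z C(1) CB by blast
  hence "emeasure lebesgue (ball z r) \<le> emeasure lebesgue (\<Union>i. B i)" by (intro emeasure_mono) (auto simp: B_def)
  also have "\<dots> \<le> (\<Sum>i. emeasure lebesgue (B i))" by (rule emeasure_subadditive_countably) (auto simp: B_def)
  also have "\<dots> \<le> (\<Sum>i. ennreal (pi * diameter (C i) powr s))" by (intro suminf_le summableI mB)
  also have "\<dots> \<le> ennreal (\<epsilon> * pi)"
  proof (rule suminf_le_const[OF summableI])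
    fix N
    have "(\<Sum>i<N. ennreal (pi * diameter (C i) powr s)) = ennreal (\<Sum>i<N. pi * diameter (C i) powr s)"
      by (rule sum_ennreal) simp
    also have "\<dots> \<le> ennreal (\<epsilon> * pi)"
      using C(3)[of N] by (intro ennreal_leI) (simp flip: sum_distrib_left)
    finally show "(\<Sum>i<N. ennreal (pi * diameter (C i) powr s)) \<le> ennreal (\<epsilon> * pi)" .
  qed
  finally have "emeasure lebesgue (ball z r) \<le> ennreal (\<epsilon> * pi)" .
  moreover have "emeasure lebesgue (ball z r) = ennreal (measure lebesgue (ball z r))"
    using emeasure_bounded_finite[OF bounded_ball, of z r] by (intro emeasure_eq_ennreal_measure) auto
  ultimately have "measure lebesgue (ball z r) \<le> \<epsilon> * pi" using e by simp
  thus False using e3 by simp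
qed

section \<open>Inverse branches\<close>

locale tower0 = tower +
  fixes c :: complex
  assumes psi0: "\<psi> 0 w = w + c"
begin

abbreviation P where "P \<equiv> F 0"

lemma P_eq: "P z = z\<^sup>2 + c" by (simp add: qm_def psi0)

lemma P_quad: "quad_poly c = P" by (auto simp: quad_poly_def P_eq)

lemma c_norm: "norm c \<le> 59/25" using L.f_upper[of 0 0] by (simp add: P_eq)

lemma P_hol: "P holomorphic_on S" by (rule L.f_hol)
lemma Pn_hol: "(P ^^ n) holomorphic_on S" by (rule holomorphic_on_subset[OF hol_funpow[OF P_hol]]) auto
lemma Pn_cont: "continuous_on S (P ^^ n)" by (rule holomorphic_on_imp_continuous_on[OF Pn_hol])

lemma P_grow: "norm z \<ge> 3 \<Longrightarrow> norm (P z) \<ge> 2 * norm z"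
proof -
  assume z: "norm z \<ge> 3"
  have "3 * norm z \<le> norm z * norm z" using z by (intro mult_right_mono) auto
  moreover have "norm (z\<^sup>2) \<le> norm (P z) + norm c" unfolding P_eq by norm
  ultimately show ?thesis using z c_norm by (simp add: norm_mult power2_eq_square)
qed

lemma Pn_grow: "norm z \<ge> 3 \<Longrightarrow> norm ((P ^^ n) z) \<ge> 2 ^ n * norm z \<and> norm ((P ^^ n) z) \<ge> 3"
proof (induction n)
  case (Suc n)
  thus ?case using P_grow[of "(P ^^ n) z"] by auto
qed simp

definition K0 where "K0 = {z. bounded (range (\<lambda>n. (P ^^ n) z))}"

lemma K0_iff: "z \<in> K0 \<longleftrightarrow> (\<forall>n. norm ((P ^^ n) z) < 3)"
proof
  assume "\<forall>n. norm ((P ^^ n) z) < 3"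
  thus "z \<in> K0" by (auto simp: K0_def bounded_iff intro!: exI[of _ 3] less_imp_le)
next
  assume z: "z \<in> K0"
  show "\<forall>n. norm ((P ^^ n) z) < 3"
  proof (rule ccontr)
    assume "\<not> (\<forall>n. norm ((P ^^ n) z) < 3)"
    then obtain n where n: "norm ((P ^^ n) z) \<ge> 3" by (auto simp: not_less)
    obtain B where B: "\<And>k. norm ((P ^^ k) z) \<le> B" using z by (auto simp: K0_def bounded_iff)
    obtain k :: nat where "B < 2 ^ k" using real_arch_pow[of 2 B] by auto
    moreover have "2 ^ k * norm ((P ^^ n) z) \<le> B"
      using Pn_grow[OF n, of k] B[of "k + n"] by (auto simp: funpow_add)
    moreover have "(2::real) ^ k * 1 \<le> 2 ^ k * norm ((P ^^ n) z)" using n by (intro mult_left_mono) auto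
    ultimately show False by simp
  qed
qed

lemma K0_small: "z \<in> K0 \<Longrightarrow> norm z < 47/20"
proof (rule ccontr)
  assume z: "z \<in> K0" "\<not> norm z < 47/20"
  have z3: "norm z < 3" using z K0_iff[of z] by (metis funpow_0)
  have "(47/20)\<^sup>2 \<le> (norm z)\<^sup>2" using z by (intro power_mono) auto
  moreover have "norm (P z) \<ge> (norm z)\<^sup>2 - 59/25" using z3 by (intro L.f_lower) auto
  moreover have "norm ((P ^^ 1) z) < 3" using z K0_iff by blast
  ultimately show False by (simp add: power2_eq_square)
qed

lemma K0_fwd: "z \<in> K0 \<Longrightarrow> (P ^^ n) z \<in> K0"
proof -
  assume z: "z \<in> K0"
  have "norm ((P ^^ k) ((P ^^ n) z)) < 3" for k
    using z[unfolded K0_iff, rule_format, of "k + n"] by (simp add: funpow_add)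
  thus ?thesis by (simp add: K0_iff)
qed

lemma K0_closed: "closed K0"
proof -
  have "K0 = (\<Inter>n. {z. norm ((P ^^ n) z) \<le> 47/20})"
  proof (intro equalityI subsetI)
    fix z assume "z \<in> K0"
    thus "z \<in> (\<Inter>n. {z. norm ((P ^^ n) z) \<le> 47/20})" using K0_fwd K0_small by (auto intro: less_imp_le)
  next
    fix z assume "z \<in> (\<Inter>n. {z. norm ((P ^^ n) z) \<le> 47/20})"
    hence "norm ((P ^^ n) z) \<le> 47/20" for n by auto
    hence "norm ((P ^^ n) z) < 3" for n by (rule le_less_trans) simp
    thus "z \<in> K0" by (simp add: K0_iff)
  qed
  moreover have "closed {z. norm ((P ^^ n) z) \<le> 47/20}" for n
    by (intro closed_Collect_le continuous_intros Pn_cont)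
  ultimately show ?thesis by auto
qed

definition br where "br n D \<phi> \<longleftrightarrow> \<phi> holomorphic_on D \<and> (\<forall>w\<in>D. (P ^^ n) (\<phi> w) = w)"

text \<open>Solving \<open>P u = \<phi> w\<close> means taking a square root of
  \<open>\<phi> w - c\<close>, which exists on a simply connected domain if the critical value
  \<open>c\<close> is omitted.\<close>

lemma br_step:
  assumes D: "simply_connected D" "open D" "y \<in> D" and b: "br j D \<phi>" and x: "P x = \<phi> y" and c: "c \<notin> \<phi> ` D"
  shows "\<exists>\<phi>'. br (Suc j) D \<phi>' \<and> \<phi>' y = x"
proof -
  have "(\<lambda>w. \<phi> w - c) holomorphic_on D" "\<forall>w\<in>D. \<phi> w - c \<noteq> 0"
    using b c by (auto simp: br_def intro!: holomorphic_intros)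
  then obtain g where g: "g holomorphic_on D" "\<forall>w\<in>D. \<phi> w - c = (g w)\<^sup>2"
    using simply_connected_eq_holomorphic_sqrt[OF D(2)] D(1) by blast
  have pg: "P (g w) = \<phi> w" "P (- g w) = \<phi> w" if "w \<in> D" for w
    using g(2) that by (auto simp: P_eq) (metis diff_add_cancel)+
  have "(g y)\<^sup>2 = x\<^sup>2" using g(2) D(3) x by (metis P_eq add_diff_cancel_right')
  hence "x = g y \<or> x = - g y" by (auto simp: power2_eq_iff)
  moreover have "br (Suc j) D g" "br (Suc j) D (\<lambda>w. - g w)"
    using b g pg unfolding br_def by (auto intro!: holomorphic_intros simp: funpow_swap1)
  ultimately show ?thesis by blast
qed

lemma br_exists:
  assumes D: "simply_connected D" "open D" "(P ^^ n) x \<in> D"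
    and c: "\<And>j \<phi>. j < n \<Longrightarrow> br j D \<phi> \<Longrightarrow> \<phi> ((P ^^ n) x) = (P ^^ (n - j)) x \<Longrightarrow> c \<notin> \<phi> ` D"
  shows "\<exists>\<phi>. br n D \<phi> \<and> \<phi> ((P ^^ n) x) = x"
proof -
  have "\<exists>\<phi>. br j D \<phi> \<and> \<phi> ((P ^^ n) x) = (P ^^ (n - j)) x" if "j \<le> n" for j
    using that
  proof (induction j)
    case 0 show ?case by (intro exI[of _ "\<lambda>w. w"]) (simp add: br_def)
  next
    case (Suc j)
    then obtain \<phi> where \<phi>: "br j D \<phi>" "\<phi> ((P ^^ n) x) = (P ^^ (n - j)) x" by auto
    have "n - j = Suc (n - Suc j)" using Suc by simp
    hence "P ((P ^^ (n - Suc j)) x) = \<phi> ((P ^^ n) x)" using \<phi> by simp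
    moreover have "c \<notin> \<phi> ` D" by (rule c[OF _ \<phi>]) (use Suc in auto)
    ultimately show ?case using br_step[OF D \<phi>(1)] by blast
  qed
  from this[of n] show ?thesis by simp
qed

lemma Pfib_finite: "finite {u. (P ^^ n) u = y}"
proof (induction n arbitrary: y)
  case (Suc n)
  have "{u. (P ^^ Suc n) u = y} = (\<Union>v\<in>{v. P v = y}. {u. (P ^^ n) u = v})" by auto
  moreover have "finite {v. P v = y}"
  proof (rule finite_subset)
    show "{v. P v = y} \<subseteq> {csqrt (y - c), - csqrt (y - c)}"
    proof
      fix v assume "v \<in> {v. P v = y}"
      hence "v\<^sup>2 = (csqrt (y - c))\<^sup>2" by (auto simp: P_eq)
      hence "v = csqrt (y - c) \<or> v = - csqrt (y - c)" by (simp only: power2_eq_iff)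
      thus "v \<in> {csqrt (y - c), - csqrt (y - c)}" by blast
    qed
  qed auto
  ultimately show ?case using Suc by auto
qed simp

section \<open>Diameter sums over all inverse branches\<close>

definition Bs where "Bs n y R = {u. (P ^^ n) u = y \<and> (\<exists>\<phi>. br n (ball y R) \<phi> \<and> \<phi> y = u)}"
text \<open>By \<open>br_unique\<close> a branch over a disc is determined by its value at the
  centre. So branches can be indexed by points, and the choice made here does not matter on the
  disc.\<close>

definition ph where "ph n y R u = (SOME \<phi>. br n (ball y R) \<phi> \<and> \<phi> y = u)"

lemma finite_Bs: "finite (Bs n y R)"
  by (rule finite_subset[OF _ Pfib_finite[of n y]]) (auto simp: Bs_def)

lemma ph: "u \<in> Bs n y R \<Longrightarrow> br n (ball y R) (ph n y R u) \<and> ph n y R u y = u"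
proof -
  assume "u \<in> Bs n y R"
  hence "\<exists>\<phi>. br n (ball y R) \<phi> \<and> \<phi> y = u" by (simp add: Bs_def)
  from someI_ex[OF this] show ?thesis by (simp only: ph_def)
qed

lemma br_unique:
  assumes "br n (ball y R) \<phi>" "br n (ball y R) \<phi>'" "v \<in> ball y R" "\<phi> v = \<phi>' v" "w \<in> ball y R"
  shows "\<phi> w = \<phi>' w"
  by (rule inverse_branch_unique[OF Pn_hol[where S=UNIV], of "ball y R" v])
     (use assms in \<open>auto simp: br_def\<close>)

lemma br_in_Bs:
  assumes "br n (ball y R) \<phi>" "R > 0" "w \<in> ball y R"
  shows "\<phi> y \<in> Bs n y R" "\<phi> w = ph n y R (\<phi> y) w"
proof -
  show B: "\<phi> y \<in> Bs n y R" using assms by (auto simp: Bs_def br_def)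
  show "\<phi> w = ph n y R (\<phi> y) w"
    by (rule br_unique[of n y R _ _ y]) (use assms ph[OF B] in auto)
qed

lemma br_deriv:
  assumes b: "br n D \<phi>" "open D" "w \<in> D"
  shows "deriv (P ^^ n) (\<phi> w) * deriv \<phi> w = 1"
proof -
  have "deriv ((P ^^ n) \<circ> \<phi>) w = deriv (P ^^ n) (\<phi> w) * deriv \<phi> w"
  proof (rule deriv_chain)
    show "\<phi> field_differentiable at w"
      using b by (auto simp: br_def intro: holomorphic_on_imp_differentiable_at)
  qed (rule hol_UNIV_diff[OF Pn_hol])
  moreover have "deriv ((P ^^ n) \<circ> \<phi>) w = deriv (\<lambda>w. w) w"
    by (rule deriv_cong_ev) (use b in \<open>auto simp: br_def eventually_nhds intro!: exI[of _ D]\<close>)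
  ultimately show ?thesis by simp
qed

lemma br_orbit_nz:
  assumes b: "br n D \<phi>" "open D" "w \<in> D" and i: "i < n"
  shows "(P ^^ i) (\<phi> w) \<noteq> 0"
proof
  assume "(P ^^ i) (\<phi> w) = 0"
  hence "deriv P ((P ^^ i) (\<phi> w)) = 0" by (simp add: L.f_deriv_0)
  hence "deriv (P ^^ n) (\<phi> w) = 0" unfolding deriv_funpow[OF P_hol] using i by (intro prod_zero) auto
  thus False using br_deriv[OF b] by simp
qed

lemma br_orbit_small:
  assumes b: "br n D \<phi>" "w \<in> D" "norm w < 3" and i: "i \<le> n"
  shows "norm ((P ^^ i) (\<phi> w)) < 3"
proof (rule ccontr)
  assume "\<not> norm ((P ^^ i) (\<phi> w)) < 3"
  hence "norm ((P ^^ (n - i)) ((P ^^ i) (\<phi> w))) \<ge> 3" using Pn_grow by auto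
  moreover have "(P ^^ (n - i)) ((P ^^ i) (\<phi> w)) = w"
    using b i by (simp add: br_def flip: funpow_add[unfolded o_def fun_eq_iff, rule_format])
  ultimately show False using b by simp
qed

text \<open>On the circle of radius \<open>r\<close> the sum of \<open>|deriv \<phi>|^(7/4)\<close>
  over all branches is part of a Poincare series and hence at most \<open>200 M\<close>. Since these
  derivatives have no zeros, they have holomorphic powers of exponent 7/4, and
  \<open>sum_norm_interior_bound\<close> carries the bound inwards. It allows a different point for
  each branch: the one where its derivative is largest, which controls the diameter.\<close>

lemma branch_sum:
  assumes r: "0 < r" "r < R" and w3: "\<And>w. norm (w - y) = r \<Longrightarrow> norm w < 3"
    and M: "\<And>w K. norm (w - y) = r \<Longrightarrow> K \<ge> K1 \<Longrightarrow> rho K 0 w \<le> M"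
    and \<theta>: "0 \<le> \<theta>" "\<theta> < 1"
  shows "(\<Sum>n<N. \<Sum>u\<in>Bs n y R. diameter (ph n y R u ` cball y (\<theta> * r)) powr (7/4))
     \<le> (2 * \<theta> * r) powr (7/4) * (200 * M / (1 - \<theta>))"
proof -
  let ?D = "ball y R" and ?I = "Sigma {..<N} (\<lambda>n. Bs n y R)"
  let ?\<phi> = "\<lambda>p. ph (fst p) y R (snd p)"
  have fI: "finite ?I" using finite_Bs by auto
  have br: "br (fst p) ?D (?\<phi> p)" and phy: "?\<phi> p y = snd p" if "p \<in> ?I" for p
    using ph that by auto
  have hol: "?\<phi> p holomorphic_on ?D" if "p \<in> ?I" for p using br[OF that] by (simp add: br_def)
  have sph: "sphere y r \<subseteq> ?D" "cball y (\<theta> * r) \<subseteq> ?D"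
  proof -
    have "\<theta> * r \<le> 1 * r" using \<theta> r by (intro mult_right_mono) auto
    hence "\<theta> * r < R" using r by linarith
    thus "sphere y r \<subseteq> ?D" "cball y (\<theta> * r) \<subseteq> ?D" using r by auto
  qed
  have dnz: "deriv (?\<phi> p) w \<noteq> 0" if "p \<in> ?I" "w \<in> ?D" for p w
    using br_deriv[OF br[OF that(1)] open_ball that(2)] by auto
  have "\<exists>g. g holomorphic_on ?D \<and> (\<forall>w\<in>?D. deriv (?\<phi> p) w = exp (g w))" if p: "p \<in> ?I" for p
  proof -
    have "deriv (?\<phi> p) holomorphic_on ?D" by (intro holomorphic_deriv hol[OF p]) auto
    moreover have "simply_connected ?D" by (simp add: convex_imp_simply_connected)
    ultimately show ?thesis using simply_connected_eq_holomorphic_log[OF open_ball] dnz[OF p] by blast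
  qed
  then obtain g where g: "\<And>p. p \<in> ?I \<Longrightarrow> g p holomorphic_on ?D"
    "\<And>p w. p \<in> ?I \<Longrightarrow> w \<in> ?D \<Longrightarrow> deriv (?\<phi> p) w = exp (g p w)" by metis
  define h where "h = (\<lambda>p w. exp (of_real (7/4) * g p w))"
  have nh: "norm (h p w) = norm (deriv (?\<phi> p) w) powr (7/4)" if "p \<in> ?I" "w \<in> ?D" for p w
  proof -
    have "norm (deriv (?\<phi> p) w) = exp (Re (g p w))" using g(2)[OF that] by simp
    thus ?thesis by (simp add: h_def powr_def)
  qed
  have bnd: "(\<Sum>p\<in>?I. norm (h p w)) \<le> 200 * M" if w: "norm (w - y) = r" for w
  proof -
    have wD: "w \<in> ?D" using w r by (simp add: dist_norm norm_minus_commute)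
    \<comment> \<open>Only finitely many orbit points occur and none is 0, as a branch cannot pass
      through the critical point. A sufficiently deep cut-off leaves none of them out; therefore the
      bound on \<open>rho\<close> is assumed for all large \<open>K\<close>.\<close>
    have "\<exists>K\<ge>K1. \<forall>p\<in>?I. \<forall>i<fst p. dl K 0 \<le> norm ((P ^^ i) (?\<phi> p w))"
    proof -
      let ?X = "insert 1 ((\<lambda>(p, i). norm ((P ^^ i) (?\<phi> p w))) ` (Sigma ?I (\<lambda>p. {..<fst p})))"
      have fX: "finite ?X" using fI by auto
      have pX: "x > 0" if xX: "x \<in> ?X" for x
      proof (cases "x = 1")
        case False
        then obtain p i where pi: "p \<in> ?I" "i < fst p" "x = norm ((P ^^ i) (?\<phi> p w))" using xX by auto
        show ?thesis using br_orbit_nz[OF br[OF pi(1)] open_ball wD pi(2)] pi(3) by simp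
      qed simp
      define \<mu> where "\<mu> = Min ?X"
      have "\<mu> \<in> ?X" unfolding \<mu>_def using fX by (intro Min_in) auto
      hence mu0: "\<mu> > 0" by (rule pX)
      have mule: "\<mu> \<le> x" if "x \<in> ?X" for x unfolding \<mu>_def using fX that by (rule Min_le)
      obtain k where k: "(1/10^8) ^ k < \<mu> / 3" using real_arch_pow_inv[of "\<mu>/3" "1/10^8"] mu0 by auto
      define K where "K = max K1 k"
      have "norm (Lam 0 K) \<le> (1/10^8) ^ K" by (rule Lam_le)
      also have "\<dots> \<le> (1/10^8) ^ k" by (rule power_decreasing) (auto simp: K_def)
      finally have dlm: "dl K 0 \<le> \<mu>" unfolding dl_def using k mu0 by linarith
      show ?thesis
      proof (intro exI[of _ K] conjI ballI allI impI)
        show "K1 \<le> K" by (simp add: K_def)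
        fix p i assume pi: "p \<in> ?I" "i < fst p"
        have "norm ((P ^^ i) (?\<phi> p w)) \<in> ?X" using pi by (intro insertI2 image_eqI[of _ _ "(p, i)"]) auto
        from mule[OF this] show "dl K 0 \<le> norm ((P ^^ i) (?\<phi> p w))" using dlm by linarith
      qed
    qed
    then obtain K where K: "K \<ge> K1" "\<And>p i. p \<in> ?I \<Longrightarrow> i < fst p \<Longrightarrow> dl K 0 \<le> norm ((P ^^ i) (?\<phi> p w))" by blast
    have "(\<Sum>p\<in>?I. norm (h p w)) = (\<Sum>n<N. \<Sum>u\<in>Bs n y R. norm (h (n, u) w))"
      by (simp add: sum.Sigma finite_Bs)
    also have "\<dots> \<le> (\<Sum>n<N. \<Sum>x\<in>A K n w. W 0 n x)"
    proof (rule sum_mono)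
      fix n assume n: "n \<in> {..<N}"
      have pI: "(n, u) \<in> ?I" if "u \<in> Bs n y R" for u using n that by auto
      have inj: "inj_on (\<lambda>u. ph n y R u w) (Bs n y R)"
      proof (rule inj_onI)
        fix u v assume uv: "u \<in> Bs n y R" "v \<in> Bs n y R" "ph n y R u w = ph n y R v w"
        have "ph n y R u y = ph n y R v y"
          by (rule br_unique[of n y R _ _ w]) (use uv ph wD r in auto)
        thus "u = v" using ph uv by simp
      qed
      have "(\<Sum>u\<in>Bs n y R. norm (h (n, u) w)) = (\<Sum>u\<in>Bs n y R. W 0 n (ph n y R u w))"
      proof (rule sum.cong[OF refl])
        fix u assume u: "u \<in> Bs n y R"
        have "norm (deriv (P ^^ n) (ph n y R u w)) * norm (deriv (ph n y R u) w) = 1"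
          using arg_cong[OF br_deriv[OF br[OF pI[OF u]] open_ball wD], of norm] by (simp add: norm_mult)
        hence "inverse (norm (deriv (P ^^ n) (ph n y R u w))) = norm (deriv (ph n y R u) w)"
          by (rule inverse_unique)
        hence "norm (deriv (ph n y R u) w) powr (7/4) = inverse (norm (deriv (P ^^ n) (ph n y R u w))) powr (7/4)"
          by (simp only:)
        also have "\<dots> = norm (deriv (P ^^ n) (ph n y R u w)) powr (- (7/4))"
          by (simp only: powr_minus inverse_powr norm_ge_zero)
        finally show "norm (h (n, u) w) = W 0 n (ph n y R u w)"
          using nh[OF pI[OF u] wD] by (simp add: W_def)
      qed
      also have "\<dots> = (\<Sum>x\<in>(\<lambda>u. ph n y R u w) ` Bs n y R. W 0 n x)" by (subst sum.reindex[OF inj]) simp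
      also have "\<dots> \<le> (\<Sum>x\<in>A K n w. W 0 n x)"
      proof (rule sum_mono2[OF finite_A])
        show "(\<lambda>u. ph n y R u w) ` Bs n y R \<subseteq> A K n w"
        proof
          fix x assume "x \<in> (\<lambda>u. ph n y R u w) ` Bs n y R"
          then obtain u where u: "u \<in> Bs n y R" "x = ph n y R u w" by auto
          have b: "br n ?D (ph n y R u)" using ph[OF u(1)] by blast
          have "(P ^^ n) x = w" using b wD u by (simp add: br_def)
          moreover have "norm ((P ^^ i) x) < 3" if "i < n" for i
            unfolding u(2) by (rule br_orbit_small[OF b wD w3[OF w]]) (use that in simp)
          moreover have "dl K 0 \<le> norm ((P ^^ i) x)" if "i < n" for i
            using K(2)[OF pI[OF u(1)], of i] that u by simp
          ultimately show "x \<in> A K n w" by (simp add: A_def)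
        qed
      qed (simp add: W_nonneg)
      finally show "(\<Sum>u\<in>Bs n y R. norm (h (n, u) w)) \<le> (\<Sum>x\<in>A K n w. W 0 n x)" .
    qed
    also have "\<dots> \<le> 200 * rho K 0 w" by (rule poincare[OF w3[OF w]])
    also have "\<dots> \<le> 200 * M" using M[OF w K(1)] by simp
    finally show ?thesis .
  qed
  have "\<exists>v\<in>cball y (\<theta> * r). \<forall>w\<in>cball y (\<theta> * r). norm (deriv (?\<phi> p) w) \<le> norm (deriv (?\<phi> p) v)" if p: "p \<in> ?I" for p
  proof (rule continuous_attains_sup)
    have "deriv (?\<phi> p) holomorphic_on ?D" by (intro holomorphic_deriv hol[OF p]) auto
    thus "continuous_on (cball y (\<theta> * r)) (\<lambda>w. norm (deriv (?\<phi> p) w))"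
      by (intro continuous_intros holomorphic_on_imp_continuous_on holomorphic_on_subset[OF _ sph(2)])
    have "0 \<le> \<theta> * r" using \<theta> r by (intro mult_nonneg_nonneg) auto
    hence "y \<in> cball y (\<theta> * r)" by (simp only: mem_cball dist_self)
    thus "cball y (\<theta> * r) \<noteq> {}" by blast
  qed (rule compact_cball)
  hence "\<forall>p\<in>?I. \<exists>v. v \<in> cball y (\<theta> * r) \<and> (\<forall>w\<in>cball y (\<theta> * r). norm (deriv (?\<phi> p) w) \<le> norm (deriv (?\<phi> p) v))"
    by blast
  from bchoice[OF this] obtain v where v': "\<forall>p\<in>?I. v p \<in> cball y (\<theta> * r) \<and>
      (\<forall>w\<in>cball y (\<theta> * r). norm (deriv (?\<phi> p) w) \<le> norm (deriv (?\<phi> p) (v p)))" ..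
  have v: "v p \<in> cball y (\<theta> * r)" "w \<in> cball y (\<theta> * r) \<Longrightarrow> norm (deriv (?\<phi> p) w) \<le> norm (deriv (?\<phi> p) (v p))"
    if "p \<in> ?I" for p w using v'[rule_format, OF that] by blast+
  have hsum: "(\<Sum>p\<in>?I. norm (h p (v p))) \<le> (200 * M) / (1 - \<theta>)"
  proof (rule sum_norm_interior_bound[OF fI _ r bnd \<theta>])
    show "h p holomorphic_on ?D" if "p \<in> ?I" for p unfolding h_def by (intro holomorphic_intros g(1)[OF that])
    show "norm (v p - y) \<le> \<theta> * r" if "p \<in> ?I" for p using v(1)[OF that] by (simp add: dist_norm norm_minus_commute)
  qed
  have dia: "diameter (?\<phi> p ` cball y (\<theta> * r)) powr (7/4) \<le> (2 * \<theta> * r) powr (7/4) * norm (h p (v p))" if p: "p \<in> ?I" for p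
  proof -
    let ?d = "norm (deriv (?\<phi> p) (v p))"
    have tr0: "0 \<le> \<theta> * r" using \<theta> r by (intro mult_nonneg_nonneg) auto
    have lip: "norm (?\<phi> p a' - ?\<phi> p b') \<le> ?d * (2 * (\<theta> * r))"
      if ab: "a' \<in> cball y (\<theta> * r)" "b' \<in> cball y (\<theta> * r)" for a' b'
    proof -
      have "norm (?\<phi> p a' - ?\<phi> p b') \<le> ?d * norm (a' - b')"
      proof (rule field_differentiable_bound[where S = "cball y (\<theta> * r)"])
        fix z assume z: "z \<in> cball y (\<theta> * r)"
        have "z \<in> ?D" using z sph(2) by blast
        thus "(?\<phi> p has_field_derivative deriv (?\<phi> p) z) (at z within cball y (\<theta> * r))"
          by (rule has_field_derivative_at_within[OF holomorphic_derivI[OF hol[OF p] open_ball]])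
        show "norm (deriv (?\<phi> p) z) \<le> ?d" by (rule v(2)[OF p z])
      qed (rule convex_cball, fact+)
      also have "\<dots> \<le> ?d * (2 * (\<theta> * r))"
      proof (rule mult_left_mono)
        have "dist a' b' \<le> dist a' y + dist b' y" by (rule dist_triangle2)
        also have "\<dots> \<le> \<theta> * r + \<theta> * r" using ab by (intro add_mono) (simp_all only: mem_cball dist_commute)
        finally show "norm (a' - b') \<le> 2 * (\<theta> * r)" by (simp only: dist_norm mult_2)
      qed (rule norm_ge_zero)
      finally show ?thesis .
    qed
    have "diameter (?\<phi> p ` cball y (\<theta> * r)) \<le> ?d * (2 * (\<theta> * r))"
    proof (rule diameter_le)
      have "0 \<le> ?d * (2 * (\<theta> * r))" by (intro mult_nonneg_nonneg norm_ge_zero tr0 zero_le_numeral)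
      thus "?\<phi> p ` cball y (\<theta> * r) \<noteq> {} \<or> 0 \<le> ?d * (2 * (\<theta> * r))" ..
      fix a b assume "a \<in> ?\<phi> p ` cball y (\<theta> * r)" "b \<in> ?\<phi> p ` cball y (\<theta> * r)"
      thus "norm (a - b) \<le> ?d * (2 * (\<theta> * r))" using lip by blast
    qed
    moreover have "diameter (?\<phi> p ` cball y (\<theta> * r)) \<ge> 0"
      by (rule diameter_ge_0[OF compact_imp_bounded[OF compact_continuous_image[OF
          holomorphic_on_imp_continuous_on[OF holomorphic_on_subset[OF hol[OF p] sph(2)]] compact_cball]]])
    ultimately have "diameter (?\<phi> p ` cball y (\<theta> * r)) powr (7/4) \<le> (?d * (2 * (\<theta> * r))) powr (7/4)"
      by (intro powr_mono2) simp_all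
    also have "\<dots> = (2 * \<theta> * r) powr (7/4) * norm (h p (v p))"
    proof -
      have "v p \<in> ?D" using v(1)[OF p] sph(2) by blast
      from nh[OF p this] have "norm (h p (v p)) = ?d powr (7/4)" .
      moreover have "(?d * (2 * (\<theta> * r))) powr (7/4) = ?d powr (7/4) * (2 * (\<theta> * r)) powr (7/4)"
        by (rule powr_mult)
      moreover have "2 * \<theta> * r = 2 * (\<theta> * r)" by simp
      ultimately show ?thesis by (simp only: mult.commute[of "?d powr (7/4)"])
    qed
    finally show ?thesis .
  qed
  have "(\<Sum>p\<in>?I. diameter (?\<phi> p ` cball y (\<theta> * r)) powr (7/4))
      \<le> (\<Sum>p\<in>?I. (2 * \<theta> * r) powr (7/4) * norm (h p (v p)))"
    by (rule sum_mono[OF dia])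
  also have "\<dots> = (2 * \<theta> * r) powr (7/4) * (\<Sum>p\<in>?I. norm (h p (v p)))" by (rule sum_distrib_left[symmetric])
  also have "\<dots> \<le> (2 * \<theta> * r) powr (7/4) * (200 * M / (1 - \<theta>))" by (rule mult_left_mono[OF hsum powr_ge_zero])
  finally have "(\<Sum>p\<in>?I. diameter (?\<phi> p ` cball y (\<theta> * r)) powr (7/4)) \<le> (2 * \<theta> * r) powr (7/4) * (200 * M / (1 - \<theta>))" .
  thus ?thesis by (simp add: sum.Sigma finite_Bs case_prod_beta)
qed


end

section \<open>The dimension of the Julia set\<close>

context tower0 begin

section \<open>Return times of the critical orbit at all scales\<close>

lemma level_scale: "(F n ^^ (m ^ k * i)) (Lam n k * z) = Lam n k * (F (n + k) ^^ i) z"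
proof (induction k arbitrary: n)
  case (Suc k)
  have "(F n ^^ (m ^ Suc k * i)) (Lam n (Suc k) * z) = (F n ^^ (m * (m ^ k * i))) (lam n * (Lam (Suc n) k * z))"
    by (simp add: Lam_Suc mult.assoc)
  also have "\<dots> = lam n * (Lam (Suc n) k * (F (Suc n + k) ^^ i) z)" unfolding F_Suc_pow Suc ..
  finally show ?case by (simp add: Lam_Suc mult.assoc)
qed (simp add: Lam_0)

text \<open>At times not divisible by \<open>m\<close> shadowing keeps the modulus at least 11/10;
  at multiples of \<open>m\<close>, rescale and repeat.\<close>

lemma crit_return:
  assumes "norm ((F n ^^ i) 0) < 3 * norm (Lam n k)" shows "m ^ k dvd i"
  using assms
proof (induction k arbitrary: n i)
  case (Suc k)
  have m2: "2 < m" by (rule L.m)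
  define q r where "q = i div m" and "r = i mod m"
  have i: "i = r + m * q" by (simp add: q_def r_def)
  define u where "u = lam n * (F (Suc n) ^^ q) 0"
  have "(F n ^^ (m * q)) 0 = u" using F_Suc_pow[where n=n and i=q and z=0] by (simp add: u_def)
  hence e: "(F n ^^ i) 0 = (F n ^^ r) u" unfolding i funpow_add by simp
  have l3: "norm ((F n ^^ i) 0) < 3 * norm (lam n)"
  proof -
    have "3 * norm (Lam n (Suc k)) \<le> 3 * (norm (lam n) * 1)"
      unfolding Lam_Suc norm_mult using Lam_le_1 by (intro mult_left_mono) auto
    thus ?thesis using Suc.prems by simp
  qed
  have u3: "norm u \<le> 3 * norm (lam n)"
    using mult_left_mono[OF crit_orbit_bd[where n="Suc n" and i=q], of "norm (lam n)"] lam_pos[of n]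
    by (simp add: u_def norm_mult)
  have "r = 0"
  proof (rule ccontr)
    assume "r \<noteq> 0"
    hence "norm ((F n ^^ r) u) \<ge> 11/10"
      using u3 lam_rr3[of n] m2 by (intro L.inner_bd L.small_inner) (auto simp: r_def)
    thus False using l3 e lam_le[of n] by simp
  qed
  hence "norm (lam n) * norm ((F (Suc n) ^^ q) 0) < norm (lam n) * (3 * norm (Lam (Suc n) k))"
    using Suc.prems e by (simp add: u_def Lam_Suc norm_mult)
  hence "norm ((F (Suc n) ^^ q) 0) < 3 * norm (Lam (Suc n) k)" using lam_pos[of n] by simp
  hence "m ^ k dvd q" by (rule Suc.IH)
  thus ?case using i \<open>r = 0\<close> by (simp add: mult_dvd_mono)
qed simp

text \<open>Otherwise the next point would exceed 29/10, because
  \<open>(47/20)^2 - 59/25 > 29/10\<close>. The improved constant leaves the gap of 1/4 below 13/5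
  used in \<open>Q_gap\<close>.\<close>

lemma crit_small: "norm ((F n ^^ i) 0) < 47/20"
proof (rule ccontr)
  assume a: "\<not> norm ((F n ^^ i) 0) < 47/20"
  let ?z = "(F n ^^ i) 0"
  have "norm ?z < 5" using crit_orbit_bd[where n=n and i=i] by simp
  hence "norm (F n ?z) \<ge> (norm ?z)\<^sup>2 - 59/25" by (rule L.f_lower)
  moreover have "(47/20)\<^sup>2 \<le> (norm ?z)\<^sup>2" using a by (intro power_mono) auto
  moreover have "norm (F n ?z) \<le> 29/10" using crit_orbit_bd[where n=n and i="Suc i"] by simp
  ultimately show False by (simp add: power2_eq_square)
qed

lemma crit_scaled: "norm ((P ^^ (m ^ k * l)) 0) < (47/20) * norm (Lam 0 k)"
proof -
  have "(P ^^ (m ^ k * l)) 0 = Lam 0 k * (F k ^^ l) 0" using level_scale[where n=0 and k=k and i=l and z=0] by simp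
  thus ?thesis using mult_strict_left_mono[OF crit_small[where n=k and i=l], of "norm (Lam 0 k)"] Lam_nz[of 0 k]
    by (simp add: norm_mult mult.commute)
qed

text \<open>The circle \<open>|v| = dl k 0\<close> is sent by the iterate of order
  \<open>m^k\<close> to moduli of at least \<open>3 |Lam 0 k|\<close>, so a connected set whose
  image stays below this modulus cannot cross it.\<close>

lemma barrier:
  assumes B: "connected B" "z \<in> B" "norm z < dl k 0"
    and q: "\<And>w. w \<in> B \<Longrightarrow> norm ((P ^^ (m ^ k)) w) < 3 * norm (Lam 0 k)" and w: "w \<in> B"
  shows "norm w < dl k 0"
proof (rule ccontr)
  assume n: "\<not> norm w < dl k 0"
  have "connected (norm ` B)" by (rule connected_continuous_image[OF _ B(1)]) (intro continuous_intros)
  hence iv: "is_interval (norm ` B)" by (simp only: is_interval_connected_1)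
  have "dl k 0 \<in> norm ` B"
    by (rule mem_is_interval_1_I[OF iv imageI[OF B(2)] imageI[OF w]]) (use n B(3) in simp_all)
  then obtain v where v: "v \<in> B" "norm v = dl k 0" by auto
  define \<zeta> where "\<zeta> = v / Lam 0 k"
  have L0: "norm (Lam 0 k) > 0" using Lam_nz by simp
  have z: "norm \<zeta> = 13/5" using v(2) L0 by (simp add: \<zeta>_def dl_def norm_divide)
  have "v = Lam 0 k * \<zeta>" using Lam_nz by (simp add: \<zeta>_def)
  moreover have "(P ^^ (m ^ k * 1)) (Lam 0 k * \<zeta>) = Lam 0 k * (F (0 + k) ^^ 1) \<zeta>" by (rule level_scale)
  ultimately have e: "norm ((P ^^ (m ^ k)) v) = norm (Lam 0 k) * norm (F k \<zeta>)"
    by (simp add: norm_mult)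
  have "norm (F k \<zeta>) \<ge> (norm \<zeta>)\<^sup>2 - 59/25" by (rule L.f_lower) (simp add: z)
  hence "3 \<le> norm (F k \<zeta>)" by (simp add: z power2_eq_square)
  hence "norm (Lam 0 k) * 3 \<le> norm (Lam 0 k) * norm (F k \<zeta>)" by (rule mult_left_mono) simp
  thus False using q[OF v(1)] e by linarith
qed

text \<open>Suppose the pullback after \<open>j\<close> steps contains the critical value. Then
  \<open>crit_return\<close> makes \<open>m^k\<close> divide \<open>j + 1\<close>, and the pullback
  to time \<open>n - m^k\<close> contains a point of the critical orbit in the disc of radius
  \<open>dl k 0\<close>. By \<open>barrier\<close> the orbit of \<open>x\<close> is in that disc at
  time \<open>n - m^k\<close> already, against the first entry at time \<open>n\<close>.\<close>

lemma entry_branch: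
  assumes n: "norm ((P ^^ n) x) < dl k 0" and first: "\<And>i. i < n \<Longrightarrow> dl k 0 \<le> norm ((P ^^ i) x)"
  shows "\<exists>\<phi>. br n (ball 0 (3 * norm (Lam 0 k))) \<phi> \<and> \<phi> ((P ^^ n) x) = x"
proof (rule br_exists)
  let ?D = "ball 0 (3 * norm (Lam 0 k)) :: complex set" and ?y = "(P ^^ n) x" and ?q = "m ^ k"
  show "simply_connected ?D" by (simp add: convex_imp_simply_connected)
  have L0: "norm (Lam 0 k) > 0" using Lam_nz by simp
  have "norm ?y < 3 * norm (Lam 0 k)" using n L0 unfolding dl_def by linarith
  thus yD: "?y \<in> ?D" by simp
  have q1: "?q \<ge> 1" using L.m by simp
  fix j \<phi> assume j: "j < n" and b: "br j ?D \<phi>" and \<phi>y: "\<phi> ?y = (P ^^ (n - j)) x"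
  show "c \<notin> \<phi> ` ?D"
  proof
    assume "c \<in> \<phi> ` ?D"
    then obtain w where w: "w \<in> ?D" "\<phi> w = c" by auto
    have c0: "c = P 0" by (simp add: P_eq)
    have "w = (P ^^ j) c" using b w by (auto simp: br_def)
    hence wj: "w = (P ^^ Suc j) 0" unfolding c0 by (simp add: funpow_swap1)
    hence "norm ((F 0 ^^ Suc j) 0) < 3 * norm (Lam 0 k)" using w by simp
    hence "?q dvd Suc j" by (rule crit_return)
    then obtain l where l: "Suc j = ?q * l" by (elim dvdE)
    have l1: "l \<ge> 1" using l by (cases l) auto
    have qj: "?q \<le> Suc j" unfolding l using l1 by simp
    have qn: "?q \<le> n" using qj j by simp
    have "norm ((P ^^ (n - ?q)) x) < dl k 0"
    proof (cases "l = 1")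
      case False
      hence l2: "l \<ge> 2" using l1 by simp
      have "?q * 2 \<le> ?q * l" by (rule mult_le_mono2[OF l2])
      hence qj': "?q \<le> j" using l q1 by linarith
      define B where "B = (\<lambda>w. (P ^^ (j - ?q)) (\<phi> w)) ` ?D"
      have conB: "connected B" unfolding B_def
      proof (rule connected_continuous_image)
        have "continuous_on ?D \<phi>" using b by (auto simp: br_def intro: holomorphic_on_imp_continuous_on)
        thus "continuous_on ?D (\<lambda>w. (P ^^ (j - ?q)) (\<phi> w))"
          using continuous_on_compose[OF _ Pn_cont] by (auto simp: o_def)
      qed (simp add: convex_connected)
      have PB: "(P ^^ ?q) ((P ^^ (j - ?q)) (\<phi> v)) = v" if "v \<in> ?D" for v
      proof -
        have "(P ^^ (?q + (j - ?q))) (\<phi> v) = v" using b that qj' by (simp add: br_def)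
        thus ?thesis by (simp only: funpow_add o_apply)
      qed
      have wB: "(P ^^ (j - ?q)) (\<phi> w) \<in> B" unfolding B_def by (rule imageI[OF w(1)])
      have wn: "norm ((P ^^ (j - ?q)) (\<phi> w)) < dl k 0"
      proof -
        have "(P ^^ (j - ?q)) (\<phi> w) = (P ^^ Suc (j - ?q)) 0" unfolding w(2) c0 by (simp add: funpow_swap1)
        also have "Suc (j - ?q) = ?q * (l - 1)" using l qj' by (simp add: diff_mult_distrib2)
        finally have "norm ((P ^^ (j - ?q)) (\<phi> w)) < (47/20) * norm (Lam 0 k)" using crit_scaled by simp
        thus ?thesis using L0 unfolding dl_def by linarith
      qed
      have yB: "(P ^^ (j - ?q)) (\<phi> ?y) \<in> B" unfolding B_def by (rule imageI[OF yD])
      have qB: "norm ((P ^^ ?q) v) < 3 * norm (Lam 0 k)" if vB: "v \<in> B" for v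
      proof -
        obtain v' where v': "v' \<in> ?D" "v = (P ^^ (j - ?q)) (\<phi> v')" using vB unfolding B_def by blast
        have "(P ^^ ?q) v = v'" unfolding v'(2) by (rule PB[OF v'(1)])
        thus ?thesis using v'(1) by simp
      qed
      have "norm ((P ^^ (j - ?q)) (\<phi> ?y)) < dl k 0" by (rule barrier[OF conB wB wn qB yB])
      moreover have "(P ^^ (j - ?q)) (\<phi> ?y) = (P ^^ (n - ?q)) x"
      proof -
        have "(P ^^ (j - ?q)) ((P ^^ (n - j)) x) = (P ^^ ((j - ?q) + (n - j))) x" by (simp only: funpow_add o_apply)
        moreover have "(j - ?q) + (n - j) = n - ?q" using qj' j by simp
        ultimately show ?thesis by (simp only: \<phi>y)
      qed
      ultimately show ?thesis by simp
    next
      case True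
      hence qj': "?q = Suc j" using l by simp
      \<comment> \<open>In this case the pullback surrounds the critical point itself and no square
        root of \<open>\<phi> - c\<close> exists. The connected set is the full preimage, under
        squaring, of a path starting at 0.\<close>
      let ?Y = "(\<lambda>v. \<phi> v - c) ` closed_segment w ?y"
      let ?S = "{z. z\<^sup>2 \<in> ?Y}"
      have seg: "closed_segment w ?y \<subseteq> ?D" using w yD by (intro closed_segment_subset) auto
      have c\<phi>: "continuous_on (closed_segment w ?y) (\<lambda>v. \<phi> v - c)"
        using b seg by (intro continuous_intros) (auto simp: br_def intro: holomorphic_on_imp_continuous_on holomorphic_on_subset)
      have S: "connected ?S"
      proof (rule sq_preimage_connected)
        show "compact ?Y" by (rule compact_continuous_image[OF c\<phi> compact_segment])
        show "connected ?Y" by (rule connected_continuous_image[OF c\<phi> connected_segment])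
        show "0 \<in> ?Y" using w by (intro image_eqI[of _ _ w]) auto
      qed
      have zS: "0 \<in> ?S" using w by (auto intro!: image_eqI[of _ _ w])
      have PS: "norm ((P ^^ ?q) z) < 3 * norm (Lam 0 k)" if zS': "z \<in> ?S" for z
      proof -
        obtain v where v: "v \<in> closed_segment w ?y" "z\<^sup>2 = \<phi> v - c" using zS' by auto
        hence "P z = \<phi> v" by (simp add: P_eq)
        hence "(P ^^ ?q) z = (P ^^ j) (\<phi> v)" unfolding qj' by (simp add: funpow_swap1)
        also have "\<dots> = v" using b v seg by (auto simp: br_def)
        finally show ?thesis using v seg by auto
      qed
      have xS: "(P ^^ (n - ?q)) x \<in> ?S"
      proof -
        have "n - j = Suc (n - ?q)" using qj' j by simp
        hence "P ((P ^^ (n - ?q)) x) = \<phi> ?y" using \<phi>y by simp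
        hence "((P ^^ (n - ?q)) x)\<^sup>2 = \<phi> ?y - c" unfolding P_eq by (simp add: eq_diff_eq)
        hence "((P ^^ (n - ?q)) x)\<^sup>2 \<in> ?Y" by (rule image_eqI[of _ _ ?y]) simp
        thus ?thesis by (rule CollectI)
      qed
      have "norm (0::complex) < dl k 0" by (simp add: dl_pos)
      thus ?thesis by (rule barrier[OF S zS _ PS xS])
    qed
    moreover have "n - ?q < n" using qn q1 by simp
    ultimately show False using first[of "n - ?q"] by linarith
  qed
qed simp

lemma ph_bounded:
  assumes "u \<in> Bs n y R" "\<rho> < R" shows "bounded (ph n y R u ` cball y \<rho>)"
proof -
  have "continuous_on (cball y \<rho>) (ph n y R u)"
    using ph[OF assms(1)] assms(2) unfolding br_def
    by (intro holomorphic_on_imp_continuous_on) (auto intro: holomorphic_on_subset)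
  thus ?thesis by (intro compact_imp_bounded compact_continuous_image compact_cball)
qed

text \<open>By first entry every point lies in the image of a branch over one fixed disc, so
  \<open>branch_sum\<close> applies. The ring bound \<open>52^k\<close> is beaten by
  \<open>|Lam|^(7/4) <= |Lam| <= 10^(-8 k)\<close>.\<close>

lemma cc_entry:
  assumes k: "k \<ge> 1"
  shows "cc (7/4) (20000 * (1/10^6) ^ k) {x. \<exists>n. norm ((P ^^ n) x) < dl k 0}"
proof -
  define l where "l = norm (Lam 0 k)"
  have l0: "l > 0" using Lam_nz by (simp add: l_def)
  \<comment> \<open>The choice makes \<open>\<theta> * r\<close> equal to \<open>dl k 0\<close>,
    while the circle of radius \<open>r = (29/10) l\<close> lies inside the ring of
    \<open>rho_ring\<close>.\<close>
  define \<theta> :: real where "\<theta> = 26/29"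
  define r where "r = (29/10) * l"
  define R where "R = 3 * l"
  have \<theta>r: "\<theta> * r = dl k 0" by (simp add: \<theta>_def r_def dl_def l_def)
  let ?X = "\<lambda>p. ph (fst p) 0 R (snd p) ` cball 0 (\<theta> * r)"
  let ?I = "Sigma UNIV (\<lambda>n. Bs n 0 R)"
  have Rr: "0 < r" "r < R" "\<theta> * r < R" using l0 by (auto simp: r_def R_def \<theta>_def)
  have l1: "l \<le> (1/10^8) ^ k" unfolding l_def by (rule Lam_le)
  have "(1/10^8::real) ^ k \<le> (1/10^8) ^ 1" using k by (intro power_decreasing) auto
  hence l8: "l \<le> 1/10^8" using l1 by simp
  have sum: "(\<Sum>n<N. \<Sum>u\<in>Bs n 0 R. diameter (ph n 0 R u ` cball 0 (\<theta> * r)) powr (7/4)) \<le> 20000 * (1/10^6) ^ k" for N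
  proof -
    have "(\<Sum>n<N. \<Sum>u\<in>Bs n 0 R. diameter (ph n 0 R u ` cball 0 (\<theta> * r)) powr (7/4))
        \<le> (2 * \<theta> * r) powr (7/4) * (200 * 52 ^ k / (1 - \<theta>))"
    proof (rule branch_sum[OF Rr(1,2), of 0 k])
      fix w :: complex assume w: "norm (w - 0) = r"
      thus "norm w < 3" using l8 by (simp add: r_def)
      fix K assume "K \<ge> k"
      then obtain K' where K': "K = k + K'" by (metis le_iff_add)
      have w': "norm w = (29/10) * norm (Lam 0 k)" using w by (simp add: r_def l_def)
      have "norm (Lam 0 k) > 0" using l0 by (simp add: l_def)
      hence "rho (k + K') 0 w \<le> 52 ^ k" using w' by (intro rho_ring) linarith+
      thus "rho K 0 w \<le> 52 ^ k" by (simp add: K')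
    qed (auto simp: \<theta>_def)
    also have "(2 * \<theta> * r) powr (7/4) \<le> (2 * \<theta> * r) powr 1"
      using l0 l8 by (intro powr_mono') (auto simp: \<theta>_def r_def)
    also have "(2 * \<theta> * r) powr 1 = (26/5) * l" using l0 by (simp add: \<theta>_def r_def)
    finally have "(\<Sum>n<N. \<Sum>u\<in>Bs n 0 R. diameter (ph n 0 R u ` cball 0 (\<theta> * r)) powr (7/4))
       \<le> (26/5) * l * (200 * 52 ^ k / (1 - \<theta>))" by (simp add: \<theta>_def)
    also have "\<dots> = (26/5) * 200 * (29/3) * (l * 52 ^ k)" by (simp add: \<theta>_def)
    also have "\<dots> \<le> 20000 * ((1/10^8) ^ k * 52 ^ k)"
      using l1 l0 by (intro mult_mono mult_right_mono) auto
    also have "(1/10^8) ^ k * 52 ^ k = (1/10^8 * 52 :: real) ^ k" by (rule power_mult_distrib[symmetric])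
    also have "20000 * (1/10^8 * 52 :: real) ^ k \<le> 20000 * (1/10^6) ^ k" by (intro mult_left_mono power_mono) auto
    finally show ?thesis .
  qed
  show ?thesis
  proof (rule cc_countable[where I = ?I and X = ?X])
    show "countable ?I" by (rule countable_SIGMA) (auto intro: countable_finite finite_Bs)
    show "{x. \<exists>n. norm ((P ^^ n) x) < dl k 0} \<subseteq> (\<Union>p\<in>?I. ?X p)"
    proof
      fix x assume "x \<in> {x. \<exists>n. norm ((P ^^ n) x) < dl k 0}"
      hence ex: "\<exists>n. norm ((P ^^ n) x) < dl k 0" by simp
      define n where "n = (LEAST n. norm ((P ^^ n) x) < dl k 0)"
      have n: "norm ((P ^^ n) x) < dl k 0" unfolding n_def by (rule LeastI_ex[OF ex])
      have f: "dl k 0 \<le> norm ((P ^^ i) x)" if "i < n" for i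
        using not_less_Least[of i "\<lambda>n. norm ((P ^^ n) x) < dl k 0"] that by (simp add: n_def)
      obtain \<phi> where \<phi>: "br n (ball 0 R) \<phi>" "\<phi> ((P ^^ n) x) = x"
        using entry_branch[OF n f] by (auto simp: R_def l_def)
      have yD: "(P ^^ n) x \<in> ball 0 R" using n \<theta>r Rr by simp
      have "\<phi> 0 \<in> Bs n 0 R" "\<phi> ((P ^^ n) x) = ph n 0 R (\<phi> 0) ((P ^^ n) x)"
        using br_in_Bs[OF \<phi>(1) _ yD] Rr by auto
      hence "x \<in> ?X (n, \<phi> 0)" using \<phi>(2) n \<theta>r by (auto intro!: image_eqI[of _ _ "(P ^^ n) x"])
      thus "x \<in> (\<Union>p\<in>?I. ?X p)" using \<open>\<phi> 0 \<in> Bs n 0 R\<close> by (intro UN_I[of "(n, \<phi> 0)"]) auto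
    qed
    show "bounded (?X p)" if "p \<in> ?I" for p using that Rr by (auto intro!: ph_bounded)
    fix J assume J: "finite J" "J \<subseteq> ?I"
    then obtain N where N: "\<And>p. p \<in> J \<Longrightarrow> fst p < N"
      using finite_nat_bounded[of "fst ` J"] by auto
    have "(\<Sum>p\<in>J. diameter (?X p) powr (7/4)) \<le> (\<Sum>p\<in>Sigma {..<N} (\<lambda>n. Bs n 0 R). diameter (?X p) powr (7/4))"
      using N J finite_Bs by (intro sum_mono2) auto
    also have "\<dots> = (\<Sum>n<N. \<Sum>u\<in>Bs n 0 R. diameter (ph n 0 R u ` cball 0 (\<theta> * r)) powr (7/4))"
      by (simp add: sum.Sigma finite_Bs case_prod_beta)
    also have "\<dots> \<le> 20000 * (1/10^6) ^ k" by (rule sum)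
    finally show "(\<Sum>p\<in>J. diameter (?X p) powr (7/4)) \<le> 20000 * (1/10^6) ^ k" .
  qed
qed


section \<open>Points that never enter the small disc\<close>

lemma P_lip:
  assumes "\<And>i. i < j \<Longrightarrow> norm ((P ^^ i) a) < 3" "\<And>i. i < j \<Longrightarrow> norm ((P ^^ i) b) < 3"
  shows "norm ((P ^^ j) a - (P ^^ j) b) \<le> 6 ^ j * norm (a - b)"
  using assms
proof (induction j)
  case (Suc j)
  let ?a = "(P ^^ j) a" and ?b = "(P ^^ j) b"
  have "P ?a - P ?b = (?a + ?b) * (?a - ?b)" by (simp add: P_eq power2_eq_square algebra_simps)
  hence "norm (P ?a - P ?b) = norm (?a + ?b) * norm (?a - ?b)" by (simp add: norm_mult)
  also have "\<dots> \<le> 6 * (6 ^ j * norm (a - b))"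
  proof (rule mult_mono)
    show "norm (?a + ?b) \<le> 6" using Suc.prems(1)[of j] Suc.prems(2)[of j] norm_triangle_ineq[of ?a ?b] by simp
    show "norm (?a - ?b) \<le> 6 ^ j * norm (a - b)" using Suc by auto
  qed auto
  finally show ?case by simp
qed simp

definition Q where "Q k = {x \<in> K0. \<forall>n. dl k 0 \<le> norm ((P ^^ n) x)}"

lemma Q_fwd: "x \<in> Q k \<Longrightarrow> (P ^^ n) x \<in> Q k"
  unfolding Q_def using K0_fwd by (auto simp: funpow_add[unfolded o_def fun_eq_iff, rule_format, symmetric])

text \<open>Any point of the critical orbit needs fewer than \<open>m^k\<close> further steps to
  reach a time divisible by \<open>m^k\<close>, when it is within \<open>(47/20) |Lam|\<close> of 0.
  A point too close would follow it to within a further \<open>|Lam| / 4\<close>, and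
  \<open>47/20 + 1/4 = 13/5\<close> is the radius that points of \<open>Q k\<close> avoid.\<close>

lemma Q_gap:
  assumes x: "x \<in> Q k" and i: "i \<ge> 1"
  shows "norm (Lam 0 k) / (4 * 6 ^ (m ^ k)) \<le> norm (x - (P ^^ i) 0)"
proof (rule ccontr)
  let ?q = "m ^ k" and ?L = "norm (Lam 0 k)"
  assume "\<not> ?thesis"
  hence lt: "norm (x - (P ^^ i) 0) < ?L / (4 * 6 ^ ?q)" by simp
  have q1: "?q \<ge> 1" using L.m by simp
  define j where "j = ?q * i - i"
  define j' where "j' = j mod ?q"
  have jq: "j' < ?q" unfolding j'_def using q1 by (intro mod_less_divisor) linarith
  have "?q dvd j' + i"
  proof -
    have "i \<le> ?q * i" using q1 by simp
    hence "(j + i) mod ?q = 0" by (simp add: j_def)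
    hence "(j' + i) mod ?q = 0" by (simp add: j'_def mod_simps)
    thus ?thesis by (simp add: dvd_eq_mod_eq_0)
  qed
  then obtain l where l: "j' + i = ?q * l" by (elim dvdE)
  have "norm ((P ^^ j') x - (P ^^ j') ((P ^^ i) 0)) \<le> 6 ^ j' * norm (x - (P ^^ i) 0)"
  proof (rule P_lip)
    fix s
    show "norm ((P ^^ s) x) < 3" using x K0_iff by (auto simp: Q_def)
    show "norm ((P ^^ s) ((P ^^ i) 0)) < 3"
      using crit_small[where n=0 and i="s + i"] by (simp add: funpow_add)
  qed
  also have "\<dots> \<le> 6 ^ ?q * norm (x - (P ^^ i) 0)" using jq by (intro mult_right_mono power_increasing) auto
  also have "\<dots> \<le> 6 ^ ?q * (?L / (4 * 6 ^ ?q))" using lt by (intro mult_left_mono) auto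
  also have "\<dots> = ?L / 4" by simp
  finally have "norm ((P ^^ j') x - (P ^^ (j' + i)) 0) \<le> ?L / 4" by (simp add: funpow_add)
  moreover have "norm ((P ^^ (j' + i)) 0) < (47/20) * ?L" unfolding l by (rule crit_scaled)
  ultimately have "norm ((P ^^ j') x) < (13/5) * ?L"
    using norm_triangle_ineq[of "(P ^^ j') x - (P ^^ (j' + i)) 0" "(P ^^ (j' + i)) 0"] by simp
  moreover have "dl k 0 \<le> norm ((P ^^ j') x)" using x by (simp add: Q_def)
  ultimately show False by (simp add: dl_def)
qed

text \<open>Away from the critical orbit all inverse branches exist on discs of a fixed size, and
  the diameter sums over all orders have bounded partial sums. So the branches of some single order
  \<open>n\<close> have total size at most \<open>\<epsilon>\<close>, and they already cover
  \<open>Q k\<close> since this set is forward invariant.\<close>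

lemma cc_Q:
  assumes \<epsilon>: "\<epsilon> > 0" shows "cc (7/4) \<epsilon> (Q k)"
proof -
  define d where "d = norm (Lam 0 k) / (4 * 6 ^ (m ^ k))"
  have d0: "d > 0" using Lam_nz by (simp add: d_def)
  have d1: "d \<le> 1"
  proof -
    have "(1::real) \<le> 6 ^ (m ^ k)" by simp
    hence "norm (Lam 0 k) \<le> 4 * 6 ^ (m ^ k)" using Lam_le_1[where n=0 and K=k] by linarith
    thus ?thesis by (simp add: d_def)
  qed
  note gap = Q_gap[where k=k, folded d_def]
  have c1: "compact (closure (Q k))"
  proof -
    have "norm z \<le> 3" if "z \<in> Q k" for z using that K0_small[of z] by (simp add: Q_def)
    hence "bounded (Q k)" by (auto simp: bounded_iff)
    thus ?thesis by (simp add: compact_closure)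
  qed
  have c2: "closure (Q k) \<subseteq> (\<Union>y\<in>Q k. ball y (d/8))"
  proof
    fix z assume "z \<in> closure (Q k)"
    then obtain y where "y \<in> Q k" "dist y z < d/8" using d0 closure_approachable[of z "Q k"] by (metis divide_pos_pos zero_less_numeral)
    thus "z \<in> (\<Union>y\<in>Q k. ball y (d/8))" by auto
  qed
  obtain Y where Y: "Y \<subseteq> Q k" "finite Y" "closure (Q k) \<subseteq> (\<Union>y\<in>Y. ball y (d/8))"
    by (rule compactE_image[OF c1 open_ball c2])
  obtain j :: nat where "8 / d < 2 ^ j" using real_arch_pow[of 2 "8/d"] by auto
  hence j: "6 / 2 ^ j \<le> 3 * d / 4" using d0 by (simp add: field_simps)
  obtain M where M0: "M \<ge> 0" and M: "\<And>n K y. norm y < 3 \<Longrightarrow> (\<forall>i\<ge>1. 6 / 2 ^ j \<le> norm (y - (F n ^^ i) 0)) \<Longrightarrow> rho K n y \<le> M"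
    using rho_away[of j] by blast
  define R r \<theta> :: real where "R = d/2" and "r = d/4" and "\<theta> = 1/2"
  have Rr: "0 < r" "r < R" "\<theta> * r = d/8" "\<theta> * r < R" using d0 by (auto simp: R_def r_def \<theta>_def)
  define T where "T = (2 * \<theta> * r) powr (7/4) * (200 * M / (1 - \<theta>))"
  have T: "(\<Sum>n<N. \<Sum>u\<in>Bs n y R. diameter (ph n y R u ` cball y (\<theta> * r)) powr (7/4)) \<le> T" if y: "y \<in> Y" for y N
    unfolding T_def
  proof (rule branch_sum[OF Rr(1,2), of y 0])
    have yQ: "y \<in> Q k" using y Y by blast
    fix w assume w: "norm (w - y) = r"
    have "norm y < 47/20" using K0_small yQ by (simp add: Q_def)
    thus w3: "norm w < 3" using w d1 norm_triangle_ineq[of "w - y" y] by (simp add: r_def)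
    fix K
    show "rho K 0 w \<le> M"
    proof (rule M[OF w3], intro allI impI)
      fix i :: nat assume "i \<ge> 1"
      hence "d \<le> norm (y - (P ^^ i) 0)" by (rule gap[OF yQ])
      hence "3 * d / 4 \<le> norm (w - (P ^^ i) 0)"
        using w norm_triangle_ineq4[of "w - (P ^^ i) 0" "w - y"] by (simp add: r_def)
      thus "6 / 2 ^ j \<le> norm (w - (P ^^ i) 0)" using j by linarith
    qed
  qed (auto simp: \<theta>_def)
  define S where "S = (\<lambda>n. \<Sum>y\<in>Y. \<Sum>u\<in>Bs n y R. diameter (ph n y R u ` cball y (\<theta> * r)) powr (7/4))"
  obtain N :: nat where N: "real (card Y) * T < real N * \<epsilon>" using reals_Archimedean3[OF \<epsilon>] by blast
  have "\<exists>n. S n \<le> \<epsilon>"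
  proof (rule ccontr)
    assume "\<not> (\<exists>n. S n \<le> \<epsilon>)"
    hence "(\<Sum>n<N. \<epsilon>) \<le> (\<Sum>n<N. S n)" by (intro sum_mono) (auto simp: not_le intro: less_imp_le)
    also have "\<dots> = (\<Sum>y\<in>Y. \<Sum>n<N. \<Sum>u\<in>Bs n y R. diameter (ph n y R u ` cball y (\<theta> * r)) powr (7/4))"
      unfolding S_def by (rule sum.swap)
    also have "\<dots> \<le> (\<Sum>y\<in>Y. T)" by (intro sum_mono T)
    finally show False using N by simp
  qed
  then obtain n where n: "S n \<le> \<epsilon>" by blast
  let ?I = "Sigma Y (\<lambda>y. Bs n y R)" and ?X = "\<lambda>p. ph n (fst p) R (snd p) ` cball (fst p) (\<theta> * r)"
  have fI: "finite ?I" using Y finite_Bs by auto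
  show ?thesis
  proof (rule cc_countable[where I = ?I and X = ?X])
    show "countable ?I" using fI by (rule countable_finite)
    show "Q k \<subseteq> (\<Union>p\<in>?I. ?X p)"
    proof
      fix x assume x: "x \<in> Q k"
      let ?z = "(P ^^ n) x"
      have "?z \<in> closure (Q k)" using Q_fwd[OF x, of n] closure_subset by blast
      then obtain y where y: "y \<in> Y" "?z \<in> ball y (d/8)" using Y(3) by blast
      have yQ: "y \<in> Q k" using y Y by blast
      have zR: "?z \<in> ball y R" using y d0 by (simp add: R_def)
      have "\<exists>\<phi>. br n (ball y R) \<phi> \<and> \<phi> ?z = x"
      proof (rule br_exists)
        show "simply_connected (ball y R)" by (simp add: convex_imp_simply_connected)
        fix j \<phi> assume b: "br j (ball y R) \<phi>"
        show "c \<notin> \<phi> ` ball y R"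
        proof
          assume "c \<in> \<phi> ` ball y R"
          then obtain w where w: "w \<in> ball y R" "\<phi> w = c" by auto
          have "w = (P ^^ j) c" using b w by (auto simp: br_def)
          hence "w = (P ^^ Suc j) 0" by (simp add: funpow_swap1 P_eq)
          hence "norm (y - (P ^^ Suc j) 0) < d" using w d0 by (simp add: R_def dist_norm)
          thus False using gap[OF yQ, of "Suc j"] by simp
        qed
      qed (use zR in auto)
      then obtain \<phi> where \<phi>: "br n (ball y R) \<phi>" "\<phi> ?z = x" by blast
      have R0: "R > 0" using Rr by simp
      have B: "\<phi> y \<in> Bs n y R" "\<phi> ?z = ph n y R (\<phi> y) ?z" by (rule br_in_Bs[OF \<phi>(1) R0 zR])+
      have "x \<in> ?X (y, \<phi> y)" using \<phi>(2) B(2) y(2) Rr(3) by (auto intro!: image_eqI[of _ _ ?z])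
      thus "x \<in> (\<Union>p\<in>?I. ?X p)" using B(1) y(1) by (intro UN_I[of "(y, \<phi> y)"]) auto
    qed
    show "bounded (?X p)" if "p \<in> ?I" for p using that Rr by (auto intro!: ph_bounded)
    fix J assume "finite J" "J \<subseteq> ?I"
    hence "(\<Sum>p\<in>J. diameter (?X p) powr (7/4)) \<le> (\<Sum>p\<in>?I. diameter (?X p) powr (7/4))"
      using fI by (intro sum_mono2) auto
    also have "\<dots> = S n" unfolding S_def using Y by (simp add: sum.Sigma finite_Bs case_prod_beta)
    finally show "(\<Sum>p\<in>J. diameter (?X p) powr (7/4)) \<le> \<epsilon>" using n by simp
  qed
qed

theorem cc_K0:
  assumes \<epsilon>: "\<epsilon> > 0" shows "cc (7/4) \<epsilon> K0"
proof -
  obtain k0 where k0: "(1/10^6::real) ^ k0 < \<epsilon> / 40000" using real_arch_pow_inv[of "\<epsilon>/40000" "1/10^6"] \<epsilon> by auto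
  define k where "k = Suc k0"
  have "(1/10^6::real) ^ k \<le> (1/10^6) ^ k0" by (rule power_decreasing) (auto simp: k_def)
  hence "20000 * (1/10^6) ^ k \<le> \<epsilon>/2" using k0 by linarith
  moreover have "cc (7/4) (20000 * (1/10^6) ^ k + \<epsilon>/2) ({x. \<exists>n. norm ((P ^^ n) x) < dl k 0} \<union> Q k)"
    using \<epsilon> by (intro cc_Un cc_entry cc_Q) (auto simp: k_def)
  moreover have "K0 \<subseteq> {x. \<exists>n. norm ((P ^^ n) x) < dl k 0} \<union> Q k" by (auto simp: Q_def not_less)
  ultimately show ?thesis by (elim cc_mono) auto
qed

lemma K0_interior: "interior K0 = {}"
  by (rule cc_empty_interior[OF cc_K0]) auto

theorem HD_lt_2: "hausdorff_dim (poly_julia c) < 2"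
proof -
  have "poly_julia c \<subseteq> K0"
  proof -
    have "poly_julia c = frontier K0" by (simp add: poly_julia_def K0_def P_quad)
    thus ?thesis using K0_closed by (simp add: frontier_subset_eq)
  qed
  hence "cc (7/4) \<epsilon> (poly_julia c)" if "\<epsilon> > 0" for \<epsilon> using cc_mono[OF cc_K0[OF that]] by simp
  hence "hausdorff_measure (7/4) (poly_julia c) = 0" by (intro hausdorff_measure_null) auto
  hence "hausdorff_dim (poly_julia c) \<le> 7/4"
    unfolding hausdorff_dim_def by (intro cInf_lower) (auto intro: bdd_belowI[of _ 0])
  thus ?thesis by simp
qed

end

section \<open>Towers give Feigenbaum maps\<close>

text \<open>Properness: the points of \<open>U\<close> mapped into the closure of the filled Julia
  set form a compact set, so limit points stay in \<open>U\<close> together with all their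
  images.\<close>

lemma filled_julia_closed:
  assumes q: "ql_map f U V"
  shows "closed (filled_julia f U)"
proof -
  let ?K = "filled_julia f U"
  have KU: "?K \<subseteq> U" unfolding filled_julia_def by (auto dest: spec[of _ 0])
  have fK: "f z \<in> ?K" if zK: "z \<in> ?K" for z
    using zK unfolding filled_julia_def by (auto simp: funpow_swap1 dest: spec[of _ "Suc _"])
  have bU: "bounded U" and cUV: "closure U \<subseteq> V" using q by (auto simp: ql_map_def topological_disk_def)
  have "compact (closure ?K)" using bounded_subset[OF bU KU] by (simp add: compact_closure)
  moreover have "closure ?K \<subseteq> V" using closure_mono[OF KU] cUV by blast
  ultimately have cE: "compact {z\<in>U. f z \<in> closure ?K}" using q by (auto simp: ql_map_def)
  have "?K \<subseteq> {z\<in>U. f z \<in> closure ?K}" using KU fK closure_subset by blast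
  hence sub: "closure ?K \<subseteq> {z\<in>U. f z \<in> closure ?K}" by (rule closure_minimal[OF _ compact_imp_closed[OF cE]])
  have "(f ^^ n) z \<in> closure ?K" if "z \<in> closure ?K" for n z
    using that by (induction n) (use sub in auto)
  hence "closure ?K \<subseteq> ?K" using sub unfolding filled_julia_def by blast
  thus ?thesis by (simp add: closure_subset_eq)
qed

lemma filled_julia_nonempty:
  assumes q: "ql_map f U V"
  shows "filled_julia f U \<noteq> {}"
proof -
  define E where "E = (\<lambda>n. ((\<lambda>S. {z\<in>U. f z \<in> S}) ^^ n) (closure U))"
  have E0: "E 0 = closure U" and ES: "E (Suc n) = {z\<in>U. f z \<in> E n}" for n by (simp_all add: E_def)
  have cUV: "closure U \<subseteq> V" and ne: "U \<noteq> {}" and cU: "compact (closure U)" and im: "f ` U = V"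
    and pr: "\<And>C. compact C \<Longrightarrow> C \<subseteq> V \<Longrightarrow> compact {z\<in>U. f z \<in> C}"
    using q by (auto simp: ql_map_def topological_disk_def)
  have E: "compact (E n) \<and> E n \<subseteq> closure U \<and> E n \<noteq> {}" for n
  proof (induction n)
    case 0 thus ?case using cU ne by (simp add: E0)
  next
    case (Suc n)
    have sV: "E n \<subseteq> V" using Suc cUV by blast
    obtain y where y: "y \<in> E n" using Suc by blast
    then obtain z where "z \<in> U" "f z = y" using sV im by blast
    thus ?case using pr[of "E n"] Suc sV y closure_subset unfolding ES by blast
  qed
  have dec: "E (Suc n) \<subseteq> E n" for n
  proof (induction n)
    case 0 show ?case unfolding ES E0 using closure_subset by blast
  next
    case (Suc n) thus ?case unfolding ES[of n] ES[of "Suc n"] by blast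
  qed
  have "\<Inter> (range E) \<noteq> {}"
  proof (rule compact_nest)
    show "compact (E n)" "E n \<noteq> {}" for n using E[of n] by auto
    show "E n \<subseteq> E k" if "k \<le> n" for k n using lift_Suc_antimono_le[of E, OF dec that] .
  qed
  then obtain z where z: "\<And>n. z \<in> E n" by blast
  have "(f ^^ n) z \<in> U \<and> (\<forall>k. (f ^^ n) z \<in> E k)" for n
  proof (induction n)
    case 0 thus ?case using z[of "Suc 0"] z unfolding ES by auto
  next
    case (Suc n)
    have k: "f ((f ^^ n) z) \<in> E k" for k
    proof -
      have "(f ^^ n) z \<in> E (Suc k)" using Suc by blast
      thus ?thesis unfolding ES by blast
    qed
    moreover have "f ((f ^^ n) z) \<in> U" using k[of "Suc 0"] unfolding ES by blast
    ultimately show ?case by simp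
  qed
  thus ?thesis unfolding filled_julia_def by blast
qed

lemma julia_eq_filled:
  assumes "closed (filled_julia f U)" "interior (filled_julia f U) = {}"
  shows "julia f U = filled_julia f U"
  using assms by (simp add: julia_def frontier_def closure_closed)

text \<open>Competing renormalizations come with arbitrary domains, so symmetry has to be proved.
  The set \<open>T\<close> of points whose negatives also lie in \<open>U\<close> is open; by
  evenness and properness it is closed in \<open>U\<close>; and \<open>U\<close> is
  connected.\<close>

lemma ql_symmetric:
  assumes q: "ql_map f U V" and ev: "\<And>z. f (- z) = f z" and z: "z \<in> U"
  shows "- z \<in> U"
proof -
  have oU: "open U" and conU: "connected U" and oV: "open V" and zU: "0 \<in> U" and hol: "f holomorphic_on U" and im: "f ` U = V"
    and pr: "\<And>C. compact C \<Longrightarrow> C \<subseteq> V \<Longrightarrow> compact {z\<in>U. f z \<in> C}"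
    using q by (auto simp: ql_map_def topological_disk_def)
  define T where "T = U \<inter> uminus -` U"
  have oT: "open T" unfolding T_def by (rule open_Int[OF oU open_vimage[OF oU]]) (intro continuous_intros)
  have TU: "T \<subseteq> U" by (simp add: T_def)
  have cT: "u \<in> T" if u: "u \<in> U" "u \<in> closure T" for u
  proof -
    have "f u \<in> V" using im u by blast
    then obtain e where e: "e > 0" "cball (f u) e \<subseteq> V" using oV open_contains_cball by blast
    define D where "D = {z\<in>U. f z \<in> cball (f u) e}"
    have D: "closed D" unfolding D_def by (rule compact_imp_closed[OF pr]) (use e in auto)
    obtain s where s: "\<And>n. s n \<in> T" "s \<longlonglongrightarrow> u" using u(2) unfolding closure_sequential by blast
    have "isCont f u" using continuous_on_interior[OF holomorphic_on_imp_continuous_on[OF hol]] u(1) interior_open[OF oU] by blast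
    hence "(\<lambda>n. f (s n)) \<longlonglongrightarrow> f u" using s(2) by (rule isCont_tendsto_compose)
    hence "eventually (\<lambda>n. dist (f (s n)) (f u) < e) sequentially" using e(1) by (rule tendstoD)
    hence "eventually (\<lambda>n. - s n \<in> D) sequentially"
    proof (rule eventually_mono)
      fix n assume "dist (f (s n)) (f u) < e"
      hence "f (- s n) \<in> cball (f u) e" unfolding ev by (simp add: dist_commute)
      moreover have "- s n \<in> U" using s(1)[of n] by (simp add: T_def)
      ultimately show "- s n \<in> D" by (simp add: D_def)
    qed
    moreover have "(\<lambda>n. - s n) \<longlonglongrightarrow> - u" by (intro tendsto_intros s)
    ultimately have "- u \<in> D" by (rule Lim_in_closed_set[OF D _ sequentially_bot])
    thus ?thesis using u by (auto simp: T_def D_def)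
  qed
  have "T = U \<inter> closure T"
  proof
    show "T \<subseteq> U \<inter> closure T" using TU closure_subset[of T] by simp
    show "U \<inter> closure T \<subseteq> T" using cT by blast
  qed
  hence "closedin (top_of_set U) T" using closedin_closed_Int[OF closed_closure, of U T] by simp
  moreover have "openin (top_of_set U) T" by (rule open_subset[OF TU oT])
  moreover have "T \<noteq> {}" using zU by (auto simp: T_def)
  ultimately have "T = U" using conU[unfolded connected_clopen] by blast
  thus ?thesis using z by (auto simp: T_def)
qed

text \<open>If 0 were in the unbounded component, \<open>x / |x|\<close> would have a continuous
  argument \<open>\<theta>\<close> on \<open>K\<close> by Borsuk's theorem. The odd function
  \<open>\<theta> x - \<theta> (- x)\<close> vanishes somewhere on the connected set
  \<open>K\<close>, and there opposite points would have the same direction.\<close>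

lemma symmetric_continuum_bounded_component:
  fixes K :: "complex set"
  assumes K: "compact K" "connected K" "K \<noteq> {}" and sym: "\<And>z. z \<in> K \<Longrightarrow> - z \<in> K" and z0: "0 \<notin> K"
  shows "bounded (connected_component_set (- K) 0)"
proof (rule ccontr)
  assume "\<not> ?thesis"
  then obtain \<theta> where \<theta>: "continuous_on K \<theta>" "\<And>x. x \<in> K \<Longrightarrow> inverse (norm (x - 0)) *\<^sub>R (x - 0) = exp (\<i> * of_real (\<theta> x))"
    using Borsuk_map_essential_bounded_component[OF K(1) z0] inessential_eq_continuous_logarithm_circle[of K "\<lambda>x. inverse (norm (x - 0)) *\<^sub>R (x - 0)"]
    by auto
  define \<delta> where "\<delta> = (\<lambda>x. \<theta> x - \<theta> (- x))"
  have "continuous_on K (\<lambda>x. \<theta> (- x))"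
  proof (rule continuous_on_compose2[OF \<theta>(1)])
    show "continuous_on K uminus" by (intro continuous_intros)
    show "uminus ` K \<subseteq> K" using sym by blast
  qed
  hence c\<delta>: "continuous_on K \<delta>" unfolding \<delta>_def by (intro continuous_intros \<theta>)
  obtain x where x: "x \<in> K" using K(3) by blast
  have "connected (\<delta> ` K)" by (rule connected_continuous_image[OF c\<delta> K(2)])
  hence iv: "is_interval (\<delta> ` K)" by (simp only: is_interval_connected_1)
  have xm: "\<delta> x \<in> \<delta> ` K" "- \<delta> x \<in> \<delta> ` K"
  proof -
    show "\<delta> x \<in> \<delta> ` K" by (rule imageI[OF x])
    have "- \<delta> x = \<delta> (- x)" by (simp add: \<delta>_def)
    thus "- \<delta> x \<in> \<delta> ` K" using sym[OF x] by blast
  qed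
  have "0 \<in> \<delta> ` K"
  proof (cases "\<delta> x \<le> 0")
    case True thus ?thesis by (intro mem_is_interval_1_I[OF iv xm(1) xm(2)]) auto
  next
    case False thus ?thesis by (intro mem_is_interval_1_I[OF iv xm(2) xm(1)]) auto
  qed
  then obtain y where y: "y \<in> K" "\<theta> y = \<theta> (- y)" by (auto simp: \<delta>_def)
  have "inverse (norm y) *\<^sub>R y = inverse (norm y) *\<^sub>R (- y)"
    using \<theta>(2)[OF y(1)] \<theta>(2)[OF sym[OF y(1)]] y(2) by simp
  hence "y = 0" by (simp add: scaleR_right.minus) 
  thus False using y z0 by simp
qed

context nq begin

text \<open>The increment \<open>d\<close> is nearly \<open>(s^2 - 1) u^2\<close>, and its inner
  product with \<open>f u\<close> is nonnegative because \<open>|u|^2 >= 4\<close> exceeds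
  \<open>59/25 + 12/500\<close>. This makes the domain \<open>U\<close> below star-shaped, as the
  bound on its modulus requires.\<close>

lemma f_radial:
  assumes u: "2 \<le> norm u" "1 \<le> s" "s * norm u \<le> 3"
  shows "norm (f u) \<le> norm (f (of_real s * u))"
proof -
  define d where "d = f (of_real s * u) - f u"
  have nu: "norm u \<le> 3" using u mult_right_mono[of 1 s "norm u"] by simp
  have nsu: "norm (of_real s * u) \<le> 3" using u by (simp add: norm_mult)
  define S where "S = s\<^sup>2 - 1"
  have S0: "S \<ge> 0" using u(2) by (simp add: S_def)
  have sq: "(of_real s * u)\<^sup>2 - u\<^sup>2 = of_real S * u\<^sup>2" by (simp add: S_def power_mult_distrib algebra_simps)
  have "norm (d - of_real S * u\<^sup>2) \<le> (1/500) * norm (of_real S * u\<^sup>2)"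
    unfolding d_def sq[symmetric] qm_def using nu nsu by (intro lip_close norm_sq16) auto
  hence e: "norm (d - of_real S * u\<^sup>2) \<le> (1/500) * (S * (norm u)\<^sup>2)" using S0 by (simp add: norm_mult norm_power)
  have "Re (cnj (f u) * d) \<ge> 0"
  proof -
    have k: "norm (f u - u\<^sup>2) \<le> 59/25"
      using f_close[of u] nu norm_t norm_triangle_ineq[of "f u - (u\<^sup>2 + t)" t] by simp
    have n4: "(norm u)\<^sup>2 \<ge> 4" using power_mono[OF u(1), of 2] by simp
    have n9: "(norm u)\<^sup>2 \<le> 9" using power_mono[OF nu, of 2] by simp
    have fu: "norm (f u) \<le> 12" using f_upper[of u] nu n9 by simp
    have "cnj (f u) * d = cnj (u\<^sup>2) * (of_real S * u\<^sup>2) + cnj (f u - u\<^sup>2) * (of_real S * u\<^sup>2) + cnj (f u) * (d - of_real S * u\<^sup>2)"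
      by (simp add: algebra_simps)
    hence "Re (cnj (f u) * d) = Re (cnj (u\<^sup>2) * (of_real S * u\<^sup>2)) + Re (cnj (f u - u\<^sup>2) * (of_real S * u\<^sup>2)) + Re (cnj (f u) * (d - of_real S * u\<^sup>2))"
      by (simp only: plus_complex.simps)
    moreover have "Re (cnj (u\<^sup>2) * (of_real S * u\<^sup>2)) = S * (norm u)\<^sup>2 * (norm u)\<^sup>2"
    proof -
      have "cnj (u\<^sup>2) * (of_real S * u\<^sup>2) = of_real S * (u\<^sup>2 * cnj (u\<^sup>2))" by simp
      also have "u\<^sup>2 * cnj (u\<^sup>2) = of_real ((norm (u\<^sup>2))\<^sup>2)" by (rule complex_norm_square[symmetric])
      also have "of_real S * of_real ((norm (u\<^sup>2))\<^sup>2) = (of_real (S * (norm u)\<^sup>2 * (norm u)\<^sup>2) :: complex)"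
        by (simp add: norm_power norm_mult power2_eq_square)
      finally show ?thesis by (simp only: Re_complex_of_real)
    qed
    moreover have "Re (cnj (f u - u\<^sup>2) * (of_real S * u\<^sup>2)) \<ge> - (59/25 * (S * (norm u)\<^sup>2))"
    proof -
      have "norm (cnj (f u - u\<^sup>2) * (of_real S * u\<^sup>2)) = norm (f u - u\<^sup>2) * (S * (norm u)\<^sup>2)"
        using S0 by (simp only: norm_mult complex_mod_cnj norm_of_real norm_power abs_of_nonneg)
      also have "\<dots> \<le> 59/25 * (S * (norm u)\<^sup>2)" using k S0 by (intro mult_right_mono) auto
      finally show ?thesis using complex_Re_le_cmod[of "- (cnj (f u - u\<^sup>2) * (of_real S * u\<^sup>2))"] by simp
    qed
    moreover have "Re (cnj (f u) * (d - of_real S * u\<^sup>2)) \<ge> - (12 * ((1/500) * (S * (norm u)\<^sup>2)))"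
    proof -
      have "norm (cnj (f u) * (d - of_real S * u\<^sup>2)) \<le> 12 * ((1/500) * (S * (norm u)\<^sup>2))"
        unfolding norm_mult complex_mod_cnj using fu e by (intro mult_mono) auto
      thus ?thesis using complex_Re_le_cmod[of "- (cnj (f u) * (d - of_real S * u\<^sup>2))"] by simp
    qed
    moreover have "S * (norm u)\<^sup>2 * (norm u)\<^sup>2 \<ge> S * (norm u)\<^sup>2 * 4" using n4 S0 by (intro mult_left_mono) auto
    moreover have "S * (norm u)\<^sup>2 \<ge> 0" using S0 by simp
    ultimately show ?thesis by linarith
  qed
  moreover have "(norm (f u + d))\<^sup>2 = (norm (f u))\<^sup>2 + 2 * Re (cnj (f u) * d) + (norm d)\<^sup>2"
    unfolding cmod_power2 by (simp add: power2_eq_square algebra_simps)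
  moreover have "(norm d)\<^sup>2 \<ge> 0" by simp
  ultimately have "(norm (f u))\<^sup>2 \<le> (norm (f u + d))\<^sup>2" by linarith
  hence "norm (f u) \<le> norm (f u + d)" by (rule power2_le_imp_le) simp
  thus ?thesis by (simp add: d_def)
qed

lemma psi_cover:
  assumes "norm v \<le> 13/2" obtains w where "norm w < 9" "\<psi> w = v"
proof -
  let ?H = "\<lambda>w. w - (\<psi> w - v)"
  have "?H w \<in> cball 0 (89/10)" if "w \<in> cball 0 (89/10)" for w
  proof -
    have "norm (\<psi> w - (w + t)) \<le> 1/100" using that by (intro close) auto
    moreover have "?H w = v - t - (\<psi> w - (w + t))" by simp
    ultimately have "norm (?H w) \<le> norm v + norm t + 1/100"
      using norm_triangle_ineq4[of "v - t" "\<psi> w - (w + t)"] norm_triangle_ineq4[of v t] by (simp only:)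
    thus ?thesis using assms norm_t by simp
  qed
  moreover have "continuous_on (cball 0 (89/10)) ?H"
    by (intro continuous_intros holomorphic_on_imp_continuous_on hol)
  ultimately obtain w where "w \<in> cball 0 (89/10)" "?H w = w"
    using brouwer_ball[of "89/10" 0 ?H] by (auto simp: Pi_def)
  thus ?thesis using that[of w] by simp
qed

end

section \<open>A quadratic-like restriction of a rescaled map\<close>

locale nqs = nq +
  fixes \<Lambda> :: complex and g :: "complex \<Rightarrow> complex"
  assumes \<Lambda>0: "\<Lambda> \<noteq> 0" and g_eq: "g z = \<Lambda> * qm \<psi> (z / \<Lambda>)"
begin

abbreviation l where "l \<equiv> norm \<Lambda>"
text \<open>13/2 separates the values of \<open>|f|\<close> on the disc of radius 2, at most
  \<open>4 + 59/25\<close>, from those on the circle of radius 3, at least \<open>9 - 59/25\<close>.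
  So \<open>U\<close> contains the disc of radius \<open>2 l\<close> and its closure avoids the
  circle of radius \<open>3 l\<close>.\<close>

definition U where "U = {z. norm z < 3 * l \<and> norm (g z) < (13/2) * l}"
definition V where "V = ball (0::complex) ((13/2) * l)"

lemma l0: "l > 0" using \<Lambda>0 by simp

lemma g_hol: "g holomorphic_on S"
proof -
  have "(\<lambda>z. f (z / \<Lambda>)) holomorphic_on S"
    by (rule holomorphic_on_compose_gen[of "\<lambda>z. z / \<Lambda>" S f UNIV, unfolded o_def, OF _ f_hol])
       (auto intro!: holomorphic_intros simp: \<Lambda>0)
  hence "(\<lambda>z. \<Lambda> * f (z / \<Lambda>)) holomorphic_on S" by (intro holomorphic_on_mult holomorphic_on_const)
  thus ?thesis by (simp add: g_eq[abs_def])
qed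

lemma g_cont: "continuous_on S g" by (rule holomorphic_on_imp_continuous_on[OF g_hol])

lemma scaled: "(norm z < k * l \<longleftrightarrow> norm (z / \<Lambda>) < k)" "(norm z \<le> k * l \<longleftrightarrow> norm (z / \<Lambda>) \<le> k)"
  "g z / \<Lambda> = f (z / \<Lambda>)"
  using \<Lambda>0 by (simp_all add: g_eq norm_divide divide_less_eq divide_le_eq)

lemma U_iff: "z \<in> U \<longleftrightarrow> norm (z / \<Lambda>) < 3 \<and> norm (f (z / \<Lambda>)) < 13/2"
  unfolding U_def mem_Collect_eq scaled ..

lemma edge: "norm \<zeta> = 3 \<Longrightarrow> norm (f \<zeta>) > 13/2" "norm \<zeta> \<le> 2 \<Longrightarrow> norm (f \<zeta>) < 13/2"
proof -
  assume "norm \<zeta> = 3"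
  thus "norm (f \<zeta>) > 13/2" using f_lower[of \<zeta>] by (simp add: power2_eq_square)
next
  assume a: "norm \<zeta> \<le> 2"
  hence "(norm \<zeta>)\<^sup>2 \<le> 2\<^sup>2" by (intro power_mono) auto
  thus "norm (f \<zeta>) < 13/2" using f_upper[of \<zeta>] a by simp
qed

lemma U_open: "open U"
proof -
  have "U = ball 0 (3 * l) \<inter> g -` ball 0 ((13/2) * l)" by (auto simp: U_def)
  moreover have "open (g -` ball 0 ((13/2) * l))" using g_cont[of UNIV] by (intro open_vimage) auto
  ultimately show ?thesis by auto
qed

lemma U_scale:
  assumes z: "z \<in> U" and s: "0 \<le> s" "s \<le> 1"
  shows "of_real s * z \<in> U"
proof -
  let ?\<zeta> = "z / \<Lambda>"
  have zU: "norm ?\<zeta> < 3" "norm (f ?\<zeta>) < 13/2" using z U_iff by auto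
  have e: "of_real s * z / \<Lambda> = of_real s * ?\<zeta>" by simp
  have n: "norm (of_real s * ?\<zeta>) = s * norm ?\<zeta>" using s by (simp only: norm_mult norm_of_real abs_of_nonneg)
  have le: "s * norm ?\<zeta> \<le> norm ?\<zeta>" using s by (simp add: mult_left_le_one_le)
  have "norm (f (of_real s * ?\<zeta>)) < 13/2"
  proof (cases "norm (of_real s * ?\<zeta>) \<le> 2")
    case True thus ?thesis by (rule edge(2))
  next
    case False
    have s0: "s > 0" using False s(1) n by (cases "s = 0") auto
    have "norm (f (of_real s * ?\<zeta>)) \<le> norm (f (of_real (1/s) * (of_real s * ?\<zeta>)))"
      using False s s0 n zU by (intro f_radial) auto
    also have "of_real (1/s) * (of_real s * ?\<zeta>) = ?\<zeta>" using s0 by simp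
    finally show ?thesis using zU by linarith
  qed
  moreover have "norm (of_real s * ?\<zeta>) < 3" using n le zU by linarith
  ultimately show ?thesis unfolding U_iff e by simp
qed

lemma zero_U: "0 \<in> U" unfolding U_iff using edge(2)[of 0] by simp

lemma U_starlike: "starlike U"
  unfolding starlike_def
proof (intro bexI[of _ 0] ballI subsetI)
  fix x y assume "x \<in> U" "y \<in> closed_segment 0 x"
  then obtain s where "0 \<le> s" "s \<le> 1" "y = of_real s * x" "x \<in> U"
    by (auto simp: closed_segment_def scaleR_conv_of_real)
  thus "y \<in> U" using U_scale by simp
qed (rule zero_U)

lemma closure_U: "closure U \<subseteq> ball 0 (3 * l)"
proof -
  let ?C = "cball 0 (3 * l) \<inter> g -` cball 0 ((13/2) * l)"
  have "closed ?C" using g_cont[of UNIV] by (intro closed_Int closed_vimage) auto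
  moreover have "U \<subseteq> ?C" by (auto simp: U_def)
  ultimately have 1: "closure U \<subseteq> ?C" by (intro closure_minimal)
  show ?thesis
  proof
    fix z assume "z \<in> closure U"
    hence z: "norm z \<le> 3 * l" "norm (g z) \<le> (13/2) * l" using 1 by auto
    hence "norm (z / \<Lambda>) \<le> 3" "norm (f (z / \<Lambda>)) \<le> 13/2" by (simp_all only: scaled)
    hence "norm (z / \<Lambda>) < 3" using edge(1)[of "z / \<Lambda>"] by linarith
    thus "z \<in> ball 0 (3 * l)" by (simp only: mem_ball dist_0_norm scaled)
  qed
qed

lemma g_deriv: "deriv g z = 2 * (z / \<Lambda>) * deriv \<psi> ((z / \<Lambda>)\<^sup>2)"
proof -
  have "(f has_field_derivative deriv f (z / \<Lambda>)) (at (z / \<Lambda>))"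
    by (rule holomorphic_derivI[OF f_hol[of UNIV]]) auto
  hence "((\<lambda>z. f (z / \<Lambda>)) has_field_derivative deriv f (z / \<Lambda>) * (1 / \<Lambda>)) (at z)"
    by (rule DERIV_chain2[where f = f and g = "\<lambda>z. z / \<Lambda>"]) (auto intro!: derivative_eq_intros simp: \<Lambda>0)
  hence "((\<lambda>z. \<Lambda> * f (z / \<Lambda>)) has_field_derivative \<Lambda> * (deriv f (z / \<Lambda>) * (1 / \<Lambda>))) (at z)"
    by (rule DERIV_cmult)
  hence "(g has_field_derivative deriv f (z / \<Lambda>)) (at z)" using \<Lambda>0 by (simp add: g_eq[abs_def])
  thus ?thesis by (simp add: DERIV_imp_deriv f_deriv)
qed

lemma zorder_simple:
  assumes "norm z < 3 * l" "z \<noteq> 0" "g z = w"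
  shows "zorder (\<lambda>x. g x - w) z = 1"
proof (rule zorder_zero_eqI')
  show "(\<lambda>x. g x - w) analytic_on {z}"
    using g_hol[of UNIV] by (intro analytic_intros) (auto simp: analytic_on_open[of UNIV] intro: analytic_on_subset[of _ UNIV])
  show "(deriv ^^ i) (\<lambda>x. g x - w) z = 0" if "i < nat 1" for i using that assms by simp
  have "deriv (\<lambda>x. g x - w) z = deriv g z"
  proof (rule DERIV_imp_deriv)
    have "(g has_field_derivative deriv g z) (at z)" by (rule holomorphic_derivI[OF g_hol[of UNIV]]) auto
    thus "((\<lambda>x. g x - w) has_field_derivative deriv g z) (at z)" by (auto intro!: derivative_eq_intros)
  qed
  moreover have "deriv \<psi> ((z / \<Lambda>)\<^sup>2) \<noteq> 0"
  proof
    assume a: "deriv \<psi> ((z / \<Lambda>)\<^sup>2) = 0"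
    have "norm (z / \<Lambda>) < 3" using assms(1) by (simp only: scaled)
    hence "norm ((z / \<Lambda>)\<^sup>2) \<le> 16" by (intro norm_sq16) simp
    from deriv_close[OF this] a show False by simp
  qed
  ultimately show "(deriv ^^ nat 1) (\<lambda>x. g x - w) z \<noteq> 0" using assms \<Lambda>0 by (simp add: g_deriv)
qed simp

lemma zorder_double: "zorder (\<lambda>x. g x - g 0) 0 = 2"
proof (rule zorder_zero_eqI')
  show "(\<lambda>x. g x - g 0) analytic_on {0}"
    using g_hol[of UNIV] by (intro analytic_intros) (auto simp: analytic_on_open[of UNIV] intro: analytic_on_subset[of _ UNIV])
  have D: "deriv (\<lambda>x. g x - g 0) = (\<lambda>z. 2 * (z / \<Lambda>) * deriv \<psi> ((z / \<Lambda>)\<^sup>2))"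
  proof
    fix z
    have "(g has_field_derivative deriv g z) (at z)" by (rule holomorphic_derivI[OF g_hol[of UNIV]]) auto
    hence "((\<lambda>x. g x - g 0) has_field_derivative deriv g z) (at z)" by (auto intro!: derivative_eq_intros)
    thus "deriv (\<lambda>x. g x - g 0) z = 2 * (z / \<Lambda>) * deriv \<psi> ((z / \<Lambda>)\<^sup>2)" by (simp add: DERIV_imp_deriv g_deriv)
  qed
  show "(deriv ^^ i) (\<lambda>x. g x - g 0) 0 = 0" if i: "i < nat 2" for i
  proof -
    have "i = 0 \<or> i = 1" using i by auto
    thus ?thesis by (auto simp: D)
  qed
  have h: "(\<lambda>z. deriv \<psi> ((z / \<Lambda>)\<^sup>2)) holomorphic_on UNIV"
    by (rule holomorphic_on_compose_gen[of "\<lambda>z. (z / \<Lambda>)\<^sup>2" UNIV "deriv \<psi>" UNIV, unfolded o_def])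
       (auto intro!: holomorphic_intros holomorphic_deriv hol simp: \<Lambda>0)
  have "((\<lambda>z. 2 * (z / \<Lambda>) * deriv \<psi> ((z / \<Lambda>)\<^sup>2)) has_field_derivative
      2 * (0 / \<Lambda>) * deriv (\<lambda>z. deriv \<psi> ((z / \<Lambda>)\<^sup>2)) 0 + (2 / \<Lambda>) * deriv \<psi> ((0 / \<Lambda>)\<^sup>2)) (at 0)"
    by (rule DERIV_mult[THEN DERIV_cong] derivative_eq_intros holomorphic_derivI[OF h] refl | simp add: \<Lambda>0)+
  hence "deriv (\<lambda>z. 2 * (z / \<Lambda>) * deriv \<psi> ((z / \<Lambda>)\<^sup>2)) 0 = (2 / \<Lambda>) * deriv \<psi> 0" by (simp add: DERIV_imp_deriv)
  moreover have "deriv \<psi> 0 \<noteq> 0" using deriv_close[of 0] by auto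
  ultimately show "(deriv ^^ nat 2) (\<lambda>x. g x - g 0) 0 \<noteq> 0" using \<Lambda>0 by (simp add: numeral_2_eq_2 D)
qed simp

lemma fibre:
  assumes w: "w \<in> V"
  shows "\<exists>z. norm z < 3 * l \<and> g z = w \<and> {u\<in>U. g u = w} = {z, - z}"
proof -
  have "norm (w / \<Lambda>) \<le> 13/2" using w l0 by (simp add: V_def norm_divide divide_le_eq)
  then obtain v where v: "norm v < 9" "\<psi> v = w / \<Lambda>" by (rule psi_cover)
  define \<zeta> where "\<zeta> = csqrt v"
  have z2: "\<zeta>\<^sup>2 = v" by (simp add: \<zeta>_def)
  have "(norm \<zeta>)\<^sup>2 < 3\<^sup>2" using v(1) z2[symmetric] by (simp add: norm_power)
  hence z3: "norm \<zeta> < 3" by (rule power_less_imp_less_base) simp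
  define z where "z = \<Lambda> * \<zeta>"
  have zz: "z / \<Lambda> = \<zeta>" using \<Lambda>0 by (simp add: z_def)
  have fz: "f \<zeta> = w / \<Lambda>" by (simp add: qm_def z2 v)
  have gz: "g z = w" "g (- z) = w" using \<Lambda>0 fz f_even[of \<zeta>] by (simp_all add: g_eq zz)
  have zl: "norm z < 3 * l" by (simp only: scaled zz z3)
  have wl: "norm w < (13/2) * l" using w by (simp add: V_def)
  have "{u\<in>U. g u = w} = {z, - z}"
  proof (intro equalityI subsetI)
    fix u assume "u \<in> {u\<in>U. g u = w}"
    hence u: "norm (u / \<Lambda>) < 3" "g u = w" using U_iff by auto
    hence "f (u / \<Lambda>) = f \<zeta>" using fz scaled(3)[of u] by simp
    hence "u / \<Lambda> = \<zeta> \<or> u / \<Lambda> = - \<zeta>" using f_eq_iff[of \<zeta> "u / \<Lambda>"] z3 u(1) by auto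
    thus "u \<in> {z, - z}" using \<Lambda>0 by (auto simp: z_def field_simps)
  next
    fix u assume "u \<in> {z, - z}"
    thus "u \<in> {u\<in>U. g u = w}" using zl gz wl by (auto simp: U_def)
  qed
  thus ?thesis using zl gz by blast
qed

lemma ql: "ql_map g U V"
  unfolding ql_map_def topological_disk_def
proof (intro conjI allI impI ballI)
  show "open U" "U \<noteq> {}" using U_open zero_U by auto
  show "connected U" "simply_connected U" using U_starlike starlike_imp_connected starlike_imp_simply_connected by auto
  show "bounded U" by (rule bounded_subset[of "ball 0 (3 * l)"]) (auto simp: U_def)
  thus "compact (closure U)" by (simp add: compact_closure)
  show "open V" "V \<noteq> {}" "connected V" "simply_connected V" "bounded V"
    using l0 by (auto simp: V_def convex_connected convex_imp_simply_connected)
  have "ball 0 (3 * l) \<subseteq> V" unfolding V_def using l0 by (intro subset_ball) linarith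
  thus "closure U \<subseteq> V" using closure_U by blast
  show "g holomorphic_on U" by (rule g_hol)
  show "g ` U = V"
  proof (intro equalityI subsetI)
    fix w assume "w \<in> V"
    thus "w \<in> g ` U" using fibre[of w] by blast
  qed (auto simp: U_def V_def)
  show "0 \<in> U" by (rule zero_U)
  show "deriv g 0 = 0" by (simp add: g_deriv)
next
  fix C assume C: "compact C \<and> C \<subseteq> V"
  have "{z\<in>U. g z \<in> C} = cball 0 (3 * l) \<inter> g -` C"
  proof (intro equalityI subsetI)
    fix z assume z: "z \<in> cball 0 (3 * l) \<inter> g -` C"
    hence "norm (g z) < (13/2) * l" using C by (auto simp: V_def)
    moreover from this have "norm (f (z / \<Lambda>)) < 13/2" by (simp only: scaled)
    moreover have "norm (z / \<Lambda>) \<le> 3" using z by (simp only: Int_iff mem_cball dist_0_norm scaled)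
    ultimately have "norm (z / \<Lambda>) < 3" using edge(1)[of "z / \<Lambda>"] by linarith
    hence "norm z < 3 * l" by (simp only: scaled)
    thus "z \<in> {z\<in>U. g z \<in> C}" using z \<open>norm (g z) < (13/2) * l\<close> by (simp add: U_def)
  qed (auto simp: U_def)
  moreover have "closed (g -` C)" using C g_cont[of UNIV] by (intro closed_vimage compact_imp_closed) auto
  ultimately show "compact {z\<in>U. g z \<in> C}" by (simp add: compact_Int_closed)
next
  fix w assume w: "w \<in> V"
  obtain z where z: "norm z < 3 * l" "g z = w" "{u\<in>U. g u = w} = {z, - z}" using fibre[OF w] by blast
  show "finite {z\<in>U. g z = w}" using z(3) by simp
  show "(\<Sum>z\<in>{z\<in>U. g z = w}. zorder (\<lambda>x. g x - w) z) = 2"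
  proof (cases "z = 0")
    case True
    thus ?thesis using z zorder_double by simp
  next
    case False
    have "g (- z) = w" using z(3) by blast
    hence "zorder (\<lambda>x. g x - w) z = 1" "zorder (\<lambda>x. g x - w) (- z) = 1"
      using False z by (auto intro!: zorder_simple)
    moreover have "z \<noteq> - z" using False by simp
    ultimately show ?thesis using z(3) by simp
  qed
qed

text \<open>The closure of \<open>U\<close> lies between the discs of radii \<open>2 l\<close> and
  \<open>3 l\<close>, inside a disc of radius \<open>(13/2) l\<close>. Only ratios of these radii
  enter, so the bound is the same at every level.\<close>

lemma modulus: "ql_mod g U V \<ge> ereal (ln (13/6) / (8 * exp pi))"
proof -
  have "annulus_mod (ball 0 ((13/2) * l) - closure U) \<ge> ereal (ln (((13/2) * l) / (3 * l)) / (8 * exp pi))"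
  proof (rule annulus_mod_ge[of "2 * l"])
    show "ball 0 (2 * l) \<subseteq> closure U"
    proof
      fix z :: complex assume "z \<in> ball 0 (2 * l)"
      hence "norm (z / \<Lambda>) < 2" by (simp only: mem_ball dist_0_norm scaled)
      hence "z \<in> U" unfolding U_iff using edge(2)[of "z / \<Lambda>"] by linarith
      thus "z \<in> closure U" using closure_subset by blast
    qed
    show "of_real s * z \<notin> closure U" if zs: "z \<notin> closure U" "s \<ge> 1" for z s
    proof
      assume "of_real s * z \<in> closure U"
      then obtain x where x: "\<And>n. x n \<in> U" "x \<longlonglongrightarrow> of_real s * z" unfolding closure_sequential by blast
      have sz: "of_real (1/s) * (of_real s * z) = z" using zs(2) by simp
      have "(\<lambda>n. of_real (1/s) * x n) \<longlonglongrightarrow> z"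
        using tendsto_mult[OF tendsto_const x(2), of "of_real (1/s)"] unfolding sz .
      moreover have "of_real (1/s) * x n \<in> U" for n using x(1) zs(2) by (intro U_scale) auto
      ultimately have "z \<in> closure U" unfolding closure_sequential by (intro exI[of _ "\<lambda>n. of_real (1/s) * x n"]) blast
      thus False using zs(1) by simp
    qed
    show "0 < 2 * l" "2 * l \<le> 3 * l" "3 * l < (13/2) * l" using l0 by simp_all
    show "closure U \<subseteq> ball 0 (3 * l)" by (rule closure_U)
  qed simp
  also have "((13/2) * l) / (3 * l) = 13/6" using l0 by simp
  also have "annulus_mod (ball 0 ((13/2) * l) - closure U) \<le> ql_mod g U V"
    unfolding ql_mod_def V_def[symmetric] by (rule Sup_upper) (use ql in \<open>auto simp: rep_eq_def\<close>)
  finally show ?thesis .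
qed

text \<open>The non-strict bounds give compact sets. They cost nothing: a point of modulus exactly
  \<open>3 l\<close> has its next iterate beyond \<open>(13/2) l\<close>.\<close>

lemma filled_julia_eq: "filled_julia g U = (\<Inter>k. {z. \<forall>i\<le>k. norm ((g ^^ i) z) \<le> 3 * l})"
proof (intro equalityI subsetI)
  fix z assume "z \<in> filled_julia g U"
  hence "norm ((g ^^ i) z) < 3 * l" for i by (simp add: filled_julia_def U_def)
  thus "z \<in> (\<Inter>k. {z. \<forall>i\<le>k. norm ((g ^^ i) z) \<le> 3 * l})" using less_imp_le by blast
next
  fix z assume "z \<in> (\<Inter>k. {z. \<forall>i\<le>k. norm ((g ^^ i) z) \<le> 3 * l})"
  hence z: "norm ((g ^^ i) z) \<le> 3 * l" for i by blast
  have "(g ^^ i) z \<in> U" for i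
  proof -
    let ?u = "(g ^^ i) z"
    have "norm (g ?u) \<le> 3 * l" using z[of "Suc i"] by simp
    hence 1: "norm (f (?u / \<Lambda>)) \<le> 3" by (simp only: scaled)
    have 2: "norm (?u / \<Lambda>) \<le> 3" using z[of i] by (simp only: scaled)
    show ?thesis unfolding U_iff using 1 2 edge(1)[of "?u / \<Lambda>"] by linarith
  qed
  thus "z \<in> filled_julia g U" by (simp add: filled_julia_def)
qed

text \<open>A nested intersection of continua. Each \<open>X (Suc k)\<close> is, up to scale, the
  preimage under squaring of a homeomorphic copy of \<open>X k\<close> containing 0, because the
  critical value lies in \<open>X k\<close>.\<close>

lemma filled_julia_connected:
  assumes crit: "\<And>n. norm ((g ^^ n) 0) \<le> 3 * l"
  shows "connected (filled_julia g U)"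
proof -
  define X where "X = (\<lambda>k. {z. \<forall>i\<le>k. norm ((g ^^ i) z) \<le> 3 * l})"
  have gn: "continuous_on UNIV (g ^^ i)" for i
  proof (induction i)
    case (Suc i)
    thus ?case using continuous_on_compose[OF Suc continuous_on_subset[OF g_cont[of UNIV]]] by simp
  qed simp
  have X_eq: "X k = (\<Inter>i\<in>{..k}. (g ^^ i) -` cball 0 (3 * l))" for k by (auto simp: X_def)
  have Xcl: "closed (X k)" for k
    unfolding X_eq by (intro closed_INT ballI closed_vimage gn) auto
  have X0: "X 0 = cball 0 (3 * l)" by (auto simp: X_def)
  have Xdec: "X k' \<subseteq> X k" if "k \<le> k'" for k k' using that by (auto simp: X_def)
  have Xsub: "X k \<subseteq> cball 0 (3 * l)" for k using Xdec[of 0 k] by (simp add: X0)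
  have Xc: "compact (X k)" for k
  proof -
    have "cball 0 (3 * l) \<inter> X k = X k" using Xsub by blast
    thus ?thesis using compact_Int_closed[OF compact_cball Xcl, of 0 "3 * l" k] by simp
  qed
  have XS: "z \<in> X (Suc k) \<longleftrightarrow> norm z \<le> 3 * l \<and> g z \<in> X k" for z k
  proof
    assume z: "z \<in> X (Suc k)"
    have "norm ((g ^^ i) (g z)) \<le> 3 * l" if "i \<le> k" for i
    proof -
      have "norm ((g ^^ Suc i) z) \<le> 3 * l" using z that unfolding X_def by blast
      thus ?thesis by (simp only: funpow_Suc_right o_apply)
    qed
    thus "norm z \<le> 3 * l \<and> g z \<in> X k" using Xsub[of "Suc k"] z by (auto simp: X_def)
  next
    assume z: "norm z \<le> 3 * l \<and> g z \<in> X k"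
    have "norm ((g ^^ i) z) \<le> 3 * l" if i: "i \<le> Suc k" for i
    proof (cases i)
      case (Suc i')
      have "norm ((g ^^ i') (g z)) \<le> 3 * l" using z i Suc unfolding X_def by auto
      thus ?thesis unfolding Suc by (simp only: funpow_Suc_right o_apply)
    qed (use z in simp)
    thus "z \<in> X (Suc k)" by (simp add: X_def)
  qed
  have "connected (X k)" for k
  proof (induction k)
    case 0 thus ?case by (simp add: X0)
  next
    case (Suc k)
    define \<phi> where "\<phi> = (\<lambda>w. \<Lambda> * \<psi> w)"
    define \<kappa> where "\<kappa> = inv_into (cball 0 9) \<phi>"
    define Y where "Y = {w \<in> cball 0 9. \<phi> w \<in> X k}"
    have c\<phi>: "continuous_on S \<phi>" for S
      unfolding \<phi>_def by (intro continuous_on_mult continuous_on_const holomorphic_on_imp_continuous_on[OF hol])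
    have inj: "inj_on \<phi> (cball 0 9)"
    proof (rule inj_onI)
      fix x y assume xy: "x \<in> cball 0 9" "y \<in> cball 0 9" "\<phi> x = \<phi> y"
      have "norm x \<le> 16" "norm y \<le> 16" "\<psi> x = \<psi> y" using xy \<Lambda>0 by (auto simp: \<phi>_def)
      thus "x = y" by (rule psi_inj)
    qed
    have c\<kappa>: "continuous_on (\<phi> ` cball 0 9) \<kappa>"
      by (rule continuous_on_inv[OF c\<phi> compact_cball]) (simp add: \<kappa>_def inv_into_f_f[OF inj])
    have cov: "X k \<subseteq> \<phi> ` cball 0 9"
    proof
      fix y assume "y \<in> X k"
      hence "norm y \<le> 3 * l" using Xsub[of k] by auto
      hence "norm (y / \<Lambda>) \<le> 3" by (simp only: scaled)
      hence "norm (y / \<Lambda>) \<le> 13/2" by linarith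
      then obtain w where w: "norm w < 9" "\<psi> w = y / \<Lambda>" by (rule psi_cover)
      hence "y = \<phi> w" using \<Lambda>0 by (simp add: \<phi>_def)
      moreover have "w \<in> cball 0 9" using w by simp
      ultimately show "y \<in> \<phi> ` cball 0 9" by blast
    qed
    have Yim: "Y = \<kappa> ` X k"
    proof (intro equalityI subsetI)
      fix w assume "w \<in> Y"
      hence w: "w \<in> cball 0 9" "\<phi> w \<in> X k" by (auto simp: Y_def)
      hence "w = \<kappa> (\<phi> w)" by (simp add: \<kappa>_def inv_into_f_f[OF inj])
      thus "w \<in> \<kappa> ` X k" using w by blast
    next
      fix w assume "w \<in> \<kappa> ` X k"
      then obtain y where y: "y \<in> X k" "w = \<kappa> y" by blast
      hence "y \<in> \<phi> ` cball 0 9" using cov by blast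
      hence "\<kappa> y \<in> cball 0 9" "\<phi> (\<kappa> y) = y" unfolding \<kappa>_def by (rule inv_into_into, rule f_inv_into_f)
      thus "w \<in> Y" using y by (simp add: Y_def)
    qed
    have "connected Y" unfolding Yim
      by (rule connected_continuous_image[OF continuous_on_subset[OF c\<kappa> cov] Suc])
    moreover have "compact Y" unfolding Yim
      by (rule compact_continuous_image[OF continuous_on_subset[OF c\<kappa> cov] Xc])
    moreover have "0 \<in> Y"
    proof -
      have "(g ^^ i) (g 0) = (g ^^ Suc i) 0" for i by (simp only: funpow_Suc_right o_apply)
      hence "g 0 \<in> X k" using crit by (auto simp: X_def simp del: funpow.simps)
      moreover have "\<phi> 0 = g 0" by (simp add: \<phi>_def g_eq qm_def)
      ultimately show ?thesis by (simp add: Y_def)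
    qed
    ultimately have cS: "connected {\<zeta>. \<zeta>\<^sup>2 \<in> Y}" by (intro sq_preimage_connected)
    have "X (Suc k) = (\<lambda>\<zeta>. \<Lambda> * \<zeta>) ` {\<zeta>. \<zeta>\<^sup>2 \<in> Y}"
    proof (intro equalityI subsetI)
      fix z assume z: "z \<in> X (Suc k)"
      let ?\<zeta> = "z / \<Lambda>"
      have "norm z \<le> 3 * l" using z XS by blast
      hence "norm ?\<zeta> \<le> 3" by (simp only: scaled)
      hence "(norm ?\<zeta>)\<^sup>2 \<le> 3\<^sup>2" by (intro power_mono) auto
      hence "norm (?\<zeta>\<^sup>2) \<le> 9" by (simp only: norm_power) simp
      moreover have "\<phi> (?\<zeta>\<^sup>2) \<in> X k" using z XS[of z k] by (simp add: \<phi>_def g_eq qm_def)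
      ultimately have "?\<zeta>\<^sup>2 \<in> Y" by (simp add: Y_def)
      moreover have "z = \<Lambda> * ?\<zeta>" using \<Lambda>0 by simp
      ultimately show "z \<in> (\<lambda>\<zeta>. \<Lambda> * \<zeta>) ` {\<zeta>. \<zeta>\<^sup>2 \<in> Y}" by blast
    next
      fix z assume "z \<in> (\<lambda>\<zeta>. \<Lambda> * \<zeta>) ` {\<zeta>. \<zeta>\<^sup>2 \<in> Y}"
      then obtain \<zeta> where \<zeta>: "z = \<Lambda> * \<zeta>" "norm (\<zeta>\<^sup>2) \<le> 9" "\<phi> (\<zeta>\<^sup>2) \<in> X k" by (auto simp: Y_def)
      have zl: "z / \<Lambda> = \<zeta>" using \<zeta> \<Lambda>0 by simp
      have "(norm \<zeta>)\<^sup>2 \<le> 3\<^sup>2" using \<zeta>(2) by (simp add: norm_power)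
      hence "norm \<zeta> \<le> 3" by (rule power2_le_imp_le) simp
      hence "norm z \<le> 3 * l" by (simp only: scaled zl)
      moreover have "g z = \<phi> (\<zeta>\<^sup>2)" by (simp add: g_eq zl \<phi>_def qm_def)
      ultimately show "z \<in> X (Suc k)" using \<zeta>(3) by (simp add: XS)
    qed
    moreover have "continuous_on {\<zeta>. \<zeta>\<^sup>2 \<in> Y} (\<lambda>\<zeta>. \<Lambda> * \<zeta>)" by (intro continuous_intros)
    ultimately show ?case using connected_continuous_image[OF _ cS, of "\<lambda>\<zeta>. \<Lambda> * \<zeta>"] by simp
  qed
  hence "connected (\<Inter> (range X))" by (intro connected_nest Xc Xdec)
  thus ?thesis unfolding filled_julia_eq X_def .
qed

end

lemma dvd_prime_power_small:
  fixes m k :: nat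
  assumes "prime m" "1 < k" "k < m" shows "\<not> k dvd m ^ l"
proof
  assume "k dvd m ^ l"
  then obtain i where i: "k = m ^ i" using divides_primepow_nat[OF assms(1)] by blast
  have "i \<noteq> 0" using i assms(2) by (cases i) auto
  hence "m \<le> m ^ i" using prime_gt_0_nat[OF assms(1)] by (cases i) auto
  thus False using i assms(3) by simp
qed

section \<open>Successive renormalizations of the polynomial and their periods\<close>

context tower0 begin

lemma iter_level: "((P ^^ (m ^ n)) ^^ i) (Lam 0 n * x) = Lam 0 n * (F n ^^ i) x"
  unfolding funpow_mult using level_scale[where n=0 and k=n and i=i and z=x] by simp

sublocale N: nqs "\<psi> n" "t n" "Lam 0 n" "P ^^ (m ^ n)" for n
proof unfold_locales
  show "Lam 0 n \<noteq> 0" by (rule Lam_nz)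
  fix z
  show "(P ^^ (m ^ n)) z = Lam 0 n * F n (z / Lam 0 n)"
    using iter_level[where n=n and i=1 and x="z / Lam 0 n"] Lam_nz[of 0 n] by simp
qed

definition KN where "KN n = filled_julia (P ^^ (m ^ n)) (N.U n)"

lemma bounded_iterates_K0:
  assumes q: "q > 0" and B: "\<And>i. norm ((P ^^ (q * i)) z) \<le> B"
  shows "z \<in> K0"
proof (rule ccontr)
  assume "z \<notin> K0"
  then obtain n where n: "norm ((P ^^ n) z) \<ge> 3" unfolding K0_iff by (auto simp: not_less)
  obtain k where k: "B < 2 ^ k" using real_arch_pow[of 2 B] by auto
  have le: "n + k \<le> q * (n + k)" using q by simp
  define j where "j = q * (n + k) - n"
  have j: "q * (n + k) = j + n" "k \<le> j" using le unfolding j_def by linarith+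
  have "(2::real) ^ k \<le> 2 ^ j" using j by (intro power_increasing) auto
  also have "\<dots> \<le> 2 ^ j * norm ((P ^^ n) z)" using n mult_left_mono[of 1 "norm ((P ^^ n) z)" "2 ^ j"] by simp
  also have "\<dots> \<le> norm ((P ^^ (q * (n + k))) z)" unfolding j(1) funpow_add o_apply using Pn_grow[OF n, of j] by simp
  also have "\<dots> \<le> B" by (rule B)
  finally show False using k by simp
qed

lemma filled_julia_sub_K0:
  assumes q: "q > 0" and b: "bounded U'"
  shows "filled_julia (P ^^ q) U' \<subseteq> K0"
proof
  fix z assume z: "z \<in> filled_julia (P ^^ q) U'"
  obtain B where B: "\<And>u. u \<in> U' \<Longrightarrow> norm u \<le> B" using b unfolding bounded_iff by blast
  show "z \<in> K0"
  proof (rule bounded_iterates_K0[OF q])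
    fix i
    have "((P ^^ q) ^^ i) z \<in> U'" using z by (simp add: filled_julia_def)
    thus "norm ((P ^^ (q * i)) z) \<le> B" using B by (simp only: funpow_mult)
  qed
qed

lemma julia_filled_pow:
  assumes "q > 0" "ql_map (P ^^ q) U' V'"
  shows "julia (P ^^ q) U' = filled_julia (P ^^ q) U'"
proof (rule julia_eq_filled[OF filled_julia_closed[OF assms(2)]])
  have "bounded U'" using assms(2) by (simp add: ql_map_def topological_disk_def)
  hence "filled_julia (P ^^ q) U' \<subseteq> K0" by (rule filled_julia_sub_K0[OF assms(1)])
  thus "interior (filled_julia (P ^^ q) U') = {}" using interior_mono K0_interior by blast
qed

lemma m_pos: "0 < m ^ n" using L.m by simp

lemma julia_KN: "julia (P ^^ (m ^ n)) (N.U n) = KN n"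
  unfolding KN_def by (rule julia_filled_pow[OF m_pos N.ql])

lemma KN_connected: "connected (KN n)"
  unfolding KN_def
proof (rule N.filled_julia_connected)
  fix i
  have "((P ^^ (m ^ n)) ^^ i) 0 = (P ^^ (m ^ n * i)) 0" by (simp only: funpow_mult)
  thus "norm (((P ^^ (m ^ n)) ^^ i) 0) \<le> 3 * norm (Lam 0 n)"
    unfolding funpow_mult using crit_scaled[where k=n and l=i] norm_ge_zero[of "Lam 0 n"] by linarith
qed

lemma Lam_Suc_right: "Lam 0 (Suc n) = Lam 0 n * lam n"
  by (simp add: Lam_def)

lemma U_Suc_small:
  assumes "z \<in> N.U (Suc n)"
  shows "norm (z / Lam 0 n) < 3 * norm (lam n)"
proof -
  have "norm z < 3 * norm (Lam 0 (Suc n))" using assms unfolding N.U_def by blast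
  hence "norm z < (3 * norm (lam n)) * norm (Lam 0 n)" by (simp add: Lam_Suc_right norm_mult mult_ac)
  thus ?thesis by (simp only: N.scaled)
qed

lemma scaled_back: "((P ^^ (m ^ n)) ^^ i) z / Lam 0 n = (F n ^^ i) (z / Lam 0 n)"
  using iter_level[where n=n and i=i and x="z / Lam 0 n"] Lam_nz[of 0 n] by simp

lemma pow_pow_Suc: "(P ^^ (m ^ n)) ^^ m = P ^^ (m ^ Suc n)"
  by (simp add: funpow_mult mult.commute)

lemma sq_small: "norm x < 3 * norm (lam n) \<Longrightarrow> (norm x)\<^sup>2 \<le> norm (lam n) / 21"
  by (rule L.small_inner) (use lam_rr3(1)[of n] in linarith)

text \<open>If images of the little Julia set at times \<open>i < j\<close> had a common point, then
  \<open>m - j\<close> further steps would bring a point back to the small disc at time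
  \<open>m - j + i < m\<close>, where shadowing keeps it away from 0. So the images are disjoint,
  without touching.\<close>

lemma is_renorm_N: "is_renorm (P ^^ (m ^ n)) (N.U n) (N.V n) m (N.U (Suc n)) (N.V (Suc n))"
proof -
  let ?g = "P ^^ (m ^ n)"
  have m2: "2 < m" by (rule L.m)
  have orb: "(?g ^^ k) z \<in> N.U n" if z: "z \<in> N.U (Suc n)" and k: "k < m" for z k
  proof -
    let ?x = "z / Lam 0 n"
    have x: "norm ?x < 3 * norm (lam n)" by (rule U_Suc_small[OF z])
    have bd: "norm ((F n ^^ j) ?x) \<le> 29/10" if "j \<le> m" for j
    proof (cases "j = 0")
      case True
      have "3 * norm (lam n) \<le> 29/10" using lam_le[of n] by simp
      thus ?thesis using True x by simp
    next
      case False thus ?thesis using that by (intro L.inner_bd'[OF sq_small[OF x]]) auto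
    qed
    have "norm ((F n ^^ k) ?x) < 3" using bd[of k] k by simp
    moreover have "norm (F n ((F n ^^ k) ?x)) < 13/2" using bd[of "Suc k"] k by simp
    ultimately show ?thesis unfolding N.U_iff scaled_back by blast
  qed
  have dis: False if z: "z \<in> KN (Suc n)" "z' \<in> KN (Suc n)" and ij: "i < j" "j < m" and e: "(?g ^^ i) z = (?g ^^ j) z'" for z z' i j
  proof -
    have KU: "u \<in> KN (Suc n) \<Longrightarrow> u \<in> N.U (Suc n)" "u \<in> KN (Suc n) \<Longrightarrow> (P ^^ (m ^ Suc n)) u \<in> N.U (Suc n)" for u
      using spec[of "\<lambda>k. ((P ^^ (m ^ Suc n)) ^^ k) u \<in> N.U (Suc n)" 0] spec[of "\<lambda>k. ((P ^^ (m ^ Suc n)) ^^ k) u \<in> N.U (Suc n)" 1]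
      unfolding KN_def filled_julia_def by auto
    have "(?g ^^ (m - j + i)) z = (?g ^^ (m - j + j)) z'" unfolding funpow_add o_apply e ..
    also have "m - j + j = m" using ij by simp
    also have "(?g ^^ m) z' = (P ^^ (m ^ Suc n)) z'" unfolding pow_pow_Suc ..
    finally have "(?g ^^ (m - j + i)) z \<in> N.U (Suc n)" using KU(2)[OF z(2)] by simp
    hence "norm ((F n ^^ (m - j + i)) (z / Lam 0 n)) < 3 * norm (lam n)"
      unfolding scaled_back[symmetric] by (rule U_Suc_small)
    moreover have "11/10 \<le> norm ((F n ^^ (m - j + i)) (z / Lam 0 n))"
      using ij by (intro L.inner_bd(1)[OF sq_small[OF U_Suc_small[OF KU(1)[OF z(1)]]]]) auto
    moreover have "3 * norm (lam n) \<le> 1" using lam_le[of n] by simp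
    ultimately show False by linarith
  qed
  have dis': "(?g ^^ i) ` KN (Suc n) \<inter> (?g ^^ j) ` KN (Suc n) = {}" if "i < m" "j < m" "i \<noteq> j" for i j
  proof (cases "i < j")
    case True thus ?thesis using dis that by blast
  next
    case False
    hence ji: "j < i" using that by simp
    show ?thesis
    proof (rule ccontr)
      assume "\<not> ?thesis"
      then obtain z z' where "z \<in> KN (Suc n)" "z' \<in> KN (Suc n)" "(?g ^^ j) z = (?g ^^ i) z'" by force
      thus False using dis ji that by blast
    qed
  qed
  show ?thesis
    unfolding is_renorm_def Let_def pow_pow_Suc julia_KN
    using m2 N.zero_U orb N.ql KN_connected dis' by (auto simp del: power_Suc)
qed

lemma P_pow_even: "q > 0 \<Longrightarrow> (P ^^ q) (- z) = (P ^^ q) z"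
  by (cases q) (auto simp: funpow_Suc_right P_eq simp del: funpow.simps)

text \<open>Otherwise the symmetric continuum encloses 0, and the maximum principle for all iterates
  puts a neighbourhood of 0 into \<open>K0\<close>, which has empty interior.\<close>

lemma zero_in_julia:
  assumes q: "q > 0" and ql: "ql_map (P ^^ q) U' V'" and con: "connected (filled_julia (P ^^ q) U')"
  shows "0 \<in> filled_julia (P ^^ q) U'"
proof (rule ccontr)
  let ?K = "filled_julia (P ^^ q) U'"
  assume z0: "0 \<notin> ?K"
  have bU: "bounded U'" using ql by (simp add: ql_map_def topological_disk_def)
  have KU: "?K \<subseteq> U'" unfolding filled_julia_def by (auto dest: spec[of _ 0])
  have clK: "closed ?K" by (rule filled_julia_closed[OF ql])
  hence cK: "compact ?K" using bounded_subset[OF bU KU] by (simp add: compact_eq_bounded_closed)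
  have KK: "?K \<subseteq> K0" by (rule filled_julia_sub_K0[OF q bU])
  have sym: "- z \<in> ?K" if z: "z \<in> ?K" for z
  proof -
    have "((P ^^ q) ^^ i) (- z) \<in> U'" for i
    proof (cases i)
      case 0
      thus ?thesis using ql_symmetric[OF ql P_pow_even[OF q]] z KU by auto
    next
      case (Suc j)
      have "((P ^^ q) ^^ i) (- z) = ((P ^^ q) ^^ i) z"
        unfolding funpow_mult using q Suc by (intro P_pow_even) simp
      thus ?thesis using z by (simp add: filled_julia_def)
    qed
    thus ?thesis by (simp add: filled_julia_def)
  qed
  let ?B = "connected_component_set (- ?K) 0"
  have bB: "bounded ?B"
    by (rule symmetric_continuum_bounded_component[OF cK con filled_julia_nonempty[OF ql] sym z0])
  have oB: "open ?B" using clK by (intro open_connected_component) auto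
  have fr: "frontier ?B \<subseteq> ?K"
    using frontier_of_connected_component_subset[of "- ?K" 0] frontier_subset_closed[OF clK] by (simp add: frontier_complement)
  have "?B \<subseteq> K0"
  proof
    fix z assume z: "z \<in> ?B"
    show "z \<in> K0"
    proof (rule bounded_iterates_K0[of 1])
      fix i
      show "norm ((P ^^ (1 * i)) z) \<le> 3"
      proof (rule maximum_modulus_frontier[of "P ^^ (1 * i)" ?B])
        show "(P ^^ (1 * i)) holomorphic_on interior ?B" by (rule Pn_hol)
        show "continuous_on (closure ?B) (P ^^ (1 * i))" by (rule Pn_cont)
        show "norm ((P ^^ (1 * i)) w) \<le> 3" if "w \<in> frontier ?B" for w
        proof -
          have "w \<in> K0" using that fr KK by blast
          thus ?thesis using K0_iff[of w] less_imp_le by (metis mult_1)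
        qed
      qed (use bB z in auto)
    qed simp
  qed
  moreover have "0 \<in> ?B" using z0 by simp
  ultimately have "0 \<in> interior K0" using oB by (auto simp: interior_def)
  thus False by (simp add: K0_interior)
qed

text \<open>The critical point is recurrent along the times \<^term>\<open>m ^ l\<close>, none of which is divisible by a
  smaller period \<^term>\<open>k\<close>; so two distinct little Julia sets of period \<^term>\<open>k\<close> would meet at 0.\<close>
lemma renorm_period_minimal:
  assumes pm: "prime m" and r: "is_renorm (P ^^ (m ^ n)) U0 V0 k U' V'"
  shows "m \<le> k"
proof (rule ccontr)
  assume "\<not> m \<le> k"
  hence km: "k < m" by simp
  let ?g = "P ^^ (m ^ n)"
  define q where "q = m ^ n * k"
  have gk: "?g ^^ k = P ^^ q" by (simp only: funpow_mult q_def)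
  have k1: "1 < k" and ql: "ql_map (P ^^ q) U' V'" and conJ: "connected (julia (P ^^ q) U')"
    using r unfolding is_renorm_def gk by auto
  have q0: "q > 0" using m_pos k1 by (simp add: q_def)
  define K where "K = filled_julia (P ^^ q) U'"
  have JK: "julia (P ^^ q) U' = K" unfolding K_def by (rule julia_filled_pow[OF q0 ql])
  have z0: "0 \<in> K" unfolding K_def by (rule zero_in_julia[OF q0 ql]) (use conJ JK K_def in simp)
  have bU: "bounded U'" using ql by (simp add: ql_map_def topological_disk_def)
  have KU: "K \<subseteq> U'" unfolding K_def filled_julia_def by (auto dest: spec[of _ 0])
  have cK: "compact K" using filled_julia_closed[OF ql] bounded_subset[OF bU KU] by (simp add: compact_eq_bounded_closed K_def)
  define C where "C = (\<Union>r\<in>{1..<k}. (?g ^^ r) ` K)"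
  have "compact C" unfolding C_def
  proof (intro compact_UN ballI)
    fix r show "compact ((?g ^^ r) ` K)" unfolding funpow_mult by (rule compact_continuous_image[OF Pn_cont cK])
  qed simp
  hence clC: "closed C" by (rule compact_imp_closed)
  have hK: "((?g ^^ k) ^^ s) 0 \<in> K" for s
  proof -
    have "((P ^^ q) ^^ i) (((P ^^ q) ^^ s) 0) \<in> U'" for i
    proof -
      have "((P ^^ q) ^^ (i + s)) 0 \<in> U'" using z0 by (simp add: K_def filled_julia_def)
      thus ?thesis by (simp only: funpow_add o_apply)
    qed
    thus ?thesis unfolding gk K_def filled_julia_def by simp
  qed
  have inC: "(?g ^^ (m ^ l)) 0 \<in> C" for l
  proof -
    define r s where "r = m ^ l mod k" and "s = m ^ l div k"
    have e: "m ^ l = r + k * s" by (simp add: r_def s_def)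
    have "r \<noteq> 0" using dvd_prime_power_small[OF pm k1 km, of l] by (simp add: r_def dvd_eq_mod_eq_0)
    hence rr: "r \<in> {1..<k}" using k1 by (auto simp: r_def)
    have "(?g ^^ (m ^ l)) 0 = (?g ^^ r) (((?g ^^ k) ^^ s) 0)"
      unfolding e funpow_mult[where f="?g" and m=k and n=s] by (simp only: funpow_add o_apply)
    thus ?thesis using rr hK unfolding C_def by blast
  qed
  have "(\<lambda>l. (?g ^^ (m ^ l)) 0) \<longlonglongrightarrow> 0"
  proof (rule Lim_null_comparison)
    show "eventually (\<lambda>l. norm ((?g ^^ (m ^ l)) 0) \<le> 3 * (1/10^8) ^ l) sequentially"
    proof (rule always_eventually, rule allI)
      fix l
      have "(?g ^^ (m ^ l)) 0 = (P ^^ (m ^ (n + l) * 1)) 0" by (simp only: funpow_mult power_add mult_1_right)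
      hence "norm ((?g ^^ (m ^ l)) 0) < (47/20) * norm (Lam 0 (n + l))" using crit_scaled[where k="n+l" and l=1] by simp
      also have "\<dots> \<le> 3 * (1/10^8) ^ (n + l)" using Lam_le[of 0 "n + l"] by (intro mult_mono) auto
      also have "\<dots> \<le> 3 * (1/10^8) ^ l" by (intro mult_left_mono power_decreasing) auto
      finally show "norm ((?g ^^ (m ^ l)) 0) \<le> 3 * (1/10^8) ^ l" by simp
    qed
    have "(\<lambda>l. (1/10^8::real) ^ l) \<longlonglongrightarrow> 0" by (rule LIMSEQ_power_zero) simp
    thus "(\<lambda>l. 3 * (1/10^8::real) ^ l) \<longlonglongrightarrow> 0" by (rule tendsto_mult_right_zero)
  qed
  with clC inC have "0 \<in> C" by (rule closed_sequentially)
  then obtain s where s: "s \<in> {1..<k}" "0 \<in> (?g ^^ s) ` K" by (auto simp: C_def)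
  \<comment> \<open>Different images of the little Julia set may meet only in images of fixed points
    of the return map, so 0 would be fixed by \<open>?g ^^ k\<close>. But the rescaled critical
    orbit has modulus at least 6/5 at the time \<open>k < m\<close>.\<close>
  have "0 \<in> (?g ^^ 0) ` K \<inter> (?g ^^ s) ` K" using z0 s(2) by simp
  moreover have "(?g ^^ 0) ` K \<inter> (?g ^^ s) ` K \<subseteq> (?g ^^ 0) ` {z\<in>K. (?g ^^ k) z = z \<and> connected (K - {z})}"
  proof -
    have *: "\<forall>i<k. \<forall>j<k. i \<noteq> j \<longrightarrow> (?g ^^ i) ` K \<inter> (?g ^^ j) ` K \<subseteq>
       (?g ^^ i) ` {z\<in>K. (?g ^^ k) z = z \<and> connected (K - {z})} \<inter> (?g ^^ j) ` {z\<in>K. (?g ^^ k) z = z \<and> connected (K - {z})}"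
      using r unfolding is_renorm_def Let_def gk JK by blast
    have "0 < k" "s < k" "0 \<noteq> s" using s k1 by auto
    from *[rule_format, OF this] show ?thesis by blast
  qed
  ultimately have "(?g ^^ k) 0 = 0" by auto
  hence "(F n ^^ k) 0 = 0" using scaled_back[where n=n and i=k and z=0] by simp
  thus False using L.a_bd(1)[of k n] km k1 by simp
qed

lemma renorm_N: "renorm_by (P ^^ (m ^ n)) (N.U n) (N.V n) m (N.U (Suc n)) (N.V (Suc n))"
  unfolding renorm_by_def rep_eq_def using is_renorm_N N.ql by blast

theorem feigenbaum:
  assumes pm: "prime m"
  shows "feigenbaum_poly c"
proof -
  have P1: "P ^^ (m ^ 0) = P" by simp
  have least: "m = (LEAST k. \<exists>U' V'. renorm_by (P ^^ (m ^ n)) (N.U n) (N.V n) k U' V')" for n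
  proof (rule Least_equality[symmetric])
    show "\<exists>U' V'. renorm_by (P ^^ (m ^ n)) (N.U n) (N.V n) m U' V'" using renorm_N by blast
    show "m \<le> k" if "\<exists>U' V'. renorm_by (P ^^ (m ^ n)) (N.U n) (N.V n) k U' V'" for k
      using that renorm_period_minimal[OF pm] unfolding renorm_by_def by blast
  qed
  have pr: "(\<Prod>i<n. m) = m ^ n" for n by simp
  have e0: "ln (13/6) / (8 * exp pi) > (0::real)" by (intro divide_pos_pos ln_gt_zero mult_pos_pos) auto
  have "feigenbaum_restriction P (N.U 0) (N.V 0)"
    unfolding feigenbaum_restriction_def
  proof (intro conjI, goal_cases)
    case 3
    show ?case
    proof (rule exI[of _ "\<lambda>_. m"], rule exI[of _ N.U], rule exI[of _ N.V], intro conjI)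
    show "\<forall>n. let g = P ^^ (\<Prod>i<n. m) in m = (LEAST k. \<exists>U' V'. renorm_by g (N.U n) (N.V n) k U' V') \<and>
        renorm_by g (N.U n) (N.V n) m (N.U (Suc n)) (N.V (Suc n))"
      unfolding Let_def pr using least renorm_N by blast
    show "\<exists>B. \<forall>n::nat. m \<le> B" by blast
    show "\<exists>\<epsilon>>0. \<forall>n. ereal \<epsilon> \<le> ql_mod (P ^^ (\<Prod>i<n. m)) (N.U n) (N.V n)"
      unfolding pr using e0 N.modulus by blast
    qed (rule refl)+
  next
    case 1 show ?case using N.ql[of 0] unfolding P1 .
  next
    case 2 show ?case using KN_connected[of 0] unfolding julia_KN[symmetric] P1 .
  qed
  thus ?thesis unfolding feigenbaum_poly_def P_quad by blast
qed

end

section \<open>Existence of towers\<close>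

text \<open>A quantitative inverse function: the lower Lipschitz bound gives injectivity, and the
  bound on the circle of radius \<open>r\<close> gives the size of the disc covered.\<close>

lemma lip_inverse:
  fixes h :: "complex \<Rightarrow> complex"
  assumes hol: "h holomorphic_on ball z0 R" and r: "0 < r" "r < R" and k: "0 < k" and \<rho>: "0 < \<rho>"
    and low: "\<And>x y. x \<in> ball z0 R \<Longrightarrow> y \<in> ball z0 R \<Longrightarrow> k * norm (x - y) \<le> norm (h x - h y)"
    and sph: "\<And>z. norm (z - z0) = r \<Longrightarrow> \<rho> \<le> norm (h z - h z0)"
  obtains \<kappa> where "\<kappa> holomorphic_on ball (h z0) \<rho>"
    "\<And>y. y \<in> ball (h z0) \<rho> \<Longrightarrow> norm (\<kappa> y - z0) < r \<and> h (\<kappa> y) = y"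
    "\<And>y y'. y \<in> ball (h z0) \<rho> \<Longrightarrow> y' \<in> ball (h z0) \<rho> \<Longrightarrow> k * norm (\<kappa> y - \<kappa> y') \<le> norm (y - y')"
proof -
  let ?S = "ball z0 r"
  have SR: "?S \<subseteq> ball z0 R" "cball z0 r \<subseteq> ball z0 R" using r by auto
  have inj: "inj_on h ?S"
  proof (rule inj_onI)
    fix x y assume xy: "x \<in> ?S" "y \<in> ?S" "h x = h y"
    have "k * norm (x - y) \<le> norm (h x - h y)" by (rule low[OF subsetD[OF SR(1) xy(1)] subsetD[OF SR(1) xy(2)]])
    hence "k * norm (x - y) \<le> 0" using xy(3) by simp
    thus "x = y" using k by (simp add: mult_le_0_iff)
  qed
  have hS: "h holomorphic_on ?S" by (rule holomorphic_on_subset[OF hol SR(1)])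
  obtain \<kappa> where \<kappa>: "\<kappa> holomorphic_on h ` ?S" "\<And>z. z \<in> ?S \<Longrightarrow> \<kappa> (h z) = z"
    by (rule holomorphic_has_inverse[OF hS open_ball inj]) (rule that)
  have cov: "ball (h z0) \<rho> \<subseteq> h ` ?S"
  proof (rule ball_subset_open_map_image)
    show "continuous_on (closure ?S) h"
      using holomorphic_on_imp_continuous_on[OF holomorphic_on_subset[OF hol SR(2)]] r by simp
    show "open (h ` interior ?S)" using open_mapping_thm3[OF hS open_ball inj] by (simp add: interior_open)
    show "\<rho> \<le> norm (h z - h z0)" if "z \<in> frontier ?S" for z
      using that r by (intro sph) (auto simp: dist_norm norm_minus_commute)
  qed (use r \<rho> in auto)
  have *: "norm (\<kappa> y - z0) < r \<and> h (\<kappa> y) = y" if y: "y \<in> ball (h z0) \<rho>" for y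
  proof -
    obtain z where z: "z \<in> ?S" "y = h z" using cov y by blast
    thus ?thesis using \<kappa>(2)[OF z(1)] by (simp add: dist_norm norm_minus_commute)
  qed
  show ?thesis
  proof (rule that)
    show "\<kappa> holomorphic_on ball (h z0) \<rho>" by (rule holomorphic_on_subset[OF \<kappa>(1) cov])
    show "norm (\<kappa> y - z0) < r \<and> h (\<kappa> y) = y" if "y \<in> ball (h z0) \<rho>" for y by (rule *[OF that])
    show "k * norm (\<kappa> y - \<kappa> y') \<le> norm (y - y')" if y: "y \<in> ball (h z0) \<rho>" "y' \<in> ball (h z0) \<rho>" for y y'
    proof -
      have "\<kappa> y \<in> ball z0 R" "\<kappa> y' \<in> ball z0 R" using *[OF y(1)] *[OF y(2)] r by (auto simp: dist_norm norm_minus_commute)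
      thus ?thesis using low[of "\<kappa> y" "\<kappa> y'"] *[OF y(1)] *[OF y(2)] by simp
    qed
  qed
qed

definition pdisc :: "complex set" where "pdisc = ball (-2) (7/20)"

lemma pdisc_iff: "t \<in> pdisc \<longleftrightarrow> norm (t + 2) < 7/20"
  by (simp add: pdisc_def dist_norm norm_minus_commute[of "-2"])

text \<open>A family of maps close to \<^term>\<open>\<lambda>w. w + t\<close>, depending holomorphically on the parameter \<^term>\<open>t\<close>;
  joint holomorphy is expressed through composition with holomorphic curves.\<close>
definition good_family :: "(complex \<Rightarrow> complex \<Rightarrow> complex) \<Rightarrow> bool" where
  "good_family \<psi> \<longleftrightarrow> (\<forall>t\<in>pdisc. \<psi> t holomorphic_on UNIV \<and> (\<forall>w. norm w < 25 \<longrightarrow> norm (\<psi> t w - (w + t)) \<le> 1/10000)) \<and>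
    (\<forall>S \<tau> u. open S \<longrightarrow> \<tau> holomorphic_on S \<longrightarrow> u holomorphic_on S \<longrightarrow> \<tau> ` S \<subseteq> pdisc \<longrightarrow>
       (\<lambda>s. \<psi> (\<tau> s) (u s)) holomorphic_on S \<and> (\<lambda>s. deriv (\<psi> (\<tau> s)) (u s)) holomorphic_on S)"

section \<open>Parameter windows for a prescribed critical orbit\<close>

locale fam =
  fixes \<psi> :: "complex \<Rightarrow> complex \<Rightarrow> complex"
  assumes good: "good_family \<psi>"
begin

lemma hol: "t \<in> pdisc \<Longrightarrow> \<psi> t holomorphic_on UNIV"
  and close: "t \<in> pdisc \<Longrightarrow> norm w < 25 \<Longrightarrow> norm (\<psi> t w - (w + t)) \<le> 1/10000"
  using good by (auto simp: good_family_def)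

lemma nq: "t \<in> pdisc \<Longrightarrow> nq (\<psi> t) t"
proof
  assume t: "t \<in> pdisc"
  have "norm (\<psi> t w - (w + t)) \<le> 1/100" if "norm w < 25" for w using close[OF t that] by simp
  thus "near_quad (\<psi> t) t" using hol[OF t] t by (simp add: near_quad_def pdisc_iff)
qed

lemma comp:
  assumes "open S" "\<tau> holomorphic_on S" "u holomorphic_on S" "\<tau> ` S \<subseteq> pdisc"
  shows "(\<lambda>s. \<psi> (\<tau> s) (u s)) holomorphic_on S" "(\<lambda>s. deriv (\<psi> (\<tau> s)) (u s)) holomorphic_on S"
  using good assms unfolding good_family_def by blast+

lemma iter_comp:
  assumes S: "open S" "\<tau> holomorphic_on S" "u holomorphic_on S" "\<tau> ` S \<subseteq> pdisc"
  shows "(\<lambda>s. (qm (\<psi> (\<tau> s)) ^^ j) (u s)) holomorphic_on S"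
proof (induction j)
  case 0 show ?case using S(3) by simp
next
  case (Suc j)
  have "(\<lambda>s. ((qm (\<psi> (\<tau> s)) ^^ j) (u s))\<^sup>2) holomorphic_on S" by (intro holomorphic_on_power Suc)
  from comp(1)[OF S(1,2) this S(4)] have h: "(\<lambda>s. \<psi> (\<tau> s) (((qm (\<psi> (\<tau> s)) ^^ j) (u s))\<^sup>2)) holomorphic_on S" .
  have "(\<lambda>s. \<psi> (\<tau> s) (((qm (\<psi> (\<tau> s)) ^^ j) (u s))\<^sup>2)) = (\<lambda>s. (qm (\<psi> (\<tau> s)) ^^ Suc j) (u s))"
  proof
    fix s show "\<psi> (\<tau> s) (((qm (\<psi> (\<tau> s)) ^^ j) (u s))\<^sup>2) = (qm (\<psi> (\<tau> s)) ^^ Suc j) (u s)"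
      unfolding funpow.simps o_apply by (rule qm_def[symmetric])
  qed
  with h show ?case by (simp only:)
qed

lemma deriv_iter_comp:
  assumes S: "open S" "\<tau> holomorphic_on S" "u holomorphic_on S" "\<tau> ` S \<subseteq> pdisc"
  shows "(\<lambda>s. deriv (qm (\<psi> (\<tau> s)) ^^ j) (u s)) holomorphic_on S"
proof -
  have "(\<lambda>s. \<Prod>i<j. 2 * (qm (\<psi> (\<tau> s)) ^^ i) (u s) * deriv (\<psi> (\<tau> s)) (((qm (\<psi> (\<tau> s)) ^^ i) (u s))\<^sup>2)) holomorphic_on S"
  proof (intro holomorphic_on_prod holomorphic_on_mult holomorphic_on_const)
    fix i
    show 1: "(\<lambda>s. (qm (\<psi> (\<tau> s)) ^^ i) (u s)) holomorphic_on S" by (rule iter_comp[OF S])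
    show "(\<lambda>s. deriv (\<psi> (\<tau> s)) (((qm (\<psi> (\<tau> s)) ^^ i) (u s))\<^sup>2)) holomorphic_on S"
      by (rule comp(2)[OF S(1,2) holomorphic_on_power[OF 1] S(4)])
  qed
  thus ?thesis
  proof (rule holomorphic_transform)
    fix s assume that: "s \<in> S"
    show "(\<Prod>i<j. 2 * (qm (\<psi> (\<tau> s)) ^^ i) (u s) * deriv (\<psi> (\<tau> s)) (((qm (\<psi> (\<tau> s)) ^^ i) (u s))\<^sup>2)) = deriv (qm (\<psi> (\<tau> s)) ^^ j) (u s)"
    proof -
      interpret nq "\<psi> (\<tau> s)" "\<tau> s" using S(4) that by (intro nq) auto
      show ?thesis unfolding deriv_funpow[OF f_hol] f_deriv ..
    qed
  qed
qed

text \<open>Cauchy in the parameter: an error 1/10000 over a distance 1/200 gives the derivative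
  1/50. The disc of radius 17/50 leaves the required margin 1/100 inside
  \<open>pdisc\<close>.\<close>

lemma lip_t:
  assumes "norm (t + 2) \<le> 17/50" "norm (t' + 2) \<le> 17/50" "norm w < 25"
  shows "norm ((\<psi> t w - \<psi> t' w) - (t - t')) \<le> (1/50) * norm (t - t')"
proof -
  let ?h = "\<lambda>t. \<psi> t w - (w + t)"
  have "(\<lambda>t. \<psi> t w) holomorphic_on pdisc"
    using comp(1)[of pdisc "\<lambda>t. t" "\<lambda>_. w"] by (auto simp: pdisc_def)
  hence hol: "?h holomorphic_on pdisc" by (intro holomorphic_on_diff holomorphic_on_add holomorphic_on_const holomorphic_on_ident)
  have DB: "(?h has_field_derivative deriv ?h z) (at z within cball (-2) (17/50)) \<and> norm (deriv ?h z) \<le> 1/50"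
    if z: "z \<in> cball (-2) (17/50)" for z
  proof
    have z': "norm (z + 2) \<le> 17/50" using z by (simp add: dist_norm norm_minus_commute[of "-2"])
    hence "z \<in> pdisc" by (simp add: pdisc_iff)
    thus "(?h has_field_derivative deriv ?h z) (at z within cball (-2) (17/50))"
      using holomorphic_derivI[OF hol] by (auto simp: pdisc_def)
    have bD: "ball z (1/100) \<subseteq> pdisc"
    proof
      fix x assume "x \<in> ball z (1/100)"
      hence "norm (x - z) < 1/100" by (simp add: dist_norm norm_minus_commute)
      thus "x \<in> pdisc" unfolding pdisc_iff using z' norm_triangle_ineq[of "x - z" "z + 2"] by simp
    qed
    have "norm (deriv ?h z) \<le> (1/10000) / (1/200)"
    proof (rule deriv_norm_bound)
      show "?h holomorphic_on ball z (1/100)" by (rule holomorphic_on_subset[OF hol bD])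
      show "norm (?h x) \<le> 1/10000" if "x \<in> ball z (1/100)" for x using that bD assms(3) by (intro close) auto
    qed auto
    thus "norm (deriv ?h z) \<le> 1/50" by simp
  qed
  have "norm (?h t - ?h t') \<le> (1/50) * norm (t - t')"
  proof (rule field_differentiable_bound[where f = ?h and f' = "deriv ?h" and S = "cball (-2) (17/50)"])
    show "t \<in> cball (-2) (17/50)" "t' \<in> cball (-2) (17/50)" using assms by (simp_all add: dist_norm norm_minus_commute[of "-2"])
  qed (use DB convex_cball in blast)+
  moreover have "?h t - ?h t' = (\<psi> t w - \<psi> t' w) - (t - t')" by simp
  ultimately show ?thesis by (simp only:)
qed

lemma a1_close: "t \<in> pdisc \<Longrightarrow> norm (\<psi> t 0 - t) \<le> 1/10000"
  using close[of t 0] by simp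

lemma pdisc_norm: "t \<in> pdisc \<Longrightarrow> norm t \<le> 47/20"
  using norm_triangle_ineq4[of "t + 2" 2] by (simp add: pdisc_iff)

lemma a1_norm: "t \<in> pdisc \<Longrightarrow> norm (\<psi> t 0) \<le> 12/5"
  using a1_close[of t] pdisc_norm[of t] norm_triangle_ineq[of "\<psi> t 0 - t" t] by simp

lemma sq_le: assumes "norm (z::complex) \<le> 12/5" shows "norm (z\<^sup>2) \<le> 6"
proof -
  have "(norm z)\<^sup>2 \<le> (12/5)\<^sup>2" using assms by (intro power_mono) auto
  also have "\<dots> \<le> 6" by (simp add: power2_eq_square)
  finally show ?thesis by (simp only: norm_power)
qed

definition A where "A t = \<psi> t ((\<psi> t 0)\<^sup>2)"

lemma A_eq: "(qm (\<psi> t) ^^ 2) 0 = A t"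
  by (simp add: A_def qm_def numeral_2_eq_2)

text \<open>With \<open>d = t + 2\<close> the model value \<open>t^2 + t\<close> equals
  \<open>2 + d (d - 3)\<close>.\<close>

lemma A_close: assumes t: "t \<in> pdisc" shows "norm (A t - 2 - (t + 2) * ((t + 2) - 3)) \<le> 1/1000"
proof -
  let ?x = "\<psi> t 0"
  have 1: "norm (A t - (?x\<^sup>2 + t)) \<le> 1/10000" unfolding A_def
    using sq_le[OF a1_norm[OF t]] by (intro close[OF t]) simp
  have "norm (?x\<^sup>2 - t\<^sup>2) = norm (?x - t) * norm (?x + t)" by (simp add: power2_eq_square algebra_simps flip: norm_mult)
  also have "\<dots> \<le> (1/10000) * 5"
    using a1_close[OF t] a1_norm[OF t] pdisc_norm[OF t] norm_triangle_ineq[of ?x t] by (intro mult_mono) auto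
  finally have 2: "norm (?x\<^sup>2 - t\<^sup>2) \<le> 5/10000" by simp
  have e: "A t - 2 - (t + 2) * ((t + 2) - 3) = (A t - (?x\<^sup>2 + t)) + (?x\<^sup>2 - t\<^sup>2)" by (simp add: algebra_simps power2_eq_square)
  show ?thesis unfolding e using 1 2 norm_triangle_ineq[of "A t - (?x\<^sup>2 + t)" "?x\<^sup>2 - t\<^sup>2"] by linarith
qed

lemma A_hol: "A holomorphic_on pdisc"
  unfolding A_def[abs_def] by (intro comp holomorphic_intros) (auto simp: pdisc_def)

text \<open>The model \<open>t^2 + t\<close> has derivative -3 at -2; the constant 2 leaves room for
  its variation on the disc and for the errors of the family.\<close>

lemma A_low:
  assumes t: "norm (t + 2) \<le> 17/50" "norm (t' + 2) \<le> 17/50"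
  shows "2 * norm (t - t') \<le> norm (A t - A t')"
proof -
  have tD: "t \<in> pdisc" "t' \<in> pdisc" using t by (auto simp: pdisc_iff)
  define x x' d where "x = \<psi> t 0" and "x' = \<psi> t' 0" and "d = norm (t - t')"
  interpret nq "\<psi> t" t by (rule nq[OF tD(1)])
  have d0: "0 \<le> d" by (simp add: d_def)
  have e0: "norm ((x - x') - (t - t')) \<le> d/50" using lip_t[OF t, of 0] by (simp add: x_def x'_def d_def)
  have xn: "norm x \<le> 12/5" "norm x' \<le> 12/5" using a1_norm tD by (auto simp: x_def x'_def)
  have q: "norm (x\<^sup>2) \<le> 6" "norm (x'\<^sup>2) \<le> 6" using sq_le xn by auto
  have e1: "norm ((\<psi> t (x\<^sup>2) - \<psi> t (x'\<^sup>2)) - (x\<^sup>2 - x'\<^sup>2)) \<le> (1/500) * norm (x\<^sup>2 - x'\<^sup>2)"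
    using q by (intro lip_close) auto
  have e2: "norm ((\<psi> t (x'\<^sup>2) - \<psi> t' (x'\<^sup>2)) - (t - t')) \<le> d/50" using lip_t[OF t, of "x'\<^sup>2"] q by (simp add: d_def)
  have s: "norm (x + x' + 4) \<le> 69/100"
  proof -
    have e: "x + x' + 4 = (x - t) + (x' - t') + ((t + 2) + (t' + 2))" by simp
    show ?thesis unfolding e using a1_close[OF tD(1), folded x_def] a1_close[OF tD(2), folded x'_def] t norm_triangle_ineq[of "(x - t) + (x' - t')" "(t + 2) + (t' + 2)"]
      norm_triangle_ineq[of "x - t" "x' - t'"] norm_triangle_ineq[of "t + 2" "t' + 2"] by linarith
  qed
  have xx: "norm (x - x') \<le> (51/50) * d"
    using e0 norm_triangle_ineq[of "(x - x') - (t - t')" "t - t'"] by (simp add: d_def)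
  define E where "E = (x\<^sup>2 - x'\<^sup>2) + 4 * (t - t')"
  have "E = (x - x') * (x + x' + 4) - 4 * ((x - x') - (t - t'))" by (simp add: E_def power2_eq_square algebra_simps)
  moreover have "norm ((x - x') * (x + x' + 4)) \<le> ((51/50) * d) * (69/100)"
    unfolding norm_mult using xx s d0 by (intro mult_mono) auto
  moreover have "norm (4 * ((x - x') - (t - t'))) \<le> 4 * (d/50)" unfolding norm_mult using e0 by simp
  ultimately have E: "norm E \<le> (79/100) * d"
    using norm_triangle_ineq4[of "(x - x') * (x + x' + 4)" "4 * ((x - x') - (t - t'))"] norm_ge_zero[of "t - t'", folded d_def] by simp
  have "x\<^sup>2 - x'\<^sup>2 = E - 4 * (t - t')" by (simp add: E_def)
  hence "norm (x\<^sup>2 - x'\<^sup>2) \<le> norm E + norm (4 * (t - t'))" by (simp only: norm_triangle_ineq4)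
  hence "norm (x\<^sup>2 - x'\<^sup>2) \<le> norm E + 4 * d" unfolding norm_mult d_def by simp
  hence e1': "norm ((\<psi> t (x\<^sup>2) - \<psi> t (x'\<^sup>2)) - (x\<^sup>2 - x'\<^sup>2)) \<le> d/100" using e1 E norm_ge_zero[of "t - t'", folded d_def] by linarith
  have e: "3 * (t - t') = ((\<psi> t (x\<^sup>2) - \<psi> t (x'\<^sup>2)) - (x\<^sup>2 - x'\<^sup>2)) + ((\<psi> t (x'\<^sup>2) - \<psi> t' (x'\<^sup>2)) - (t - t')) + E - (A t - A t')"
    by (simp add: A_def x_def x'_def E_def)
  have "3 * d = norm (3 * (t - t'))" unfolding norm_mult d_def by simp
  also have "\<dots> \<le> d/100 + d/50 + (79/100) * d + norm (A t - A t')"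
    unfolding e using e1' e2 E norm_triangle_ineq4[of "((\<psi> t (x\<^sup>2) - \<psi> t (x'\<^sup>2)) - (x\<^sup>2 - x'\<^sup>2)) + ((\<psi> t (x'\<^sup>2) - \<psi> t' (x'\<^sup>2)) - (t - t')) + E" "A t - A t'"]
      norm_triangle_ineq[of "((\<psi> t (x\<^sup>2) - \<psi> t (x'\<^sup>2)) - (x\<^sup>2 - x'\<^sup>2)) + ((\<psi> t (x'\<^sup>2) - \<psi> t' (x'\<^sup>2)) - (t - t'))" E]
      norm_triangle_ineq[of "(\<psi> t (x\<^sup>2) - \<psi> t (x'\<^sup>2)) - (x\<^sup>2 - x'\<^sup>2)" "(\<psi> t (x'\<^sup>2) - \<psi> t' (x'\<^sup>2)) - (t - t')"] by linarith
  finally show ?thesis using d0 unfolding d_def[symmetric] by linarith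
qed

text \<open>A right inverse of the parameter map sending \<open>t\<close> to the critical orbit
  point at time \<open>j\<close>. Rather than differentiating iterates in the parameter, the
  parameter is followed as a function of the position of the orbit. Lipschitz constant 1/2 means
  that the map moves more slowly than the orbit point, so the expansion near 2 survives.\<close>

definition sect where
  "sect b j \<theta> \<longleftrightarrow> \<theta> holomorphic_on ball 2 (4/5) \<and>
    (\<forall>y\<in>ball 2 (4/5). norm (\<theta> y + 2) \<le> b \<and> (qm (\<psi> (\<theta> y)) ^^ j) 0 = y \<and>
       (\<forall>i. 2 \<le> i \<longrightarrow> i \<le> j \<longrightarrow> norm ((qm (\<psi> (\<theta> y)) ^^ i) 0 - 2) < 4/5)) \<and>
    (\<forall>y\<in>ball 2 (4/5). \<forall>y'\<in>ball 2 (4/5). norm (\<theta> y - \<theta> y') \<le> (1/2) * norm (y - y'))"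

lemma section_2:
  obtains \<theta> where "sect (8/25) 2 \<theta>" "\<And>y. y \<in> ball 2 (4/5) \<Longrightarrow> norm (\<theta> y + 2) \<le> (2/5) * norm (y - 2) + 1/1000"
proof -
  have bD: "ball (-2) (17/50) \<subseteq> pdisc" by (auto simp: pdisc_def)
  have m2: "-2 \<in> pdisc" by (simp add: pdisc_iff)
  have A2: "norm (A (-2) - 2) \<le> 1/1000" using A_close[OF m2] by simp
  have low: "2 * norm (x - y) \<le> norm (A x - A y)" if "x \<in> ball (-2) (17/50)" "y \<in> ball (-2) (17/50)" for x y
    using that by (intro A_low) (auto simp: dist_norm norm_minus_commute[of "-2"])
  have sph: "17/20 \<le> norm (A z - A (-2))" if z: "norm (z - (-2)) = 8/25" for z
  proof -
    have z': "norm (z + 2) = 8/25" using z by simp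
    hence zD: "z \<in> pdisc" by (simp add: pdisc_iff)
    have "norm ((z + 2) - 3) \<ge> 3 - 8/25" using norm_triangle_ineq3[of "z + 2" 3] z' by simp
    hence "norm ((z + 2) * ((z + 2) - 3)) \<ge> (8/25) * (3 - 8/25)" unfolding norm_mult z' by (intro mult_left_mono) auto
    moreover have "(z + 2) * ((z + 2) - 3) = (A z - A (-2)) + (A (-2) - 2) - (A z - 2 - (z + 2) * ((z + 2) - 3))" by simp
    ultimately show ?thesis using A_close[OF zD] A2
      norm_triangle_ineq4[of "(A z - A (-2)) + (A (-2) - 2)" "A z - 2 - (z + 2) * ((z + 2) - 3)"]
      norm_triangle_ineq[of "A z - A (-2)" "A (-2) - 2"] by simp
  qed
  obtain \<theta> where \<theta>: "\<theta> holomorphic_on ball (A (-2)) (17/20)"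
    "\<And>y. y \<in> ball (A (-2)) (17/20) \<Longrightarrow> norm (\<theta> y - (-2)) < 8/25 \<and> A (\<theta> y) = y"
    "\<And>y y'. y \<in> ball (A (-2)) (17/20) \<Longrightarrow> y' \<in> ball (A (-2)) (17/20) \<Longrightarrow> 2 * norm (\<theta> y - \<theta> y') \<le> norm (y - y')"
    using lip_inverse[OF holomorphic_on_subset[OF A_hol bD], of "8/25" 2 "17/20"] low sph by auto
  have sub: "ball 2 (4/5) \<subseteq> ball (A (-2)) (17/20)"
  proof
    fix y :: complex assume "y \<in> ball 2 (4/5)"
    hence "norm (y - 2) < 4/5" by (simp add: dist_norm norm_minus_commute)
    hence "norm (A (-2) - y) < 17/20" using A2 norm_triangle_ineq4[of "A (-2) - 2" "y - 2"] by simp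
    thus "y \<in> ball (A (-2)) (17/20)" by (simp add: dist_norm)
  qed
  have \<theta>': "norm (\<theta> y + 2) < 8/25" "A (\<theta> y) = y" if "y \<in> ball 2 (4/5)" for y using \<theta>(2)[of y] that sub by auto
  show ?thesis
  proof (rule that)
    show "sect (8/25) 2 \<theta>" unfolding sect_def
    proof (intro conjI ballI)
      show "\<theta> holomorphic_on ball 2 (4/5)" by (rule holomorphic_on_subset[OF \<theta>(1) sub])
    next
      fix y :: complex assume y: "y \<in> ball 2 (4/5)"
      show "norm (\<theta> y + 2) \<le> 8/25" using \<theta>'(1)[OF y] by simp
      show A: "(qm (\<psi> (\<theta> y)) ^^ 2) 0 = y" unfolding A_eq by (rule \<theta>'(2)[OF y])
      show "\<forall>i. 2 \<le> i \<longrightarrow> i \<le> 2 \<longrightarrow> norm ((qm (\<psi> (\<theta> y)) ^^ i) 0 - 2) < 4/5"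
      proof (intro allI impI)
        fix i :: nat assume "2 \<le> i" "i \<le> 2"
        hence "i = 2" by simp
        thus "norm ((qm (\<psi> (\<theta> y)) ^^ i) 0 - 2) < 4/5" using A y by (simp only: A) (simp add: dist_norm norm_minus_commute)
      qed
    next
      fix y y' :: complex assume "y \<in> ball 2 (4/5)" "y' \<in> ball 2 (4/5)"
      hence "2 * norm (\<theta> y - \<theta> y') \<le> norm (y - y')" using sub by (intro \<theta>(3)) blast+
      thus "norm (\<theta> y - \<theta> y') \<le> (1/2) * norm (y - y')" by simp
    qed
    show "norm (\<theta> y + 2) \<le> (2/5) * norm (y - 2) + 1/1000" if y: "y \<in> ball 2 (4/5)" for y
    proof -
      let ?d = "\<theta> y + 2"
      have d: "norm ?d < 8/25" by (rule \<theta>'(1)[OF y])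
      hence "\<theta> y \<in> pdisc" by (simp add: pdisc_iff)
      from A_close[OF this] have "norm (y - 2 - ?d * (?d - 3)) \<le> 1/1000" unfolding \<theta>'(2)[OF y] .
      hence "norm (?d * (?d - 3)) \<le> norm (y - 2) + 1/1000" using norm_triangle_ineq4[of "y - 2" "y - 2 - ?d * (?d - 3)"] by simp
      moreover have "norm ?d * (5/2) \<le> norm ?d * norm (?d - 3)"
        using d norm_triangle_ineq3[of ?d 3] by (intro mult_left_mono) auto
      ultimately have "norm ?d * (5/2) \<le> norm (y - 2) + 1/1000" by (simp only: norm_mult)
      thus ?thesis by simp
    qed
  qed
qed

text \<open>The next orbit point \<open>g y\<close> expands distances by 3/2 even though the map
  varies with \<open>y\<close>, and its inverse \<open>\<kappa>\<close> continues the section by one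
  step. The radius matters: for \<open>b = 8/25\<close> it exceeds 4/5, so the construction can be
  repeated; for \<open>b = 3/20\<close> it exceeds \<open>2 + 1/20\<close>, so it reaches a
  neighbourhood of 0.\<close>

lemma section_extend:
  assumes s: "sect b j \<theta>" and b: "0 \<le> b" "b \<le> 8/25"
  obtains \<kappa> where "\<kappa> holomorphic_on ball 2 (63/25 - 3 * b)"
    "\<And>y. y \<in> ball 2 (63/25 - 3 * b) \<Longrightarrow> \<kappa> y \<in> ball 2 (4/5) \<and> (qm (\<psi> (\<theta> (\<kappa> y))) ^^ Suc j) 0 = y \<and>
        norm ((\<kappa> y)\<^sup>2 - 2 - y) \<le> b + 1/10000"
    "\<And>y y'. y \<in> ball 2 (63/25 - 3 * b) \<Longrightarrow> y' \<in> ball 2 (63/25 - 3 * b) \<Longrightarrow> norm (\<kappa> y - \<kappa> y') \<le> norm (y - y')"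
proof -
  let ?B = "ball (2::complex) (4/5)"
  have \<theta>: "\<theta> holomorphic_on ?B" "\<And>y. y \<in> ?B \<Longrightarrow> norm (\<theta> y + 2) \<le> b" "\<And>y. y \<in> ?B \<Longrightarrow> (qm (\<psi> (\<theta> y)) ^^ j) 0 = y"
    "\<And>y y'. y \<in> ?B \<Longrightarrow> y' \<in> ?B \<Longrightarrow> norm (\<theta> y - \<theta> y') \<le> (1/2) * norm (y - y')"
    using s by (auto simp: sect_def)
  have tD: "\<theta> y \<in> pdisc" if "y \<in> ?B" for y using \<theta>(2)[OF that] b by (simp add: pdisc_iff)
  define g where "g = (\<lambda>y. \<psi> (\<theta> y) (y\<^sup>2))"
  have ghol: "g holomorphic_on ?B" unfolding g_def
    by (rule comp(1)) (use \<theta>(1) tD in \<open>auto intro!: holomorphic_intros\<close>)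
  have nB: "norm (y - 2) < 4/5" "6/5 < norm y" "norm y < 14/5" "norm (y + 2) \<ge> 16/5" "norm (y\<^sup>2) \<le> 16" if "y \<in> ?B" for y
  proof -
    show 1: "norm (y - 2) < 4/5" using that by (simp add: dist_norm norm_minus_commute)
    show "6/5 < norm y" using 1 norm_triangle_ineq4[of "y - 2" y] by simp
    show 2: "norm y < 14/5" using 1 norm_triangle_ineq[of "y - 2" 2] by simp
    show "norm (y + 2) \<ge> 16/5" using 1 norm_triangle_ineq4[of "y - 2" "y + 2"] by simp
    have "(norm y)\<^sup>2 \<le> 4\<^sup>2" using 2 by (intro power_mono) auto
    thus "norm (y\<^sup>2) \<le> 16" by (simp add: norm_power)
  qed
  have gc: "norm (g y - (y\<^sup>2 - 2)) \<le> b + 1/10000" if y: "y \<in> ?B" for y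
  proof -
    have "norm (g y - (y\<^sup>2 + \<theta> y)) \<le> 1/10000" unfolding g_def using nB(5)[OF y] by (intro close[OF tD[OF y]]) simp
    moreover have e: "g y - (y\<^sup>2 - 2) = (g y - (y\<^sup>2 + \<theta> y)) + (\<theta> y + 2)" by simp
    ultimately show ?thesis unfolding e using \<theta>(2)[OF y] norm_triangle_ineq[of "g y - (y\<^sup>2 + \<theta> y)" "\<theta> y + 2"] by linarith
  qed
  have low: "(3/2) * norm (x - y) \<le> norm (g x - g y)" if xy: "x \<in> ?B" "y \<in> ?B" for x y
  proof -
    interpret nq "\<psi> (\<theta> x)" "\<theta> x" by (rule nq[OF tD[OF xy(1)]])
    define d where "d = norm (x - y)"
    have d0: "d \<ge> 0" by (simp add: d_def)
    have "norm (x + y) \<ge> 12/5"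
      using nB(1)[OF xy(1)] nB(1)[OF xy(2)] norm_triangle_ineq4[of "(x - 2) + (y - 2)" "x + y"] norm_triangle_ineq[of "x - 2" "y - 2"] by simp
    hence "d * (12/5) \<le> d * norm (x + y)" using d0 by (intro mult_left_mono)
    also have "\<dots> = norm (x\<^sup>2 - y\<^sup>2)" by (simp add: d_def power2_eq_square algebra_simps flip: norm_mult)
    finally have 1: "norm (x\<^sup>2 - y\<^sup>2) \<ge> d * (12/5)" .
    have 2: "norm (\<psi> (\<theta> x) (x\<^sup>2) - \<psi> (\<theta> x) (y\<^sup>2)) \<ge> (499/500) * norm (x\<^sup>2 - y\<^sup>2)"
      by (rule lip_lower[OF nB(5)[OF xy(1)] nB(5)[OF xy(2)]])
    have "norm ((\<psi> (\<theta> x) (y\<^sup>2) - \<psi> (\<theta> y) (y\<^sup>2)) - (\<theta> x - \<theta> y)) \<le> (1/50) * norm (\<theta> x - \<theta> y)"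
      using \<theta>(2) xy b nB(5)[OF xy(2)] by (intro lip_t) force+
    hence 3: "norm (\<psi> (\<theta> x) (y\<^sup>2) - \<psi> (\<theta> y) (y\<^sup>2)) \<le> (51/100) * d"
      using \<theta>(4)[OF xy] norm_triangle_ineq[of "(\<psi> (\<theta> x) (y\<^sup>2) - \<psi> (\<theta> y) (y\<^sup>2)) - (\<theta> x - \<theta> y)" "\<theta> x - \<theta> y"] by (simp add: d_def)
    have e: "\<psi> (\<theta> x) (x\<^sup>2) - \<psi> (\<theta> x) (y\<^sup>2) = (g x - g y) - (\<psi> (\<theta> x) (y\<^sup>2) - \<psi> (\<theta> y) (y\<^sup>2))" by (simp add: g_def)
    have "norm (\<psi> (\<theta> x) (x\<^sup>2) - \<psi> (\<theta> x) (y\<^sup>2)) \<le> norm (g x - g y) + (51/100) * d"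
      unfolding e using 3 norm_triangle_ineq4[of "g x - g y" "\<psi> (\<theta> x) (y\<^sup>2) - \<psi> (\<theta> y) (y\<^sup>2)"] by linarith
    thus ?thesis using 1 2 d0 unfolding d_def[symmetric] by linarith
  qed
  have in2: "2 \<in> ?B" by simp
  have g2: "norm (g 2 - 2) \<le> b + 1/10000" using gc[OF in2] by simp
  have sph: "101/40 - 2 * b \<le> norm (g z - g 2)" if z: "norm (z - 2) = 79/100" for z
  proof -
    have zB: "z \<in> ?B" using z by (simp add: dist_norm norm_minus_commute)
    have "norm (z + 2) \<ge> 321/100" using norm_triangle_ineq4[of "z - 2" "z + 2"] z by simp
    hence "(79/100) * (321/100) \<le> norm (z - 2) * norm (z + 2)" unfolding z by (intro mult_left_mono) auto
    also have "\<dots> = norm (z\<^sup>2 - 2 - 2)" by (simp add: power2_eq_square algebra_simps flip: norm_mult)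
    finally have 1: "253/100 \<le> norm (z\<^sup>2 - 2 - 2)" by simp
    have e: "z\<^sup>2 - 2 - 2 = (g z - g 2) + (g 2 - 2) - (g z - (z\<^sup>2 - 2))" by simp
    have "norm (z\<^sup>2 - 2 - 2) \<le> norm (g z - g 2) + (b + 1/10000) + (b + 1/10000)"
      unfolding e using g2 gc[OF zB] norm_triangle_ineq4[of "(g z - g 2) + (g 2 - 2)" "g z - (z\<^sup>2 - 2)"] norm_triangle_ineq[of "g z - g 2" "g 2 - 2"] by linarith
    thus ?thesis using 1 by linarith
  qed
  let ?\<rho> = "101/40 - 2 * b"
  have \<rho>0: "0 < ?\<rho>" using b by simp
  obtain \<kappa> where \<kappa>: "\<kappa> holomorphic_on ball (g 2) ?\<rho>"
    "\<And>y. y \<in> ball (g 2) ?\<rho> \<Longrightarrow> norm (\<kappa> y - 2) < 79/100 \<and> g (\<kappa> y) = y"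
    "\<And>y y'. y \<in> ball (g 2) ?\<rho> \<Longrightarrow> y' \<in> ball (g 2) ?\<rho> \<Longrightarrow> (3/2) * norm (\<kappa> y - \<kappa> y') \<le> norm (y - y')"
  proof (rule lip_inverse[where h = g and ?z0.0 = 2 and R = "4/5" and r = "79/100" and k = "3/2" and \<rho> = ?\<rho>])
  qed (rule ghol \<rho>0 low sph that | assumption | simp)+
  have sub: "ball 2 (63/25 - 3 * b) \<subseteq> ball (g 2) ?\<rho>"
  proof
    fix y :: complex assume "y \<in> ball 2 (63/25 - 3 * b)"
    hence "norm (y - 2) < 63/25 - 3 * b" by (simp add: dist_norm norm_minus_commute)
    hence "norm (g 2 - y) < ?\<rho>" using g2 norm_triangle_ineq4[of "g 2 - 2" "y - 2"] by simp
    thus "y \<in> ball (g 2) ?\<rho>" by (simp add: dist_norm)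
  qed
  show ?thesis
  proof (rule that)
    show "\<kappa> holomorphic_on ball 2 (63/25 - 3 * b)" by (rule holomorphic_on_subset[OF \<kappa>(1) sub])
  next
    fix y :: complex assume "y \<in> ball 2 (63/25 - 3 * b)"
    hence k: "norm (\<kappa> y - 2) < 79/100" "g (\<kappa> y) = y" using \<kappa>(2)[of y] sub by auto
    hence kB: "\<kappa> y \<in> ?B" by (simp add: dist_norm norm_minus_commute)
    have "(qm (\<psi> (\<theta> (\<kappa> y))) ^^ Suc j) 0 = g (\<kappa> y)" using \<theta>(3)[OF kB] by (simp add: g_def qm_def)
    moreover have "norm ((\<kappa> y)\<^sup>2 - 2 - y) \<le> b + 1/10000" using gc[OF kB] k(2) by (simp add: norm_minus_commute)
    ultimately show "\<kappa> y \<in> ?B \<and> (qm (\<psi> (\<theta> (\<kappa> y))) ^^ Suc j) 0 = y \<and> norm ((\<kappa> y)\<^sup>2 - 2 - y) \<le> b + 1/10000"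
      using kB k(2) by simp
  next
    fix y y' :: complex assume "y \<in> ball 2 (63/25 - 3 * b)" "y' \<in> ball 2 (63/25 - 3 * b)"
    hence "(3/2) * norm (\<kappa> y - \<kappa> y') \<le> norm (y - y')" using \<kappa>(3) sub by blast
    thus "norm (\<kappa> y - \<kappa> y') \<le> norm (y - y')" using norm_ge_zero[of "\<kappa> y - \<kappa> y'"] by linarith
  qed
qed

lemma section_Suc:
  assumes s: "sect b j \<theta>" and b: "0 \<le> b" "b \<le> 8/25"
  obtains \<kappa> where "sect b (Suc j) (\<lambda>y. \<theta> (\<kappa> y))"
    "\<And>y. y \<in> ball 2 (4/5) \<Longrightarrow> \<kappa> y \<in> ball 2 (4/5) \<and> norm ((\<kappa> y)\<^sup>2 - 2 - y) \<le> b + 1/10000"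
proof -
  let ?B = "ball (2::complex) (4/5)"
  obtain \<kappa> where \<kappa>: "\<kappa> holomorphic_on ball 2 (63/25 - 3 * b)"
    "\<And>y. y \<in> ball 2 (63/25 - 3 * b) \<Longrightarrow> \<kappa> y \<in> ball 2 (4/5) \<and> (qm (\<psi> (\<theta> (\<kappa> y))) ^^ Suc j) 0 = y \<and>
        norm ((\<kappa> y)\<^sup>2 - 2 - y) \<le> b + 1/10000"
    "\<And>y y'. y \<in> ball 2 (63/25 - 3 * b) \<Longrightarrow> y' \<in> ball 2 (63/25 - 3 * b) \<Longrightarrow> norm (\<kappa> y - \<kappa> y') \<le> norm (y - y')"
    using section_extend[OF s b] by blast
  have sub: "?B \<subseteq> ball 2 (63/25 - 3 * b)" using b by (intro subset_ball) simp
  have kB: "\<kappa> y \<in> ?B" if "y \<in> ?B" for y using \<kappa>(2) sub that by blast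
  have \<theta>: "\<theta> holomorphic_on ?B" "\<And>y. y \<in> ?B \<Longrightarrow> norm (\<theta> y + 2) \<le> b"
    "\<And>y i. y \<in> ?B \<Longrightarrow> 2 \<le> i \<Longrightarrow> i \<le> j \<Longrightarrow> norm ((qm (\<psi> (\<theta> y)) ^^ i) 0 - 2) < 4/5"
    "\<And>y y'. y \<in> ?B \<Longrightarrow> y' \<in> ?B \<Longrightarrow> norm (\<theta> y - \<theta> y') \<le> (1/2) * norm (y - y')"
    using s by (auto simp: sect_def)
  have "sect b (Suc j) (\<lambda>y. \<theta> (\<kappa> y))"
    unfolding sect_def
  proof (intro conjI ballI allI impI)
    show "(\<lambda>y. \<theta> (\<kappa> y)) holomorphic_on ?B"
      by (rule holomorphic_on_compose_gen[OF holomorphic_on_subset[OF \<kappa>(1) sub] \<theta>(1), unfolded o_def]) (use kB in blast)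
  next
    fix y assume y: "y \<in> ?B"
    show "norm (\<theta> (\<kappa> y) + 2) \<le> b" by (rule \<theta>(2)[OF kB[OF y]])
    show e: "(qm (\<psi> (\<theta> (\<kappa> y))) ^^ Suc j) 0 = y" using \<kappa>(2) y sub by blast
    fix i assume i: "2 \<le> i" "i \<le> Suc j"
    show "norm ((qm (\<psi> (\<theta> (\<kappa> y))) ^^ i) 0 - 2) < 4/5"
    proof (cases "i = Suc j")
      case True show ?thesis unfolding True e using y by (simp add: dist_norm norm_minus_commute)
    next
      case False thus ?thesis using i by (intro \<theta>(3)[OF kB[OF y]]) auto
    qed
  next
    fix y y' assume y: "y \<in> ?B" "y' \<in> ?B"
    have "norm (\<theta> (\<kappa> y) - \<theta> (\<kappa> y')) \<le> (1/2) * norm (\<kappa> y - \<kappa> y')" by (rule \<theta>(4)[OF kB[OF y(1)] kB[OF y(2)]])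
    also have "\<dots> \<le> (1/2) * norm (y - y')" using \<kappa>(3)[OF subsetD[OF sub y(1)] subsetD[OF sub y(2)]] by (intro mult_left_mono) auto
    finally show "norm (\<theta> (\<kappa> y) - \<theta> (\<kappa> y')) \<le> (1/2) * norm (y - y')" .
  qed
  moreover have "\<kappa> y \<in> ?B \<and> norm ((\<kappa> y)\<^sup>2 - 2 - y) \<le> b + 1/10000" if "y \<in> ?B" for y using \<kappa>(2) sub that by blast
  ultimately show ?thesis by (rule that)
qed

text \<open>With \<open>b = 8/25\<close> the disc of \<open>section_extend\<close> has radius 39/25
  and does not reach 0. After one more step the values of \<open>\<kappa>\<close> lie within 36/100
  of 2, which improves the parameter bound of \<open>section_2\<close> to 3/20.\<close>

lemma section_3: "\<exists>\<theta>. sect (3/20) 3 \<theta>"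
proof -
  let ?B = "ball (2::complex) (4/5)"
  obtain \<theta> where \<theta>: "sect (8/25) 2 \<theta>" "\<And>y. y \<in> ?B \<Longrightarrow> norm (\<theta> y + 2) \<le> (2/5) * norm (y - 2) + 1/1000"
    using section_2 by blast
  obtain \<kappa> where s: "sect (8/25) (Suc 2) (\<lambda>y. \<theta> (\<kappa> y))"
    and \<kappa>: "\<And>y. y \<in> ?B \<Longrightarrow> \<kappa> y \<in> ?B \<and> norm ((\<kappa> y)\<^sup>2 - 2 - y) \<le> 8/25 + 1/10000"
    using section_Suc[OF \<theta>(1)] by auto
  have "norm (\<theta> (\<kappa> y) + 2) \<le> 3/20" if y: "y \<in> ?B" for y
  proof -
    have k: "\<kappa> y \<in> ?B" "norm ((\<kappa> y)\<^sup>2 - 2 - y) \<le> 8/25 + 1/10000" using \<kappa>[OF y] by auto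
    let ?k = "\<kappa> y"
    have k1: "norm (?k - 2) < 4/5" using k by (simp add: dist_norm norm_minus_commute)
    have y1: "norm (y - 2) < 4/5" using y by (simp add: dist_norm norm_minus_commute)
    have "norm (?k + 2) \<ge> 16/5" using k1 norm_triangle_ineq4[of "?k - 2" "?k + 2"] by simp
    hence "norm (?k - 2) * (16/5) \<le> norm (?k - 2) * norm (?k + 2)" by (intro mult_left_mono) auto
    also have "\<dots> = norm ((?k\<^sup>2 - 2 - y) + (y - 2))" by (simp add: power2_eq_square algebra_simps flip: norm_mult)
    also have "\<dots> \<le> 8/25 + 1/10000 + 4/5" using k(2) y1 norm_triangle_ineq[of "?k\<^sup>2 - 2 - y" "y - 2"] by linarith
    finally have "norm (?k - 2) \<le> 36/100" by simp
    thus ?thesis using \<theta>(2)[OF k(1)] by simp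
  qed
  hence "sect (3/20) 3 (\<lambda>y. \<theta> (\<kappa> y))" using s unfolding sect_def by (simp add: eval_nat_numeral)
  thus ?thesis by blast
qed

lemma section_ge_3: "3 \<le> j \<Longrightarrow> \<exists>\<theta>. sect (3/20) j \<theta>"
proof (induction j rule: nat_induct_at_least)
  case base show ?case by (rule section_3)
next
  case (Suc j)
  then obtain \<theta> where "sect (3/20) j \<theta>" by blast
  then obtain \<kappa> where "sect (3/20) (Suc j) (\<lambda>y. \<theta> (\<kappa> y))" by (rule section_Suc) auto
  thus ?case by blast
qed

text \<open>At time \<open>m\<close> the full disc of \<open>section_extend\<close> is used, so the
  last orbit point can be prescribed near 0 in place of near 2.\<close>

lemma section_0:
  assumes m: "4 \<le> m"
  obtains \<theta> where "\<theta> holomorphic_on ball 0 (1/20)"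
    "\<And>y. y \<in> ball 0 (1/20) \<Longrightarrow> norm (\<theta> y + 2) \<le> 3/20 \<and> (qm (\<psi> (\<theta> y)) ^^ m) 0 = y"
    "\<And>y i. y \<in> ball 0 (1/20) \<Longrightarrow> 2 \<le> i \<Longrightarrow> i < m \<Longrightarrow> norm ((qm (\<psi> (\<theta> y)) ^^ i) 0 - 2) < 4/5"
proof -
  obtain \<theta> where s: "sect (3/20) (m - 1) \<theta>" using section_ge_3[of "m - 1"] m by fastforce
  obtain \<kappa> where \<kappa>: "\<kappa> holomorphic_on ball 2 (63/25 - 3 * (3/20))"
    "\<And>y. y \<in> ball 2 (63/25 - 3 * (3/20)) \<Longrightarrow> \<kappa> y \<in> ball 2 (4/5) \<and> (qm (\<psi> (\<theta> (\<kappa> y))) ^^ Suc (m - 1)) 0 = y"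
  proof (rule section_extend[OF s])
    fix \<kappa> assume "\<kappa> holomorphic_on ball 2 (63/25 - 3 * (3/20))"
      and "\<And>y. y \<in> ball 2 (63/25 - 3 * (3/20)) \<Longrightarrow> \<kappa> y \<in> ball 2 (4/5) \<and> (qm (\<psi> (\<theta> (\<kappa> y))) ^^ Suc (m - 1)) 0 = y \<and>
        norm ((\<kappa> y)\<^sup>2 - 2 - y) \<le> 3/20 + 1/10000"
    thus thesis using that by blast
  qed auto
  have sub: "ball 0 (1/20) \<subseteq> ball (2::complex) (63/25 - 3 * (3/20))"
  proof
    fix y :: complex assume "y \<in> ball 0 (1/20)"
    thus "y \<in> ball 2 (63/25 - 3 * (3/20))" using norm_triangle_ineq4[of 2 y] by (simp add: dist_norm)
  qed
  have kB: "\<kappa> y \<in> ball 2 (4/5)" "(qm (\<psi> (\<theta> (\<kappa> y))) ^^ m) 0 = y" if "y \<in> ball 0 (1/20)" for y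
  proof -
    have "Suc (m - 1) = m" using m by simp
    thus "\<kappa> y \<in> ball 2 (4/5)" "(qm (\<psi> (\<theta> (\<kappa> y))) ^^ m) 0 = y" using \<kappa>(2)[of y] that sub by (simp_all only: subset_iff)
  qed
  have \<theta>: "\<theta> holomorphic_on ball 2 (4/5)" "\<And>y. y \<in> ball 2 (4/5) \<Longrightarrow> norm (\<theta> y + 2) \<le> 3/20"
    "\<And>y i. y \<in> ball 2 (4/5) \<Longrightarrow> 2 \<le> i \<Longrightarrow> i \<le> m - 1 \<Longrightarrow> norm ((qm (\<psi> (\<theta> y)) ^^ i) 0 - 2) < 4/5"
    using s by (auto simp: sect_def)
  show ?thesis
  proof (rule that[of "\<lambda>y. \<theta> (\<kappa> y)"])
    show "(\<lambda>y. \<theta> (\<kappa> y)) holomorphic_on ball 0 (1/20)"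
      by (rule holomorphic_on_compose_gen[OF holomorphic_on_subset[OF \<kappa>(1) sub] \<theta>(1), unfolded o_def]) (use kB(1) in blast)
    show "norm (\<theta> (\<kappa> y) + 2) \<le> 3/20 \<and> (qm (\<psi> (\<theta> (\<kappa> y))) ^^ m) 0 = y" if "y \<in> ball 0 (1/20)" for y
      using \<theta>(2)[OF kB(1)[OF that]] kB(2)[OF that] by simp
    show "norm ((qm (\<psi> (\<theta> (\<kappa> y))) ^^ i) 0 - 2) < 4/5" if "y \<in> ball 0 (1/20)" "2 \<le> i" "i < m" for y i
      using that by (intro \<theta>(3)[OF kB(1)]) auto
  qed
qed


section \<open>The renormalized family\<close>

lemma multiplier_lower:
  assumes t: "norm (t + 2) \<le> 3/20" and m: "2 \<le> m"
    and orb: "\<And>i. 2 \<le> i \<Longrightarrow> i < m \<Longrightarrow> norm ((qm (\<psi> t) ^^ i) 0 - 2) < 4/5"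
  shows "2 ^ (m - 2) \<le> norm (deriv (qm (\<psi> t) ^^ (m - 1)) (\<psi> t 0) * deriv (\<psi> t) 0)"
proof -
  have tD: "t \<in> pdisc" using t by (simp add: pdisc_iff)
  interpret nq "\<psi> t" t by (rule nq[OF tD])
  have f: "2 \<le> norm (deriv f ((f ^^ i) (\<psi> t 0)))" if i: "i < m - 1" for i
  proof -
    have e: "(f ^^ i) (\<psi> t 0) = (f ^^ Suc i) 0" unfolding funpow_Suc_right o_apply by (simp add: qm_def)
    have "6/5 \<le> norm ((f ^^ Suc i) 0) \<and> norm ((f ^^ Suc i) 0) \<le> 4"
    proof (cases "i = 0")
      case True
      have "(f ^^ Suc i) 0 = \<psi> t 0" using True by (simp add: qm_def)
      thus ?thesis using a1_close[OF tD] t a1_norm[OF tD] norm_triangle_ineq4[of "(\<psi> t 0 - t) + (t + 2)" "\<psi> t 0"]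
        norm_triangle_ineq[of "\<psi> t 0 - t" "t + 2"] by simp
    next
      case False
      have "norm ((f ^^ Suc i) 0 - 2) < 4/5" using False i by (intro orb) auto
      thus ?thesis using norm_triangle_ineq4[of "(f ^^ Suc i) 0 - 2" "(f ^^ Suc i) 0"]
        norm_triangle_ineq[of "(f ^^ Suc i) 0 - 2" 2] by simp
    qed
    thus ?thesis unfolding e using f_deriv_lower[of "(f ^^ Suc i) 0"] by linarith
  qed
  have "(\<Prod>i<m - 1. 2) \<le> (\<Prod>i<m - 1. norm (deriv f ((f ^^ i) (\<psi> t 0))))"
    using f by (intro prod_mono) auto
  hence 1: "2 ^ (m - 1) \<le> norm (deriv (f ^^ (m - 1)) (\<psi> t 0))" by (simp add: deriv_funpow[OF f_hol] prod_norm)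
  have 2: "1/2 \<le> norm (deriv (\<psi> t) 0)" using deriv_close[of 0] norm_triangle_ineq2[of 1 "deriv (\<psi> t) 0"]
    by (simp add: norm_minus_commute)
  have "2 ^ (m - 1) * (1/2) \<le> norm (deriv (f ^^ (m - 1)) (\<psi> t 0)) * norm (deriv (\<psi> t) 0)"
    by (intro mult_mono 1 2) auto
  moreover have "(2::real) ^ (m - 1) * (1/2) = 2 ^ (m - 2)"
  proof -
    have "m - 1 = Suc (m - 2)" using m by simp
    thus ?thesis by simp
  qed
  ultimately show ?thesis by (simp add: norm_mult)
qed

lemma deriv_iter_psi:
  assumes "t \<in> pdisc"
  shows "deriv (\<lambda>w. (qm (\<psi> t) ^^ k) (\<psi> t w)) x = deriv (qm (\<psi> t) ^^ k) (\<psi> t x) * deriv (\<psi> t) x"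
proof -
  interpret nq "\<psi> t" t by (rule nq[OF assms])
  show ?thesis
    using deriv_chain[of "\<psi> t" x "f ^^ k", OF hol_UNIV_diff[OF hol] hol_UNIV_diff[OF hol_funpow[OF f_hol]]]
    by (simp add: o_def)
qed

text \<open>At 0 the renormalized map takes the value \<open>a m / lam = s\<close>. So the new
  family is again parametrized by its own translation part, which allows the construction to be
  iterated.\<close>

lemma good_next:
  assumes \<tau>: "\<tau> holomorphic_on pdisc" "\<tau> ` pdisc \<subseteq> pdisc" and lam: "lam holomorphic_on pdisc"
    and step: "\<And>s. s \<in> pdisc \<Longrightarrow> step (\<psi> (\<tau> s)) (\<tau> s) m (lam s)"
    and ams: "\<And>s. s \<in> pdisc \<Longrightarrow> (qm (\<psi> (\<tau> s)) ^^ m) 0 = s * lam s"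
  shows "good_family (\<lambda>s w. (qm (\<psi> (\<tau> s)) ^^ (m - 1)) (\<psi> (\<tau> s) ((lam s)\<^sup>2 * w)) / lam s)"
  unfolding good_family_def
proof (intro conjI ballI allI impI)
  fix s assume s: "s \<in> pdisc"
  interpret step "\<psi> (\<tau> s)" "\<tau> s" m "lam s" by (rule step[OF s])
  have e: "(\<lambda>w. (qm (\<psi> (\<tau> s)) ^^ (m - 1)) (\<psi> (\<tau> s) ((lam s)\<^sup>2 * w)) / lam s) = nxt" by (simp add: nxt_def[abs_def])
  show "(\<lambda>w. (qm (\<psi> (\<tau> s)) ^^ (m - 1)) (\<psi> (\<tau> s) ((lam s)\<^sup>2 * w)) / lam s) holomorphic_on UNIV"
    unfolding e by (rule nxt_hol)
  have n0: "nxt 0 = s" using ams[OF s] lam0 by (simp add: nxt_0)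
  show "norm ((qm (\<psi> (\<tau> s)) ^^ (m - 1)) (\<psi> (\<tau> s) ((lam s)\<^sup>2 * w)) / lam s - (w + s)) \<le> 1/10000" if "norm w < 25" for w
    using nxt_near[OF that] unfolding n0 nxt_def[symmetric] by (simp add: add.commute)
next
  fix S \<sigma> u assume S: "open S" "\<sigma> holomorphic_on S" "u holomorphic_on S" "\<sigma> ` S \<subseteq> pdisc"
  have T: "(\<lambda>x. \<tau> (\<sigma> x)) holomorphic_on S"
    by (rule holomorphic_on_compose_gen[OF S(2) \<tau>(1) S(4), unfolded o_def])
  have L: "(\<lambda>x. lam (\<sigma> x)) holomorphic_on S"
    by (rule holomorphic_on_compose_gen[OF S(2) lam S(4), unfolded o_def])
  have TD: "(\<lambda>x. \<tau> (\<sigma> x)) ` S \<subseteq> pdisc" using S(4) \<tau>(2) by blast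
  have v: "(\<lambda>x. (lam (\<sigma> x))\<^sup>2 * u x) holomorphic_on S" by (intro holomorphic_on_mult holomorphic_on_power L S)
  have w: "(\<lambda>x. \<psi> (\<tau> (\<sigma> x)) ((lam (\<sigma> x))\<^sup>2 * u x)) holomorphic_on S" by (rule comp(1)[OF S(1) T v TD])
  have l0: "lam (\<sigma> x) \<noteq> 0" if "x \<in> S" for x
    using step.lam0[OF step] S(4) that by blast
  show "(\<lambda>x. (qm (\<psi> (\<tau> (\<sigma> x))) ^^ (m - 1)) (\<psi> (\<tau> (\<sigma> x)) ((lam (\<sigma> x))\<^sup>2 * u x)) / lam (\<sigma> x)) holomorphic_on S"
    by (rule holomorphic_on_divide[OF iter_comp[OF S(1) T w TD] L l0])
  have h: "(\<lambda>x. deriv (qm (\<psi> (\<tau> (\<sigma> x))) ^^ (m - 1)) (\<psi> (\<tau> (\<sigma> x)) ((lam (\<sigma> x))\<^sup>2 * u x)) *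
        deriv (\<psi> (\<tau> (\<sigma> x))) ((lam (\<sigma> x))\<^sup>2 * u x) * lam (\<sigma> x)) holomorphic_on S"
    by (intro holomorphic_on_mult deriv_iter_comp[OF S(1) T w TD] comp(2)[OF S(1) T v TD] L)
  show "(\<lambda>x. deriv (\<lambda>w. (qm (\<psi> (\<tau> (\<sigma> x))) ^^ (m - 1)) (\<psi> (\<tau> (\<sigma> x)) ((lam (\<sigma> x))\<^sup>2 * w)) / lam (\<sigma> x)) (u x)) holomorphic_on S"
  proof (rule holomorphic_transform[OF h])
    fix x assume x: "x \<in> S"
    let ?t = "\<tau> (\<sigma> x)" and ?l = "lam (\<sigma> x)"
    have tD: "?t \<in> pdisc" using TD x by blast
    interpret nq "\<psi> ?t" ?t by (rule nq[OF tD])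
    let ?P = "\<lambda>w. (f ^^ (m - 1)) (\<psi> ?t w)"
    have "?P holomorphic_on UNIV"
      using holomorphic_on_compose[OF hol holomorphic_on_subset[OF hol_funpow[OF f_hol]]] by (simp add: o_def)
    hence "(?P has_field_derivative deriv ?P (?l\<^sup>2 * u x)) (at (?l\<^sup>2 * u x))" by (simp add: holomorphic_derivI)
    hence "((\<lambda>w. ?P (?l\<^sup>2 * w)) has_field_derivative deriv ?P (?l\<^sup>2 * u x) * ?l\<^sup>2) (at (u x))"
      by (rule DERIV_chain2) (auto intro!: derivative_eq_intros)
    hence "((\<lambda>w. ?P (?l\<^sup>2 * w) / ?l) has_field_derivative deriv ?P (?l\<^sup>2 * u x) * ?l\<^sup>2 / ?l) (at (u x))"
      by (rule DERIV_cdivide)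
    hence "deriv (\<lambda>w. ?P (?l\<^sup>2 * w) / ?l) (u x) = deriv ?P (?l\<^sup>2 * u x) * ?l\<^sup>2 / ?l" by (rule DERIV_imp_deriv)
    also have "\<dots> = deriv ?P (?l\<^sup>2 * u x) * ?l" using l0[OF x] by (simp add: power2_eq_square)
    also have "\<dots> = deriv (f ^^ (m - 1)) (\<psi> ?t (?l\<^sup>2 * u x)) * deriv (\<psi> ?t) (?l\<^sup>2 * u x) * ?l"
      unfolding deriv_iter_psi[OF tD] ..
    finally show "deriv (f ^^ (m - 1)) (\<psi> ?t (?l\<^sup>2 * u x)) * deriv (\<psi> ?t) (?l\<^sup>2 * u x) * ?l
        = deriv (\<lambda>w. ?P (?l\<^sup>2 * w) / ?l) (u x)" by (rule sym)
  qed
qed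

text \<open>The return value \<open>y\<close> must be \<open>s\<close> times the scale, and the
  scale \<open>l y = 1 / M y\<close> itself depends on \<open>y\<close>. The equation
  \<open>y = s * l y\<close> is a contraction, since \<open>l\<close> is tiny together with its
  derivative. The solution is holomorphic in \<open>s\<close> because it inverts the injective
  holomorphic map \<open>y * M y\<close>.\<close>

lemma renormalization_parameters:
  assumes m: "600 \<le> m"
  obtains \<tau> lam where "\<tau> holomorphic_on pdisc" "lam holomorphic_on pdisc"
    "\<And>s. s \<in> pdisc \<Longrightarrow> norm (\<tau> s + 2) \<le> 3/20"
    "\<And>s. s \<in> pdisc \<Longrightarrow> step (\<psi> (\<tau> s)) (\<tau> s) m (lam s)"
    "\<And>s. s \<in> pdisc \<Longrightarrow> (qm (\<psi> (\<tau> s)) ^^ m) 0 = s * lam s"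
proof -
  let ?B = "ball (0::complex) (1/20)"
  have m4: "4 \<le> m" using m by simp
  obtain \<theta> where \<theta>: "\<theta> holomorphic_on ?B"
    "\<And>y. y \<in> ?B \<Longrightarrow> norm (\<theta> y + 2) \<le> 3/20 \<and> (qm (\<psi> (\<theta> y)) ^^ m) 0 = y"
    "\<And>y i. y \<in> ?B \<Longrightarrow> 2 \<le> i \<Longrightarrow> i < m \<Longrightarrow> norm ((qm (\<psi> (\<theta> y)) ^^ i) 0 - 2) < 4/5"
    using section_0[OF m4] by blast
  have \<theta>D: "\<theta> y \<in> pdisc" if "y \<in> ?B" for y using \<theta>(2)[OF that] by (simp add: pdisc_iff)
  hence \<theta>D': "\<theta> ` ?B \<subseteq> pdisc" by blast
  define M where "M = (\<lambda>y. deriv (qm (\<psi> (\<theta> y)) ^^ (m - 1)) (\<psi> (\<theta> y) 0) * deriv (\<psi> (\<theta> y)) 0)"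
  have c0: "(\<lambda>_. 0::complex) holomorphic_on ?B" by (rule holomorphic_on_const)
  have Mhol: "M holomorphic_on ?B" unfolding M_def
    by (intro holomorphic_on_mult deriv_iter_comp[OF open_ball \<theta>(1) comp(1)[OF open_ball \<theta>(1) c0 \<theta>D'] \<theta>D']
      comp(2)[OF open_ball \<theta>(1) c0 \<theta>D'])
  have Mlow: "2 ^ (m - 2) \<le> norm (M y)" if "y \<in> ?B" for y
    unfolding M_def using \<theta>(2)[OF that] \<theta>(3)[OF that] m by (intro multiplier_lower) auto
  have M0: "M y \<noteq> 0" if "y \<in> ?B" for y
  proof -
    have "(0::real) < 2 ^ (m - 2)" by simp
    thus ?thesis using Mlow[OF that] by (metis norm_zero not_le)
  qed
  define \<eta> where "\<eta> = (1/2::real) ^ (m - 2)"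
  define l where "l = (\<lambda>y. 1 / M y)"
  have lhol: "l holomorphic_on ?B" unfolding l_def by (intro holomorphic_on_divide holomorphic_on_const Mhol M0)
  have lle: "norm (l y) \<le> \<eta>" if "y \<in> ?B" for y
    using Mlow[OF that] unfolding l_def \<eta>_def by (simp add: norm_divide power_divide divide_simps)
  have \<eta>0: "0 < \<eta>" by (simp add: \<eta>_def)
  \<comment> \<open>\<open>(1/2)^14 <= 1/10^4\<close> and \<open>14 * 36 = 504\<close>, well below
    \<open>m - 2\<close>; this is what the bound 600 is for.\<close>
  have \<eta>s: "\<eta> \<le> (1/10^4)^36"
  proof -
    have "\<eta> \<le> (1/2) ^ (14 * 36)" unfolding \<eta>_def using m by (intro power_decreasing) auto
    also have "\<dots> = ((1/2) ^ 14) ^ 36" by (rule power_mult)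
    also have "\<dots> \<le> (1/10^4)^36" by (rule power_mono) (auto simp: power_divide)
    finally show ?thesis .
  qed
  have \<eta>8: "\<eta> \<le> 1/10^8"
  proof -
    have "(1/10^4::real)^36 \<le> (1/10^4)^2" by (rule power_decreasing) auto
    thus ?thesis using \<eta>s by (simp add: power2_eq_square)
  qed
  let ?C = "cball (0::complex) (1/40)"
  have CB: "?C \<subseteq> ?B" by auto
  have llip: "norm (l x - l y) \<le> (50 * \<eta>) * norm (x - y)" if xy: "x \<in> ?C" "y \<in> ?C" for x y
  proof (rule field_differentiable_bound[where f = l and f' = "deriv l" and S = ?C])
    fix z assume z: "z \<in> ?C"
    show "(l has_field_derivative deriv l z) (at z within ?C)"
      using holomorphic_derivI[OF lhol] CB z by (auto intro: has_field_derivative_at_within)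
    have zb: "ball z (1/40) \<subseteq> ?B"
    proof
      fix x assume "x \<in> ball z (1/40)"
      thus "x \<in> ?B" using z norm_triangle_ineq[of "x - z" z] by (simp add: dist_norm norm_minus_commute)
    qed
    have "norm (deriv l z) \<le> \<eta> / (1/50)"
    proof (rule deriv_norm_bound)
      show "l holomorphic_on ball z (1/40)" by (rule holomorphic_on_subset[OF lhol zb])
      show "norm (l x) \<le> \<eta>" if "x \<in> ball z (1/40)" for x using that zb by (intro lle) blast
    qed auto
    thus "norm (deriv l z) \<le> 50 * \<eta>" by simp
  qed (use xy convex_cball in blast)+
  have sn: "norm s \<le> 3" if "s \<in> pdisc" for s using pdisc_norm[OF that] by simp
  have contr: "norm (s * l x - s * l y) \<le> (1/2) * norm (x - y)" if "s \<in> pdisc" "x \<in> ?C" "y \<in> ?C" for s x y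
  proof -
    have "norm (s * l x - s * l y) = norm s * norm (l x - l y)" by (simp add: right_diff_distrib flip: norm_mult)
    also have "\<dots> \<le> 3 * ((50 * \<eta>) * norm (x - y))" using sn[OF that(1)] llip[OF that(2,3)] by (intro mult_mono) auto
    also have "\<dots> = (150 * \<eta>) * norm (x - y)" by simp
    also have "\<dots> \<le> (1/2) * norm (x - y)" using \<eta>8 by (intro mult_right_mono) auto
    finally show ?thesis .
  qed
  define H where "H = (\<lambda>y. y * M y)"
  have Hl: "H y = s \<longleftrightarrow> y = s * l y" if "y \<in> ?B" for y s
    using M0[OF that] unfolding H_def l_def by (simp add: field_simps)
  define W where "W = {y \<in> ball 0 (1/40). H y \<in> pdisc}"
  have WC: "W \<subseteq> ?C" "W \<subseteq> ?B" by (auto simp: W_def)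
  have Hhol: "H holomorphic_on ?B" unfolding H_def by (intro holomorphic_on_mult holomorphic_on_ident Mhol)
  have Wo: "open W"
  proof -
    have "continuous_on (ball 0 (1/40)) H"
      by (rule holomorphic_on_imp_continuous_on[OF holomorphic_on_subset[OF Hhol]]) auto
    hence "open (ball 0 (1/40) \<inter> H -` pdisc)" by (rule continuous_open_preimage) (auto simp: pdisc_def)
    moreover have "ball 0 (1/40) \<inter> H -` pdisc = W" by (auto simp: W_def)
    ultimately show ?thesis by simp
  qed
  have Hinj: "inj_on H W"
  proof (rule inj_onI)
    fix x y assume xy: "x \<in> W" "y \<in> W" "H x = H y"
    have sD: "H x \<in> pdisc" using xy by (simp add: W_def)
    have e: "x = H x * l x" "y = H x * l y" using Hl[of x "H x"] Hl[of y "H x"] xy WC by auto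
    have "norm (x - y) = norm (H x * l x - H x * l y)" using e by simp
    also have "\<dots> \<le> (1/2) * norm (x - y)" using xy WC by (intro contr[OF sD]) auto
    finally show "x = y" by simp
  qed
  have Hcov: "\<exists>y\<in>W. H y = s" if s: "s \<in> pdisc" for s
  proof -
    have small: "norm (s * l y) < 1/40" if y: "y \<in> ?C" for y
    proof -
      have "norm (s * l y) \<le> 3 * \<eta>" unfolding norm_mult using sn[OF s] lle[of y] y CB by (intro mult_mono) auto
      also have "\<dots> < 1/40" using \<eta>8 by simp
      finally show ?thesis .
    qed
    have "\<exists>!y. y \<in> ?C \<and> s * l y = y"
    proof (rule Banach_fix[of ?C "1/2"])
      show "(\<lambda>y. s * l y) ` ?C \<subseteq> ?C" using small by (force simp: less_imp_le)
      show "dist (s * l x) (s * l y) \<le> (1/2) * dist x y" if "x \<in> ?C" "y \<in> ?C" for x y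
        using contr[OF s that] by (simp add: dist_norm)
    qed (auto intro: compact_imp_complete)
    then obtain y where y: "y \<in> ?C" "s * l y = y" by blast
    have "norm y < 1/40" using small[OF y(1)] y(2) by simp
    moreover have "H y = s" using Hl[of y s] y CB by auto
    ultimately show ?thesis using s by (intro bexI[of _ y]) (auto simp: W_def)
  qed
  obtain Y where Y: "Y holomorphic_on H ` W" "\<And>y. y \<in> W \<Longrightarrow> Y (H y) = y"
    by (rule holomorphic_has_inverse[OF holomorphic_on_subset[OF Hhol WC(2)] Wo Hinj]) (rule that)
  have HW: "H ` W = pdisc" using Hcov by (auto simp: W_def)
  have YW: "Y s \<in> ?B \<and> H (Y s) = s" if s: "s \<in> pdisc" for s
  proof -
    obtain y where "y \<in> W" "H y = s" using Hcov[OF s] by blast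
    thus ?thesis using Y(2)[of y] WC(2) by auto
  qed
  have YB: "Y ` pdisc \<subseteq> ?B" using YW by blast
  have Yhol: "Y holomorphic_on pdisc" using Y(1) HW by simp
  show ?thesis
  proof (rule that[of "\<lambda>s. \<theta> (Y s)" "\<lambda>s. l (Y s)"])
    show "(\<lambda>s. \<theta> (Y s)) holomorphic_on pdisc" by (rule holomorphic_on_compose_gen[OF Yhol \<theta>(1) YB, unfolded o_def])
    show "(\<lambda>s. l (Y s)) holomorphic_on pdisc" by (rule holomorphic_on_compose_gen[OF Yhol lhol YB, unfolded o_def])
    fix s assume s: "s \<in> pdisc"
    have y: "Y s \<in> ?B" "H (Y s) = s" using YW[OF s] by auto
    show "norm (\<theta> (Y s) + 2) \<le> 3/20" using \<theta>(2)[OF y(1)] by blast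
    have a: "(qm (\<psi> (\<theta> (Y s))) ^^ m) 0 = Y s" using \<theta>(2)[OF y(1)] by blast
    have Ys: "Y s = s * l (Y s)" using Hl[OF y(1)] y(2) by blast
    show am: "(qm (\<psi> (\<theta> (Y s))) ^^ m) 0 = s * l (Y s)" unfolding a by (rule Ys)
    interpret nq "\<psi> (\<theta> (Y s))" "\<theta> (Y s)" by (rule nq[OF \<theta>D[OF y(1)]])
    show "step (\<psi> (\<theta> (Y s))) (\<theta> (Y s)) m (l (Y s))"
    proof
      show "2 < m" using m by simp
      show "norm ((f ^^ j) 0 - 2) < 4/5" if "2 \<le> j" "j < m" for j by (rule \<theta>(3)[OF y(1) that])
      show "l (Y s) \<noteq> 0" using M0[OF y(1)] by (simp add: l_def)
      show "norm (l (Y s)) \<le> (1/10^4)^36" using lle[OF y(1)] \<eta>s by (rule order_trans)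
      show "l (Y s) * deriv (\<lambda>w. (f ^^ (m - 1)) (\<psi> (\<theta> (Y s)) w)) 0 = 1"
        unfolding deriv_iter_psi[OF \<theta>D[OF y(1)]] using M0[OF y(1)] by (simp add: l_def M_def)
      show "norm ((f ^^ m) 0) \<le> 3 * norm (l (Y s))"
        unfolding am norm_mult using sn[OF s] by (intro mult_right_mono) auto
    qed
  qed
qed

end

lemma good_base: "good_family (\<lambda>t w. w + t)"
  unfolding good_family_def
proof (intro conjI ballI allI impI)
  fix S :: "complex set" and \<tau> u :: "complex \<Rightarrow> complex"
  assume "\<tau> holomorphic_on S" "u holomorphic_on S"
  thus "(\<lambda>s. u s + \<tau> s) holomorphic_on S" by (intro holomorphic_on_add)
  have "deriv (\<lambda>w. w + \<tau> s) x = 1" for s x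
    by (rule DERIV_imp_deriv) (auto intro!: derivative_eq_intros)
  thus "(\<lambda>s. deriv (\<lambda>w. w + \<tau> s) (u s)) holomorphic_on S" by simp
qed (auto intro!: holomorphic_intros)

text \<open>\<open>E k n\<close> is the image of \<open>C\<close> under \<open>k\<close> consecutive
  maps starting at level \<open>n\<close>. Compactness gives a point in all \<open>E k 0\<close>;
  injectivity makes its preimages for different depths coincide, so the preimage lies in all the
  sets of the next level and the choice can go on.\<close>

lemma inverse_limit_point:
  fixes \<tau> :: "nat \<Rightarrow> complex \<Rightarrow> complex"
  assumes C: "compact C" "C \<noteq> {}" and cont: "\<And>n. continuous_on C (\<tau> n)" and im: "\<And>n. \<tau> n ` C \<subseteq> C"
    and inj: "\<And>n. inj_on (\<tau> n) C"
  obtains x where "\<And>n. x n \<in> C" "\<And>n. \<tau> n (x (Suc n)) = x n"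
proof -
  define E where "E = rec_nat (\<lambda>n::nat. C) (\<lambda>k E n. \<tau> n ` E (Suc n))"
  have E0: "E 0 n = C" and ES: "E (Suc k) n = \<tau> n ` E k (Suc n)" for k n by (simp_all add: E_def)
  have E: "compact (E k n) \<and> E k n \<noteq> {} \<and> E k n \<subseteq> C" for k n
  proof (induction k arbitrary: n)
    case 0 thus ?case using C by (simp add: E0)
  next
    case (Suc k)
    have "compact (\<tau> n ` E k (Suc n))"
      by (rule compact_continuous_image[OF continuous_on_subset[OF cont]]) (use Suc[of "Suc n"] in auto)
    moreover have "\<tau> n ` E k (Suc n) \<subseteq> C" using Suc[of "Suc n"] im[of n] by blast
    ultimately show ?case unfolding ES using Suc[of "Suc n"] by blast
  qed
  have dec: "E (Suc k) n \<subseteq> E k n" for k n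
  proof (induction k arbitrary: n)
    case 0 show ?case unfolding ES E0 by (rule im)
  next
    case (Suc k)
    show ?case unfolding ES[of k n] ES[of "Suc k" n] by (rule image_mono[OF Suc])
  qed
  have "\<Inter> (range (\<lambda>k. E k 0)) \<noteq> {}"
  proof (rule compact_nest)
    show "compact (E k 0)" "E k 0 \<noteq> {}" for k using E[of k 0] by auto
    show "E k 0 \<subseteq> E j 0" if "j \<le> k" for j k using lift_Suc_antimono_le[of "\<lambda>k. E k 0", OF dec that] .
  qed
  then obtain x0 where x0: "\<And>k. x0 \<in> E k 0" by blast
  have ex: "\<exists>y. (\<forall>k. y \<in> E k (Suc n)) \<and> \<tau> n y = x" if x: "\<forall>k. x \<in> E k n" for x n
  proof -
    have "\<exists>y. y \<in> E k (Suc n) \<and> \<tau> n y = x" for k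
    proof -
      have "x \<in> \<tau> n ` E k (Suc n)" using x ES[of k n] by blast
      thus ?thesis by blast
    qed
    then obtain y where y: "\<And>k. y k \<in> E k (Suc n)" "\<And>k. \<tau> n (y k) = x" by metis
    have "y k = y 0" for k
    proof (rule inj_onD[OF inj[of n]])
      show "\<tau> n (y k) = \<tau> n (y 0)" by (simp only: y(2))
      show "y k \<in> C" "y 0 \<in> C" using y(1) E by blast+
    qed
    hence "\<forall>k. y 0 \<in> E k (Suc n)" using y(1) by metis
    thus ?thesis using y(2) by blast
  qed
  have "\<exists>x. \<forall>n. (\<forall>k. x n \<in> E k n) \<and> \<tau> n (x (Suc n)) = x n"
  proof (rule dependent_nat_choice)
    show "\<exists>x. \<forall>k. x \<in> E k 0" using x0 by blast
    show "\<exists>y. (\<forall>k. y \<in> E k (Suc n)) \<and> \<tau> n y = x" if "\<forall>k. x \<in> E k n" for x n by (rule ex[OF that])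
  qed
  then obtain x where x: "\<And>n k. x n \<in> E k n" "\<And>n. \<tau> n (x (Suc n)) = x n" by blast
  show ?thesis
  proof (rule that)
    show "x n \<in> C" for n using x(1)[of n 0] by (simp add: E0)
    show "\<tau> n (x (Suc n)) = x n" for n by (rule x(2))
  qed
qed

theorem tower_exists:
  assumes m: "600 \<le> m"
  shows "\<exists>\<psi> t lam c. tower0 m \<psi> t lam c"
proof -
  define nx where "nx = (\<lambda>(\<psi> :: complex \<Rightarrow> complex \<Rightarrow> complex) (\<tau> :: complex \<Rightarrow> complex) lam (s :: complex) w. (qm (\<psi> (\<tau> s)) ^^ (m - 1)) (\<psi> (\<tau> s) ((lam s)\<^sup>2 * w)) / lam s :: complex)"
  define Q where "Q = (\<lambda>\<psi> \<tau>l. (fst \<tau>l holomorphic_on pdisc \<and> (\<forall>s\<in>pdisc. norm (fst \<tau>l s + 2) \<le> 3/20 \<and> step (\<psi> (fst \<tau>l s)) (fst \<tau>l s) m (snd \<tau>l s) \<and>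
      (qm (\<psi> (fst \<tau>l s)) ^^ m) 0 = s * snd \<tau>l s)) \<and> good_family (nx \<psi> (fst \<tau>l) (snd \<tau>l)))"
  have Q: "\<exists>\<tau>l. Q \<psi> \<tau>l" if g: "good_family \<psi>" for \<psi>
  proof -
    interpret fam \<psi> by unfold_locales (rule g)
    obtain \<tau> lam where R: "\<tau> holomorphic_on pdisc" "lam holomorphic_on pdisc"
      "\<And>s. s \<in> pdisc \<Longrightarrow> norm (\<tau> s + 2) \<le> 3/20"
      "\<And>s. s \<in> pdisc \<Longrightarrow> step (\<psi> (\<tau> s)) (\<tau> s) m (lam s)"
      "\<And>s. s \<in> pdisc \<Longrightarrow> (qm (\<psi> (\<tau> s)) ^^ m) 0 = s * lam s"
      by (rule renormalization_parameters[OF m]) (rule that)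
    have "\<tau> s \<in> pdisc" if "s \<in> pdisc" for s using R(3)[OF that] by (simp add: pdisc_iff)
    hence "\<tau> ` pdisc \<subseteq> pdisc" by blast
    from good_next[OF R(1) this R(2) R(4) R(5)] have "good_family (nx \<psi> \<tau> lam)" unfolding nx_def .
    hence "Q \<psi> (\<tau>, lam)" unfolding Q_def fst_conv snd_conv using R(1,3-5) by (intro conjI ballI)
    thus ?thesis ..
  qed
  define sel where "sel = (\<lambda>\<psi>. SOME \<tau>l. Q \<psi> \<tau>l)"
  have "Q \<psi> (sel \<psi>)" if "good_family \<psi>" for \<psi> unfolding sel_def by (rule someI_ex[OF Q[OF that]])
  hence sel: "\<And>\<psi>. good_family \<psi> \<Longrightarrow> fst (sel \<psi>) holomorphic_on pdisc"
    "\<And>\<psi> s. good_family \<psi> \<Longrightarrow> s \<in> pdisc \<Longrightarrow> norm (fst (sel \<psi>) s + 2) \<le> 3/20"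
    "\<And>\<psi> s. good_family \<psi> \<Longrightarrow> s \<in> pdisc \<Longrightarrow> step (\<psi> (fst (sel \<psi>) s)) (fst (sel \<psi>) s) m (snd (sel \<psi>) s)"
    "\<And>\<psi> s. good_family \<psi> \<Longrightarrow> s \<in> pdisc \<Longrightarrow> (qm (\<psi> (fst (sel \<psi>) s)) ^^ m) 0 = s * snd (sel \<psi>) s"
    "\<And>\<psi>. good_family \<psi> \<Longrightarrow> good_family (nx \<psi> (fst (sel \<psi>)) (snd (sel \<psi>)))"
    unfolding Q_def by blast+
  define \<Psi> where "\<Psi> = rec_nat (\<lambda>t w. w + t) (\<lambda>_ \<psi>. nx \<psi> (fst (sel \<psi>)) (snd (sel \<psi>)))"
  have \<Psi>0: "\<Psi> 0 = (\<lambda>t w. w + t)" and \<Psi>S: "\<Psi> (Suc n) = nx (\<Psi> n) (fst (sel (\<Psi> n))) (snd (sel (\<Psi> n)))" for n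
    by (simp_all add: \<Psi>_def)
  have g: "good_family (\<Psi> n)" for n
  proof (induction n)
    case 0 show ?case unfolding \<Psi>0 by (rule good_base)
  next
    case (Suc n) show ?case unfolding \<Psi>S by (rule sel(5)[OF Suc])
  qed
  define \<tau> lm where "\<tau> = (\<lambda>n. fst (sel (\<Psi> n)))" and "lm = (\<lambda>n. snd (sel (\<Psi> n)))"
  have sl: "\<tau> n holomorphic_on pdisc" "s \<in> pdisc \<Longrightarrow> norm (\<tau> n s + 2) \<le> 3/20"
    "s \<in> pdisc \<Longrightarrow> step (\<Psi> n (\<tau> n s)) (\<tau> n s) m (lm n s)"
    "s \<in> pdisc \<Longrightarrow> (qm (\<Psi> n (\<tau> n s)) ^^ m) 0 = s * lm n s" for n s
    unfolding \<tau>_def lm_def by (rule sel(1)[OF g] sel(2)[OF g] sel(3)[OF g] sel(4)[OF g], assumption?)+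
  let ?C = "cball (-2::complex) (3/20)"
  have C_iff: "x \<in> ?C \<longleftrightarrow> norm (x + 2) \<le> 3/20" for x by (simp add: dist_norm norm_minus_commute[of "-2"])
  have CD: "?C \<subseteq> pdisc" by (auto simp: pdisc_def)
  obtain x where x: "\<And>n. x n \<in> ?C" "\<And>n. \<tau> n (x (Suc n)) = x n"
  proof (rule inverse_limit_point[of ?C \<tau>])
    show "continuous_on ?C (\<tau> n)" for n
      by (rule holomorphic_on_imp_continuous_on[OF holomorphic_on_subset[OF sl(1) CD]])
    show "\<tau> n ` ?C \<subseteq> ?C" for n
    proof (rule image_subsetI)
      fix y assume "y \<in> ?C"
      hence "y \<in> pdisc" by (rule subsetD[OF CD])
      thus "\<tau> n y \<in> ?C" unfolding C_iff by (rule sl(2))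
    qed
    \<comment> \<open>The map at the parameter \<open>\<tau> n s\<close> determines the scale
      \<open>lm n s\<close> through its multiplier, and then \<open>s\<close> through its return
      value.\<close>
    show "inj_on (\<tau> n) ?C" for n
    proof (rule inj_onI)
      fix s s' assume ss: "s \<in> ?C" "s' \<in> ?C" "\<tau> n s = \<tau> n s'"
      have D: "s \<in> pdisc" "s' \<in> pdisc" using ss CD by blast+
      let ?d = "deriv (\<lambda>w. (qm (\<Psi> n (\<tau> n s)) ^^ (m - 1)) (\<Psi> n (\<tau> n s) w)) 0"
      have 1: "lm n s * ?d = 1" by (rule step.lam_eq[OF sl(3)[OF D(1)]])
      have 2: "lm n s' * ?d = 1" using step.lam_eq[OF sl(3)[OF D(2)]] unfolding ss(3) .
      have d: "?d \<noteq> 0" using 1 by auto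
      have l: "lm n s = lm n s'" using 1 2 mult_right_cancel[OF d, of "lm n s" "lm n s'"] by simp
      have "s * lm n s = s' * lm n s" using sl(4)[OF D(1), of n] sl(4)[OF D(2), of n] unfolding ss(3) l by auto
      moreover have "lm n s \<noteq> 0" using 1 by auto
      ultimately show "s = s'" by simp
    qed
    fix x assume "\<And>n. x n \<in> ?C" "\<And>n. \<tau> n (x (Suc n)) = x n"
    thus thesis by (rule that)
  qed simp_all
  have xD: "x n \<in> pdisc" for n using x(1) CD by blast
  \<comment> \<open>The scale at level \<open>n\<close> is read at \<open>x (Suc n)\<close>, because
    \<open>\<tau> n\<close> and \<open>lm n\<close> are functions of the parameter of the
    renormalized map, not of the map being renormalized.\<close>
  have "tower0 m (\<lambda>n. \<Psi> n (x n)) x (\<lambda>n. lm n (x (Suc n))) (x 0)"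
  proof (intro tower0.intro tower.intro tower0_axioms.intro)
    show "step (\<Psi> n (x n)) (x n) m (lm n (x (Suc n)))" for n
      using sl(3)[OF xD[of "Suc n"], of n] unfolding x(2) .
    show "\<Psi> (Suc n) (x (Suc n)) w = (qm (\<Psi> n (x n)) ^^ (m - 1)) (\<Psi> n (x n) ((lm n (x (Suc n)))\<^sup>2 * w)) / lm n (x (Suc n))" for n w
    proof -
      have "\<Psi> (Suc n) = nx (\<Psi> n) (\<tau> n) (lm n)" by (simp add: \<Psi>S \<tau>_def lm_def)
      thus ?thesis by (simp add: nx_def x(2))
    qed
    show "\<Psi> 0 (x 0) w = w + x 0" for w by (simp add: \<Psi>0)
  qed
  thus ?thesis by blast
qed

theorem theoremA:
  shows "\<exists>c :: complex. feigenbaum_poly c \<and> hausdorff_dim (poly_julia c) < 2"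
proof -
  obtain m :: nat where m: "prime m" "600 < m" using bigger_prime by blast
  then obtain \<psi> t lam c where "tower0 m \<psi> t lam c" using tower_exists[of m] by auto
  then interpret tower0 m \<psi> t lam c .
  show ?thesis using feigenbaum[OF m(1)] HD_lt_2 by blast
qed

end
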